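(* For all $y_0\in D(\mathcal A)$ the trajectory $\gamma(y_0)=\bigcup_{t\ge0}S(t)y_0$ is precompact in $\mathcal H$.
   Context: Throughout, $L,\rho,\Lambda,J,M>0$ are constants, $n_1,n_2\in\mathbb N$, a prime on a function of $x\in[0,L]$ denotes the $x$-derivative, $u^{(4)}$ is the fourth $x$-derivative, and a subscript $t$ denotes the time derivative. Standing assumptions, for $j=1,2$: (A1) $d_j\in C^2(\mathbb R;\mathbb R)$, $d_j(0)=0$, $d_j'(s)\ge 0$ for all $s\in\mathbb R$, and $d_j'(0)>0$. (A2) $k_j\in C^2(\mathbb R;\mathbb R)$, $k_j(0)=0$, $k_j'(0)>0$, and $\int_0^s k_j(\sigma)\,d\sigma>0$ for all $s\ne0$. (A3) There is $V_j\in C^2(\mathbb R^{n_j};\mathbb R)$ with $V_j(0)=0$, and $V_j(z)>0$ and $\nabla V_j(z)\cdot a_j(z)<0$ for all $z\neq0$, and $\nabla V_j(z)\cdot b_j(z)=c_j(z)$ for all $z$. (A4) $V_j(z)\to\infty$ as $|z|\to\infty$, and the Hessian $P_j:=\operatorname{Hess}(V_j)(0)$ is positive definite. (A5) $a_j,b_j\in C^2(\mathbb R^{n_j};\mathbb R^{n_j})$, $a_j(0)=0$, and the Jacobian $A_j:=J_{a_j}(0)$ satisfies $\det A_j\ne0$. (A6) $c_j\in C^2(\mathbb R^{n_j};\mathbb R)$, $c_j(0)=0$. Put $D_j:=d_j'(0)$, $K_j:=k_j'(0)$, $B_j:=b_j(0)$, $C_j:=\nabla c_j(0)$. For $n\ge2$,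 $\tilde H_0^n(0,L):=\{f\in H^n(0,L): f(0)=f'(0)=0\}$. The state space is the Hilbert space $\mathcal H=\tilde H_0^2(0,L)\times L^2(0,L)\times\mathbb R^{n_1}\times\mathbb R^{n_2}\times\mathbb R\times\mathbb R$, with elements $y=[u,v,z_1,z_2,\xi,\psi]^\top$ and inner product $$\langle y,\tilde y\rangle_{\mathcal H}=\Lambda\int_0^L u''\tilde u''\,dx+\rho\int_0^L v\tilde v\,dx+\tfrac1J\xi\tilde\xi+\tfrac1M\psi\tilde\psi+K_1u'(L)\tilde u'(L)+K_2u(L)\tilde u(L)+z_1^\top P_1\tilde z_1+z_2^\top P_2\tilde z_2.$$ The nonlinear operator $\mathcal A$ is $$\mathcal A y=\begin{bmatrix} v\\ -\frac{\Lambda}{\rho}u^{(4)}\\ a_1(z_1)+\frac1J b_1(z_1)\xi\\ a_2(z_2)+\frac1M b_2(z_2)\psi\\ -\Lambda u''(L)-[c_1(z_1)+d_1(\frac{\xi}{J})+k_1(u'(L))]\\ \Lambda u'''(L)-[c_2(z_2)+d_2(\frac{\psi}{M})+k_2(u(L))]\end{bmatrix}$$ with domain $D(\mathcal A)=\{y\in\mathcal H: u\in\tilde H_0^4(0,L),\ v\in\tilde H_0^2(0,L),\ \xi=Jv'(L),\ \psi=Mv(L)\}$. Its linearization at the origin is the linear operator $\mathcal L$ with $D(\mathcal L)=D(\mathcal A)$ obtained from the formula for $\mathcal A$ by replacing $a_j(z_j),b_j(z_j),c_j(z_j),d_j(s),k_j(s)$ by $A_jz_j,B_j,C_j\cdot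 z_j,D_js,K_js$; it generates a $C_0$-semigroup of contractions $(e^{t\mathcal L})_{t\ge0}$ on $\mathcal H$. The nonlinear remainder $\mathcal N:=\mathcal A-\mathcal L$ extends to the continuous map $\mathcal N:\mathcal H\to\mathcal H$ with first two components $0$ and remaining components $\alpha_1(z_1)+\frac1J\beta_1(z_1)\xi$, $\ \alpha_2(z_2)+\frac1M\beta_2(z_2)\psi$, $\ -\gamma_1(z_1)-\delta_1(\frac\xi J)-\kappa_1(u'(L))$, $\ -\gamma_2(z_2)-\delta_2(\frac\psi M)-\kappa_2(u(L))$, where $\alpha_j(z)=a_j(z)-A_jz$, $\beta_j(z)=b_j(z)-B_j$, $\gamma_j(z)=c_j(z)-C_j\cdot z$, $\delta_j(s)=d_j(s)-D_js$, $\kappa_j(s)=k_j(s)-K_js$. A mild solution of $y_t=\mathcal Ay$, $y(0)=y_0$ is a continuous $\mathcal H$-valued function with $y(t)=e^{t\mathcal L}y_0+\int_0^te^{(t-s)\mathcal L}\mathcal N y(s)\,ds$. For every $y_0\in\mathcal H$ there is a unique mild solution and it exists on $[0,\infty)$; $S(t)y_0:=y(t)$ defines a strongly continuous semigroup $S=(S(t))_{t\ge0}$ of nonlinear operators in $\mathcal H$. Precompact means having compact closure. *)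

theory Defs
  imports "HOL-Analysis.Analysis"
begin

section \<open>The Hilbert space of square-integrable functions on the real line\<close>

definition sq_integrable :: "(real \<Rightarrow> real) \<Rightarrow> bool" where
  "sq_integrable f \<longleftrightarrow> f \<in> borel_measurable lborel \<and> integrable lborel (\<lambda>x. (f x)\<^sup>2)"

definition L2_rel :: "(real \<Rightarrow> real) \<Rightarrow> (real \<Rightarrow> real) \<Rightarrow> bool" where
  "L2_rel f g \<longleftrightarrow> sq_integrable f \<and> sq_integrable g \<and> (AE x in lborel. f x = g x)"

lemma sq_integrable_zero: "sq_integrable (\<lambda>x. 0)"
  by (simp add: sq_integrable_def)

lemma sq_integrable_mult:
  assumes "sq_integrable f" "sq_integrable g"
  shows "integrable lborel (\<lambda>x. f x * g x)"
proof (rule Bochner_Integration.integrable_bound)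
  show "integrable lborel (\<lambda>x. (f x)\<^sup>2 + (g x)\<^sup>2)"
    using assms by (simp add: sq_integrable_def)
  show "(\<lambda>x. f x * g x) \<in> borel_measurable lborel"
    using assms by (auto simp: sq_integrable_def)
  show "AE x in lborel. norm (f x * g x) \<le> norm ((f x)\<^sup>2 + (g x)\<^sup>2)"
  proof (rule AE_I2)
    fix x
    have "2 * (\<bar>f x\<bar> * \<bar>g x\<bar>) \<le> (f x)\<^sup>2 + (g x)\<^sup>2"
      using sum_squares_bound[of "\<bar>f x\<bar>" "\<bar>g x\<bar>"] by (simp add: mult.assoc)
    moreover have "0 \<le> \<bar>f x\<bar> * \<bar>g x\<bar>" by simp
    ultimately have "\<bar>f x\<bar> * \<bar>g x\<bar> \<le> (f x)\<^sup>2 + (g x)\<^sup>2" by linarith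
    then show "norm (f x * g x) \<le> norm ((f x)\<^sup>2 + (g x)\<^sup>2)"
      by (simp add: abs_mult)
  qed
qed

lemma sq_integrable_add:
  assumes "sq_integrable f" "sq_integrable g"
  shows "sq_integrable (\<lambda>x. f x + g x)"
proof -
  have "integrable lborel (\<lambda>x. (f x)\<^sup>2 + (g x)\<^sup>2 + 2 * (f x * g x))"
    using assms sq_integrable_mult[OF assms] by (simp add: sq_integrable_def)
  then show ?thesis
    using assms by (auto simp: sq_integrable_def power2_sum mult.assoc)
qed

lemma sq_integrable_scale:
  assumes "sq_integrable f"
  shows "sq_integrable (\<lambda>x. c * f x)"
  using assms by (auto simp: sq_integrable_def power_mult_distrib)

lemma L2_rel_part_equivp: "part_equivp L2_rel"
proof (rule part_equivpI)
  show "\<exists>f. L2_rel f f"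
    using sq_integrable_zero by (auto simp: L2_rel_def)
  show "symp L2_rel"
    by (auto simp: symp_def L2_rel_def elim: eventually_mono)
  show "transp L2_rel"
    unfolding transp_def L2_rel_def by (auto elim: eventually_elim2)
qed

quotient_type L2 = "real \<Rightarrow> real" / partial: L2_rel
  by (rule L2_rel_part_equivp)

instantiation L2 :: real_inner
begin

lift_definition zero_L2 :: L2 is "\<lambda>x. 0"
  by (simp add: L2_rel_def sq_integrable_zero)

lift_definition plus_L2 :: "L2 \<Rightarrow> L2 \<Rightarrow> L2" is "\<lambda>f g x. f x + g x"
  unfolding L2_rel_def by (auto intro: sq_integrable_add elim: eventually_elim2)

lift_definition scaleR_L2 :: "real \<Rightarrow> L2 \<Rightarrow> L2" is "\<lambda>c f x. c * f x"
  unfolding L2_rel_def by (auto intro: sq_integrable_scale elim: eventually_mono)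

lift_definition inner_L2 :: "L2 \<Rightarrow> L2 \<Rightarrow> real" is
  "\<lambda>f g. \<integral>x. f x * g x \<partial>lborel"
proof -
  fix f f' g g' :: "real \<Rightarrow> real"
  assume *: "L2_rel f f'" "L2_rel g g'"
  have "AE x in lborel. f x = f' x" "AE x in lborel. g x = g' x"
    using * by (auto simp: L2_rel_def)
  then have "AE x in lborel. f x * g x = f' x * g' x"
    by (auto elim: eventually_elim2)
  then show "(\<integral>x. f x * g x \<partial>lborel) = (\<integral>x. f' x * g' x \<partial>lborel)"
    using * by (intro integral_cong_AE) (auto simp: L2_rel_def sq_integrable_def)
qed

definition uminus_L2 :: "L2 \<Rightarrow> L2" where "uminus_L2 f = (-1) *\<^sub>R f"

definition minus_L2 :: "L2 \<Rightarrow> L2 \<Rightarrow> L2" where "minus_L2 f g = f + (- g)"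

definition norm_L2 :: "L2 \<Rightarrow> real" where "norm_L2 f = sqrt (inner f f)"

definition sgn_L2 :: "L2 \<Rightarrow> L2" where "sgn_L2 f = inverse (norm f) *\<^sub>R f"

definition dist_L2 :: "L2 \<Rightarrow> L2 \<Rightarrow> real" where "dist_L2 f g = norm (f - g)"

definition uniformity_L2 :: "(L2 \<times> L2) filter" where
  "uniformity_L2 = (INF e\<in>{0 <..}. principal {(x, y). dist x y < e})"

definition open_L2 :: "L2 set \<Rightarrow> bool" where
  "open_L2 U \<longleftrightarrow> (\<forall>x\<in>U. eventually (\<lambda>(x', y). x' = x \<longrightarrow> y \<in> U) uniformity)"

instance
proof
  fix f g h :: L2 and a b :: real
  show "f + g + h = f + (g + h)"
    by transfer (auto simp: L2_rel_def add.assoc intro!: sq_integrable_add)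
  show "f + g = g + f"
    by transfer (auto simp: L2_rel_def add.commute intro!: sq_integrable_add)
  show "0 + f = f"
    by transfer (auto simp: L2_rel_def)
  show "- f + f = 0"
    unfolding uminus_L2_def by transfer
      (auto simp: L2_rel_def intro!: sq_integrable_zero)
  show "f - g = f + - g"
    by (rule minus_L2_def)
  show "a *\<^sub>R (f + g) = a *\<^sub>R f + a *\<^sub>R g"
    by transfer (auto simp: L2_rel_def distrib_left
        intro!: sq_integrable_add sq_integrable_scale)
  show "(a + b) *\<^sub>R f = a *\<^sub>R f + b *\<^sub>R f"
    apply transfer
    subgoal for a b f
      using sq_integrable_add[OF sq_integrable_scale[of f a] sq_integrable_scale[of f b]]
      by (auto simp: L2_rel_def distrib_right)
    done
  show "a *\<^sub>R b *\<^sub>R f = (a * b) *\<^sub>R f"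
    apply transfer
    subgoal for a b f
      using sq_integrable_scale[of f "a * b"] by (auto simp: L2_rel_def mult.assoc)
    done
  show "1 *\<^sub>R f = f"
    by transfer (auto simp: L2_rel_def)
  show "dist f g = norm (f - g)"
    by (rule dist_L2_def)
  show "sgn f = inverse (norm f) *\<^sub>R f"
    by (rule sgn_L2_def)
  show "(uniformity :: (L2 \<times> L2) filter) = (INF e\<in>{0 <..}. principal {(x, y). dist x y < e})"
    by (rule uniformity_L2_def)
  show "open U \<longleftrightarrow> (\<forall>x\<in>U. \<forall>\<^sub>F (x', y) in uniformity. x' = x \<longrightarrow> y \<in> U)" for U :: "L2 set"
    by (rule open_L2_def)
  show "f \<bullet> g = g \<bullet> f"
    by transfer (simp add: mult.commute)
  show "(f + g) \<bullet> h = f \<bullet> h + g \<bullet> h"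
    apply transfer
    by (auto simp: L2_rel_def distrib_right sq_integrable_mult)
  show "a *\<^sub>R f \<bullet> g = a * (f \<bullet> g)"
    by transfer (auto simp: L2_rel_def mult.assoc)
  show "0 \<le> f \<bullet> f"
    by transfer simp
  show "f \<bullet> f = 0 \<longleftrightarrow> f = 0"
    apply transfer
    subgoal for f
      using sq_integrable_mult[of f f] sq_integrable_zero
      by (auto simp: L2_rel_def integral_nonneg_eq_0_iff_AE)
    done
  show "norm f = sqrt (f \<bullet> f)"
    by (rule norm_L2_def)
qed

end


section \<open>Sobolev spaces on a bounded interval\<close>

text \<open>Functions on \<open>(0,l)\<close> are identified with their extensions by zero, so that
  \<open>L2_on l\<close> is a subspace of \<open>L2\<close> and the inner product of two of its elements is the
  integral of their product over \<open>(0,l)\<close>.\<close>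

definition L2_on :: "real \<Rightarrow> L2 set" where
  "L2_on l = {f. AE x in lborel. x \<notin> {0<..<l} \<longrightarrow> rep_L2 f x = 0}"

definition test_function :: "real \<Rightarrow> (real \<Rightarrow> real) \<Rightarrow> bool" where
  "test_function l \<phi> \<longleftrightarrow>
     (\<forall>k x. (deriv ^^ k) \<phi> differentiable (at x)) \<and>
     (\<exists>a b. 0 < a \<and> b < l \<and> (\<forall>x. x \<notin> {a..b} \<longrightarrow> \<phi> x = 0))"

definition has_weak_deriv :: "real \<Rightarrow> nat \<Rightarrow> L2 \<Rightarrow> L2 \<Rightarrow> bool" where
  "has_weak_deriv l k u w \<longleftrightarrow>
     u \<in> L2_on l \<and> w \<in> L2_on l \<and>
     (\<forall>\<phi>. test_function l \<phi> \<longrightarrow>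
        (\<integral>x. rep_L2 u x * (deriv ^^ k) \<phi> x \<partial>lborel) =
        (-1) ^ k * (\<integral>x. rep_L2 w x * \<phi> x \<partial>lborel))"

definition weak_deriv :: "real \<Rightarrow> nat \<Rightarrow> L2 \<Rightarrow> L2" where
  "weak_deriv l k u = (THE w. has_weak_deriv l k u w)"

definition Sobolev :: "real \<Rightarrow> nat \<Rightarrow> L2 set" where
  "Sobolev l n = {u \<in> L2_on l. \<forall>k\<le>n. \<exists>w. has_weak_deriv l k u w}"

text \<open>The value at \<open>x \<in> [0,l]\<close> of the representative that is continuous on \<open>[0,l]\<close>;
  meaningful for elements of \<open>Sobolev l 1\<close>.\<close>

definition pt_val :: "real \<Rightarrow> L2 \<Rightarrow> real \<Rightarrow> real" where
  "pt_val l u x = (THE c. \<exists>f. continuous_on {0..l} f \<and>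
     (AE s in lborel. s \<in> {0<..<l} \<longrightarrow> f s = rep_L2 u s) \<and> f x = c)"

definition Sobolev0 :: "real \<Rightarrow> nat \<Rightarrow> L2 set" where
  "Sobolev0 l n = {f \<in> Sobolev l n. pt_val l f 0 = 0 \<and> pt_val l (weak_deriv l 1 f) 0 = 0}"


section \<open>Controllers and their linearization\<close>

definition C2_map :: "('a::euclidean_space \<Rightarrow> 'b::real_normed_vector) \<Rightarrow> bool" where
  "C2_map f \<longleftrightarrow> (\<exists>(f' :: 'a \<Rightarrow> 'a \<Rightarrow>\<^sub>L 'b) (f'' :: 'a \<Rightarrow> 'a \<Rightarrow>\<^sub>L 'a \<Rightarrow>\<^sub>L 'b).
     (\<forall>x. (f has_derivative blinfun_apply (f' x)) (at x)) \<and>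
     (\<forall>x. (f' has_derivative blinfun_apply (f'' x)) (at x)) \<and>
     continuous_on UNIV f'')"

definition grad :: "('a::real_inner \<Rightarrow> real) \<Rightarrow> 'a \<Rightarrow> 'a" where
  "grad f z = (THE D. GDERIV f z :> D)"

definition hessian :: "(real^'n::finite \<Rightarrow> real) \<Rightarrow> real^'n \<Rightarrow> real^'n^'n" where
  "hessian f z = jacobian (grad f) (at z)"

text \<open>\<open>fV\<close> is the Lyapunov function of the controller; its Hessian at \<open>0\<close> enters the
  inner product of the state space.\<close>

record 'n controller =
  fa :: "real^'n \<Rightarrow> real^'n"
  fb :: "real^'n \<Rightarrow> real^'n"
  fc :: "real^'n \<Rightarrow> real"
  fd :: "real \<Rightarrow> real"
  fk :: "real \<Rightarrow> real"
  fV :: "real^'n \<Rightarrow> real"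

definition admissible_controller :: "'n::finite controller \<Rightarrow> bool" where
  "admissible_controller q \<longleftrightarrow>
     (C2_map (fd q) \<and> fd q 0 = 0 \<and> (\<forall>s. deriv (fd q) s \<ge> 0) \<and> deriv (fd q) 0 > 0) \<and>
     (C2_map (fk q) \<and> fk q 0 = 0 \<and> deriv (fk q) 0 > 0 \<and>
        (\<forall>s::real. s \<noteq> 0 \<longrightarrow> (LBINT \<sigma>=0..s. fk q \<sigma>) > 0)) \<and>
     (C2_map (fV q) \<and> fV q 0 = 0 \<and>
        (\<forall>z. z \<noteq> 0 \<longrightarrow> fV q z > 0 \<and> grad (fV q) z \<bullet> fa q z < 0) \<and>
        (\<forall>z. grad (fV q) z \<bullet> fb q z = fc q z)) \<and>
     (filterlim (fV q) at_top at_infinity \<and>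
        (\<forall>z. z \<noteq> 0 \<longrightarrow> z \<bullet> (hessian (fV q) 0 *v z) > 0)) \<and>
     (C2_map (fa q) \<and> C2_map (fb q) \<and> fa q 0 = 0 \<and> det (jacobian (fa q) (at 0)) \<noteq> 0) \<and>
     (C2_map (fc q) \<and> fc q 0 = 0)"

definition linear_part :: "'n::finite controller \<Rightarrow> 'n controller" where
  "linear_part q = q\<lparr>
     fa := \<lambda>z. jacobian (fa q) (at 0) *v z,
     fb := \<lambda>z. fb q 0,
     fc := \<lambda>z. grad (fc q) 0 \<bullet> z,
     fd := \<lambda>s. deriv (fd q) 0 * s,
     fk := \<lambda>s. deriv (fk q) 0 * s\<rparr>"

definition nonlinear_part :: "'n::finite controller \<Rightarrow> 'n controller" where
  "nonlinear_part q = q\<lparr>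
     fa := \<lambda>z. fa q z - fa (linear_part q) z,
     fb := \<lambda>z. fb q z - fb (linear_part q) z,
     fc := \<lambda>z. fc q z - fc (linear_part q) z,
     fd := \<lambda>s. fd q s - fd (linear_part q) s,
     fk := \<lambda>s. fk q s - fk (linear_part q) s\<rparr>"


section \<open>The beam system: state space and operators\<close>

record ('n1, 'n2) beam_system =
  len :: real      \<comment> \<open>\<open>L\<close>\<close>
  dens :: real     \<comment> \<open>\<open>\<rho>\<close>\<close>
  stiff :: real    \<comment> \<open>\<open>\<Lambda>\<close>\<close>
  inert :: real    \<comment> \<open>\<open>J\<close>\<close>
  mass :: real     \<comment> \<open>\<open>M\<close>\<close>
  ctrl1 :: "'n1 controller"
  ctrl2 :: "'n2 controller"

definition admissible :: "('n1::finite, 'n2::finite) beam_system \<Rightarrow> bool" where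
  "admissible p \<longleftrightarrow> len p > 0 \<and> dens p > 0 \<and> stiff p > 0 \<and> inert p > 0 \<and> mass p > 0 \<and>
     admissible_controller (ctrl1 p) \<and> admissible_controller (ctrl2 p)"

text \<open>States are tuples \<open>(u, v, z1, z2, \<xi>, \<psi>)\<close>. Only the vector space operations of this
  product type are used: its library norm is not the norm of the state space, which is
  \<open>norm_H\<close> below.\<close>

type_synonym ('n1, 'n2) state = "L2 \<times> L2 \<times> (real^'n1) \<times> (real^'n2) \<times> real \<times> real"

definition space_H :: "('n1::finite, 'n2::finite) beam_system \<Rightarrow> ('n1, 'n2) state set" where
  "space_H p = {(u, v, z1, z2, \<xi>, \<psi>). u \<in> Sobolev0 (len p) 2 \<and> v \<in> L2_on (len p)}"

definition tip_val :: "('n1::finite, 'n2::finite) beam_system \<Rightarrow> nat \<Rightarrow> L2 \<Rightarrow> real" where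
  "tip_val p k u = pt_val (len p) (weak_deriv (len p) k u) (len p)"

fun inner_H :: "('n1::finite, 'n2::finite) beam_system \<Rightarrow> ('n1, 'n2) state \<Rightarrow> ('n1, 'n2) state \<Rightarrow> real"
  where
  "inner_H p (u, v, z1, z2, \<xi>, \<psi>) (u', v', z1', z2', \<xi>', \<psi>') =
     stiff p * (weak_deriv (len p) 2 u \<bullet> weak_deriv (len p) 2 u') + dens p * (v \<bullet> v')
     + (1 / inert p) * \<xi> * \<xi>' + (1 / mass p) * \<psi> * \<psi>'
     + deriv (fk (ctrl1 p)) 0 * tip_val p 1 u * tip_val p 1 u'
     + deriv (fk (ctrl2 p)) 0 * tip_val p 0 u * tip_val p 0 u'
     + z1 \<bullet> (hessian (fV (ctrl1 p)) 0 *v z1') + z2 \<bullet> (hessian (fV (ctrl2 p)) 0 *v z2')"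

definition norm_H :: "('n1::finite, 'n2::finite) beam_system \<Rightarrow> ('n1, 'n2) state \<Rightarrow> real" where
  "norm_H p y = sqrt (inner_H p y y)"

definition top_H :: "('n1::finite, 'n2::finite) beam_system \<Rightarrow> ('n1, 'n2) state topology" where
  "top_H p = Metric_space.mtopology (space_H p) (\<lambda>x y. norm_H p (x - y))"

definition precompact_H :: "('n1::finite, 'n2::finite) beam_system \<Rightarrow> ('n1, 'n2) state set \<Rightarrow> bool" where
  "precompact_H p X \<longleftrightarrow> compactin (top_H p) (top_H p closure_of X)"

definition dom_A :: "('n1::finite, 'n2::finite) beam_system \<Rightarrow> ('n1, 'n2) state set" where
  "dom_A p = {(u, v, z1, z2, \<xi>, \<psi>) \<in> space_H p.
     u \<in> Sobolev0 (len p) 4 \<and> v \<in> Sobolev0 (len p) 2 \<and>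
     \<xi> = inert p * tip_val p 1 v \<and> \<psi> = mass p * tip_val p 0 v}"

fun op_A :: "('n1::finite, 'n2::finite) beam_system \<Rightarrow> ('n1, 'n2) state \<Rightarrow> ('n1, 'n2) state" where
  "op_A p (u, v, z1, z2, \<xi>, \<psi>) =
    (v,
     - (stiff p / dens p) *\<^sub>R weak_deriv (len p) 4 u,
     fa (ctrl1 p) z1 + (1 / inert p * \<xi>) *\<^sub>R fb (ctrl1 p) z1,
     fa (ctrl2 p) z2 + (1 / mass p * \<psi>) *\<^sub>R fb (ctrl2 p) z2,
     - stiff p * tip_val p 2 u
       - (fc (ctrl1 p) z1 + fd (ctrl1 p) (\<xi> / inert p) + fk (ctrl1 p) (tip_val p 1 u)),
     stiff p * tip_val p 3 u
       - (fc (ctrl2 p) z2 + fd (ctrl2 p) (\<psi> / mass p) + fk (ctrl2 p) (tip_val p 0 u)))"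

definition op_L :: "('n1::finite, 'n2::finite) beam_system \<Rightarrow> ('n1, 'n2) state \<Rightarrow> ('n1, 'n2) state" where
  "op_L p = op_A (p\<lparr>ctrl1 := linear_part (ctrl1 p), ctrl2 := linear_part (ctrl2 p)\<rparr>)"

fun op_N :: "('n1::finite, 'n2::finite) beam_system \<Rightarrow> ('n1, 'n2) state \<Rightarrow> ('n1, 'n2) state" where
  "op_N p (u, v, z1, z2, \<xi>, \<psi>) =
    (let r1 = nonlinear_part (ctrl1 p); r2 = nonlinear_part (ctrl2 p) in
    (0,
     0,
     fa r1 z1 + (1 / inert p * \<xi>) *\<^sub>R fb r1 z1,
     fa r2 z2 + (1 / mass p * \<psi>) *\<^sub>R fb r2 z2,
     - fc r1 z1 - fd r1 (\<xi> / inert p) - fk r1 (tip_val p 1 u),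
     - fc r2 z2 - fd r2 (\<psi> / mass p) - fk r2 (tip_val p 0 u)))"

lemma op_A_eq_op_L_plus_op_N: "op_A p y = op_L p y + op_N p y"
  by (cases y) (simp add: op_L_def nonlinear_part_def linear_part_def tip_val_def Let_def
      algebra_simps)


section \<open>Semigroups and mild solutions\<close>

text \<open>The next two definitions are for a linear subspace \<open>X\<close> of a vector space that is a
  normed space under \<open>nrm\<close>.\<close>

definition contraction_C0_semigroup ::
  "'a::real_vector set \<Rightarrow> ('a \<Rightarrow> real) \<Rightarrow> (real \<Rightarrow> 'a \<Rightarrow> 'a) \<Rightarrow> bool" where
  "contraction_C0_semigroup X nrm T \<longleftrightarrow>
     (\<forall>t\<ge>0. \<forall>x\<in>X. T t x \<in> X) \<and>
     (\<forall>t\<ge>0. \<forall>x\<in>X. \<forall>y\<in>X. T t (x + y) = T t x + T t y) \<and>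
     (\<forall>t\<ge>0. \<forall>c. \<forall>x\<in>X. T t (c *\<^sub>R x) = c *\<^sub>R T t x) \<and>
     (\<forall>t\<ge>0. \<forall>x\<in>X. nrm (T t x) \<le> nrm x) \<and>
     (\<forall>x\<in>X. T 0 x = x) \<and>
     (\<forall>s\<ge>0. \<forall>t\<ge>0. \<forall>x\<in>X. T (s + t) x = T s (T t x)) \<and>
     (\<forall>x\<in>X. ((\<lambda>t. nrm (T t x - x)) \<longlongrightarrow> 0) (at_right 0))"

definition generator_graph ::
  "'a::real_vector set \<Rightarrow> ('a \<Rightarrow> real) \<Rightarrow> (real \<Rightarrow> 'a \<Rightarrow> 'a) \<Rightarrow> ('a \<times> 'a) set" where
  "generator_graph X nrm T = {(x, w). x \<in> X \<and> w \<in> X \<and>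
     ((\<lambda>h. nrm ((1 / h) *\<^sub>R (T h x - x) - w)) \<longlongrightarrow> 0) (at_right 0)}"

definition semigroup_of_L ::
  "('n1::finite, 'n2::finite) beam_system \<Rightarrow> (real \<Rightarrow> ('n1, 'n2) state \<Rightarrow> ('n1, 'n2) state) \<Rightarrow> bool" where
  "semigroup_of_L p T \<longleftrightarrow>
     contraction_C0_semigroup (space_H p) (norm_H p) T \<and>
     generator_graph (space_H p) (norm_H p) T = {(y, op_L p y) | y. y \<in> dom_A p}"

text \<open>Riemann integral over \<open>[a,b]\<close> of a function with values in the state space,
  with convergence of the Riemann sums in the norm of that space.\<close>

definition has_integral_H ::
  "('n1::finite, 'n2::finite) beam_system \<Rightarrow> (real \<Rightarrow> ('n1, 'n2) state) \<Rightarrow> ('n1, 'n2) state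
     \<Rightarrow> real \<Rightarrow> real \<Rightarrow> bool" where
  "has_integral_H p f I a b \<longleftrightarrow>
     (\<forall>e>0. \<exists>d>0. \<forall>P. P tagged_division_of {a..b} \<and> (\<lambda>x. ball x d) fine P \<longrightarrow>
        norm_H p ((\<Sum>(x, K)\<in>P. measure lborel K *\<^sub>R f x) - I) < e)"

definition mild_solution ::
  "('n1::finite, 'n2::finite) beam_system \<Rightarrow> (real \<Rightarrow> ('n1, 'n2) state \<Rightarrow> ('n1, 'n2) state)
     \<Rightarrow> ('n1, 'n2) state \<Rightarrow> (real \<Rightarrow> ('n1, 'n2) state) \<Rightarrow> bool" where
  "mild_solution p T y0 y \<longleftrightarrow>
     (\<forall>t\<ge>0. y t \<in> space_H p) \<and>
     (\<forall>t\<ge>0. ((\<lambda>s. norm_H p (y s - y t)) \<longlongrightarrow> 0) (at t within {0..})) \<and>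
     (\<forall>t\<ge>0. has_integral_H p (\<lambda>s. T (t - s) (op_N p (y s))) (y t - T t y0) 0 t)"

end

theory Submission
  imports Defs
begin

text \<open>The energy \<open>total\<close> of the closed loop (elastic and kinetic energy of the beam, the potentials of the
  springs, the Lyapunov functions of the controllers) is nonincreasing, so trajectories are bounded, and Barbalat's
  lemma drives the tip velocities and the controller states to zero. Testing the momentum balance with the two
  cubics that are admissible displacements, the tip displacement \<open>(q, r)\<close> approaches the set of equilibrium
  pairs, where the elastic reaction balances the nonlinear springs.

  It remains to exclude that mechanical energy persists in the beam. Write \<open>total\<close> as the energy of the static
  profile with tip data \<open>(q, r)\<close> plus a nonnegative \<open>rest\<close>. For data in the domain the trajectory is Lipschitz in
  time, so the damping, which is strictly monotone near zero, bounds the accelerations of the tip in the mean.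
  With the multiplier \<open>x u'\<close> this yields \<open>liminf rest = 0\<close>. If \<open>rest\<close> did not tend to zero, then by continuity
  it would take each small value \<open>c\<close> at arbitrarily late times, so that each \<open>lim total - c\<close> would be the static
  energy of an equilibrium pair. But equilibrium pairs are critical points of the static energy, which by Sard's
  theorem has only a null set of critical values. Hence \<open>rest\<close> tends to zero, and the trajectory approaches the
  bounded part of the two-dimensional space of static profiles.

  Mild solutions need not lie in the domain, but their time integrals do; all identities are therefore derived for
  time averages over intervals of length \<open>h\<close>, and then \<open>h\<close> tends to zero.\<close>

section \<open>Completeness of the space of square-integrable functions\<close>

text \<open>The springs need not be monotone, so equilibria may form continua and a trajectory need
  not have a single limit. Precompactness asks only for approach to a compact family of profiles,
  and equilibria are therefore controlled through their energy values. No uniform bound in the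
  domain of \<open>op_A\<close> is used: the Lipschitz constant of a trajectory may grow with time,
  so compactness is not drawn from an embedding of the domain.

  The obstacle is the tip. The multiplier produces the tip values of u'' and u''', which the dynamic
  boundary conditions turn into forces and accelerations, the latter also squared. They are bounded
  by applying the energy identity to the motion shifted by h minus the motion itself: the damping
  contributes a negative multiple of the squared velocity increment, the increments of springs and
  controller states are o(h) because the velocities decay, and the initial energy of the difference
  is O(h^2). The resulting bound grows linearly in time with an arbitrarily small factor. This gives
  small values of \<open>rest\<close> at late times, but not by itself convergence.\<close>

lemma L2_rel_rep: "L2_rel (rep_L2 f) (rep_L2 f)"
  by (rule Quotient3_rep_reflp[OF Quotient3_L2])

lemma sq_integrable_rep: "sq_integrable (rep_L2 f)"
  using L2_rel_rep by (simp add: L2_rel_def)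

lemma rep_L2_measurable [measurable]: "rep_L2 f \<in> borel_measurable borel"
  using sq_integrable_rep[of f] by (simp add: sq_integrable_def)

lemma AE_rep_abs_L2:
  assumes "sq_integrable f" shows "AE x in lborel. rep_L2 (abs_L2 f) x = f x"
proof -
  have "L2_rel (rep_L2 (abs_L2 f)) f"
    by (rule rep_abs_rsp_left[OF Quotient3_L2]) (simp add: L2_rel_def assms)
  then show ?thesis by (simp add: L2_rel_def)
qed

lemma L2_eqI:
  assumes "AE x in lborel. rep_L2 f x = rep_L2 g x" shows "f = g"
proof -
  have "L2_rel (rep_L2 f) (rep_L2 g)"
    using assms sq_integrable_rep by (simp add: L2_rel_def)
  then show ?thesis
    by (rule Quotient3_rel_rep[OF Quotient3_L2, THEN iffD1])
qed

lemma inner_L2_rep: "f \<bullet> g = (\<integral>x. rep_L2 f x * rep_L2 g x \<partial>lborel)"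
  by (simp add: inner_L2.rep_eq)

lemma rep_L2_add: "AE x in lborel. rep_L2 (f + g) x = rep_L2 f x + rep_L2 g x"
proof -
  have "f + g = abs_L2 (\<lambda>x. rep_L2 f x + rep_L2 g x)"
    by (simp add: plus_L2_def)
  then show ?thesis
    using AE_rep_abs_L2[OF sq_integrable_add[OF sq_integrable_rep sq_integrable_rep]] by simp
qed

lemma rep_L2_scaleR: "AE x in lborel. rep_L2 (c *\<^sub>R f) x = c * rep_L2 f x"
proof -
  have "c *\<^sub>R f = abs_L2 (\<lambda>x. c * rep_L2 f x)"
    by (simp add: scaleR_L2_def)
  then show ?thesis
    using AE_rep_abs_L2[OF sq_integrable_scale[OF sq_integrable_rep]] by simp
qed

lemma rep_L2_diff: "AE x in lborel. rep_L2 (f - g) x = rep_L2 f x - rep_L2 g x"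
proof -
  have "f - g = f + (-1) *\<^sub>R g" by simp
  then show ?thesis
    using rep_L2_add[of f "(-1) *\<^sub>R g"] rep_L2_scaleR[of "-1" g] by (auto elim: eventually_elim2)
qed

lemma rep_L2_zero: "AE x in lborel. rep_L2 0 x = 0"
  using AE_rep_abs_L2[OF sq_integrable_zero] by (simp add: zero_L2_def)

lemma inner_abs_L2:
  assumes "sq_integrable f" "sq_integrable g"
  shows "abs_L2 f \<bullet> abs_L2 g = (\<integral>x. f x * g x \<partial>lborel)"
  unfolding inner_L2_rep
  using AE_rep_abs_L2[OF assms(1)] AE_rep_abs_L2[OF assms(2)] assms
  by (intro integral_cong_AE) (auto simp: sq_integrable_def elim!: eventually_elim2)

lemma nn_integral_rep_L2: "(\<integral>\<^sup>+x. ennreal ((rep_L2 f x)\<^sup>2) \<partial>lborel) = ennreal ((norm f)\<^sup>2)"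
proof -
  have "(norm f)\<^sup>2 = (\<integral>x. (rep_L2 f x)\<^sup>2 \<partial>lborel)"
    unfolding power2_norm_eq_inner inner_L2_rep by (simp add: power2_eq_square)
  then show ?thesis
    using sq_integrable_rep[of f] by (simp add: sq_integrable_def nn_integral_eq_integral)
qed

lemma ennreal_neq_infinityE:
  assumes "(a::ennreal) \<noteq> \<infinity>" obtains C where "a = ennreal C" "0 \<le> C"
  using assms by (cases a) auto

text \<open>Riesz-Fischer for increments of size 4^-n. The weight 4^n is tuned to this rate: 4^n
  times the squared norm is at most 4^-n, so the weighted sum of squares is integrable, hence finite
  almost everywhere, and there the increments are at most a constant times 2^-n. Fatou's lemma turns
  the pointwise limit into a norm limit.\<close>

lemma L2_fast_Cauchy_convergent:
  fixes X :: "nat \<Rightarrow> L2"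
  assumes fast: "\<And>n. norm (X (Suc n) - X n) \<le> (1/4) ^ n"
  shows "convergent X"
proof -
  define d where "d n x = rep_L2 (X (Suc n) - X n) x" for n x
  have dm [measurable]: "d n \<in> borel_measurable lborel" for n by (simp add: d_def[abs_def])
  have "(\<integral>\<^sup>+x. (\<Sum>n. ennreal (4 ^ n * (d n x)\<^sup>2)) \<partial>lborel)
      = (\<Sum>n. \<integral>\<^sup>+x. ennreal (4 ^ n * (d n x)\<^sup>2) \<partial>lborel)"
    by (rule nn_integral_suminf) simp
  also have "\<dots> \<le> (\<Sum>n. ennreal ((1/4) ^ n))"
  proof (rule suminf_le)
    fix n
    have "(\<integral>\<^sup>+x. ennreal (4 ^ n * (d n x)\<^sup>2) \<partial>lborel) = ennreal (4 ^ n) * ennreal ((norm (X (Suc n) - X n))\<^sup>2)"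
      unfolding d_def by (simp add: ennreal_mult'' nn_integral_cmult nn_integral_rep_L2)
    also have "\<dots> = ennreal (4 ^ n * (norm (X (Suc n) - X n))\<^sup>2)"
      by (simp add: ennreal_mult'')
    also have "\<dots> \<le> ennreal (4 ^ n * ((1/4) ^ n)\<^sup>2)"
      by (intro ennreal_leI mult_left_mono power_mono fast) auto
    also have "4 ^ n * ((1/4::real) ^ n)\<^sup>2 = (1/4) ^ n"
      by (simp add: power2_eq_square flip: power_mult_distrib)
    finally show "(\<integral>\<^sup>+x. ennreal (4 ^ n * (d n x)\<^sup>2) \<partial>lborel) \<le> ennreal ((1/4) ^ n)" .
  qed auto
  also have "\<dots> = ennreal (\<Sum>n. (1/4) ^ n)"
    by (rule suminf_ennreal2) (auto intro: summable_geometric)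
  finally have fin: "(\<integral>\<^sup>+x. (\<Sum>n. ennreal (4 ^ n * (d n x)\<^sup>2)) \<partial>lborel) \<noteq> \<infinity>"
    by (auto simp: top_unique)
  have aefin: "AE x in lborel. (\<Sum>n. ennreal (4 ^ n * (d n x)\<^sup>2)) \<noteq> \<infinity>"
    by (rule nn_integral_PInf_AE[OF _ fin]) simp
  have aed: "AE x in lborel. \<forall>n. d n x = rep_L2 (X (Suc n)) x - rep_L2 (X n) x"
    unfolding AE_all_countable d_def by (intro allI rep_L2_diff)
  have aeconv: "AE x in lborel. convergent (\<lambda>n. rep_L2 (X n) x)"
    using aefin aed
  proof eventually_elim
    case (elim x)
    obtain C where C: "(\<Sum>n. ennreal (4 ^ n * (d n x)\<^sup>2)) = ennreal C" "0 \<le> C"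
      using ennreal_neq_infinityE[OF elim(1)] by blast
    have "\<bar>d n x\<bar> \<le> sqrt C * (1/2) ^ n" for n
    proof -
      have "ennreal (4 ^ n * (d n x)\<^sup>2) \<le> ennreal C"
        using sum_le_suminf[OF summableI, of "{n}" "\<lambda>n. ennreal (4 ^ n * (d n x)\<^sup>2)"]
        unfolding C(1) by simp
      then have "4 ^ n * (d n x)\<^sup>2 \<le> C" using C(2) by simp
      moreover have "(2 ^ n * \<bar>d n x\<bar>)\<^sup>2 = 4 ^ n * (d n x)\<^sup>2"
        by (simp add: power_mult_distrib) (simp add: power2_eq_square flip: power_mult_distrib)
      ultimately have "(2 ^ n * \<bar>d n x\<bar>)\<^sup>2 \<le> C" by simp
      then have "2 ^ n * \<bar>d n x\<bar> \<le> sqrt C" by (rule real_le_rsqrt)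
      then show ?thesis by (simp add: power_one_over pos_le_divide_eq mult.commute)
    qed
    then have nd: "norm (d n x) \<le> sqrt C * (1/2) ^ n" for n by simp
    have "summable (\<lambda>n. sqrt C * (1/2) ^ n)"
      by (intro summable_mult summable_geometric) simp
    then have "summable (\<lambda>n. d n x)"
      by (rule summable_comparison_test'[where N=0]) (rule nd)
    then have "summable (\<lambda>n. rep_L2 (X (Suc n)) x - rep_L2 (X n) x)"
      unfolding elim(2)[rule_format] .
    then have "convergent (\<lambda>n. \<Sum>i<n. rep_L2 (X (Suc i)) x - rep_L2 (X i) x)"
      by (simp add: summable_iff_convergent)
    then have "convergent (\<lambda>n. rep_L2 (X n) x - rep_L2 (X 0) x)"
      unfolding sum_lessThan_telescope[of "\<lambda>n. rep_L2 (X n) x"] .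
    then have "convergent (\<lambda>n. (rep_L2 (X n) x - rep_L2 (X 0) x) + rep_L2 (X 0) x)"
      by (intro convergent_add convergent_const)
    then show ?case by simp
  qed
  define g where "g x = lim (\<lambda>n. rep_L2 (X n) x)" for x
  have gm [measurable]: "g \<in> borel_measurable lborel"
    unfolding g_def[abs_def] by (rule borel_measurable_lim_metric) simp
  have aelim: "AE x in lborel. (\<lambda>n. rep_L2 (X n) x) \<longlonglongrightarrow> g x"
    using aeconv by eventually_elim (simp add: g_def convergent_LIMSEQ_iff)
  have dist: "norm (X m - X n) \<le> 2 * (1/4) ^ n" if "n \<le> m" for m n
  proof -
    have "norm (X (n + k) - X n) \<le> (\<Sum>i<k. (1/4) ^ (n + i))" for k
    proof (induction k)
      case (Suc k)
      have "norm (X (n + Suc k) - X n) \<le> norm (X (Suc (n + k)) - X (n + k)) + norm (X (n + k) - X n)"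
        by (metis add_Suc_right diff_add_cancel add_diff_eq norm_triangle_ineq)
      then show ?case using Suc fast[of "n + k"] by simp
    qed simp
    moreover have "(\<Sum>i<k. (1/4::real) ^ (n + i)) \<le> 2 * (1/4) ^ n" for k
    proof -
      have "(\<Sum>i<k. (1/4::real) ^ i) \<le> 2"
        by (simp add: sum_gp_strict) (rule order_trans[of _ 0]; simp)
      then have "(1/4) ^ n * (\<Sum>i<k. (1/4::real) ^ i) \<le> (1/4) ^ n * 2"
        by (intro mult_left_mono) auto
      then show ?thesis by (simp add: power_add sum_distrib_left mult.commute)
    qed
    ultimately show ?thesis using that by (metis le_add_diff_inverse order_trans)
  qed
  have fatou: "(\<integral>\<^sup>+x. ennreal ((g x - rep_L2 (X n) x)\<^sup>2) \<partial>lborel) \<le> ennreal ((2 * (1/4) ^ n)\<^sup>2)" for n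
  proof -
    have "(\<integral>\<^sup>+x. ennreal ((g x - rep_L2 (X n) x)\<^sup>2) \<partial>lborel)
        = (\<integral>\<^sup>+x. liminf (\<lambda>m. ennreal ((rep_L2 (X m) x - rep_L2 (X n) x)\<^sup>2)) \<partial>lborel)"
    proof (rule nn_integral_cong_AE)
      show "AE x in lborel. ennreal ((g x - rep_L2 (X n) x)\<^sup>2)
          = liminf (\<lambda>m. ennreal ((rep_L2 (X m) x - rep_L2 (X n) x)\<^sup>2))"
        using aelim
      proof eventually_elim
        case (elim x)
        have "(\<lambda>m. ennreal ((rep_L2 (X m) x - rep_L2 (X n) x)\<^sup>2)) \<longlonglongrightarrow> ennreal ((g x - rep_L2 (X n) x)\<^sup>2)"
          by (intro tendsto_intros elim)
        then show ?case
          using lim_imp_Liminf trivial_limit_sequentially by metis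
      qed
    qed
    also have "\<dots> \<le> liminf (\<lambda>m. \<integral>\<^sup>+x. ennreal ((rep_L2 (X m) x - rep_L2 (X n) x)\<^sup>2) \<partial>lborel)"
      by (rule nn_integral_liminf) simp
    also have "\<dots> \<le> ennreal ((2 * (1/4) ^ n)\<^sup>2)"
    proof (rule Liminf_le)
      show "\<forall>\<^sub>F m in sequentially. (\<integral>\<^sup>+x. ennreal ((rep_L2 (X m) x - rep_L2 (X n) x)\<^sup>2) \<partial>lborel)
          \<le> ennreal ((2 * (1/4) ^ n)\<^sup>2)"
        using eventually_ge_at_top[of n]
      proof eventually_elim
        case (elim m)
        have "(\<integral>\<^sup>+x. ennreal ((rep_L2 (X m) x - rep_L2 (X n) x)\<^sup>2) \<partial>lborel)
            = (\<integral>\<^sup>+x. ennreal ((rep_L2 (X m - X n) x)\<^sup>2) \<partial>lborel)"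
          using rep_L2_diff[of "X m" "X n"] by (intro nn_integral_cong_AE) (auto elim: eventually_mono)
        also have "\<dots> \<le> ennreal ((2 * (1/4) ^ n)\<^sup>2)"
          unfolding nn_integral_rep_L2 by (intro ennreal_leI power_mono dist elim) auto
        finally show ?case .
      qed
    qed simp
    finally show ?thesis .
  qed
  \<comment> \<open>Square integrability of \<open>g\<close> is not known beforehand; it comes from
    the Fatou bound at n = 0 by adding \<open>X 0\<close> back.\<close>
  have sq1: "sq_integrable (\<lambda>x. g x - rep_L2 (X 0) x)"
    unfolding sq_integrable_def using fatou[of 0]
    by (auto simp: integrable_iff_bounded intro: le_less_trans)
  have sqg: "sq_integrable g"
    using sq_integrable_add[OF sq1 sq_integrable_rep[of "X 0"]] by simp
  have le: "norm (X n - abs_L2 g) \<le> 2 * (1/4) ^ n" for n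
  proof -
    have "ennreal ((norm (X n - abs_L2 g))\<^sup>2) = (\<integral>\<^sup>+x. ennreal ((rep_L2 (X n - abs_L2 g) x)\<^sup>2) \<partial>lborel)"
      by (rule nn_integral_rep_L2[symmetric])
    also have "\<dots> = (\<integral>\<^sup>+x. ennreal ((g x - rep_L2 (X n) x)\<^sup>2) \<partial>lborel)"
      using rep_L2_diff[of "X n" "abs_L2 g"] AE_rep_abs_L2[OF sqg]
      by (intro nn_integral_cong_AE) (auto elim!: eventually_elim2 simp: power2_commute)
    also have "\<dots> \<le> ennreal ((2 * (1/4) ^ n)\<^sup>2)" by (rule fatou)
    finally have "(norm (X n - abs_L2 g))\<^sup>2 \<le> (2 * (1/4) ^ n)\<^sup>2" by simp
    then show ?thesis by (rule power2_le_imp_le) simp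
  qed
  have lim0: "(\<lambda>n. 2 * (1/4::real) ^ n) \<longlonglongrightarrow> 0"
    by (intro tendsto_mult_right_zero LIMSEQ_power_zero) simp
  have "(\<lambda>n. X n - abs_L2 g) \<longlonglongrightarrow> 0"
    by (rule Lim_null_comparison[OF _ lim0]) (rule always_eventually, rule allI, rule le)
  then have "X \<longlonglongrightarrow> abs_L2 g" by (rule LIM_zero_cancel)
  then show ?thesis by (rule convergentI)
qed

instance L2 :: banach
proof
  fix X :: "nat \<Rightarrow> L2" assume C: "Cauchy X"
  have "\<exists>N. \<forall>m\<ge>N. \<forall>n\<ge>N. norm (X m - X n) < (1/4) ^ k" for k
    using C by (auto simp: Cauchy_def dist_norm)
  then obtain N where N: "\<And>k m n. m \<ge> N k \<Longrightarrow> n \<ge> N k \<Longrightarrow> norm (X m - X n) < (1/4) ^ k"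
    by metis
  \<comment> \<open>The summands \<open>Suc (N i)\<close> make \<open>r\<close> strictly increasing
    and at least \<open>N\<close> at the same time.\<close>
  define r where "r k = (\<Sum>i\<le>k. Suc (N i))" for k
  have rN: "r k \<ge> N k" for k
    by (induction k) (auto simp: r_def)
  have sm: "strict_mono r"
    by (intro strict_mono_Suc_iff[THEN iffD2]) (simp add: r_def)
  have "convergent (X \<circ> r)"
  proof (rule L2_fast_Cauchy_convergent)
    fix n
    have "r (Suc n) \<ge> N n" using rN[of n] sm by (meson lessI less_imp_le order_trans strict_mono_less)
    then show "norm ((X \<circ> r) (Suc n) - (X \<circ> r) n) \<le> (1/4) ^ n"
      using N[of n "r (Suc n)" "r n"] rN[of n] by simp
  qed
  then obtain L where "(X \<circ> r) \<longlonglongrightarrow> L" by (auto simp: convergent_def)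
  then show "convergent X"
    using Cauchy_converges_subseq[OF C sm] by (auto simp: convergent_def)
qed

section \<open>Absolutely continuous functions\<close>

text \<open>Fubini on the half planes s \<le> x and x \<le> s, which cover the plane and overlap
  only in the diagonal, a null set on each line. It is integration by parts for primitives of
  integrable functions.\<close>

lemma integral_mult_primitive_swap:
  fixes f g :: "real \<Rightarrow> real"
  assumes f: "integrable lborel f" and g: "integrable lborel g"
  shows "(\<integral>x. f x * (\<integral>s. indicator {..x} s * g s \<partial>lborel) \<partial>lborel)
    + (\<integral>x. g x * (\<integral>s. indicator {..x} s * f s \<partial>lborel) \<partial>lborel)
    = (\<integral>x. f x \<partial>lborel) * (\<integral>x. g x \<partial>lborel)"
proof -
  have [measurable]: "f \<in> borel_measurable borel" "g \<in> borel_measurable borel"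
    using f g by (auto dest: borel_measurable_integrable)
  let ?Q = "\<lambda>x s. indicator {(x, s). s \<le> x} (x, s) * (f x * g s)"
  let ?R = "\<lambda>x s. indicator {(x, s). x \<le> s} (x, s) * (f x * g s)"
  have Q: "integrable (lborel \<Otimes>\<^sub>M lborel) (\<lambda>(x, s). f x * g s)"
  proof (rule lborel_pair.Fubini_integrable)
    show "integrable lborel (\<lambda>x. LBINT y. norm (case (x, y) of (x, s) \<Rightarrow> f x * g s))"
      using f by (simp add: abs_mult)
    show "AE x in lborel. integrable lborel (\<lambda>y. case (x, y) of (x, s) \<Rightarrow> f x * g s)"
      using g by simp
  qed simp
  have Q1: "integrable (lborel \<Otimes>\<^sub>M lborel) (\<lambda>(x, s). ?Q x s)"
    by (rule Bochner_Integration.integrable_bound[OF Q]) (auto simp: indicator_def)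
  have R1: "integrable (lborel \<Otimes>\<^sub>M lborel) (\<lambda>(x, s). ?R x s)"
    by (rule Bochner_Integration.integrable_bound[OF Q]) (auto simp: indicator_def)
  have "(\<integral>x. f x * (\<integral>s. indicator {..x} s * g s \<partial>lborel) \<partial>lborel) = (\<integral>x. (\<integral>s. ?Q x s \<partial>lborel) \<partial>lborel)"
    by (auto intro!: Bochner_Integration.integral_cong simp: indicator_def simp flip: integral_mult_right_zero)
  moreover have "(\<integral>x. g x * (\<integral>s. indicator {..x} s * f s \<partial>lborel) \<partial>lborel) = (\<integral>s. (\<integral>x. ?R x s \<partial>lborel) \<partial>lborel)"
    by (auto intro!: Bochner_Integration.integral_cong simp: indicator_def simp flip: integral_mult_right_zero)
  moreover have "(\<integral>s. (\<integral>x. ?R x s \<partial>lborel) \<partial>lborel) = (\<integral>x. (\<integral>s. ?R x s \<partial>lborel) \<partial>lborel)"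
    by (rule lborel_pair.Fubini_integral[OF R1])
  moreover have "(\<integral>x. (\<integral>s. ?Q x s \<partial>lborel) \<partial>lborel) + (\<integral>x. (\<integral>s. ?R x s \<partial>lborel) \<partial>lborel)
      = (\<integral>x. (\<integral>s. ?Q x s \<partial>lborel) + (\<integral>s. ?R x s \<partial>lborel) \<partial>lborel)"
    using lborel_pair.integrable_fst'[OF Q1] lborel_pair.integrable_fst'[OF R1] by simp
  moreover have "(\<integral>s. ?Q x s \<partial>lborel) + (\<integral>s. ?R x s \<partial>lborel) = f x * (\<integral>s. g s \<partial>lborel)" for x
  proof -
    have gi: "integrable lborel (\<lambda>s. f x * g s)" using g by simp
    have "integrable lborel (\<lambda>s. ?Q x s)" "integrable lborel (\<lambda>s. ?R x s)"
      by (rule Bochner_Integration.integrable_bound[OF gi]; auto simp: indicator_def)+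
    then have "(\<integral>s. ?Q x s \<partial>lborel) + (\<integral>s. ?R x s \<partial>lborel) = (\<integral>s. ?Q x s + ?R x s \<partial>lborel)"
      by simp
    also have "\<dots> = (\<integral>s. f x * g s \<partial>lborel)"
    proof (rule integral_cong_AE)
      have "AE s in lborel. s \<noteq> x" by (rule AE_lborel_singleton)
      then show "AE s in lborel. ?Q x s + ?R x s = f x * g s"
        by eventually_elim (auto simp: indicator_def)
    qed simp_all
    finally show ?thesis by simp
  qed
  ultimately show ?thesis by simp
qed

text \<open>\<open>AC l F f\<close>: on \<open>[0,l]\<close> the function \<open>F\<close> is absolutely continuous with derivative \<open>f\<close>.\<close>

definition AC :: "real \<Rightarrow> (real \<Rightarrow> real) \<Rightarrow> (real \<Rightarrow> real) \<Rightarrow> bool" where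
  "AC l F f \<longleftrightarrow> set_integrable lborel {0..l} f \<and> (\<forall>x\<in>{0..l}. (LBINT s:{0..x}. f s) = F x - F 0)"

lemma AC_integrable: "AC l F f \<Longrightarrow> set_integrable lborel {0..l} f"
  by (simp add: AC_def)

lemma AC_end: "AC l F f \<Longrightarrow> 0 \<le> l \<Longrightarrow> (LBINT s:{0..l}. f s) = F l - F 0"
  by (simp add: AC_def)

lemma AC_mono: "AC l F f \<Longrightarrow> m \<le> l \<Longrightarrow> AC m F f"
  unfolding AC_def by (auto intro: set_integrable_subset)

lemma AC_continuous:
  assumes "AC l F f" shows "continuous_on {0..l} F"
proof -
  have i: "f integrable_on {0..l}"
    using AC_integrable[OF assms] by (rule set_borel_integral_eq_integral(1))
  have "continuous_on {0..l} (\<lambda>x. F 0 + integral {0..x} f)"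
    by (intro continuous_intros indefinite_integral_continuous_1 i)
  moreover have "F 0 + integral {0..x} f = F x" if "x \<in> {0..l}" for x
  proof -
    have "set_integrable lborel {0..x} f"
      using AC_integrable[OF assms] that by (auto intro: set_integrable_subset)
    then have "integral {0..x} f = (LBINT s:{0..x}. f s)"
      by (rule set_borel_integral_eq_integral(2)[symmetric])
    then show ?thesis
      using assms that by (simp add: AC_def)
  qed
  ultimately show ?thesis by (rule continuous_on_eq)
qed

lemma set_integrable_mult_continuous:
  fixes F g :: "real \<Rightarrow> real"
  assumes F: "continuous_on {a..b} F" and g: "set_integrable lborel {a..b} g"
  shows "set_integrable lborel {a..b} (\<lambda>x. F x * g x)" "set_integrable lborel {a..b} (\<lambda>x. g x * F x)"
proof -
  obtain B where B: "\<And>x. x \<in> {a..b} \<Longrightarrow> \<bar>F x\<bar> \<le> B"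
    using compact_imp_bounded[OF compact_continuous_image[OF F compact_Icc]] by (force simp: bounded_iff)
  have m: "(\<lambda>x. indicator {a..b} x *\<^sub>R F x) \<in> borel_measurable lborel"
    using borel_measurable_continuous_on_indicator[OF _ F] by simp
  have i: "integrable lborel (\<lambda>x. indicator {a..b} x *\<^sub>R g x)"
    using g by (simp add: set_integrable_def)
  have "integrable lborel (\<lambda>x. (indicator {a..b} x *\<^sub>R F x) * (indicator {a..b} x *\<^sub>R g x))"
  proof (rule Bochner_Integration.integrable_bound)
    show "integrable lborel (\<lambda>x. B * (indicator {a..b} x *\<^sub>R g x))" using i by (rule integrable_mult_right)
    show "(\<lambda>x. (indicator {a..b} x *\<^sub>R F x) * (indicator {a..b} x *\<^sub>R g x)) \<in> borel_measurable lborel"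
      using m borel_measurable_integrable[OF i] by (rule borel_measurable_times)
    have "\<bar>F x * g x\<bar> \<le> \<bar>B * g x\<bar>" if "x \<in> {a..b}" for x
      using B[OF that] by (auto simp: abs_mult intro!: mult_right_mono)
    then show "AE x in lborel. norm ((indicator {a..b} x *\<^sub>R F x) * (indicator {a..b} x *\<^sub>R g x))
        \<le> norm (B * (indicator {a..b} x *\<^sub>R g x))"
      by (auto simp: indicator_def)
  qed
  also have "(\<lambda>x. (indicator {a..b} x *\<^sub>R F x) * (indicator {a..b} x *\<^sub>R g x))
      = (\<lambda>x. indicator {a..b} x *\<^sub>R (F x * g x))"
    by (auto simp: indicator_def)
  finally show *: "set_integrable lborel {a..b} (\<lambda>x. F x * g x)"
    by (simp add: set_integrable_def)
  then show "set_integrable lborel {a..b} (\<lambda>x. g x * F x)"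
    by (simp add: mult.commute)
qed

text \<open>\<open>AC\<close> speaks of integrals only, so the product rule is obtained from the
  Fubini swap for F - F 0 and G - G 0; the two constants are put back by linearity.\<close>

lemma AC_ibp:
  assumes F: "AC l F f" and G: "AC l G g" and l: "0 \<le> l"
  shows "(LBINT x:{0..l}. f x * G x + F x * g x) = F l * G l - F 0 * G 0"
proof -
  let ?i = "indicator {0..l} :: real \<Rightarrow> real"
  have f: "set_integrable lborel {0..l} f" and g: "set_integrable lborel {0..l} g"
    using F G by (auto simp: AC_def)
  have prim: "(\<integral>s. indicator {..x} s * (?i s * h s) \<partial>lborel) = (LBINT s:{0..x}. h s)" if "x \<in> {0..l}" for h x
    using that unfolding set_lebesgue_integral_def
    by (intro Bochner_Integration.integral_cong) (auto simp: indicator_def)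
  have eq: "(\<integral>x. (?i x * h x) * (\<integral>s. indicator {..x} s * (?i s * k s) \<partial>lborel) \<partial>lborel)
      = (LBINT x:{0..l}. h x * (K x - K 0))" if "AC l K k" for h K k
    unfolding set_lebesgue_integral_def
  proof (intro Bochner_Integration.integral_cong refl)
    fix x
    show "(?i x * h x) * (\<integral>s. indicator {..x} s * (?i s * k s) \<partial>lborel) = ?i x *\<^sub>R (h x * (K x - K 0))"
    proof (cases "x \<in> {0..l}")
      case True
      have "(LBINT s:{0..x}. k s) = K x - K 0" using that True by (simp add: AC_def)
      then show ?thesis using prim[OF True] by simp
    qed simp
  qed
  have "(LBINT x:{0..l}. f x * (G x - G 0)) + (LBINT x:{0..l}. g x * (F x - F 0))
      = (\<integral>x. ?i x * f x \<partial>lborel) * (\<integral>x. ?i x * g x \<partial>lborel)"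
    using integral_mult_primitive_swap[of "\<lambda>x. ?i x * f x" "\<lambda>x. ?i x * g x"] f g
    unfolding eq[OF F] eq[OF G] by (simp add: set_integrable_def)
  also have "\<dots> = (F l - F 0) * (G l - G 0)"
    using AC_end[OF F l] AC_end[OF G l] by (simp add: set_lebesgue_integral_def)
  finally have main: "(LBINT x:{0..l}. f x * (G x - G 0)) + (LBINT x:{0..l}. g x * (F x - F 0))
      = (F l - F 0) * (G l - G 0)" .
  have fG: "set_integrable lborel {0..l} (\<lambda>x. f x * G x)" and Fg: "set_integrable lborel {0..l} (\<lambda>x. F x * g x)"
    using set_integrable_mult_continuous(2)[OF AC_continuous[OF G] f]
      set_integrable_mult_continuous(1)[OF AC_continuous[OF F] g] by auto
  have "(LBINT x:{0..l}. f x * (G x - G 0)) = (LBINT x:{0..l}. f x * G x) - (LBINT x:{0..l}. f x) * G 0"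
    using fG f by (simp add: right_diff_distrib)
  moreover have "(LBINT x:{0..l}. g x * (F x - F 0)) = (LBINT x:{0..l}. F x * g x) - (LBINT x:{0..l}. g x) * F 0"
    using Fg g by (simp add: right_diff_distrib mult.commute)
  moreover have "(LBINT x:{0..l}. f x * G x + F x * g x) = (LBINT x:{0..l}. f x * G x) + (LBINT x:{0..l}. F x * g x)"
    using fG Fg by simp
  ultimately show ?thesis
    using main AC_end[OF F l] AC_end[OF G l] by (simp add: algebra_simps)
qed

lemma AC_mult:
  assumes F: "AC l F f" and G: "AC l G g"
  shows "AC l (\<lambda>x. F x * G x) (\<lambda>x. f x * G x + F x * g x)"
  unfolding AC_def
proof safe
  show "set_integrable lborel {0..l} (\<lambda>x. f x * G x + F x * g x)"
    using set_integrable_mult_continuous(2)[OF AC_continuous[OF G] AC_integrable[OF F]]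
      set_integrable_mult_continuous(1)[OF AC_continuous[OF F] AC_integrable[OF G]]
    by (rule set_integral_add)
  fix x assume "x \<in> {0..l}"
  then show "(LBINT s:{0..x}. f s * G s + F s * g s) = F x * G x - F 0 * G 0"
    using AC_ibp[OF AC_mono[OF F] AC_mono[OF G], of x] by simp
qed

lemma AC_add: "AC l F f \<Longrightarrow> AC l G g \<Longrightarrow> AC l (\<lambda>x. F x + G x) (\<lambda>x. f x + g x)"
  unfolding AC_def
proof safe
  assume a: "set_integrable lborel {0..l} f" "set_integrable lborel {0..l} g"
    "\<forall>x\<in>{0..l}. (LBINT s:{0..x}. f s) = F x - F 0" "\<forall>x\<in>{0..l}. (LBINT s:{0..x}. g s) = G x - G 0"
  then show "set_integrable lborel {0..l} (\<lambda>x. f x + g x)" by simp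
  fix x assume x: "x \<in> {0..l}"
  have "set_integrable lborel {0..x} f" "set_integrable lborel {0..x} g"
    using a(1,2) x by (auto intro: set_integrable_subset)
  then have "(LBINT s:{0..x}. f s + g s) = (LBINT s:{0..x}. f s) + (LBINT s:{0..x}. g s)" by simp
  then show "(LBINT s:{0..x}. f s + g s) = F x + G x - (F 0 + G 0)"
    using a(3,4)[rule_format, OF x] by simp
qed

lemma AC_cmult: "AC l F f \<Longrightarrow> AC l (\<lambda>x. c * F x) (\<lambda>x. c * f x)"
  unfolding AC_def by (auto simp: right_diff_distrib)

lemma AC_C1:
  assumes "\<And>x. x \<in> {0..l} \<Longrightarrow> (F has_real_derivative f x) (at x within {0..l})" and c: "continuous_on {0..l} f"
  shows "AC l F f"
  unfolding AC_def
proof safe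
  show i: "set_integrable lborel {0..l} f" by (rule borel_integrable_atLeastAtMost'[OF c])
  fix x assume x: "x \<in> {0..l}"
  have "(f has_integral F x - F 0) {0..x}"
    using x assms(1)
    by (intro fundamental_theorem_of_calculus)
      (auto simp flip: has_real_derivative_iff_has_vector_derivative intro!: DERIV_subset[where t="{0..x}" and s="{0..l}"])
  moreover have "(LBINT s:{0..x}. f s) = integral {0..x} f"
    using x by (intro set_borel_integral_eq_integral(2) set_integrable_subset[OF i]) auto
  ultimately show "(LBINT s:{0..x}. f s) = F x - F 0"
    by (simp add: integral_unique)
qed

lemma AC_primitive:
  assumes "set_integrable lborel {0..l} f"
  shows "AC l (\<lambda>x. c + (LBINT s:{0..x}. f s)) f"
proof -
  have "(\<integral>s. indicator {0} s *\<^sub>R f s \<partial>lborel) = (\<integral>s. 0 \<partial>lborel)"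
    by (rule integral_eq_zero_AE[THEN trans]) (auto intro!: eventually_mono[OF AE_lborel_singleton[of 0]])
  then show ?thesis using assms by (simp add: AC_def set_lebesgue_integral_def)
qed

section \<open>Smooth functions, bump functions and the lemma of du Bois-Reymond\<close>

definition smooth :: "(real \<Rightarrow> real) \<Rightarrow> bool" where
  "smooth f \<longleftrightarrow> (\<forall>k x. (deriv ^^ k) f differentiable (at x))"

text \<open>Induction on the order: each iterated derivative stays in \<open>S\<close>. This spares
  formulas for higher derivatives; each use below only names a class closed under
  differentiation.\<close>

lemma smooth_coinduct:
  assumes "f \<in> S" and step: "\<And>f. f \<in> S \<Longrightarrow> \<exists>g\<in>S. \<forall>x. (f has_real_derivative g x) (at x)"
  shows "smooth f"
proof -
  have "(deriv ^^ k) f \<in> S" for k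
  proof (induction k)
    case (Suc k)
    then obtain g where "g \<in> S" "\<And>x. ((deriv ^^ k) f has_real_derivative g x) (at x)"
      using step by blast
    then have "deriv ((deriv ^^ k) f) = g" by (auto intro!: ext DERIV_imp_deriv)
    then show ?case using \<open>g \<in> S\<close> by simp
  qed (simp add: assms)
  then show ?thesis
    unfolding smooth_def using step real_differentiable_def by blast
qed

lemma smooth_DERIV: "smooth f \<Longrightarrow> (f has_real_derivative deriv f x) (at x)"
  unfolding smooth_def DERIV_deriv_iff_real_differentiable by (metis funpow_0)

lemma smooth_deriv: "smooth f \<Longrightarrow> smooth (deriv f)"
  unfolding smooth_def by (metis funpow_simps_right(2) comp_apply)

lemma smooth_continuous_on: "smooth f \<Longrightarrow> continuous_on A f"
  using smooth_DERIV DERIV_isCont continuous_at_imp_continuous_on by metis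

lemma smooth_lincomb:
  assumes "smooth f" "smooth g" shows "smooth (\<lambda>x. a * f x + b * g x)"
proof (rule smooth_coinduct[where S="{\<lambda>x. a * f x + b * g x | f g. smooth f \<and> smooth g}"])
  fix h assume "h \<in> {\<lambda>x. a * f x + b * g x | f g. smooth f \<and> smooth g}"
  then obtain f g where h: "h = (\<lambda>x. a * f x + b * g x)" "smooth f" "smooth g" by blast
  have "(h has_real_derivative a * deriv f x + b * deriv g x) (at x)" for x
    unfolding h(1) by (intro DERIV_add DERIV_cmult smooth_DERIV h)
  then show "\<exists>k\<in>{\<lambda>x. a * f x + b * g x | f g. smooth f \<and> smooth g}. \<forall>x. (h has_real_derivative k x) (at x)"
    using smooth_deriv[OF h(2)] smooth_deriv[OF h(3)]
    by (intro bexI[of _ "\<lambda>x. a * deriv f x + b * deriv g x"]) auto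
qed (use assms in auto)

lemma smooth_primitive:
  assumes "smooth f" "\<And>x. (F has_real_derivative f x) (at x)" shows "smooth F"
proof (rule smooth_coinduct[where S="insert F {f. smooth f}"])
  fix h assume "h \<in> insert F {f. smooth f}"
  then show "\<exists>k\<in>insert F {f. smooth f}. \<forall>x. (h has_real_derivative k x) (at x)"
  proof
    assume "h = F"
    then show ?thesis using assms by (intro bexI[of _ f]) auto
  next
    assume "h \<in> {f. smooth f}"
    then show ?thesis using smooth_DERIV smooth_deriv by (intro bexI[of _ "deriv h"]) auto
  qed
qed simp

lemma smooth_affine:
  assumes "smooth f" shows "smooth (\<lambda>x. f (m * x + c))"
proof (rule smooth_coinduct[where S="{\<lambda>x. d * f (m * x + c) | d f. smooth f}"])
  show "(\<lambda>x. f (m * x + c)) \<in> {\<lambda>x. d * f (m * x + c) | d f. smooth f}"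
    using assms by (intro CollectI exI[of _ 1] exI[of _ f]) simp
  fix h assume "h \<in> {\<lambda>x. d * f (m * x + c) | d f. smooth f}"
  then obtain d f where h: "h = (\<lambda>x. d * f (m * x + c))" "smooth f" by blast
  have "((\<lambda>x. f (m * x + c)) has_real_derivative deriv f (m * x + c) * m) (at x)" for x
    by (rule DERIV_chain2[OF smooth_DERIV[OF h(2)]]) (auto intro!: derivative_eq_intros)
  then have "(h has_real_derivative d * (deriv f (m * x + c) * m)) (at x)" for x
    unfolding h(1) by (rule DERIV_cmult)
  then have "\<forall>x. (h has_real_derivative (d * m) * deriv f (m * x + c)) (at x)"
    by (simp add: mult_ac)
  then show "\<exists>k\<in>{\<lambda>x. d * f (m * x + c) | d f. smooth f}. \<forall>x. (h has_real_derivative k x) (at x)"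
    using smooth_deriv[OF h(2)] by (intro bexI[of _ "\<lambda>x. (d * m) * deriv f (m * x + c)"]) auto
qed

text \<open>Sums are included because the derivative of a product is a sum of two products.\<close>

inductive_set smooth_products :: "(real \<Rightarrow> real) set" where
  base: "smooth f \<Longrightarrow> smooth g \<Longrightarrow> (\<lambda>x. f x * g x) \<in> smooth_products"
| add: "f \<in> smooth_products \<Longrightarrow> g \<in> smooth_products \<Longrightarrow> (\<lambda>x. f x + g x) \<in> smooth_products"

lemma smooth_mult:
  assumes "smooth f" "smooth g" shows "smooth (\<lambda>x. f x * g x)"
proof (rule smooth_coinduct[where S=smooth_products])
  fix h assume "h \<in> smooth_products"
  then show "\<exists>k\<in>smooth_products. \<forall>x. (h has_real_derivative k x) (at x)"
  proof induction
    case (base f g)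
    show ?case
    proof (rule bexI)
      show "\<forall>x. ((\<lambda>x. f x * g x) has_real_derivative deriv f x * g x + deriv g x * f x) (at x)"
        using DERIV_mult[OF smooth_DERIV[OF base(1)] smooth_DERIV[OF base(2)]] by simp
      show "(\<lambda>x. deriv f x * g x + deriv g x * f x) \<in> smooth_products"
        by (rule smooth_products.add[OF smooth_products.base[OF smooth_deriv[OF base(1)] base(2)]
              smooth_products.base[OF smooth_deriv[OF base(2)] base(1)]])
    qed
  next
    case (add f g)
    then obtain f' g' where *: "f' \<in> smooth_products" "g' \<in> smooth_products"
      "\<forall>x. (f has_real_derivative f' x) (at x)" "\<forall>x. (g has_real_derivative g' x) (at x)" by blast
    show ?case
    proof (rule bexI)
      show "\<forall>x. ((\<lambda>x. f x + g x) has_real_derivative f' x + g' x) (at x)"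
        using * by (simp add: DERIV_add)
      show "(\<lambda>x. f' x + g' x) \<in> smooth_products" by (rule smooth_products.add[OF *(1,2)])
    qed
  qed
qed (intro smooth_products.base assms)

text \<open>\<open>flat 0\<close> is the classical function exp(-1/x), which vanishes to infinite
  order at 0. The factor (1/x)^k is there because differentiation produces it, so that the family
  spans a class closed under derivatives.\<close>

definition flat :: "nat \<Rightarrow> real \<Rightarrow> real" where
  "flat k x = (if x > 0 then (1 / x) ^ k * exp (- (1 / x)) else 0)"

lemma DERIV_flat: "(flat k has_real_derivative flat (k + 2) x - real k * flat (k + 1) x) (at x)"
proof -
  consider "x > 0" | "x < 0" | "x = 0" by linarith
  then show ?thesis
  proof cases
    case 1
    have "((\<lambda>x. (1 / x) ^ k * exp (- (1 / x))) has_real_derivative flat (k + 2) x - real k * flat (k + 1) x) (at x)"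
      using 1 by (auto intro!: derivative_eq_intros simp: flat_def power2_eq_square)
        (cases k; simp add: field_simps power2_eq_square)
    then show ?thesis
      by (rule has_field_derivative_transform_within_open[where S="{0<..}"]) (use 1 in \<open>auto simp: flat_def\<close>)
  next
    case 2
    have "((\<lambda>x. 0) has_real_derivative flat (k + 2) x - real k * flat (k + 1) x) (at x)"
      using 2 by (simp add: flat_def)
    then show ?thesis
      by (rule has_field_derivative_transform_within_open[where S="{..<0}"]) (use 2 in \<open>auto simp: flat_def\<close>)
  next
    case 3
    \<comment> \<open>In the variable y = 1/h the right difference quotient at 0 is y^(k+1) / exp
      y.\<close>
    have "((\<lambda>h::real. (inverse h) ^ (k + 1) / exp (inverse h)) \<longlongrightarrow> 0) (at_right 0)"
      by (rule filterlim_compose[OF tendsto_power_div_exp_0 filterlim_inverse_at_top_right])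
    then have "((\<lambda>h. flat k h / h) \<longlongrightarrow> 0) (at_right 0)"
      by (rule Lim_transform_eventually)
        (auto simp: eventually_at_right_field flat_def exp_minus field_simps intro!: exI[of _ 1])
    moreover have "((\<lambda>h. flat k h / h) \<longlongrightarrow> 0) (at_left 0)"
      by (rule Lim_transform_eventually[OF tendsto_const])
        (auto simp: eventually_at_left_field flat_def intro!: exI[of _ "-1"])
    ultimately show ?thesis
      using 3 by (simp add: DERIV_def filterlim_at_split flat_def)
  qed
qed

inductive_set flat_span :: "(real \<Rightarrow> real) set" where
  base: "flat k \<in> flat_span"
| lincomb: "f \<in> flat_span \<Longrightarrow> g \<in> flat_span \<Longrightarrow> (\<lambda>x. f x - c * g x) \<in> flat_span"

lemma smooth_flat: "smooth (flat k)"
proof (rule smooth_coinduct[where S=flat_span])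
  fix h assume "h \<in> flat_span"
  then show "\<exists>k\<in>flat_span. \<forall>x. (h has_real_derivative k x) (at x)"
  proof induction
    case (base k)
    show ?case
    proof (rule bexI)
      show "\<forall>x. (flat k has_real_derivative flat (k + 2) x - real k * flat (k + 1) x) (at x)"
        using DERIV_flat by blast
      show "(\<lambda>x. flat (k + 2) x - real k * flat (k + 1) x) \<in> flat_span"
        by (rule flat_span.lincomb[OF flat_span.base flat_span.base])
    qed
  next
    case (lincomb f g c)
    then obtain f' g' where *: "f' \<in> flat_span" "g' \<in> flat_span"
      "\<forall>x. (f has_real_derivative f' x) (at x)" "\<forall>x. (g has_real_derivative g' x) (at x)" by blast
    show ?case
    proof (rule bexI)
      show "\<forall>x. ((\<lambda>x. f x - c * g x) has_real_derivative f' x - c * g' x) (at x)"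
        using * by (simp add: DERIV_diff DERIV_cmult)
      show "(\<lambda>x. f' x - c * g' x) \<in> flat_span" by (rule flat_span.lincomb[OF *(1,2)])
    qed
  qed
qed (rule flat_span.base)

text \<open>One factor vanishes left of \<open>a\<close>, the other right of \<open>b\<close>;
  growing steepness \<open>n\<close> drives both to 1 in between, so the product tends to the
  indicator of the open interval.\<close>

definition bump :: "real \<Rightarrow> real \<Rightarrow> nat \<Rightarrow> real \<Rightarrow> real" where
  "bump a b n x = flat 0 (real n * x + - (real n * a)) * flat 0 (- real n * x + real n * b)"

lemma flat_0: "flat 0 x = (if x > 0 then exp (- (1 / x)) else 0)"
  by (simp add: flat_def)

lemma test_function_bump:
  assumes "0 < a" "b < l" shows "test_function l (bump a b n)"
proof -
  have "smooth (bump a b n)"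
    unfolding bump_def[abs_def] by (intro smooth_mult smooth_affine smooth_flat)
  moreover have "bump a b n x = 0" if "x \<notin> {a..b}" for x
  proof -
    have "real n * x + - (real n * a) \<le> 0 \<or> - real n * x + real n * b \<le> 0"
      using that by (auto simp: mult_left_mono)
    then show ?thesis by (auto simp: bump_def flat_0)
  qed
  ultimately show ?thesis using assms unfolding test_function_def smooth_def by blast
qed

lemma abs_bump_le: "\<bar>bump a b n x\<bar> \<le> 1"
proof -
  have "0 \<le> flat 0 y \<and> flat 0 y \<le> 1" for y by (simp add: flat_0)
  then show ?thesis by (auto simp: bump_def abs_mult intro!: mult_le_one)
qed

lemma bump_tendsto: "(\<lambda>n. bump a b n x) \<longlonglongrightarrow> indicator {a<..<b} x"
proof -
  have pos: "(\<lambda>n. flat 0 (real n * d)) \<longlonglongrightarrow> 1" if "d > 0" for d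
  proof -
    have "filterlim (\<lambda>n. real n * d) at_top sequentially"
      using that by (intro filterlim_at_top_mult_tendsto_pos[OF tendsto_const] filterlim_real_sequentially)
    then have "(\<lambda>n. 1 / (real n * d)) \<longlonglongrightarrow> 0"
      by (rule tendsto_divide_0[OF tendsto_const filterlim_at_top_imp_at_infinity])
    from tendsto_exp[OF tendsto_minus[OF this]] have "(\<lambda>n. exp (- (1 / (real n * d)))) \<longlonglongrightarrow> 1" by simp
    then show ?thesis
      by (rule Lim_transform_eventually)
        (auto simp: flat_0 that intro: eventually_sequentiallyI[of 1])
  qed
  have neg: "(\<lambda>n. flat 0 (real n * d)) \<longlonglongrightarrow> 0" if "d \<le> 0" for d
    using that by (simp add: flat_0 mult_nonneg_nonpos not_less zero_less_mult_iff)
  have "(\<lambda>n. flat 0 (real n * (x - a)) * flat 0 (real n * (b - x))) \<longlonglongrightarrow> indicator {a<..<b} x"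
  proof (cases "x \<in> {a<..<b}")
    case True
    then show ?thesis using tendsto_mult[OF pos[of "x - a"] pos[of "b - x"]] by simp
  next
    case False
    have "\<exists>c. (\<lambda>n. flat 0 (real n * d)) \<longlonglongrightarrow> c" for d using pos neg by (meson not_less)
    then obtain c1 c2 where c: "(\<lambda>n. flat 0 (real n * (x - a))) \<longlonglongrightarrow> c1" "(\<lambda>n. flat 0 (real n * (b - x))) \<longlonglongrightarrow> c2"
      by meson
    have "c1 = 0 \<or> c2 = 0"
    proof (cases "x \<le> a")
      case True
      then show ?thesis using neg[of "x - a"] LIMSEQ_unique[OF c(1)] by auto
    next
      case f: False
      then show ?thesis using neg[of "b - x"] LIMSEQ_unique[OF c(2)] False by auto
    qed
    then show ?thesis using tendsto_mult[OF c] False by auto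
  qed
  then show ?thesis by (simp add: bump_def right_diff_distrib)
qed

text \<open>Bumps and dominated convergence give integral zero over every closed interval inside
  (0,l), and Lebesgue differentiation then gives zero almost everywhere.\<close>

lemma fundamental_lemma:
  fixes g :: "real \<Rightarrow> real"
  assumes g: "set_integrable lborel {0..l} g"
    and 0: "\<And>\<phi>. test_function l \<phi> \<Longrightarrow> (LBINT x:{0..l}. g x * \<phi> x) = 0"
  shows "AE x in lborel. x \<in> {0..l} \<longrightarrow> g x = 0"
proof -
  define g0 where "g0 x = indicator {0..l} x * g x" for x
  have g0: "integrable lborel g0" using g by (simp add: g0_def[abs_def] set_integrable_def)
  then have [measurable]: "g0 \<in> borel_measurable borel" by (auto dest: borel_measurable_integrable)
  have g0s: "set_integrable lborel {a..b} g0" for a b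
    unfolding set_integrable_def by (intro integrable_mult_indicator g0) simp
  have int0: "integral {a..b} g0 = 0" if ab: "0 < a" "b < l" for a b
  proof -
    have L: "(\<lambda>n. \<integral>x. g0 x * bump a b n x \<partial>lborel) \<longlonglongrightarrow> (\<integral>x. g0 x * indicator {a<..<b} x \<partial>lborel)"
    proof (rule integral_dominated_convergence[where w="\<lambda>x. \<bar>g0 x\<bar>"])
      have "smooth (bump a b n)" for n using test_function_bump[OF ab] by (simp add: test_function_def smooth_def)
      then have [measurable]: "bump a b n \<in> borel_measurable borel" for n
        using borel_measurable_continuous_onI smooth_continuous_on by blast
      show "(\<lambda>x. g0 x * bump a b n x) \<in> borel_measurable lborel" for n by measurable
      show "integrable lborel (\<lambda>x. \<bar>g0 x\<bar>)" using g0 by simp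
      show "AE x in lborel. (\<lambda>n. g0 x * bump a b n x) \<longlonglongrightarrow> g0 x * indicator {a<..<b} x"
        by (intro AE_I2 tendsto_mult tendsto_const bump_tendsto)
      show "AE x in lborel. norm (g0 x * bump a b n x) \<le> \<bar>g0 x\<bar>" for n
        using abs_bump_le[of a b n] by (intro AE_I2) (auto simp: abs_mult intro: mult_left_le)
    qed measurable
    have z: "(\<integral>x. g0 x * bump a b n x \<partial>lborel) = 0" for n
      using 0[OF test_function_bump[OF ab]] by (simp add: g0_def set_lebesgue_integral_def mult.assoc)
    have "(\<integral>x. g0 x * indicator {a<..<b} x \<partial>lborel) = 0"
      by (rule LIMSEQ_unique[OF L]) (unfold z, rule tendsto_const)
    moreover have "(\<integral>x. g0 x * indicator {a<..<b} x \<partial>lborel) = (LBINT x:{a..b}. g0 x)"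
      unfolding set_lebesgue_integral_def
    proof (rule integral_cong_AE)
      show "AE x in lborel. g0 x * indicator {a<..<b} x = indicator {a..b} x *\<^sub>R g0 x"
        using AE_lborel_singleton[of a] AE_lborel_singleton[of b]
        by eventually_elim (auto simp: indicator_def)
    qed simp_all
    moreover have "(LBINT x:{a..b}. g0 x) = integral {a..b} g0"
      by (intro set_borel_integral_eq_integral(2) g0s)
    ultimately show ?thesis by simp
  qed
  have "g0 integrable_on cbox a b" for a b
    unfolding cbox_interval by (intro set_borel_integral_eq_integral(1) g0s)
  then obtain N where N: "negligible N" and
    lim: "\<And>x e. \<lbrakk>x \<notin> N; 0 < e\<rbrakk> \<Longrightarrow> \<exists>d>0. \<forall>h. 0 < h \<and> h < d \<longrightarrow>
      norm (integral (cbox x (x + h *\<^sub>R One)) g0 /\<^sub>R h ^ DIM(real) - g0 x) < e"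
    using integrable_ccontinuous_explicit by blast
  have z: "g x = 0" if "x \<notin> N" "0 < x" "x < l" for x
  proof (rule ccontr)
    assume "g x \<noteq> 0"
    then have "\<bar>g0 x\<bar> > 0" using that by (simp add: g0_def)
    from lim[OF that(1) this] obtain d where d: "d > 0"
      "\<And>h. 0 < h \<Longrightarrow> h < d \<Longrightarrow> norm (integral (cbox x (x + h *\<^sub>R One)) g0 /\<^sub>R h ^ DIM(real) - g0 x) < \<bar>g0 x\<bar>"
      by blast
    \<comment> \<open>Half of each bound, so that h < d and x + h < l hold strictly.\<close>
    define h where "h = min (d / 2) ((l - x) / 2)"
    have "0 < h" "h < d" "x + h < l" using d(1) that by (auto simp: h_def min_def field_simps)
    then show False using d(2)[of h] int0[of x "x + h"] that by simp
  qed
  have "AE x in lebesgue. x \<notin> N"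
    using N by (auto simp: negligible_iff_null_sets intro: AE_not_in)
  then have "AE x in lborel. x \<notin> N" by (simp add: AE_completion_iff)
  then show ?thesis
    using AE_lborel_singleton[of 0] AE_lborel_singleton[of l]
    by eventually_elim (use z in force)
qed

lemma test_function_smooth: "test_function l \<phi> \<Longrightarrow> smooth \<phi>"
  by (simp add: test_function_def smooth_def)

lemma test_function_AC:
  assumes "test_function l \<phi>"
  shows "AC l \<phi> (deriv \<phi>)" "\<phi> 0 = 0" "\<phi> l = 0"
proof -
  note s = test_function_smooth[OF assms]
  show "AC l \<phi> (deriv \<phi>)"
    by (rule AC_C1) (auto intro: DERIV_subset[OF smooth_DERIV[OF s]] smooth_continuous_on[OF smooth_deriv[OF s]])
  show "\<phi> 0 = 0" "\<phi> l = 0" using assms by (auto simp: test_function_def)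
qed

lemma test_function_deriv:
  assumes "test_function l \<phi>" shows "test_function l (deriv \<phi>)"
proof -
  obtain a b where ab: "0 < a" "b < l" "\<And>x. x \<notin> {a..b} \<Longrightarrow> \<phi> x = 0"
    using assms unfolding test_function_def by blast
  have "deriv \<phi> x = 0" if "x \<notin> {a..b}" for x
  proof -
    have "((\<lambda>x. 0) has_real_derivative 0) (at x)" by simp
    then have "(\<phi> has_real_derivative 0) (at x)"
      by (rule has_field_derivative_transform_within_open[where S="- {a..b}"]) (use that ab in auto)
    then show ?thesis by (rule DERIV_imp_deriv)
  qed
  then show ?thesis
    using ab smooth_deriv[OF test_function_smooth[OF assms]] unfolding test_function_def smooth_def by blast
qed

lemma test_function_primitive:
  assumes "test_function l \<theta>" and 0: "(LBINT x:{0..l}. \<theta> x) = 0"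
    and l: "0 < l"
  obtains \<Phi> where "test_function l \<Phi>" "deriv \<Phi> = \<theta>"
proof -
  obtain a0 b where "0 < a0" "b < l" and z: "\<And>x. x \<notin> {a0..b} \<Longrightarrow> \<theta> x = 0"
    using assms unfolding test_function_def by blast
  \<comment> \<open>\<open>test_function\<close> allows an empty interval with \<open>a0\<close>
    beyond l; the minimum restores a \<le> l.\<close>
  moreover define a where "a = min a0 l"
  ultimately have ab: "0 < a" "b < l" "a \<le> l" "\<And>x. x \<notin> {a..b} \<Longrightarrow> \<theta> x = 0"
    using l by auto
  have zl: "\<theta> x = 0" if "x < a" for x using ab(4)[of x] that by simp
  have zr: "\<theta> x = 0" if "b < x" for x using ab(4)[of x] that by simp
  note s = test_function_smooth[OF assms(1)]
  \<comment> \<open>The base point -1 lies left of the support, so every x \<ge> \<open>a\<close> is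
    interior to the interval \<open>{-1..x+1}\<close> on which \<Phi> is a primitive.\<close>
  define \<Phi> where "\<Phi> x = integral {-1..x} \<theta>" for x
  have cont: "continuous_on A \<theta>" for A by (rule smooth_continuous_on[OF s])
  have left: "\<Phi> x = 0" if "x < a" for x
    unfolding \<Phi>_def by (rule trans[OF integral_cong[where g="\<lambda>_. 0"]]) (use that zl zr ab(1-3) in auto)
  have right: "\<Phi> x = 0" if "b < x" for x
  proof (cases "x < a")
    case False
    have "\<Phi> x = integral {-1..a/2} \<theta> + integral {a/2..x} \<theta>"
      unfolding \<Phi>_def using ab False
      by (intro Henstock_Kurzweil_Integration.integral_combine[symmetric] integrable_continuous_real cont) auto
    also have "integral {-1..a/2} \<theta> = 0" using left[of "a/2"] ab by (simp add: \<Phi>_def)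
    also have "integral {a/2..x} \<theta> = integral {a/2..min x l} \<theta> + integral {min x l..x} \<theta>"
      using ab False that
      by (intro Henstock_Kurzweil_Integration.integral_combine[symmetric] integrable_continuous_real cont) auto
    also have "integral {min x l..x} \<theta> = 0"
      by (rule trans[OF integral_cong[where g="\<lambda>_. 0"]]) (use that zl zr ab(1-3) in auto)
    also have "integral {a/2..min x l} \<theta> = integral {0..l} \<theta>"
    proof -
      have "integral {0..l} \<theta> = integral {0..a/2} \<theta> + integral {a/2..l} \<theta>"
        using ab False that
        by (intro Henstock_Kurzweil_Integration.integral_combine[symmetric] integrable_continuous_real cont) auto
      moreover have "integral {0..a/2} \<theta> = 0"
        by (rule trans[OF integral_cong[where g="\<lambda>_. 0"]]) (use that zl zr ab(1-3) in auto)
      moreover have "integral {a/2..l} \<theta> = integral {a/2..min x l} \<theta> + integral {min x l..l} \<theta>"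
        using ab False that
        by (intro Henstock_Kurzweil_Integration.integral_combine[symmetric] integrable_continuous_real cont) auto
      moreover have "integral {min x l..l} \<theta> = 0"
        by (rule trans[OF integral_cong[where g="\<lambda>_. 0"]]) (use that zl zr ab(1-3) in auto)
      ultimately show ?thesis by simp
    qed
    also have "integral {0..l} \<theta> = 0"
      using 0 set_borel_integral_eq_integral(2)[OF borel_integrable_atLeastAtMost'[OF cont]] by simp
    finally show ?thesis by simp
  qed (rule left)
  have D: "(\<Phi> has_real_derivative \<theta> x) (at x)" for x
  proof (cases "x < a")
    case True
    have "((\<lambda>x. 0) has_real_derivative \<theta> x) (at x)" using ab True by simp
    then show ?thesis
      by (rule has_field_derivative_transform_within_open[where S="{..<a}"]) (use True left in auto)
  next
    case False
    then have "(\<Phi> has_real_derivative \<theta> x) (at x within {-1..x+1})"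
      unfolding \<Phi>_def[abs_def] using ab by (intro integral_has_real_derivative cont) auto
    then show ?thesis using False ab by (simp add: at_within_Icc_at)
  qed
  have "\<forall>x. x \<notin> {a..b} \<longrightarrow> \<Phi> x = 0" using left right by (metis atLeastAtMost_iff not_le)
  then have "test_function l \<Phi>"
    unfolding test_function_def smooth_def[symmetric]
    using smooth_primitive[OF s D] ab(1,2) by blast
  moreover have "deriv \<Phi> = \<theta>" using D by (auto intro: DERIV_imp_deriv)
  ultimately show ?thesis by (rule that)
qed

text \<open>With W a primitive of w, the function u - W annihilates the derivatives of test
  functions, that is, the test functions of mean zero. Correcting an arbitrary test function by a
  multiple of a fixed one with nonzero mean shows that u - W minus a constant annihilates all of
  them.\<close>

lemma du_Bois_Reymond:
  fixes u w :: "real \<Rightarrow> real"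
  assumes l: "0 < l" and u: "set_integrable lborel {0..l} u" and w: "set_integrable lborel {0..l} w"
    and weak: "\<And>\<phi>. test_function l \<phi> \<Longrightarrow> (LBINT x:{0..l}. u x * deriv \<phi> x) = - (LBINT x:{0..l}. w x * \<phi> x)"
  obtains c where "AE x in lborel. x \<in> {0..l} \<longrightarrow> u x = c + (LBINT s:{0..x}. w s)"
proof -
  define W where "W x = 0 + (LBINT s:{0..x}. w s)" for x
  have W: "AC l W w" unfolding W_def by (rule AC_primitive[OF w])
  define g where "g x = u x - W x" for x
  have Wi: "set_integrable lborel {0..l} W" by (rule borel_integrable_atLeastAtMost'[OF AC_continuous[OF W]])
  have gi: "set_integrable lborel {0..l} g" unfolding g_def using u Wi by simp
  have tc: "continuous_on {0..l} \<phi>" if "test_function l \<phi>" for \<phi>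
    using that test_function_smooth smooth_continuous_on by blast
  have gd: "(LBINT x:{0..l}. g x * deriv \<phi> x) = 0" if t: "test_function l \<phi>" for \<phi>
  proof -
    note d = tc[OF test_function_deriv[OF t]] and A = test_function_AC[OF t]
    have i1: "set_integrable lborel {0..l} (\<lambda>x. w x * \<phi> x)" by (rule set_integrable_mult_continuous(2)[OF tc[OF t] w])
    have i2: "set_integrable lborel {0..l} (\<lambda>x. W x * deriv \<phi> x)" by (rule set_integrable_mult_continuous(2)[OF d Wi])
    have i3: "set_integrable lborel {0..l} (\<lambda>x. u x * deriv \<phi> x)" by (rule set_integrable_mult_continuous(2)[OF d u])
    have "(LBINT x:{0..l}. w x * \<phi> x + W x * deriv \<phi> x) = 0"
      using AC_ibp[OF W A(1)] A(2,3) l by simp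
    then have "(LBINT x:{0..l}. W x * deriv \<phi> x) = - (LBINT x:{0..l}. w x * \<phi> x)" using i1 i2 by simp
    then show ?thesis using weak[OF t] i2 i3 by (simp add: g_def left_diff_distrib)
  qed
  \<comment> \<open>Otherwise the constant 1 would annihilate all test functions, against the
    fundamental lemma.\<close>
  obtain \<omega>0 where \<omega>0: "test_function l \<omega>0" "(LBINT x:{0..l}. \<omega>0 x) \<noteq> 0"
  proof -
    show thesis if \<omega>0: "\<And>\<omega>0. test_function l \<omega>0 \<Longrightarrow> (LBINT x:{0..l}. \<omega>0 x) \<noteq> 0 \<Longrightarrow> thesis"
    proof (rule ccontr)
    assume n: "\<not> thesis"
    have "(LBINT x:{0..l}. 1 * \<phi> x) = 0" if "test_function l \<phi>" for \<phi> using n \<omega>0[OF that] by auto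
    moreover have "set_integrable lborel {0..l} (\<lambda>x. 1::real)" by (rule borel_integrable_atLeastAtMost') simp
    ultimately have "AE x in lborel. x \<in> {0..l} \<longrightarrow> (1::real) = 0" by (rule fundamental_lemma[rotated])
    then have "AE x in lborel. x \<notin> {0..l}" by eventually_elim auto
    then have "emeasure lborel {0..l} = 0" by (subst (asm) AE_iff_measurable[where N="{0..l}"]) auto
    then show False using l by simp
    qed
  qed
  define m where "m = (LBINT x:{0..l}. \<omega>0 x)"
  have s0: "smooth \<omega>0" by (rule test_function_smooth[OF \<omega>0(1)])
  \<comment> \<open>Forced by the requirement that \<open>g\<close> - c annihilate
    \<open>\<omega>0\<close>.\<close>
  define c where "c = (LBINT x:{0..l}. g x * \<omega>0 x) / m"
  have "(LBINT x:{0..l}. (g x - c) * \<psi> x) = 0" if t: "test_function l \<psi>" for \<psi>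
  proof -
    define k where "k = (LBINT x:{0..l}. \<psi> x) / m"
    define \<theta> where "\<theta> x = 1 * \<psi> x + (- k) * \<omega>0 x" for x
    have i: "set_integrable lborel {0..l} \<psi>" "set_integrable lborel {0..l} \<omega>0"
      using borel_integrable_atLeastAtMost' tc t \<omega>0(1) by blast+
    have gi2: "set_integrable lborel {0..l} (\<lambda>x. g x * \<psi> x)" "set_integrable lborel {0..l} (\<lambda>x. g x * \<omega>0 x)"
      using set_integrable_mult_continuous(2) tc t \<omega>0(1) gi by blast+
    have "test_function l \<theta>"
    proof -
      obtain a b where ab: "0 < a" "b < l" "\<And>x. x \<notin> {a..b} \<Longrightarrow> \<psi> x = 0"
        using t unfolding test_function_def by blast
      obtain a' b' where ab': "0 < a'" "b' < l" "\<And>x. x \<notin> {a'..b'} \<Longrightarrow> \<omega>0 x = 0"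
        using \<omega>0(1) unfolding test_function_def by blast
      have "\<theta> x = 0" if "x \<notin> {min a a'..max b b'}" for x
      proof -
        have "x \<notin> {a..b}" "x \<notin> {a'..b'}" using that by auto
        then show ?thesis unfolding \<theta>_def using ab(3)[of x] ab'(3)[of x] by simp
      qed
      moreover have "0 < min a a'" "max b b' < l" using ab ab' by auto
      moreover have "smooth \<theta>" unfolding \<theta>_def[abs_def] by (intro smooth_lincomb s0 test_function_smooth[OF t])
      ultimately show ?thesis unfolding test_function_def smooth_def by blast
    qed
    moreover have "(LBINT x:{0..l}. \<theta> x) = 0"
    proof -
      have "(LBINT x:{0..l}. \<theta> x) = (LBINT x:{0..l}. 1 * \<psi> x) + (LBINT x:{0..l}. (- k) * \<omega>0 x)"
        unfolding \<theta>_def by (intro set_integral_add(2) set_integrable_mult_right i)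
      then show ?thesis using \<omega>0(2) unfolding set_integral_mult_right by (simp add: k_def m_def)
    qed
    ultimately obtain \<Phi> where "test_function l \<Phi>" "deriv \<Phi> = \<theta>" by (rule test_function_primitive[OF _ _ l])
    then have "(LBINT x:{0..l}. g x * \<theta> x) = 0" using gd by blast
    moreover have "(LBINT x:{0..l}. g x * \<theta> x) = (LBINT x:{0..l}. g x * \<psi> x - k * (g x * \<omega>0 x))"
      by (simp add: \<theta>_def right_diff_distrib mult.left_commute)
    ultimately have "(LBINT x:{0..l}. g x * \<psi> x) = k * (LBINT x:{0..l}. g x * \<omega>0 x)"
      using gi2 by simp
    moreover have "(LBINT x:{0..l}. (g x - c) * \<psi> x) = (LBINT x:{0..l}. g x * \<psi> x) - c * (LBINT x:{0..l}. \<psi> x)"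
      using gi2 i by (simp add: left_diff_distrib)
    ultimately show ?thesis by (simp add: k_def c_def)
  qed
  moreover have "set_integrable lborel {0..l} (\<lambda>x. g x - c)"
    using gi by (intro set_integral_diff) (auto intro: borel_integrable_atLeastAtMost')
  ultimately have "AE x in lborel. x \<in> {0..l} \<longrightarrow> g x - c = 0" by (rule fundamental_lemma[rotated])
  then have "AE x in lborel. x \<in> {0..l} \<longrightarrow> u x = c + (LBINT s:{0..x}. w s)"
    by eventually_elim (auto simp: g_def W_def)
  then show ?thesis by (rule that)
qed

section \<open>Weak derivatives and traces\<close>

lemma LBINT_cong_AE:
  fixes f g :: "real \<Rightarrow> real"
  assumes "set_integrable lborel A f" "set_integrable lborel A g" "AE x in lborel. x \<in> A \<longrightarrow> f x = g x"
  shows "(LBINT x:A. f x) = (LBINT x:A. g x)"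
  unfolding set_lebesgue_integral_def
proof (rule integral_cong_AE)
  show "AE x in lborel. indicat_real A x *\<^sub>R f x = indicat_real A x *\<^sub>R g x"
    using assms(3) by eventually_elim (auto simp: indicator_def)
qed (use assms in \<open>auto simp: set_integrable_def dest: borel_measurable_integrable\<close>)

lemma AC_cong:
  assumes F: "AC l F f" and g: "set_integrable lborel {0..l} g"
    and eq: "AE x in lborel. x \<in> {0..l} \<longrightarrow> f x = g x"
  shows "AC l F g"
  unfolding AC_def
proof safe
  fix x assume x: "x \<in> {0..l}"
  have "(LBINT s:{0..x}. g s) = (LBINT s:{0..x}. f s)"
  proof (rule LBINT_cong_AE)
    show "set_integrable lborel {0..x} g" "set_integrable lborel {0..x} f"
      using x g AC_integrable[OF F] by (auto intro: set_integrable_subset)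
    show "AE s in lborel. s \<in> {0..x} \<longrightarrow> g s = f s"
      using eq by eventually_elim (use x in auto)
  qed
  then show "(LBINT s:{0..x}. g s) = F x - F 0" using F x by (simp add: AC_def)
qed (rule g)

lemma AE_Ioo_Icc:
  fixes P :: "real \<Rightarrow> bool"
  assumes "AE x in lborel. x \<in> {0<..<l} \<longrightarrow> P x" shows "AE x in lborel. x \<in> {0..l} \<longrightarrow> P x"
  using assms AE_lborel_singleton[of 0] AE_lborel_singleton[of l]
  by eventually_elim force

section \<open>Representatives of classes in \<open>L2_on l\<close>\<close>

definition agrees :: "real \<Rightarrow> L2 \<Rightarrow> (real \<Rightarrow> real) \<Rightarrow> bool" where
  "agrees l a f \<longleftrightarrow> a \<in> L2_on l \<and> (AE x in lborel. x \<in> {0<..<l} \<longrightarrow> rep_L2 a x = f x)"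

lemma agrees_rep: "a \<in> L2_on l \<Longrightarrow> agrees l a (rep_L2 a)"
  by (simp add: agrees_def)

lemma agrees_L2_on: "agrees l a f \<Longrightarrow> a \<in> L2_on l"
  by (simp add: agrees_def)

lemma agrees_unique:
  assumes "agrees l a f" "agrees l b f" shows "a = b"
proof (rule L2_eqI)
  have "AE x in lborel. x \<notin> {0<..<l} \<longrightarrow> rep_L2 a x = 0" "AE x in lborel. x \<notin> {0<..<l} \<longrightarrow> rep_L2 b x = 0"
    "AE x in lborel. x \<in> {0<..<l} \<longrightarrow> rep_L2 a x = f x" "AE x in lborel. x \<in> {0<..<l} \<longrightarrow> rep_L2 b x = f x"
    using assms by (auto simp: agrees_def L2_on_def)
  then show "AE x in lborel. rep_L2 a x = rep_L2 b x"
    by eventually_elim metis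
qed

lemma agrees_add:
  assumes "agrees l a f" "agrees l b g" shows "agrees l (a + b) (\<lambda>x. f x + g x)"
proof -
  have "AE x in lborel. x \<notin> {0<..<l} \<longrightarrow> rep_L2 a x = 0" "AE x in lborel. x \<notin> {0<..<l} \<longrightarrow> rep_L2 b x = 0"
    "AE x in lborel. x \<in> {0<..<l} \<longrightarrow> rep_L2 a x = f x" "AE x in lborel. x \<in> {0<..<l} \<longrightarrow> rep_L2 b x = g x"
    using assms by (auto simp: agrees_def L2_on_def)
  then have "AE x in lborel. (x \<notin> {0<..<l} \<longrightarrow> rep_L2 (a + b) x = 0) \<and> (x \<in> {0<..<l} \<longrightarrow> rep_L2 (a + b) x = f x + g x)"
    using rep_L2_add[of a b] by eventually_elim auto
  then show ?thesis by (simp add: agrees_def L2_on_def)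
qed

lemma agrees_scaleR:
  assumes "agrees l a f" shows "agrees l (c *\<^sub>R a) (\<lambda>x. c * f x)"
proof -
  have "AE x in lborel. x \<notin> {0<..<l} \<longrightarrow> rep_L2 a x = 0" "AE x in lborel. x \<in> {0<..<l} \<longrightarrow> rep_L2 a x = f x"
    using assms by (auto simp: agrees_def L2_on_def)
  then have "AE x in lborel. (x \<notin> {0<..<l} \<longrightarrow> rep_L2 (c *\<^sub>R a) x = 0) \<and> (x \<in> {0<..<l} \<longrightarrow> rep_L2 (c *\<^sub>R a) x = c * f x)"
    using rep_L2_scaleR[of c a] by eventually_elim auto
  then show ?thesis by (simp add: agrees_def L2_on_def)
qed

lemma L2_on_add: "a \<in> L2_on l \<Longrightarrow> b \<in> L2_on l \<Longrightarrow> a + b \<in> L2_on l"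
  using agrees_add[OF agrees_rep agrees_rep] agrees_L2_on by blast

lemma L2_on_scaleR: "a \<in> L2_on l \<Longrightarrow> c *\<^sub>R a \<in> L2_on l"
  using agrees_scaleR[OF agrees_rep] agrees_L2_on by blast

lemma L2_on_diff: "a \<in> L2_on l \<Longrightarrow> b \<in> L2_on l \<Longrightarrow> a - b \<in> L2_on l"
  using L2_on_add[OF _ L2_on_scaleR[of b l "-1"], of a] by simp

lemma L2_on_zero: "0 \<in> L2_on l"
  using rep_L2_zero by (auto simp: L2_on_def elim: eventually_mono)

lemma sq_integrable_indicator_mult:
  assumes "sq_integrable f" "A \<in> sets borel" shows "sq_integrable (\<lambda>x. indicator A x * f x)"
proof -
  have [measurable]: "f \<in> borel_measurable borel" using assms by (simp add: sq_integrable_def)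
  note [measurable] = assms(2)
  have "integrable lborel (\<lambda>x. (indicator A x * f x)\<^sup>2)"
  proof (rule Bochner_Integration.integrable_bound)
    show "integrable lborel (\<lambda>x. (f x)\<^sup>2)" using assms by (simp add: sq_integrable_def)
  qed (auto simp: indicator_def)
  then show ?thesis by (simp add: sq_integrable_def)
qed

lemma sq_integrable_continuous:
  assumes "continuous_on {0..l} f" shows "sq_integrable (\<lambda>x. indicator {0<..<l} x * f x)"
proof -
  have "(\<lambda>x. indicator {0<..<l} x *\<^sub>R f x) \<in> borel_measurable lborel"
    using borel_measurable_continuous_on_indicator[OF _ continuous_on_subset[OF assms, of "{0<..<l}"]] by force
  moreover have "set_integrable lborel {0<..<l} (\<lambda>x. (f x)\<^sup>2)"
    by (rule set_integrable_subset[OF borel_integrable_atLeastAtMost'[of 0 l]])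
      (use assms in \<open>auto intro!: continuous_intros\<close>)
  then have "integrable lborel (\<lambda>x. (indicator {0<..<l} x * f x)\<^sup>2)"
    by (simp add: set_integrable_def power_mult_distrib) (simp add: power2_eq_square flip: indicator_inter_arith)
  ultimately show ?thesis by (simp add: sq_integrable_def)
qed

definition toL2 :: "real \<Rightarrow> (real \<Rightarrow> real) \<Rightarrow> L2" where
  "toL2 l f = abs_L2 (\<lambda>x. indicator {0<..<l} x * f x)"

lemma agrees_toL2_aux:
  assumes "sq_integrable (\<lambda>x. indicator {0<..<l} x * f x)" shows "agrees l (toL2 l f) f"
proof -
  have "AE x in lborel. (x \<notin> {0<..<l} \<longrightarrow> rep_L2 (toL2 l f) x = 0) \<and> (x \<in> {0<..<l} \<longrightarrow> rep_L2 (toL2 l f) x = f x)"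
    unfolding toL2_def using AE_rep_abs_L2[OF assms] by eventually_elim auto
  then show ?thesis by (simp add: agrees_def L2_on_def)
qed

lemma agrees_toL2: "continuous_on {0..l} f \<Longrightarrow> agrees l (toL2 l f) f"
  by (intro agrees_toL2_aux sq_integrable_continuous)

lemma set_integrable_rep: "set_integrable lborel {0..l} (rep_L2 a)"
proof -
  have "set_integrable lborel {0..l} (\<lambda>x. 1 + (rep_L2 a x)\<^sup>2)"
    using sq_integrable_rep[of a]
    by (intro set_integral_add(1) borel_integrable_atLeastAtMost'[of _ _ "\<lambda>x. 1"] continuous_on_const)
      (auto simp: set_integrable_def sq_integrable_def intro!: integrable_mult_indicator[of _ _ "\<lambda>x. (rep_L2 a x)\<^sup>2", simplified])
  then show ?thesis
    unfolding set_integrable_def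
  proof (rule Bochner_Integration.integrable_bound)
    have "\<bar>y\<bar> \<le> 1 + y\<^sup>2" for y :: real
      using sum_squares_bound[of 1 "\<bar>y\<bar>"] by simp
    then show "AE x in lborel. norm (indicat_real {0..l} x *\<^sub>R rep_L2 a x) \<le> norm (indicat_real {0..l} x *\<^sub>R (1 + (rep_L2 a x)\<^sup>2))"
      by (auto simp: indicator_def)
  qed simp
qed

lemma integral_L2_on:
  assumes "a \<in> L2_on l" "h \<in> borel_measurable borel"
  shows "(\<integral>x. rep_L2 a x * h x \<partial>lborel) = (LBINT x:{0..l}. rep_L2 a x * h x)"
  unfolding set_lebesgue_integral_def
proof (rule integral_cong_AE)
  note [measurable] = assms(2)
  have "AE x in lborel. x \<notin> {0<..<l} \<longrightarrow> rep_L2 a x = 0" using assms by (simp add: L2_on_def)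
  then show "AE x in lborel. rep_L2 a x * h x = indicat_real {0..l} x *\<^sub>R (rep_L2 a x * h x)"
    by eventually_elim (auto simp: indicator_def)
qed (use assms in simp_all)

lemma inner_agrees:
  assumes a: "a \<in> L2_on l" and b: "agrees l b G" and G: "continuous_on {0..l} G"
  shows "a \<bullet> b = (LBINT x:{0..l}. rep_L2 a x * G x)"
proof -
  have "a \<bullet> b = (LBINT x:{0..l}. rep_L2 a x * rep_L2 b x)"
    using integral_L2_on[OF a, of "rep_L2 b"] by (simp add: inner_L2_rep)
  also have "\<dots> = (LBINT x:{0..l}. rep_L2 a x * G x)"
  proof (rule LBINT_cong_AE)
    show "set_integrable lborel {0..l} (\<lambda>x. rep_L2 a x * rep_L2 b x)"
      unfolding set_integrable_def
      by (intro integrable_mult_indicator sq_integrable_mult sq_integrable_rep) simp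
    show "set_integrable lborel {0..l} (\<lambda>x. rep_L2 a x * G x)"
      by (rule set_integrable_mult_continuous(2)[OF G set_integrable_rep])
    have "AE x in lborel. x \<in> {0..l} \<longrightarrow> rep_L2 b x = G x"
      using b by (intro AE_Ioo_Icc) (simp add: agrees_def)
    then show "AE x in lborel. x \<in> {0..l} \<longrightarrow> rep_L2 a x * rep_L2 b x = rep_L2 a x * G x"
      by eventually_elim simp
  qed
  finally show ?thesis .
qed

lemma inner_agrees2:
  assumes a: "agrees l a F" and F: "continuous_on {0..l} F" and b: "agrees l b G" and G: "continuous_on {0..l} G"
  shows "a \<bullet> b = (LBINT x:{0..l}. F x * G x)"
proof -
  have "a \<bullet> b = (LBINT x:{0..l}. rep_L2 a x * G x)"
    by (rule inner_agrees[OF agrees_L2_on[OF a] b G])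
  also have "\<dots> = (LBINT x:{0..l}. F x * G x)"
  proof (rule LBINT_cong_AE)
    show "set_integrable lborel {0..l} (\<lambda>x. rep_L2 a x * G x)"
      by (rule set_integrable_mult_continuous(2)[OF G set_integrable_rep])
    show "set_integrable lborel {0..l} (\<lambda>x. F x * G x)"
      by (intro borel_integrable_atLeastAtMost' continuous_intros F G)
    have "AE x in lborel. x \<in> {0..l} \<longrightarrow> rep_L2 a x = F x"
      using a by (intro AE_Ioo_Icc) (simp add: agrees_def)
    then show "AE x in lborel. x \<in> {0..l} \<longrightarrow> rep_L2 a x * G x = F x * G x"
      by eventually_elim simp
  qed
  finally show ?thesis .
qed

lemma continuous_agrees_unique:
  fixes F G :: "real \<Rightarrow> real"
  assumes l: "0 < l" and F: "continuous_on {0..l} F" and G: "continuous_on {0..l} G"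
    and eq: "AE x in lborel. x \<in> {0<..<l} \<longrightarrow> F x = G x" and x: "x \<in> {0..l}"
  shows "F x = G x"
proof -
  have c: "continuous_on {0..l} (\<lambda>x. \<bar>F x - G x\<bar>)" by (intro continuous_intros F G)
  have i: "set_integrable lborel {0..l} (\<lambda>x. \<bar>F x - G x\<bar>)" by (rule borel_integrable_atLeastAtMost'[OF c])
  have "(LBINT x:{0..l}. \<bar>F x - G x\<bar>) = (LBINT x:{0..l}. 0)"
  proof (rule LBINT_cong_AE[OF i])
    show "AE x in lborel. x \<in> {0..l} \<longrightarrow> \<bar>F x - G x\<bar> = 0"
      using AE_Ioo_Icc[OF eq] by eventually_elim simp
  qed (simp add: set_integrable_def)
  then have "integral {0..l} (\<lambda>x. \<bar>F x - G x\<bar>) = 0"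
    using set_borel_integral_eq_integral(2)[OF i] by (simp add: set_lebesgue_integral_def)
  then show ?thesis using integral_eq_0_iff[OF c l] x by simp
qed

lemma pt_val_eq:
  assumes l: "0 < l" and u: "agrees l u F" and F: "continuous_on {0..l} F" and x: "x \<in> {0..l}"
  shows "pt_val l u x = F x"
  unfolding pt_val_def
proof (rule the_equality)
  have "AE s in lborel. s \<in> {0<..<l} \<longrightarrow> F s = rep_L2 u s"
    using u by (auto simp: agrees_def elim: eventually_mono)
  then show "\<exists>f. continuous_on {0..l} f \<and> (AE s in lborel. s \<in> {0<..<l} \<longrightarrow> f s = rep_L2 u s) \<and> f x = F x"
    using F by blast
  fix c assume "\<exists>f. continuous_on {0..l} f \<and> (AE s in lborel. s \<in> {0<..<l} \<longrightarrow> f s = rep_L2 u s) \<and> f x = c"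
  then obtain f where f: "continuous_on {0..l} f" "AE s in lborel. s \<in> {0<..<l} \<longrightarrow> f s = rep_L2 u s" "f x = c" by blast
  have "AE s in lborel. s \<in> {0<..<l} \<longrightarrow> rep_L2 u s = F s" using u by (simp add: agrees_def)
  then have "AE s in lborel. s \<in> {0<..<l} \<longrightarrow> f s = F s" using f(2) by eventually_elim simp
  then show "c = F x" using continuous_agrees_unique[OF l f(1) F _ x] f(3) by simp
qed

section \<open>Weak derivatives and absolutely continuous representatives\<close>

lemma smooth_iterate_measurable: "test_function l \<phi> \<Longrightarrow> (deriv ^^ k) \<phi> \<in> borel_measurable borel"
proof (induction k arbitrary: \<phi>)
  case 0
  then show ?case using smooth_continuous_on[OF test_function_smooth] by (simp add: borel_measurable_continuous_onI)
next
  case (Suc k)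
  then show ?case using test_function_deriv by (simp add: funpow_Suc_right del: funpow.simps)
qed

lemma has_weak_deriv_iff:
  "has_weak_deriv l k u w \<longleftrightarrow> u \<in> L2_on l \<and> w \<in> L2_on l \<and> (\<forall>\<phi>. test_function l \<phi> \<longrightarrow>
     (LBINT x:{0..l}. rep_L2 u x * (deriv ^^ k) \<phi> x) = (-1) ^ k * (LBINT x:{0..l}. rep_L2 w x * \<phi> x))"
proof -
  have eq: "(\<integral>x. rep_L2 a x * (deriv ^^ j) \<phi> x \<partial>lborel) = (LBINT x:{0..l}. rep_L2 a x * (deriv ^^ j) \<phi> x)"
    if "a \<in> L2_on l" "test_function l \<phi>" for a j \<phi>
    by (rule integral_L2_on[OF that(1) smooth_iterate_measurable[OF that(2)]])
  have "(\<integral>x. rep_L2 u x * (deriv ^^ k) \<phi> x \<partial>lborel) = (-1) ^ k * (\<integral>x. rep_L2 w x * \<phi> x \<partial>lborel)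
    \<longleftrightarrow> (LBINT x:{0..l}. rep_L2 u x * (deriv ^^ k) \<phi> x) = (-1) ^ k * (LBINT x:{0..l}. rep_L2 w x * \<phi> x)"
    if "u \<in> L2_on l" "w \<in> L2_on l" "test_function l \<phi>" for \<phi>
    unfolding eq[OF that(1,3)] eq[OF that(2,3), of 0, unfolded funpow_0] ..
  then show ?thesis unfolding has_weak_deriv_def by blast
qed

lemma has_weak_derivD:
  assumes "has_weak_deriv l k u w" "test_function l \<phi>"
  shows "(LBINT x:{0..l}. rep_L2 u x * (deriv ^^ k) \<phi> x) = (-1) ^ k * (LBINT x:{0..l}. rep_L2 w x * \<phi> x)"
  by (rule assms(1)[unfolded has_weak_deriv_iff, THEN conjunct2, THEN conjunct2, rule_format, OF assms(2)])

lemma has_weak_deriv_unique: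
  assumes "has_weak_deriv l k u a" "has_weak_deriv l k u b" shows "a = b"
proof (rule agrees_unique)
  show "agrees l b (rep_L2 b)" using assms by (intro agrees_rep) (simp add: has_weak_deriv_def)
  have "AE x in lborel. x \<in> {0..l} \<longrightarrow> rep_L2 a x - rep_L2 b x = 0"
  proof (rule fundamental_lemma)
    show "set_integrable lborel {0..l} (\<lambda>x. rep_L2 a x - rep_L2 b x)" by (intro set_integral_diff set_integrable_rep)
    fix \<phi> assume t: "test_function l \<phi>"
    have c: "continuous_on {0..l} \<phi>" by (rule smooth_continuous_on[OF test_function_smooth[OF t]])
    have "(-1) ^ k * (LBINT x:{0..l}. rep_L2 a x * \<phi> x) = (-1) ^ k * (LBINT x:{0..l}. rep_L2 b x * \<phi> x)"
      using has_weak_derivD[OF assms(1) t] has_weak_derivD[OF assms(2) t] by (rule trans[OF sym])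
    then have "(LBINT x:{0..l}. rep_L2 a x * \<phi> x) = (LBINT x:{0..l}. rep_L2 b x * \<phi> x)" by simp
    then show "(LBINT x:{0..l}. (rep_L2 a x - rep_L2 b x) * \<phi> x) = 0"
      using set_integrable_mult_continuous(2)[OF c set_integrable_rep] by (simp add: left_diff_distrib)
  qed
  then have "AE x in lborel. x \<in> {0<..<l} \<longrightarrow> rep_L2 a x = rep_L2 b x" by eventually_elim auto
  then show "agrees l a (rep_L2 b)" using assms by (simp add: agrees_def has_weak_deriv_def)
qed

lemma weak_deriv_eq: "has_weak_deriv l k u w \<Longrightarrow> weak_deriv l k u = w"
  unfolding weak_deriv_def using has_weak_deriv_unique by (blast intro: the_equality)

lemma has_weak_deriv_0: "u \<in> L2_on l \<Longrightarrow> has_weak_deriv l 0 u u"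
  by (simp add: has_weak_deriv_def)

text \<open>Test with \<open>deriv \<phi>\<close> in the definition of order k.
  \<open>Sobolev\<close> asks for each order separately; this turns it into a tower of first-order
  derivatives, to each of which du Bois-Reymond assigns an absolutely continuous
  representative.\<close>

lemma has_weak_deriv_chain:
  assumes "has_weak_deriv l k u a" "has_weak_deriv l (Suc k) u b" shows "has_weak_deriv l 1 a b"
  unfolding has_weak_deriv_iff
proof (intro conjI allI impI)
  fix \<phi> assume t: "test_function l \<phi>"
  have "(-1) ^ k * (LBINT x:{0..l}. rep_L2 a x * deriv \<phi> x) = (-1) ^ Suc k * (LBINT x:{0..l}. rep_L2 b x * \<phi> x)"
    using has_weak_derivD[OF assms(1) test_function_deriv[OF t]] has_weak_derivD[OF assms(2) t]
    by (simp add: funpow_Suc_right del: funpow.simps(2))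
  then have "(LBINT x:{0..l}. rep_L2 a x * deriv \<phi> x) = - (LBINT x:{0..l}. rep_L2 b x * \<phi> x)"
    by (cases "even k") simp_all
  then show "(LBINT x:{0..l}. rep_L2 a x * (deriv ^^ 1) \<phi> x) = (-1) ^ 1 * (LBINT x:{0..l}. rep_L2 b x * \<phi> x)"
    by simp
qed (use assms in \<open>auto simp: has_weak_deriv_def\<close>)

lemma has_weak_deriv_comp:
  assumes "has_weak_deriv l k u a" "has_weak_deriv l 1 a b" shows "has_weak_deriv l (Suc k) u b"
  unfolding has_weak_deriv_iff
proof (intro conjI allI impI)
  fix \<phi> assume t: "test_function l \<phi>"
  have "(LBINT x:{0..l}. rep_L2 u x * (deriv ^^ k) (deriv \<phi>) x) = (-1) ^ k * (LBINT x:{0..l}. rep_L2 a x * deriv \<phi> x)"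
    by (rule has_weak_derivD[OF assms(1) test_function_deriv[OF t]])
  moreover have "(LBINT x:{0..l}. rep_L2 a x * (deriv ^^ 1) \<phi> x) = (-1) ^ 1 * (LBINT x:{0..l}. rep_L2 b x * \<phi> x)"
    by (rule has_weak_derivD[OF assms(2) t])
  ultimately show "(LBINT x:{0..l}. rep_L2 u x * (deriv ^^ Suc k) \<phi> x) = (-1) ^ Suc k * (LBINT x:{0..l}. rep_L2 b x * \<phi> x)"
    by (simp add: funpow_Suc_right del: funpow.simps(2))
qed (use assms in \<open>auto simp: has_weak_deriv_def\<close>)

lemma has_weak_deriv_AC:
  assumes l: "0 < l" and h: "has_weak_deriv l 1 u w"
  obtains F where "agrees l u F" "AC l F (rep_L2 w)"
proof -
  have "(LBINT x:{0..l}. rep_L2 u x * deriv \<phi> x) = - (LBINT x:{0..l}. rep_L2 w x * \<phi> x)" if "test_function l \<phi>" for \<phi>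
    using has_weak_derivD[OF h that] by simp
  then obtain c where c: "AE x in lborel. x \<in> {0..l} \<longrightarrow> rep_L2 u x = c + (LBINT s:{0..x}. rep_L2 w s)"
    using du_Bois_Reymond[OF l set_integrable_rep set_integrable_rep] by blast
  have "AE x in lborel. x \<in> {0<..<l} \<longrightarrow> rep_L2 u x = c + (LBINT s:{0..x}. rep_L2 w s)"
    using c by eventually_elim auto
  then have "agrees l u (\<lambda>x. c + (LBINT s:{0..x}. rep_L2 w s))"
    using h by (simp add: agrees_def has_weak_deriv_def)
  then show ?thesis using that AC_primitive[OF set_integrable_rep] by blast
qed

lemma AC_has_weak_deriv:
  assumes l: "0 < l" and w: "w \<in> L2_on l" and u: "agrees l u F" and F: "AC l F (rep_L2 w)"
  shows "has_weak_deriv l 1 u w"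
  unfolding has_weak_deriv_iff
proof (intro conjI allI impI)
  fix \<phi> assume t: "test_function l \<phi>"
  note A = test_function_AC[OF t]
  have d: "continuous_on {0..l} (deriv \<phi>)" by (rule smooth_continuous_on[OF smooth_deriv[OF test_function_smooth[OF t]]])
  have Fd: "set_integrable lborel {0..l} (\<lambda>x. F x * deriv \<phi> x)"
    by (intro borel_integrable_atLeastAtMost' continuous_intros AC_continuous[OF F] d)
  have "(LBINT x:{0..l}. rep_L2 u x * deriv \<phi> x) = (LBINT x:{0..l}. F x * deriv \<phi> x)"
  proof (rule LBINT_cong_AE[OF _ Fd])
    show "set_integrable lborel {0..l} (\<lambda>x. rep_L2 u x * deriv \<phi> x)"
      by (rule set_integrable_mult_continuous(2)[OF d set_integrable_rep])
    have "AE x in lborel. x \<in> {0..l} \<longrightarrow> rep_L2 u x = F x" using u by (intro AE_Ioo_Icc) (simp add: agrees_def)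
    then show "AE x in lborel. x \<in> {0..l} \<longrightarrow> rep_L2 u x * deriv \<phi> x = F x * deriv \<phi> x" by eventually_elim simp
  qed
  moreover have "(LBINT x:{0..l}. rep_L2 w x * \<phi> x + F x * deriv \<phi> x) = 0"
    using AC_ibp[OF F A(1)] A(2,3) l by simp
  ultimately show "(LBINT x:{0..l}. rep_L2 u x * (deriv ^^ 1) \<phi> x) = (-1) ^ 1 * (LBINT x:{0..l}. rep_L2 w x * \<phi> x)"
    using Fd set_integrable_mult_continuous(2)[OF AC_continuous[OF A(1)] set_integrable_rep] by simp
qed (use u w in \<open>auto simp: agrees_def\<close>)

lemma Sobolev_has_weak_deriv:
  "u \<in> Sobolev l n \<Longrightarrow> k \<le> n \<Longrightarrow> has_weak_deriv l k u (weak_deriv l k u)"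
  unfolding Sobolev_def using weak_deriv_eq by fastforce

lemma Sobolev_AC:
  assumes "0 < l" "u \<in> Sobolev l n" "k < n"
  obtains F where "agrees l (weak_deriv l k u) F" "AC l F (rep_L2 (weak_deriv l (Suc k) u))"
  using assms has_weak_deriv_AC[OF assms(1) has_weak_deriv_chain]
    Sobolev_has_weak_deriv[OF assms(2), of k] Sobolev_has_weak_deriv[OF assms(2), of "Suc k"]
  by (metis Suc_leI less_imp_le)

lemma AC_agrees:
  assumes "AC l F (rep_L2 w)" "agrees l w G" "continuous_on {0..l} G" shows "AC l F G"
  using assms by (intro AC_cong[OF assms(1) borel_integrable_atLeastAtMost'] AE_Ioo_Icc) (auto simp: agrees_def)

lemma AC_agrees_rep:
  assumes "AC l F G" "agrees l w G" shows "AC l F (rep_L2 w)"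
proof (rule AC_cong[OF assms(1) set_integrable_rep])
  show "AE x in lborel. x \<in> {0..l} \<longrightarrow> G x = rep_L2 w x"
    using assms by (intro AE_Ioo_Icc) (auto simp: agrees_def elim: eventually_mono)
qed

text \<open>\<open>prim2 l u F0 F1 a\<close>: \<open>u\<close> is the second primitive of \<open>a\<close> clamped at \<open>0\<close>, and \<open>F0\<close>, \<open>F1\<close> are
  the continuous representatives of \<open>u\<close> and \<open>u'\<close>.\<close>

definition prim2 :: "real \<Rightarrow> L2 \<Rightarrow> (real \<Rightarrow> real) \<Rightarrow> (real \<Rightarrow> real) \<Rightarrow> L2 \<Rightarrow> bool" where
  "prim2 l u F0 F1 a \<longleftrightarrow> agrees l u F0 \<and> AC l F0 F1 \<and> AC l F1 (rep_L2 a) \<and> a \<in> L2_on l \<and> F0 0 = 0 \<and> F1 0 = 0"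

lemma Sobolev0_prim2:
  assumes l: "0 < l" and u: "u \<in> Sobolev0 l n" and n: "2 \<le> n"
  obtains F0 F1 where "prim2 l u F0 F1 (weak_deriv l 2 u)"
proof -
  have S: "u \<in> Sobolev l n" and uon: "u \<in> L2_on l" and p: "pt_val l u 0 = 0" "pt_val l (weak_deriv l 1 u) 0 = 0"
    using u by (auto simp: Sobolev0_def Sobolev_def)
  have w0: "weak_deriv l 0 u = u" by (rule weak_deriv_eq[OF has_weak_deriv_0[OF uon]])
  obtain F0 where F0: "agrees l u F0" "AC l F0 (rep_L2 (weak_deriv l 1 u))"
    using Sobolev_AC[OF l S, of 0] n w0 by auto
  obtain F1 where F1: "agrees l (weak_deriv l 1 u) F1" "AC l F1 (rep_L2 (weak_deriv l 2 u))"
    using Sobolev_AC[OF l S, of 1] n by (auto simp: numeral_2_eq_2)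
  have "F0 0 = 0" "F1 0 = 0"
    using p pt_val_eq[OF l F0(1) AC_continuous[OF F0(2)], of 0] pt_val_eq[OF l F1(1) AC_continuous[OF F1(2)], of 0] l by auto
  moreover have "AC l F0 F1" by (rule AC_agrees[OF F0(2) F1(1) AC_continuous[OF F1(2)]])
  moreover have "weak_deriv l 2 u \<in> L2_on l"
    using Sobolev_has_weak_deriv[OF S n] by (simp add: has_weak_deriv_def)
  ultimately show ?thesis using that F0 F1 by (simp add: prim2_def)
qed

lemma prim2_Sobolev0:
  assumes l: "0 < l" and p: "prim2 l u F0 F1 a"
  shows "u \<in> Sobolev0 l 2" "weak_deriv l 2 u = a" "pt_val l (weak_deriv l 1 u) l = F1 l"
    "pt_val l (weak_deriv l 0 u) l = F0 l"
proof -
  have F0: "agrees l u F0" "AC l F0 F1" "F0 0 = 0" and F1: "AC l F1 (rep_L2 a)" "F1 0 = 0" and a: "a \<in> L2_on l"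
    using p by (auto simp: prim2_def)
  have u: "u \<in> L2_on l" by (rule agrees_L2_on[OF F0(1)])
  define u1 where "u1 = toL2 l F1"
  have u1: "agrees l u1 F1" unfolding u1_def by (rule agrees_toL2[OF AC_continuous[OF F1(1)]])
  have h1: "has_weak_deriv l 1 u u1"
    by (rule AC_has_weak_deriv[OF l agrees_L2_on[OF u1] F0(1) AC_agrees_rep[OF F0(2) u1]])
  have h2: "has_weak_deriv l 2 u a"
    using has_weak_deriv_comp[OF h1 AC_has_weak_deriv[OF l a u1 F1(1)]] by (simp add: numeral_2_eq_2)
  show w2: "weak_deriv l 2 u = a" by (rule weak_deriv_eq[OF h2])
  have w1: "weak_deriv l 1 u = u1" by (rule weak_deriv_eq[OF h1])
  have w0: "weak_deriv l 0 u = u" by (rule weak_deriv_eq[OF has_weak_deriv_0[OF u]])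
  have "\<exists>w. has_weak_deriv l k u w" if "k \<le> 2" for k
  proof -
    have "k = 0 \<or> k = 1 \<or> k = 2" using that by linarith
    then show ?thesis using has_weak_deriv_0[OF u] h1 h2 by blast
  qed
  then have "u \<in> Sobolev l 2" using u by (simp add: Sobolev_def)
  moreover have "pt_val l u x = F0 x" "pt_val l u1 x = F1 x" if "x \<in> {0..l}" for x
    using pt_val_eq[OF l F0(1) AC_continuous[OF F0(2)] that] pt_val_eq[OF l u1 AC_continuous[OF F1(1)] that] by auto
  ultimately show "u \<in> Sobolev0 l 2" "pt_val l (weak_deriv l 1 u) l = F1 l" "pt_val l (weak_deriv l 0 u) l = F0 l"
    using l F0(3) F1(2) w0 w1 by (auto simp: Sobolev0_def)
qed

section \<open>Tip functionals and the multiplier x u'\<close>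

lemma LBINT_singleton: "(LBINT s:{0..0::real}. f s :: real) = 0"
  unfolding set_lebesgue_integral_def
  by (rule integral_eq_zero_AE) (auto intro!: eventually_mono[OF AE_lborel_singleton[of 0]])

lemma AC_pow:
  assumes "0 \<le> l" shows "AC l (\<lambda>x. c * x ^ n) (\<lambda>x. c * (real n * x ^ (n - 1)))"
  by (rule AC_C1) (auto intro!: derivative_eq_intros continuous_intros)

lemma AC_id: "AC l (\<lambda>x. x) (\<lambda>x. 1)"
  by (rule AC_C1) (auto intro!: derivative_eq_intros continuous_intros)

text \<open>With \<open>lin_l\<close>, the Riesz representers of tip slope and tip value: for u
  clamped at 0 with second derivative a, u'(l) is the integral of a and u(l) that of (l - x)
  a.\<close>

definition one_l :: "real \<Rightarrow> L2" where "one_l l = toL2 l (\<lambda>x. 1)"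
definition lin_l :: "real \<Rightarrow> L2" where "lin_l l = toL2 l (\<lambda>x. l - x)"

lemma agrees_one: "agrees l (one_l l) (\<lambda>x. 1)" and agrees_lin: "agrees l (lin_l l) (\<lambda>x. l - x)"
  unfolding one_l_def lin_l_def by (intro agrees_toL2 continuous_intros)+

lemma prim2_tips:
  assumes l: "0 < l" and p: "prim2 l u F0 F1 a"
  shows "F1 l = a \<bullet> one_l l" "F0 l = a \<bullet> lin_l l"
proof -
  have F0: "AC l F0 F1" "F0 0 = 0" and F1: "AC l F1 (rep_L2 a)" "F1 0 = 0" and a: "a \<in> L2_on l"
    using p by (auto simp: prim2_def)
  show "F1 l = a \<bullet> one_l l"
    using inner_agrees[OF a agrees_one] AC_end[OF F1(1)] F1(2) l by simp
  have "AC l (\<lambda>x. l - x) (\<lambda>x. -1)"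
    by (rule AC_C1) (auto intro!: derivative_eq_intros)
  then have "(LBINT x:{0..l}. rep_L2 a x * (l - x) + F1 x * (-1)) = 0"
    using AC_ibp[OF F1(1)] F1(2) l by fastforce
  moreover have c: "continuous_on {0..l} (\<lambda>x. l - x)" by (intro continuous_intros)
  moreover have "set_integrable lborel {0..l} (\<lambda>x. rep_L2 a x * (l - x))"
    by (rule set_integrable_mult_continuous(2)[OF c set_integrable_rep])
  moreover have "set_integrable lborel {0..l} F1" by (rule AC_integrable[OF F0(1)])
  ultimately have "(LBINT x:{0..l}. rep_L2 a x * (l - x)) = (LBINT x:{0..l}. F1 x)" by simp
  then show "F0 l = a \<bullet> lin_l l"
    using inner_agrees[OF a agrees_lin c] AC_end[OF F0(1)] F0(2) l by simp
qed

text \<open>For a = u'' with u clamped at 0 this is the multiplier x u'. As an operator on a it is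
  bounded in L^2, so time derivatives pass through it.\<close>

definition moment_op :: "real \<Rightarrow> L2 \<Rightarrow> L2" where
  "moment_op l a = toL2 l (\<lambda>x. x * (LBINT s:{0..x}. rep_L2 a s))"

lemma agrees_moment_op:
  assumes "AC l F (rep_L2 a)" "F 0 = 0" shows "agrees l (moment_op l a) (\<lambda>x. x * F x)"
proof -
  have eq: "x * (LBINT s:{0..x}. rep_L2 a s) = x * F x" if "x \<in> {0..l}" for x
    using assms that by (simp add: AC_def)
  have "continuous_on {0..l} (\<lambda>x. x * F x)" by (intro continuous_intros AC_continuous[OF assms(1)])
  then have "continuous_on {0..l} (\<lambda>x. x * (LBINT s:{0..x}. rep_L2 a s))"
    by (rule continuous_on_eq) (simp add: eq)
  then have "agrees l (moment_op l a) (\<lambda>x. x * (LBINT s:{0..x}. rep_L2 a s))"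
    unfolding moment_op_def by (rule agrees_toL2)
  then show ?thesis using eq by (auto simp: agrees_def elim!: eventually_mono)
qed

lemma AC_rep_primitive: "AC l (\<lambda>x. 0 + (LBINT s:{0..x}. rep_L2 a s)) (rep_L2 a)"
  by (rule AC_primitive[OF set_integrable_rep])

lemma rep_L2_add_Icc: "AE x in lborel. x \<in> {0..l} \<longrightarrow> rep_L2 a x + rep_L2 b x = rep_L2 (a + b) x"
  using rep_L2_add[of a b] by eventually_elim simp

lemma rep_L2_scaleR_Icc: "AE x in lborel. x \<in> {0..l} \<longrightarrow> c * rep_L2 a x = rep_L2 (c *\<^sub>R a) x"
  using rep_L2_scaleR[of c a] by eventually_elim simp

lemma AC_rep_add: "AC l F (rep_L2 a) \<Longrightarrow> AC l G (rep_L2 b) \<Longrightarrow> AC l (\<lambda>x. F x + G x) (rep_L2 (a + b))"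
  by (rule AC_cong[OF AC_add set_integrable_rep rep_L2_add_Icc])

lemma AC_rep_scaleR: "AC l F (rep_L2 a) \<Longrightarrow> AC l (\<lambda>x. c * F x) (rep_L2 (c *\<^sub>R a))"
  by (rule AC_cong[OF AC_cmult set_integrable_rep rep_L2_scaleR_Icc])

text \<open>Cauchy-Schwarz against the indicator of [0,x].\<close>

lemma abs_primitive_le:
  assumes "AC l F (rep_L2 a)" "F 0 = 0" "x \<in> {0..l}" shows "\<bar>F x\<bar> \<le> norm a * sqrt l"
proof -
  have sx: "sq_integrable (\<lambda>s. indicator {0..x} s * 1)" if "0 \<le> x" for x :: real
    unfolding sq_integrable_def
    by (simp add: power2_eq_square integrable_indicator_iff emeasure_lborel_Icc_eq flip: indicator_inter_arith)
  have x: "0 \<le> x" "x \<le> l" using assms(3) by auto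
  define e where "e = abs_L2 (\<lambda>s. indicator {0..x} s * 1 :: real)"
  have "F x = (LBINT s:{0..x}. rep_L2 a s)" using assms by (simp add: AC_def)
  also have "\<dots> = a \<bullet> e"
    unfolding inner_L2_rep set_lebesgue_integral_def
    using AE_rep_abs_L2[OF sx[OF x(1)]]
    by (intro integral_cong_AE) (auto simp: e_def elim!: eventually_mono)
  finally have "\<bar>F x\<bar> \<le> norm a * norm e" using Cauchy_Schwarz_ineq2 by simp
  moreover have "e \<bullet> e = x"
    unfolding e_def inner_abs_L2[OF sx[OF x(1)] sx[OF x(1)]] using x by (simp flip: indicator_inter_arith)
  then have "norm e \<le> sqrt l" using x by (simp add: norm_eq_sqrt_inner)
  ultimately show ?thesis by (meson mult_left_mono norm_ge_zero order_trans)
qed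

lemma norm_agrees_le:
  assumes "agrees l a F" "continuous_on {0..l} F" "\<And>x. x \<in> {0..l} \<Longrightarrow> \<bar>F x\<bar> \<le> B" "0 \<le> l"
  shows "norm a \<le> B * sqrt l"
proof -
  have B: "0 \<le> B" using assms(3)[of 0] assms(4) by force
  have "a \<bullet> a = (LBINT x:{0..l}. F x * F x)" by (rule inner_agrees2[OF assms(1,2,1,2)])
  also have "\<dots> \<le> (LBINT x:{0..l}. B * B)"
  proof (rule set_integral_mono)
    show "set_integrable lborel {0..l} (\<lambda>x. F x * F x)" "set_integrable lborel {0..l} (\<lambda>x. B * B)"
      by (intro borel_integrable_atLeastAtMost' continuous_intros assms)+
    show "F x * F x \<le> B * B" if "x \<in> {0..l}" for x
      using assms(3)[OF that] B abs_le_square_iff[of "F x" B] by (simp add: power2_eq_square)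
  qed
  also have "\<dots> = (B * sqrt l)\<^sup>2"
    using assms(4) by (simp add: set_lebesgue_integral_def power_mult_distrib power2_eq_square)
  finally have "(norm a)\<^sup>2 \<le> (B * sqrt l)\<^sup>2" by (simp add: power2_norm_eq_inner)
  then show ?thesis by (rule power2_le_imp_le) (use B assms(4) in simp)
qed

lemma bounded_linear_moment_op: assumes l: "0 < l" shows "bounded_linear (moment_op l)"
proof (rule bounded_linear_intro[where K="l * sqrt l * sqrt l"])
  let ?F = "\<lambda>a x. 0 + (LBINT s:{0..x}. rep_L2 a s)"
  have F0: "?F a 0 = 0" for a
    using LBINT_singleton by simp
  have ag: "agrees l (moment_op l a) (\<lambda>x. x * ?F a x)" for a by (rule agrees_moment_op[OF AC_rep_primitive F0])
  fix a b :: L2 and c :: real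
  have "agrees l (moment_op l (a + b)) (\<lambda>x. x * (?F a x + ?F b x))"
    by (rule agrees_moment_op[OF AC_rep_add[OF AC_rep_primitive AC_rep_primitive]]) (use F0 in simp)
  then show "moment_op l (a + b) = moment_op l a + moment_op l b"
    using agrees_add[OF ag ag] agrees_unique by (simp add: distrib_left)
  have "agrees l (moment_op l (c *\<^sub>R a)) (\<lambda>x. x * (c * ?F a x))"
    by (rule agrees_moment_op[OF AC_rep_scaleR[OF AC_rep_primitive]]) (use F0 in simp)
  then show "moment_op l (c *\<^sub>R a) = c *\<^sub>R moment_op l a"
    using agrees_scaleR[OF ag, of c a] agrees_unique by (simp add: mult.left_commute)
  have "norm (moment_op l a) \<le> (l * (norm a * sqrt l)) * sqrt l"
  proof (rule norm_agrees_le[OF ag])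
    show "continuous_on {0..l} (\<lambda>x. x * ?F a x)" by (intro continuous_on_mult continuous_on_id AC_continuous[OF AC_rep_primitive])
    show "\<bar>x * ?F a x\<bar> \<le> l * (norm a * sqrt l)" if "x \<in> {0..l}" for x
      using abs_primitive_le[OF AC_rep_primitive F0 that, of a] that by (auto simp: abs_mult intro!: mult_mono)
  qed (use l in simp)
  then show "norm (moment_op l a) \<le> norm a * (l * sqrt l * sqrt l)" by (simp only: mult_ac)
qed

text \<open>In \<open>beam_reg l A V a b p1 p0 m1 m2\<close>, \<open>A\<close> plays the role of \<open>u''\<close> with \<open>b = u\<close>'s fourth
  derivative, \<open>V\<close> that of the velocity with \<open>a = V''\<close>, and the numbers are
  \<open>V'(l), V(l), u''(l), u'''(l)\<close>.\<close>

definition beam_reg :: "real \<Rightarrow> L2 \<Rightarrow> L2 \<Rightarrow> L2 \<Rightarrow> L2 \<Rightarrow> real \<Rightarrow> real \<Rightarrow> real \<Rightarrow> real \<Rightarrow> bool" where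
  "beam_reg l A V a b p1 p0 m1 m2 \<longleftrightarrow> (\<exists>F2 F3 G0 G1. agrees l A F2 \<and> AC l F2 F3 \<and> AC l F3 (rep_L2 b) \<and> b \<in> L2_on l \<and>
     prim2 l V G0 G1 a \<and> G1 l = p1 \<and> G0 l = p0 \<and> F2 l = m1 \<and> F3 l = m2)"

lemma beam_reg_scaleR:
  assumes "beam_reg l A V a b p1 p0 m1 m2"
  shows "beam_reg l (c *\<^sub>R A) (c *\<^sub>R V) (c *\<^sub>R a) (c *\<^sub>R b) (c * p1) (c * p0) (c * m1) (c * m2)"
proof -
  obtain F2 F3 G0 G1 where *: "agrees l A F2" "AC l F2 F3" "AC l F3 (rep_L2 b)" "b \<in> L2_on l"
     "agrees l V G0" "AC l G0 G1" "AC l G1 (rep_L2 a)" "a \<in> L2_on l" "G0 0 = 0" "G1 0 = 0" "G1 l = p1" "G0 l = p0" "F2 l = m1" "F3 l = m2"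
    using assms by (auto simp: beam_reg_def prim2_def)
  show ?thesis
    unfolding beam_reg_def prim2_def
    by (rule exI[of _ "\<lambda>x. c * F2 x"], rule exI[of _ "\<lambda>x. c * F3 x"], rule exI[of _ "\<lambda>x. c * G0 x"], rule exI[of _ "\<lambda>x. c * G1 x"])
      (use * in \<open>simp add: agrees_scaleR AC_cmult AC_rep_scaleR L2_on_scaleR\<close>)
qed

context
  fixes l :: real and A V a b :: L2 and p1 p0 m1 m2 :: real
  assumes l: "0 < l" and reg: "beam_reg l A V a b p1 p0 m1 m2"
begin

lemma beam_reg_tips: "a \<bullet> one_l l = p1" "a \<bullet> lin_l l = p0"
proof -
  obtain G0 G1 where p: "prim2 l V G0 G1 a" "G1 l = p1" "G0 l = p0" using reg by (auto simp: beam_reg_def)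
  show "a \<bullet> one_l l = p1" "a \<bullet> lin_l l = p0" using prim2_tips[OF l p(1)] p(2,3) by simp_all
qed

text \<open>Two integrations by parts move the derivatives from b to V; the clamping of V removes
  the terms at 0.\<close>

lemma beam_reg_energy: "V \<bullet> b = p0 * m2 - p1 * m1 + a \<bullet> A"
proof -
  obtain F2 F3 G0 G1 where *: "agrees l A F2" "AC l F2 F3" "AC l F3 (rep_L2 b)" "b \<in> L2_on l"
     "agrees l V G0" "AC l G0 G1" "AC l G1 (rep_L2 a)" "a \<in> L2_on l" "G0 0 = 0" "G1 0 = 0" "G1 l = p1" "G0 l = p0" "F2 l = m1" "F3 l = m2"
    using reg by (auto simp: beam_reg_def prim2_def)
  note c = AC_continuous[OF *(2)] AC_continuous[OF *(3)] AC_continuous[OF *(6)] AC_continuous[OF *(7)]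
  have "(LBINT x:{0..l}. rep_L2 b x * G0 x + F3 x * G1 x) = m2 * p0"
    using AC_ibp[OF *(3,6)] l * by simp
  moreover have "(LBINT x:{0..l}. F3 x * G1 x + F2 x * rep_L2 a x) = m1 * p1"
    using AC_ibp[OF *(2,7)] l * by simp
  moreover have "set_integrable lborel {0..l} (\<lambda>x. rep_L2 b x * G0 x)" "set_integrable lborel {0..l} (\<lambda>x. F3 x * G1 x)"
    "set_integrable lborel {0..l} (\<lambda>x. F2 x * rep_L2 a x)"
    by (intro set_integrable_mult_continuous set_integrable_rep AC_integrable[OF *(2)] c)+
  moreover have "V \<bullet> b = (LBINT x:{0..l}. rep_L2 b x * G0 x)"
    using inner_agrees[OF *(4,5) c(3)] by (simp add: inner_commute)
  moreover have "a \<bullet> A = (LBINT x:{0..l}. F2 x * rep_L2 a x)"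
    using inner_agrees[OF *(8,1) c(1)] by (simp add: mult.commute)
  ultimately show ?thesis by (simp add: algebra_simps)
qed

text \<open>A Rellich-type identity for the fourth derivative against x u'. One integration by parts
  yields -u''' u' and -x u'' u'''. The first contributes the full square of u'', the second half of
  it through the derivative of x (u'')^2, whence the factor 3/2.\<close>

lemma beam_reg_moment1:
  "b \<bullet> moment_op l A = l * m2 * (A \<bullet> one_l l) - m1 * (A \<bullet> one_l l) - l / 2 * m1\<^sup>2 + 3 / 2 * (A \<bullet> A)"
proof -
  obtain F2 F3 where *: "agrees l A F2" "AC l F2 F3" "AC l F3 (rep_L2 b)" "b \<in> L2_on l" "F2 l = m1" "F3 l = m2"
    using reg by (auto simp: beam_reg_def prim2_def)
  define U where "U x = 0 + (LBINT s:{0..x}. rep_L2 A s)" for x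
  have U0: "U 0 = 0" using LBINT_singleton by (simp add: U_def)
  have UA: "AC l U (rep_L2 A)" unfolding U_def by (rule AC_rep_primitive)
  have U: "AC l U F2" by (rule AC_agrees[OF UA *(1) AC_continuous[OF *(2)]])
  note c = AC_continuous[OF *(2)] AC_continuous[OF *(3)] AC_continuous[OF U]
  have Ul: "U l = A \<bullet> one_l l"
    using inner_agrees[OF agrees_L2_on[OF *(1)] agrees_one] AC_end[OF UA] U0 l by simp
  have xU: "AC l (\<lambda>x. x * U x) (\<lambda>x. 1 * U x + x * F2 x)" by (rule AC_mult[OF AC_id U])
  have "(LBINT x:{0..l}. rep_L2 b x * (x * U x) + F3 x * (1 * U x + x * F2 x)) = m2 * (l * U l)"
    using AC_ibp[OF *(3) xU] l * U0 by simp
  then have "(LBINT x:{0..l}. rep_L2 b x * (x * U x) + (F3 x * U x + x * F2 x * F3 x)) = m2 * (l * U l)"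
    by (simp add: algebra_simps)
  moreover have "(LBINT x:{0..l}. F3 x * U x + F2 x * F2 x) = m1 * U l"
    using AC_ibp[OF *(2) U] l * U0 by simp
  moreover have "(LBINT x:{0..l}. 1 * (F2 x * F2 x) + x * (F3 x * F2 x + F2 x * F3 x)) = l * (m1 * m1)"
    using AC_ibp[OF AC_id AC_mult[OF *(2,2)]] l * by simp
  then have "(LBINT x:{0..l}. F2 x * F2 x + 2 * (x * F2 x * F3 x)) = l * (m1 * m1)"
    by (simp add: algebra_simps)
  moreover have i: "set_integrable lborel {0..l} (\<lambda>x. rep_L2 b x * (x * U x))"
    by (intro set_integrable_mult_continuous(2) set_integrable_rep continuous_intros c)
  have j: "set_integrable lborel {0..l} (\<lambda>x. F3 x * U x)" "set_integrable lborel {0..l} (\<lambda>x. F2 x * F2 x)"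
    "set_integrable lborel {0..l} (\<lambda>x. x * F2 x * F3 x)"
    by (intro borel_integrable_atLeastAtMost' continuous_intros c)+
  have "(LBINT x:{0..l}. rep_L2 b x * (x * U x) + (F3 x * U x + x * F2 x * F3 x))
      = (LBINT x:{0..l}. rep_L2 b x * (x * U x)) + ((LBINT x:{0..l}. F3 x * U x) + (LBINT x:{0..l}. x * F2 x * F3 x))"
    "(LBINT x:{0..l}. F3 x * U x + F2 x * F2 x) = (LBINT x:{0..l}. F3 x * U x) + (LBINT x:{0..l}. F2 x * F2 x)"
    "(LBINT x:{0..l}. F2 x * F2 x + 2 * (x * F2 x * F3 x)) = (LBINT x:{0..l}. F2 x * F2 x) + 2 * (LBINT x:{0..l}. x * F2 x * F3 x)"
    using i j by simp_all
  moreover have "b \<bullet> moment_op l A = (LBINT x:{0..l}. rep_L2 b x * (x * U x))"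
    by (rule inner_agrees[OF *(4) agrees_moment_op[OF UA U0]]) (intro continuous_intros c)
  moreover have "A \<bullet> A = (LBINT x:{0..l}. F2 x * F2 x)"
    by (rule inner_agrees2[OF *(1) c(1) *(1) c(1)])
  ultimately show ?thesis using Ul by (simp add: power2_eq_square algebra_simps)
qed

text \<open>From (x V^2)' = V^2 + 2 x V V'.\<close>

lemma beam_reg_moment2: "V \<bullet> moment_op l a = l / 2 * p0\<^sup>2 - (V \<bullet> V) / 2"
proof -
  obtain G0 G1 where *: "agrees l V G0" "AC l G0 G1" "AC l G1 (rep_L2 a)" "G0 0 = 0" "G1 0 = 0" "G0 l = p0"
    using reg by (auto simp: beam_reg_def prim2_def)
  note c = AC_continuous[OF *(2)] AC_continuous[OF *(3)]
  have cx: "continuous_on {0..l} (\<lambda>x. x * G1 x)" by (intro continuous_intros c)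
  have "(LBINT x:{0..l}. 1 * (G0 x * G0 x) + x * (G1 x * G0 x + G0 x * G1 x)) = l * (p0 * p0)"
    using AC_ibp[OF AC_id AC_mult[OF *(2,2)]] l * by simp
  then have "(LBINT x:{0..l}. G0 x * G0 x + 2 * (G0 x * (x * G1 x))) = l * (p0 * p0)"
    by (simp add: algebra_simps)
  moreover have "set_integrable lborel {0..l} (\<lambda>x. G0 x * G0 x)" "set_integrable lborel {0..l} (\<lambda>x. G0 x * (x * G1 x))"
    by (intro borel_integrable_atLeastAtMost' continuous_intros c)+
  then have "(LBINT x:{0..l}. G0 x * G0 x + 2 * (G0 x * (x * G1 x)))
      = (LBINT x:{0..l}. G0 x * G0 x) + 2 * (LBINT x:{0..l}. G0 x * (x * G1 x))" by simp
  moreover have "V \<bullet> moment_op l a = (LBINT x:{0..l}. G0 x * (x * G1 x))"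
    by (rule inner_agrees2[OF *(1) c(1) agrees_moment_op[OF *(3,5)] cx])
  moreover have "V \<bullet> V = (LBINT x:{0..l}. G0 x * G0 x)"
    by (rule inner_agrees2[OF *(1) c(1) *(1) c(1)])
  ultimately show ?thesis by (simp add: power2_eq_square)
qed

text \<open>Weak form of the fourth derivative against a clamped displacement; the tip terms remain
  because \<open>f\<close> is free at l.\<close>

lemma beam_reg_test:
  assumes "AC l f f1" "AC l f1 f2" "continuous_on {0..l} f2" "f 0 = 0" "f1 0 = 0"
  shows "b \<bullet> toL2 l f = m2 * f l - m1 * f1 l + A \<bullet> toL2 l f2"
proof -
  obtain F2 F3 where *: "agrees l A F2" "AC l F2 F3" "AC l F3 (rep_L2 b)" "b \<in> L2_on l" "F2 l = m1" "F3 l = m2"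
    using reg by (auto simp: beam_reg_def prim2_def)
  note c = AC_continuous[OF *(2)] AC_continuous[OF *(3)] AC_continuous[OF assms(1)] AC_continuous[OF assms(2)] assms(3)
  have "(LBINT x:{0..l}. rep_L2 b x * f x + F3 x * f1 x) = m2 * f l"
    using AC_ibp[OF *(3) assms(1)] l * assms by simp
  moreover have "(LBINT x:{0..l}. F3 x * f1 x + F2 x * f2 x) = m1 * f1 l"
    using AC_ibp[OF *(2) assms(2)] l * assms by simp
  moreover have "set_integrable lborel {0..l} (\<lambda>x. rep_L2 b x * f x)"
    by (intro set_integrable_mult_continuous(2) set_integrable_rep c)
  moreover have "set_integrable lborel {0..l} (\<lambda>x. F3 x * f1 x)" "set_integrable lborel {0..l} (\<lambda>x. F2 x * f2 x)"
    by (intro borel_integrable_atLeastAtMost' continuous_intros c)+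
  moreover have "b \<bullet> toL2 l f = (LBINT x:{0..l}. rep_L2 b x * f x)"
    by (rule inner_agrees[OF *(4) agrees_toL2[OF c(3)] c(3)])
  moreover have "A \<bullet> toL2 l f2 = (LBINT x:{0..l}. F2 x * f2 x)"
    by (rule inner_agrees2[OF *(1) c(1) agrees_toL2[OF c(5)] c(5)])
  ultimately show ?thesis by (simp add: algebra_simps)
qed

end

text \<open>The Gram matrix of the tip representers; \<open>tip_moment\<close> and
  \<open>tip_shear\<close> below solve the linear system with this matrix.\<close>

lemma inner_one_lin:
  assumes l: "0 < l"
  shows "one_l l \<bullet> one_l l = l" "one_l l \<bullet> lin_l l = l\<^sup>2 / 2" "lin_l l \<bullet> lin_l l = l ^ 3 / 3"
proof -
  have c: "continuous_on {0..l} (\<lambda>x. l - x)" "continuous_on {0..l} (\<lambda>x. 1 :: real)" by (intro continuous_intros)+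
  have 1: "AC l (\<lambda>x. x) (\<lambda>x. 1 * 1)" using AC_id by simp
  have 2: "AC l (\<lambda>x. l * x - x\<^sup>2 / 2) (\<lambda>x. 1 * (l - x))"
    by (rule AC_C1) (auto intro!: derivative_eq_intros continuous_intros)
  have 3: "AC l (\<lambda>x. - ((l - x) ^ 3 / 3)) (\<lambda>x. (l - x) * (l - x))"
    by (rule AC_C1) (auto intro!: derivative_eq_intros continuous_intros simp: power2_eq_square)
  show "one_l l \<bullet> one_l l = l" "one_l l \<bullet> lin_l l = l\<^sup>2 / 2" "lin_l l \<bullet> lin_l l = l ^ 3 / 3"
    unfolding inner_agrees2[OF agrees_one c(2) agrees_one c(2)] inner_agrees2[OF agrees_one c(2) agrees_lin c(1)]
      inner_agrees2[OF agrees_lin c(1) agrees_lin c(1)]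
    using AC_end[OF 1] AC_end[OF 2] AC_end[OF 3] l by (simp_all add: power2_eq_square)
qed

section \<open>Beam motions\<close>

lemma beam_reg_add:
  assumes "beam_reg l A V a b p1 p0 m1 m2" "beam_reg l A' V' a' b' p1' p0' m1' m2'"
  shows "beam_reg l (A + A') (V + V') (a + a') (b + b') (p1 + p1') (p0 + p0') (m1 + m1') (m2 + m2')"
proof -
  obtain F2 F3 G0 G1 where *: "agrees l A F2" "AC l F2 F3" "AC l F3 (rep_L2 b)" "b \<in> L2_on l"
     "agrees l V G0" "AC l G0 G1" "AC l G1 (rep_L2 a)" "a \<in> L2_on l" "G0 0 = 0" "G1 0 = 0" "G1 l = p1" "G0 l = p0" "F2 l = m1" "F3 l = m2"
    using assms(1) by (auto simp: beam_reg_def prim2_def)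
  obtain F2' F3' G0' G1' where **: "agrees l A' F2'" "AC l F2' F3'" "AC l F3' (rep_L2 b')" "b' \<in> L2_on l"
     "agrees l V' G0'" "AC l G0' G1'" "AC l G1' (rep_L2 a')" "a' \<in> L2_on l" "G0' 0 = 0" "G1' 0 = 0" "G1' l = p1'" "G0' l = p0'" "F2' l = m1'" "F3' l = m2'"
    using assms(2) by (auto simp: beam_reg_def prim2_def)
  show ?thesis
    unfolding beam_reg_def prim2_def
    by (rule exI[of _ "\<lambda>x. F2 x + F2' x"], rule exI[of _ "\<lambda>x. F3 x + F3' x"], rule exI[of _ "\<lambda>x. G0 x + G0' x"], rule exI[of _ "\<lambda>x. G1 x + G1' x"])
      (use * ** in \<open>simp add: agrees_add AC_add AC_rep_add L2_on_add\<close>)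
qed

lemma beam_reg_diff:
  assumes "beam_reg l A V a b p1 p0 m1 m2" "beam_reg l A' V' a' b' p1' p0' m1' m2'"
  shows "beam_reg l (A - A') (V - V') (a - a') (b - b') (p1 - p1') (p0 - p0') (m1 - m1') (m2 - m2')"
  using beam_reg_add[OF assms(1) beam_reg_scaleR[OF assms(2), of "-1"]] by simp

text \<open>Written over the unit interval rather than as 1/h times an integral over [t, t+h], so
  that h = 0 gives \<open>f t\<close> and the average is jointly continuous in (h, t) up to h = 0.
  Limits for h to 0 become evaluations of continuous functions at 0.\<close>

definition avg :: "real \<Rightarrow> (real \<Rightarrow> 'a::banach) \<Rightarrow> real \<Rightarrow> 'a" where
  "avg h f t = integral {0..1} (\<lambda>\<tau>. f (t + h * \<tau>))"

lemma avg_0 [simp]: "avg 0 f t = f t"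
  by (simp add: avg_def)

lemma continuous_on_Icc_sub: "continuous_on {0..} f \<Longrightarrow> 0 \<le> s \<Longrightarrow> continuous_on {s..t::real} f"
  by (erule continuous_on_subset) auto

lemma integrable_Icc_sub:
  fixes f :: "real \<Rightarrow> 'a::banach"
  shows "continuous_on {0..} f \<Longrightarrow> 0 \<le> s \<Longrightarrow> f integrable_on {s..t}"
  by (intro integrable_continuous_real continuous_on_Icc_sub)

lemma avg_eq:
  assumes f: "continuous_on {0..} f" and h: "0 < h" and t: "0 \<le> t"
  shows "avg h f t = (1 / h) *\<^sub>R integral {t..t+h} f"
proof -
  have "(f has_integral integral {t..t+h} f) (cbox t (t + h))"
    using integrable_Icc_sub[OF f t] by auto
  from has_integral_affinity'[OF this h, of t]
  have "((\<lambda>x. f (h * x + t)) has_integral (1 / h) *\<^sub>R integral {t..t+h} f) {0..1}"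
    using h by (simp add: divide_inverse)
  then show ?thesis unfolding avg_def by (simp add: integral_unique add.commute)
qed

lemma continuous_on_avg:
  assumes f: "continuous_on {0..} f"
  shows "continuous_on ({0..} \<times> {0..}) (\<lambda>(h, t). avg h f t)"
proof -
  have "continuous_on (({0..} \<times> {0..}) \<times> cbox 0 1) (\<lambda>(p, \<tau>). f (snd p + fst p * \<tau> :: real))"
    unfolding split_beta
    by (rule continuous_on_compose2[OF f]) (auto intro!: continuous_intros)
  from integral_continuous_on_param[OF this] show ?thesis
    unfolding avg_def split_beta by simp
qed

lemma continuous_on_avg_comp [continuous_intros]:
  assumes f: "continuous_on {0..} f" and "continuous_on S p" "continuous_on S q"
    "\<And>x. x \<in> S \<Longrightarrow> 0 \<le> p x" "\<And>x. x \<in> S \<Longrightarrow> 0 \<le> q x"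
  shows "continuous_on S (\<lambda>x. avg (p x) f (q x))"
proof -
  have "continuous_on S (\<lambda>x. (\<lambda>(h, t). avg h f t) (p x, q x))"
    by (rule continuous_on_compose2[OF continuous_on_avg[OF f] continuous_on_Pair[OF assms(2,3)]]) (use assms in auto)
  then show ?thesis by simp
qed

lemma avg_has_vector_derivative:
  assumes f: "continuous_on {0..} f" and h: "0 < h" and st: "0 \<le> s" "t \<in> {s..T}"
  shows "(avg h f has_vector_derivative (1 / h) *\<^sub>R (f (t + h) - f t)) (at t within {s..T})"
proof -
  let ?P = "\<lambda>t. integral {0..t} f"
  have P: "(?P has_vector_derivative f x) (at x within {0..T+h})" if "x \<in> {0..T+h}" for x
    by (rule integral_has_vector_derivative[OF continuous_on_Icc_sub[OF f] that]) simp
  have P1: "(?P has_vector_derivative f t) (at t within {s..T})"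
    by (rule has_vector_derivative_within_subset[OF P]) (use st h in auto)
  have P2: "(?P has_vector_derivative f (t + h)) (at (t + h) within (\<lambda>t. t + h) ` {s..T})"
    by (rule has_vector_derivative_within_subset[OF P[of "t + h"]]) (use st h in auto)
  have "((\<lambda>t. t + h) has_vector_derivative 1) (at t within {s..T})"
    by (auto intro!: derivative_eq_intros)
  from vector_diff_chain_within[OF this P2]
  have "(?P \<circ> (\<lambda>t. t + h) has_vector_derivative 1 *\<^sub>R f (t + h)) (at t within {s..T})" .
  then have "((\<lambda>t. (1 / h) *\<^sub>R (?P (t + h) - ?P t)) has_vector_derivative (1 / h) *\<^sub>R (f (t + h) - f t)) (at t within {s..T})"
    using P1 by (auto intro!: derivative_eq_intros simp: o_def)
  then show ?thesis
  proof (rule has_vector_derivative_transform[rotated 2])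
    fix x assume x: "x \<in> {s..T}"
    then have "0 \<le> x" using st by simp
    then have "integral {0..x} f + integral {x..x+h} f = integral {0..x+h} f"
      using h by (intro Henstock_Kurzweil_Integration.integral_combine integrable_Icc_sub[OF f]) auto
    then have "integral {x..x+h} f = ?P (x + h) - ?P x" by (simp add: eq_diff_eq add.commute)
    then show "avg h f x = (1 / h) *\<^sub>R (?P (x + h) - ?P x)"
      unfolding avg_eq[OF f h \<open>0 \<le> x\<close>] by simp
  qed (use st in auto)
qed

lemma clear_denom:
  fixes c :: real
  assumes "- (r / c) * x = f * (p / c) - g * (q / c) + z" "0 < c"
  shows "- r * x = f * p - g * q + c * z"
proof -
  have "- r * x = c * (- (r / c) * x)" using assms(2) by simp
  also have "\<dots> = c * (f * (p / c) - g * (q / c) + z)" by (simp only: assms(1))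
  also have "\<dots> = f * p - g * q + c * z" using assms(2) by (simp add: distrib_left right_diff_distrib)
  finally show ?thesis .
qed

text \<open>A motion of the beam with tip masses under a tip torque \<open>G1\<close> and a tip force \<open>G2\<close>, in
  time-integrated form: \<open>a\<close> is \<open>u''\<close>, and every time integral of the state is a classical state.\<close>

locale beam_motion =
  fixes l \<rho> \<Lambda> J M :: real and a v :: "real \<Rightarrow> L2" and \<xi> \<psi> G1 G2 :: "real \<Rightarrow> real"
  assumes pos: "0 < l" "0 < \<rho>" "0 < \<Lambda>" "0 < J" "0 < M"
    and cont: "continuous_on {0..} a" "continuous_on {0..} v" "continuous_on {0..} \<xi>"
      "continuous_on {0..} \<psi>" "continuous_on {0..} G1" "continuous_on {0..} G2"
    and reg: "\<And>s t. 0 \<le> s \<Longrightarrow> s \<le> t \<Longrightarrow> beam_reg l (integral {s..t} a) (integral {s..t} v) (a t - a s)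
      (- (\<rho> / \<Lambda>) *\<^sub>R (v t - v s)) (integral {s..t} \<xi> / J) (integral {s..t} \<psi> / M)
      ((integral {s..t} G1 - (\<xi> t - \<xi> s)) / \<Lambda>) ((\<psi> t - \<psi> s - integral {s..t} G2) / \<Lambda>)"
begin

definition energy :: "real \<Rightarrow> real" where
  "energy t = \<Lambda> / 2 * (a t \<bullet> a t) + \<rho> / 2 * (v t \<bullet> v t) + (\<xi> t)\<^sup>2 / (2 * J) + (\<psi> t)\<^sup>2 / (2 * M)"

lemma tips:
  assumes "0 \<le> s" "s \<le> t"
  shows "a t \<bullet> one_l l - a s \<bullet> one_l l = integral {s..t} \<xi> / J"
    "a t \<bullet> lin_l l - a s \<bullet> lin_l l = integral {s..t} \<psi> / M"
  using beam_reg_tips[OF pos(1) reg[OF assms]] by (auto simp: inner_diff_left)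

text \<open>\<open>reg\<close> already concerns time integrals, so the momentum balance tested with
  a clamped displacement holds for the motion itself, with no averaging and no limit. The left side
  is the change of the tested momentum, tip masses included.\<close>

lemma test_identity:
  assumes st: "0 \<le> s" "s \<le> t"
    and f: "AC l f f1" "AC l f1 f2" "continuous_on {0..l} f2" "f 0 = 0" "f1 0 = 0"
  shows "(\<rho> * (v t \<bullet> toL2 l f) + \<psi> t * f l + \<xi> t * f1 l) - (\<rho> * (v s \<bullet> toL2 l f) + \<psi> s * f l + \<xi> s * f1 l)
    = integral {s..t} (\<lambda>r. G2 r * f l + G1 r * f1 l - \<Lambda> * (a r \<bullet> toL2 l f2))"
proof -
  have "integral {s..t} (\<lambda>r. G2 r * f l + G1 r * f1 l - \<Lambda> * (a r \<bullet> toL2 l f2))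
      = integral {s..t} G2 * f l + integral {s..t} G1 * f1 l - \<Lambda> * (integral {s..t} a \<bullet> toL2 l f2)"
  proof (rule integral_unique)
    have i: "(g has_integral integral {s..t} g) {s..t}" if "continuous_on {0..} g" for g :: "real \<Rightarrow> 'z::banach"
      using integrable_Icc_sub[OF that st(1)] by (rule integrable_integral)
    have "((\<lambda>r. a r \<bullet> toL2 l f2) has_integral integral {s..t} a \<bullet> toL2 l f2) {s..t}"
      using has_integral_linear[OF i[OF cont(1)] bounded_linear_inner_left[of "toL2 l f2"]] by (simp add: o_def)
    then show "((\<lambda>r. G2 r * f l + G1 r * f1 l - \<Lambda> * (a r \<bullet> toL2 l f2)) has_integral
        integral {s..t} G2 * f l + integral {s..t} G1 * f1 l - \<Lambda> * (integral {s..t} a \<bullet> toL2 l f2)) {s..t}"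
      by (intro has_integral_add has_integral_diff has_integral_mult_left has_integral_mult_right i cont)
  qed
  moreover have "- (\<rho> / \<Lambda>) * (v t \<bullet> toL2 l f - v s \<bullet> toL2 l f) = f l * ((\<psi> t - \<psi> s - integral {s..t} G2) / \<Lambda>)
      - f1 l * ((integral {s..t} G1 - (\<xi> t - \<xi> s)) / \<Lambda>) + integral {s..t} a \<bullet> toL2 l f2"
    using beam_reg_test[OF pos(1) reg[OF st] f] by (simp add: inner_diff_left mult.commute)
  note clear_denom[OF this pos(3)]
  ultimately show ?thesis by (simp add: algebra_simps)
qed

context
  fixes h :: real assumes h: "0 < h"
begin

text \<open>Division of \<open>reg\<close> by h: the averaged state is classical, and its time
  derivative is a difference quotient of the state.\<close>

lemma avg_reg:
  assumes t: "0 \<le> t"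
  shows "beam_reg l (avg h a t) (avg h v t) ((1 / h) *\<^sub>R (a (t + h) - a t)) (- (\<rho> / \<Lambda>) *\<^sub>R ((1 / h) *\<^sub>R (v (t + h) - v t)))
    (avg h \<xi> t / J) (avg h \<psi> t / M) ((avg h G1 t - (\<xi> (t + h) - \<xi> t) / h) / \<Lambda>) (((\<psi> (t + h) - \<psi> t) / h - avg h G2 t) / \<Lambda>)"
proof -
  have "t \<le> t + h" using h by simp
  from beam_reg_scaleR[OF reg[OF t this], of "1 / h"] show ?thesis
    unfolding avg_eq[OF cont(1) h t] avg_eq[OF cont(2) h t] avg_eq[OF cont(3) h t]
      avg_eq[OF cont(4) h t] avg_eq[OF cont(5) h t] avg_eq[OF cont(6) h t]
    by (simp add: diff_divide_distrib scaleR_left_commute mult.commute)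
qed

text \<open>The averaged motion is regular in space and differentiable in time. In the derivative of
  its energy the tip terms of \<open>beam_reg_energy\<close> cancel the inertia of the tip masses,
  and only the power of the applied torque and force is left.\<close>

lemma avg_energy_identity:
  assumes st: "0 \<le> s" "s \<le> T"
  defines "E \<equiv> \<lambda>t. \<Lambda> / 2 * (avg h a t \<bullet> avg h a t) + \<rho> / 2 * (avg h v t \<bullet> avg h v t)
    + (avg h \<xi> t)\<^sup>2 / (2 * J) + (avg h \<psi> t)\<^sup>2 / (2 * M)"
  shows "E T - E s = integral {s..T} (\<lambda>t. avg h \<xi> t * avg h G1 t / J + avg h \<psi> t * avg h G2 t / M)"
proof -
  have "((\<lambda>t. avg h \<xi> t * avg h G1 t / J + avg h \<psi> t * avg h G2 t / M) has_integral E T - E s) {s..T}"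
  proof (rule fundamental_theorem_of_calculus[OF st(2)])
    fix t assume t: "t \<in> {s..T}"
    then have t0: "0 \<le> t" using st by simp
    let ?da = "(1 / h) *\<^sub>R (a (t + h) - a t)" and ?dv = "(1 / h) *\<^sub>R (v (t + h) - v t)"
    let ?dx = "(1 / h) *\<^sub>R (\<xi> (t + h) - \<xi> t)" and ?dp = "(1 / h) *\<^sub>R (\<psi> (t + h) - \<psi> t)"
    have d: "(avg h a has_vector_derivative ?da) (at t within {s..T})" "(avg h v has_vector_derivative ?dv) (at t within {s..T})"
      "(avg h \<xi> has_vector_derivative ?dx) (at t within {s..T})" "(avg h \<psi> has_vector_derivative ?dp) (at t within {s..T})"
      by (intro avg_has_vector_derivative cont h st t)+
    have in2: "((\<lambda>t. f t \<bullet> f t) has_vector_derivative 2 * (f t \<bullet> f')) (at t within {s..T})"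
      if "(f has_vector_derivative f') (at t within {s..T})" for f :: "real \<Rightarrow> 'z::real_inner" and f'
      using bounded_bilinear.has_vector_derivative[OF bounded_bilinear_inner that that] by (simp add: inner_commute)
    have dx: "((\<lambda>t. (avg h \<xi> t)\<^sup>2) has_vector_derivative 2 * (avg h \<xi> t * ?dx)) (at t within {s..T})"
      "((\<lambda>t. (avg h \<psi> t)\<^sup>2) has_vector_derivative 2 * (avg h \<psi> t * ?dp)) (at t within {s..T})"
      using in2[OF d(3)] in2[OF d(4)] by (simp_all add: power2_eq_square)
    have "(E has_vector_derivative \<Lambda> / 2 * (2 * (avg h a t \<bullet> ?da)) + \<rho> / 2 * (2 * (avg h v t \<bullet> ?dv))
        + 2 * (avg h \<xi> t * ?dx) / (2 * J) + 2 * (avg h \<psi> t * ?dp) / (2 * M)) (at t within {s..T})"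
      unfolding E_def
      by (intro has_vector_derivative_add has_vector_derivative_mult_right has_vector_derivative_divide in2 d dx)
    also have "\<Lambda> / 2 * (2 * (avg h a t \<bullet> ?da)) + \<rho> / 2 * (2 * (avg h v t \<bullet> ?dv))
        + 2 * (avg h \<xi> t * ?dx) / (2 * J) + 2 * (avg h \<psi> t * ?dp) / (2 * M)
        = avg h \<xi> t * avg h G1 t / J + avg h \<psi> t * avg h G2 t / M"
    proof -
      have "- (\<rho> / \<Lambda>) * (avg h v t \<bullet> ?dv) = avg h \<psi> t / M * ((?dp - avg h G2 t) / \<Lambda>)
          - avg h \<xi> t / J * ((avg h G1 t - ?dx) / \<Lambda>) + ?da \<bullet> avg h a t"
        using beam_reg_energy[OF pos(1) avg_reg[OF t0]] by simp
      from clear_denom[OF this pos(3)]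
      have "- \<rho> * (avg h v t \<bullet> ?dv) = avg h \<psi> t / M * (?dp - avg h G2 t)
          - avg h \<xi> t / J * (avg h G1 t - ?dx) + \<Lambda> * (avg h a t \<bullet> ?da)"
        by (simp add: inner_commute)
      then show ?thesis by (simp add: algebra_simps add_divide_distrib diff_divide_distrib)
    qed
    finally show "(E has_vector_derivative avg h \<xi> t * avg h G1 t / J + avg h \<psi> t * avg h G2 t / M) (at t within {s..T})" .
  qed
  then show ?thesis by (rule integral_unique[symmetric])
qed

text \<open>Time derivative of \<rho> times the inner product of the velocity with x u'. The part
  with the rate of x u' gives the kinetic terms by \<open>beam_reg_moment2\<close>, the part with
  the acceleration gives the strain terms by \<open>beam_reg_moment1\<close>. The tip values of
  \<Lambda> u'' and \<Lambda> u''' appear as differences of a force and a difference quotient; these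
  quotients are not sent to their limit but estimated uniformly in h later.\<close>

lemma avg_multiplier_identity:
  assumes st: "0 \<le> s" "s \<le> T"
  shows "((\<lambda>t. \<rho> * l / 2 * (avg h \<psi> t / M)\<^sup>2 - \<rho> / 2 * (avg h v t \<bullet> avg h v t) - 3 * \<Lambda> / 2 * (avg h a t \<bullet> avg h a t)
      + (avg h G1 t - (\<xi> (t + h) - \<xi> t) / h)\<^sup>2 * l / (2 * \<Lambda>)
      + (avg h G1 t - (\<xi> (t + h) - \<xi> t) / h) * (avg h a t \<bullet> one_l l)
      - l * ((\<psi> (t + h) - \<psi> t) / h - avg h G2 t) * (avg h a t \<bullet> one_l l))
    has_integral \<rho> * (avg h v T \<bullet> moment_op l (avg h a T)) - \<rho> * (avg h v s \<bullet> moment_op l (avg h a s))) {s..T}"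
proof (rule fundamental_theorem_of_calculus[OF st(2)])
  fix t assume t: "t \<in> {s..T}"
  then have t0: "0 \<le> t" using st by simp
  let ?da = "(1 / h) *\<^sub>R (a (t + h) - a t)" and ?dv = "(1 / h) *\<^sub>R (v (t + h) - v t)"
  let ?m1 = "avg h G1 t - (\<xi> (t + h) - \<xi> t) / h" and ?m2 = "(\<psi> (t + h) - \<psi> t) / h - avg h G2 t"
  let ?q = "avg h a t \<bullet> one_l l"
  have d: "(avg h a has_vector_derivative ?da) (at t within {s..T})" "(avg h v has_vector_derivative ?dv) (at t within {s..T})"
    by (intro avg_has_vector_derivative cont h st t)+
  have dM: "((\<lambda>t. moment_op l (avg h a t)) has_vector_derivative moment_op l ?da) (at t within {s..T})"
    by (rule bounded_linear.has_vector_derivative[OF bounded_linear_moment_op[OF pos(1)] d(1)])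
  have "((\<lambda>t. \<rho> * (avg h v t \<bullet> moment_op l (avg h a t))) has_vector_derivative
      \<rho> * (avg h v t \<bullet> moment_op l ?da + ?dv \<bullet> moment_op l (avg h a t))) (at t within {s..T})"
    by (intro has_vector_derivative_mult_right bounded_bilinear.has_vector_derivative[OF bounded_bilinear_inner d(2) dM])
  also have "\<rho> * (avg h v t \<bullet> moment_op l ?da + ?dv \<bullet> moment_op l (avg h a t)) =
      \<rho> * l / 2 * (avg h \<psi> t / M)\<^sup>2 - \<rho> / 2 * (avg h v t \<bullet> avg h v t) - 3 * \<Lambda> / 2 * (avg h a t \<bullet> avg h a t)
      + ?m1\<^sup>2 * l / (2 * \<Lambda>) + ?m1 * ?q - l * ?m2 * ?q"
  proof -
    have 1: "avg h v t \<bullet> moment_op l ?da = l / 2 * (avg h \<psi> t / M)\<^sup>2 - (avg h v t \<bullet> avg h v t) / 2"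
      by (rule beam_reg_moment2[OF pos(1) avg_reg[OF t0]])
    have "- (\<rho> / \<Lambda>) * (?dv \<bullet> moment_op l (avg h a t)) = l * (?m2 / \<Lambda>) * ?q - ?m1 / \<Lambda> * ?q
        - l / 2 * (?m1 / \<Lambda>)\<^sup>2 + 3 / 2 * (avg h a t \<bullet> avg h a t)"
      using beam_reg_moment1[OF pos(1) avg_reg[OF t0]] by simp
    then have "- \<Lambda> * (- (\<rho> / \<Lambda>) * (?dv \<bullet> moment_op l (avg h a t))) = - \<Lambda> * (l * (?m2 / \<Lambda>) * ?q - ?m1 / \<Lambda> * ?q
        - l / 2 * (?m1 / \<Lambda>)\<^sup>2 + 3 / 2 * (avg h a t \<bullet> avg h a t))" by simp
    moreover have "\<Lambda> * (l / 2 * (?m1 / \<Lambda>)\<^sup>2) = ?m1\<^sup>2 * l / (2 * \<Lambda>)"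
      using pos(3) by (simp add: power2_eq_square)
    ultimately have 2: "\<rho> * (?dv \<bullet> moment_op l (avg h a t)) = - (l * ?m2 * ?q) + ?m1 * ?q + ?m1\<^sup>2 * l / (2 * \<Lambda>)
        - 3 * \<Lambda> / 2 * (avg h a t \<bullet> avg h a t)"
      using pos(3) by (simp add: distrib_left right_diff_distrib)
    show ?thesis
      unfolding distrib_left 2 1 by (simp add: right_diff_distrib)
  qed
  finally show "((\<lambda>t. \<rho> * (avg h v t \<bullet> moment_op l (avg h a t))) has_vector_derivative
      \<rho> * l / 2 * (avg h \<psi> t / M)\<^sup>2 - \<rho> / 2 * (avg h v t \<bullet> avg h v t) - 3 * \<Lambda> / 2 * (avg h a t \<bullet> avg h a t)
      + ?m1\<^sup>2 * l / (2 * \<Lambda>) + ?m1 * ?q - l * ?m2 * ?q) (at t within {s..T})" .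
qed

end

lemma continuous_limit_0:
  fixes f :: "real \<Rightarrow> real"
  assumes "continuous_on {0..1} f" "\<And>h. 0 < h \<Longrightarrow> h \<le> 1 \<Longrightarrow> f h \<le> c"
  shows "f 0 \<le> c"
proof -
  have "(f \<longlongrightarrow> f 0) (at 0 within {0..1})" using assms(1) by (simp add: continuous_on)
  then have "(f \<longlongrightarrow> f 0) (at_right 0)" by (simp add: at_within_Icc_at_right)
  moreover have "\<forall>\<^sub>F h in at_right 0. f h \<le> c"
    unfolding eventually_at_right_field using assms(2) by (intro exI[of _ 1]) auto
  ultimately show ?thesis by (rule tendsto_upperbound) simp
qed

lemma continuous_on_integral_param:
  fixes g :: "real \<Rightarrow> real \<Rightarrow> real"
  assumes "continuous_on ({0..1} \<times> {s..T}) (\<lambda>(h, t). g h t)"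
  shows "continuous_on {0..1} (\<lambda>h. integral {s..T} (g h))"
  using integral_continuous_on_param[of "{0..1}" s T g] assms by simp

text \<open>The averaged identity contains no difference quotients, so both sides are continuous in
  h up to 0 and the identity survives at h = 0.\<close>

theorem energy_identity:
  assumes st: "0 \<le> s" "s \<le> T"
  shows "energy T - energy s = integral {s..T} (\<lambda>t. \<xi> t * G1 t / J + \<psi> t * G2 t / M)"
proof -
  define E where "E h t = \<Lambda> / 2 * (avg h a t \<bullet> avg h a t) + \<rho> / 2 * (avg h v t \<bullet> avg h v t)
    + (avg h \<xi> t)\<^sup>2 / (2 * J) + (avg h \<psi> t)\<^sup>2 / (2 * M)" for h t
  define g where "g h t = avg h \<xi> t * avg h G1 t / J + avg h \<psi> t * avg h G2 t / M" for h t
  have E: "continuous_on {0..1} (\<lambda>h. E h t)" if "0 \<le> t" for t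
    unfolding E_def using that pos by (intro continuous_intros cont) auto
  have "continuous_on ({0..1} \<times> {s..T}) (\<lambda>(h, t). g h t)"
    unfolding g_def split_beta using st pos by (intro continuous_intros cont) auto
  then have I: "continuous_on {0..1} (\<lambda>h. integral {s..T} (g h))" by (rule continuous_on_integral_param)
  have "continuous_on {0..1} (\<lambda>h. \<bar>E h T - E h s - integral {s..T} (g h)\<bar>)"
    using st by (intro continuous_intros E I) auto
  moreover have "\<bar>E h T - E h s - integral {s..T} (g h)\<bar> \<le> 0" if "0 < h" for h
    using avg_energy_identity[OF that st] unfolding E_def g_def[abs_def] by simp
  ultimately have "\<bar>E 0 T - E 0 s - integral {s..T} (g 0)\<bar> \<le> 0"
    by (rule continuous_limit_0)
  then show ?thesis by (simp add: E_def g_def[abs_def] energy_def)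
qed

text \<open>The conditions of \<open>beam_motion\<close> are linear in motion and forces jointly and
  invariant under time shifts. The energy identity thereby applies to increments, which is the
  source of the bound on the tip accelerations.\<close>

lemma shift_diff_motion:
  assumes h: "0 \<le> h"
  shows "beam_motion l \<rho> \<Lambda> J M (\<lambda>t. a (t + h) - a t) (\<lambda>t. v (t + h) - v t) (\<lambda>t. \<xi> (t + h) - \<xi> t)
    (\<lambda>t. \<psi> (t + h) - \<psi> t) (\<lambda>t. G1 (t + h) - G1 t) (\<lambda>t. G2 (t + h) - G2 t)"
proof
  have sh: "continuous_on {0..} (\<lambda>t. f (t + h) - f t)" if "continuous_on {0..} f" for f :: "real \<Rightarrow> 'z::real_normed_vector"
    by (intro continuous_on_diff that continuous_on_compose2[OF that]) (use h in \<open>auto intro!: continuous_intros\<close>)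
  show "continuous_on {0..} (\<lambda>t. a (t + h) - a t)" "continuous_on {0..} (\<lambda>t. v (t + h) - v t)" "continuous_on {0..} (\<lambda>t. \<xi> (t + h) - \<xi> t)"
    "continuous_on {0..} (\<lambda>t. \<psi> (t + h) - \<psi> t)" "continuous_on {0..} (\<lambda>t. G1 (t + h) - G1 t)" "continuous_on {0..} (\<lambda>t. G2 (t + h) - G2 t)"
    by (intro sh cont)+
  fix s t :: real assume st: "0 \<le> s" "s \<le> t"
  have int: "integral {s..t} (\<lambda>r. f (r + h) - f r) = integral {s+h..t+h} f - integral {s..t} f" if "continuous_on {0..} f" for f :: "real \<Rightarrow> 'z::banach"
  proof -
    have "(\<lambda>r. f (r + h)) integrable_on {s..t}"
      by (intro integrable_continuous_real continuous_on_compose2[OF that]) (use h st in \<open>auto intro!: continuous_intros\<close>)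
    moreover have "integral {s..t} (\<lambda>r. f (r + h)) = integral {s+h..t+h} f"
      using integral_shift_Icc_real[of s t f h] by (simp add: o_def add.commute)
    ultimately show ?thesis using integrable_Icc_sub[OF that st(1)] by (simp add: Henstock_Kurzweil_Integration.integral_diff)
  qed
  have "s + h \<le> t + h" "0 \<le> s + h" using st h by auto
  from beam_reg_diff[OF reg[OF this(2,1)] reg[OF st]]
  show "beam_reg l (integral {s..t} (\<lambda>t. a (t + h) - a t)) (integral {s..t} (\<lambda>t. v (t + h) - v t)) (a (t + h) - a t - (a (s + h) - a s))
        (- (\<rho> / \<Lambda>) *\<^sub>R (v (t + h) - v t - (v (s + h) - v s))) (integral {s..t} (\<lambda>t. \<xi> (t + h) - \<xi> t) / J)
        (integral {s..t} (\<lambda>t. \<psi> (t + h) - \<psi> t) / M)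
        ((integral {s..t} (\<lambda>t. G1 (t + h) - G1 t) - (\<xi> (t + h) - \<xi> t - (\<xi> (s + h) - \<xi> s))) / \<Lambda>)
        ((\<psi> (t + h) - \<psi> t - (\<psi> (s + h) - \<psi> s) - integral {s..t} (\<lambda>t. G2 (t + h) - G2 t)) / \<Lambda>)"
    unfolding int[OF cont(1)] int[OF cont(2)] int[OF cont(3)] int[OF cont(4)] int[OF cont(5)] int[OF cont(6)]
    by (simp add: algebra_simps diff_divide_distrib add_divide_distrib)
qed (use pos in auto)

end

section \<open>Controllers\<close>

text \<open>A late value f t \<ge> e forces f \<ge> e/2 on an interval of length d/2, hence a gain
  of e d/4 for the integral, while past \<open>T0\<close> less than e d/8 is left below the
  supremum.\<close>

lemma Barbalat:
  fixes f :: "real \<Rightarrow> real"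
  assumes uc: "uniformly_continuous_on {0..} f" and nn: "\<And>t. 0 \<le> t \<Longrightarrow> 0 \<le> f t"
    and bd: "\<And>T. 0 \<le> T \<Longrightarrow> integral {0..T} f \<le> C"
  shows "(f \<longlongrightarrow> 0) at_top"
proof (rule ccontr)
  assume "\<not> (f \<longlongrightarrow> 0) at_top"
  then obtain e where e: "e > 0" and "\<not> (\<forall>\<^sub>F t in at_top. dist (f t) 0 < e)" by (auto simp: tendsto_iff)
  then have freq: "\<exists>t\<ge>T. e \<le> \<bar>f t\<bar>" for T
    by (simp add: eventually_at_top_linorder not_less)
  have cf: "continuous_on {0..} f" by (rule uniformly_continuous_imp_continuous[OF uc])
  note fi = integrable_Icc_sub[OF cf]
  obtain d where d: "d > 0" "\<And>s t. 0 \<le> s \<Longrightarrow> 0 \<le> t \<Longrightarrow> dist s t < d \<Longrightarrow> dist (f s) (f t) < e / 2"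
    using uc e unfolding uniformly_continuous_on_def by (metis atLeast_iff half_gt_zero)
  let ?P = "\<lambda>T. integral {0..T} f"
  let ?S = "SUP T\<in>{0..}. ?P T"
  have bdd: "bdd_above (?P ` {0..})" using bd by (intro bdd_aboveI2[where M=C]) auto
  have "\<exists>T\<in>{0..}. ?S - e * d / 8 < ?P T"
  proof (rule ccontr)
    assume "\<not> ?thesis"
    then have "?S \<le> ?S - e * d / 8" by (intro cSUP_least) (auto simp: not_less)
    then show False using mult_pos_pos[OF e d(1)] by linarith
  qed
  then obtain T0 where T0: "0 \<le> T0" "?S - e * d / 8 < ?P T0" by auto
  obtain t where t: "t \<ge> T0" "e \<le> \<bar>f t\<bar>" using freq by blast
  have t0: "0 \<le> t" using t T0 by simp
  have ge: "e / 2 \<le> f s" if "s \<in> {t..t + d / 2}" for s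
  proof -
    have "dist t s < d" using that d by (auto simp: dist_real_def)
    then have "dist (f t) (f s) < e / 2" using d(2)[OF t0] that t0 by simp
    moreover have "\<bar>f t\<bar> = f t" using nn[OF t0] by simp
    ultimately show ?thesis using t(2) unfolding dist_real_def by arith
  qed
  have "integral {t..t + d / 2} (\<lambda>_. e / 2) \<le> integral {t..t + d / 2} f"
    by (rule integral_le) (use ge fi[OF t0] in auto)
  then have "e * d / 4 \<le> integral {t..t + d / 2} f" using d(1) by (simp add: mult.commute)
  moreover have "?P t + integral {t..t + d / 2} f = ?P (t + d / 2)"
    using d t0 by (intro Henstock_Kurzweil_Integration.integral_combine fi) auto
  moreover have "?P T0 + integral {T0..t} f = ?P t"
    using t T0 by (intro Henstock_Kurzweil_Integration.integral_combine fi) auto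
  moreover have "0 \<le> integral {T0..t} f" using T0 by (intro integral_nonneg fi) (auto intro: nn)
  moreover have "?P (t + d / 2) \<le> ?S" using d t0 by (intro cSUP_upper bdd) auto
  ultimately have "e * d / 4 < e * d / 8" using T0(2) by linarith
  then show False using mult_pos_pos[OF e d(1)] by linarith
qed

text \<open>On the compact set e \<le> norm x \<le> R the function \<open>g\<close> has a positive
  minimum; once g (z t) is below it, z t has left this set.\<close>

lemma tendsto_0_of_definite:
  fixes z :: "real \<Rightarrow> 'a::euclidean_space" and g :: "'a \<Rightarrow> real"
  assumes g: "continuous_on UNIV g" "\<And>x. x \<noteq> 0 \<Longrightarrow> 0 < g x"
    and z: "\<And>t. 0 \<le> t \<Longrightarrow> norm (z t) \<le> R" and lim: "((\<lambda>t. g (z t)) \<longlongrightarrow> 0) at_top"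
  shows "(z \<longlongrightarrow> 0) at_top"
proof (rule tendstoI)
  fix e :: real assume e: "0 < e"
  let ?K = "cball (0::'a) R \<inter> {x. e \<le> norm x}"
  have K: "compact ?K" by (intro compact_Int_closed compact_cball closed_Collect_le continuous_intros)
  have "\<exists>m>0. \<forall>x\<in>?K. m \<le> g x"
  proof (cases "?K = {}")
    case False
    from continuous_attains_inf[OF K this continuous_on_subset[OF g(1)]]
    obtain x where "x \<in> ?K" "\<forall>y\<in>?K. g x \<le> g y" by auto
    moreover have "0 < g x" using e \<open>x \<in> ?K\<close> by (intro g(2)) auto
    ultimately show ?thesis by blast
  qed (auto intro: exI[of _ 1])
  then obtain m where m: "m > 0" "\<And>x. x \<in> ?K \<Longrightarrow> m \<le> g x" by blast
  have "\<forall>\<^sub>F t in at_top. g (z t) < m" using order_tendstoD(2)[OF lim m(1)] .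
  then show "\<forall>\<^sub>F t in at_top. dist (z t) 0 < e"
    using eventually_ge_at_top[of 0]
  proof eventually_elim
    case (elim t)
    then show ?case using m(2)[of "z t"] z[of t] by (auto simp: not_le intro: ccontr)
  qed
qed

lemma integral_eq_has_vector_derivative:
  fixes F f :: "real \<Rightarrow> 'a::banach"
  assumes "continuous_on {s..T} f" "\<And>t. t \<in> {s..T} \<Longrightarrow> F t - F s = integral {s..t} f" "t \<in> {s..T}"
  shows "(F has_vector_derivative f t) (at t within {s..T})"
proof -
  have D: "((\<lambda>t. F s + integral {s..t} f) has_vector_derivative 0 + f t) (at t within {s..T})"
    by (intro has_vector_derivative_add has_vector_derivative_const integral_has_vector_derivative assms)
  have "(F has_vector_derivative 0 + f t) (at t within {s..T})"
  proof (rule has_vector_derivative_transform[OF assms(3) _ D])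
    show "F u = F s + integral {s..u} f" if "u \<in> {s..T}" for u
      using assms(2)[OF that] by (simp add: algebra_simps)
  qed
  then show ?thesis by simp
qed

lemma C2_map_derivative:
  fixes f :: "'a::euclidean_space \<Rightarrow> 'b::real_normed_vector"
  assumes "C2_map f"
  obtains f' where "\<And>x. (f has_derivative blinfun_apply (f' x)) (at x)" "continuous_on UNIV f'"
proof -
  obtain f' :: "'a \<Rightarrow> 'a \<Rightarrow>\<^sub>L 'b" and f'' where
    f: "\<And>x. (f has_derivative blinfun_apply (f' x)) (at x)" "\<And>x. (f' has_derivative blinfun_apply (f'' x)) (at x)"
    using assms unfolding C2_map_def by blast
  have "continuous_on UNIV f'"
    by (meson continuous_at_imp_continuous_on f(2) has_derivative_continuous)
  then show ?thesis using that f(1) by blast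
qed

lemma C2_map_continuous: "C2_map f \<Longrightarrow> continuous_on A f"
  by (metis C2_map_derivative continuous_at_imp_continuous_on has_derivative_continuous)

lemma C2_map_Lipschitz:
  fixes f :: "'a::euclidean_space \<Rightarrow> 'b::real_normed_vector"
  assumes "C2_map f"
  obtains L where "0 \<le> L" "\<And>x y. norm x \<le> R \<Longrightarrow> norm y \<le> R \<Longrightarrow> norm (f x - f y) \<le> L * norm (x - y)"
proof -
  obtain f' where f: "\<And>x. (f has_derivative blinfun_apply (f' x)) (at x)" "continuous_on UNIV f'"
    using C2_map_derivative[OF assms] by blast
  have "bounded (f' ` cball 0 R)"
    by (intro compact_imp_bounded compact_continuous_image continuous_on_subset[OF f(2)]) auto
  then obtain L where L: "L > 0" "\<And>x. x \<in> cball 0 R \<Longrightarrow> norm (f' x) \<le> L"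
    by (auto simp: bounded_pos)
  have "norm (f x - f y) \<le> L * norm (x - y)" if "norm x \<le> R" "norm y \<le> R" for x y
  proof (rule differentiable_bound[where S="cball 0 R" and f'="\<lambda>x. blinfun_apply (f' x)"])
    show "(f has_derivative blinfun_apply (f' x)) (at x within cball 0 R)" for x
      using f(1) has_derivative_at_withinI by blast
    show "onorm (blinfun_apply (f' x)) \<le> L" if "x \<in> cball 0 R" for x
      using L(2)[OF that] by (simp add: norm_blinfun.rep_eq)
  qed (use that in auto)
  then show ?thesis using that L(1) less_imp_le by blast
qed

lemma C2_map_real_deriv:
  fixes f :: "real \<Rightarrow> real"
  assumes "C2_map f"
  shows "(f has_real_derivative deriv f x) (at x)" "continuous_on UNIV (deriv f)"
proof -
  obtain f' where f: "\<And>x. (f has_derivative blinfun_apply (f' x)) (at x)" "continuous_on UNIV f'"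
    using C2_map_derivative[OF assms] by blast
  have *: "(f has_real_derivative blinfun_apply (f' x) 1) (at x)" for x
  proof -
    have "blinfun_apply (f' x) h = blinfun_apply (f' x) 1 * h" for h
      using blinfun.scaleR_right[of "f' x" h 1] by (simp add: mult.commute)
    then have "blinfun_apply (f' x) = (*) (blinfun_apply (f' x) 1)" by (intro ext)
    then show ?thesis unfolding has_field_derivative_def using f(1)[of x] by simp
  qed
  then have d: "deriv f = (\<lambda>x. blinfun_apply (f' x) 1)" by (auto intro!: ext DERIV_imp_deriv)
  show "(f has_real_derivative deriv f x) (at x)" using * d by simp
  show "continuous_on UNIV (deriv f)" unfolding d by (intro continuous_intros f)
qed

lemma C2_map_grad:
  fixes f :: "real^'n::finite \<Rightarrow> real"
  assumes "C2_map f"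
  shows "(f has_derivative (\<lambda>h. h \<bullet> grad f z)) (at z)" "continuous_on UNIV (grad f)"
proof -
  obtain f' where f: "\<And>x. (f has_derivative blinfun_apply (f' x)) (at x)" "continuous_on UNIV f'"
    using C2_map_derivative[OF assms] by blast
  let ?D = "\<lambda>z. \<Sum>b\<in>Basis. blinfun_apply (f' z) b *\<^sub>R b"
  have eq: "blinfun_apply (f' z) h = h \<bullet> ?D z" for z h
  proof -
    have "blinfun_apply (f' z) h = blinfun_apply (f' z) (\<Sum>b\<in>Basis. (h \<bullet> b) *\<^sub>R b)" by (simp add: euclidean_representation)
    also have "\<dots> = (\<Sum>b\<in>Basis. (h \<bullet> b) * blinfun_apply (f' z) b)" by (simp add: blinfun.sum_right blinfun.scaleR_right)
    finally show ?thesis by (simp add: inner_sum_right mult.commute)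
  qed
  have G: "(f has_derivative (\<lambda>h. h \<bullet> ?D z)) (at z)" for z
    using f(1)[of z] by (rule has_derivative_eq_rhs) (rule ext, rule eq)
  have "grad f z = ?D z" for z
    unfolding grad_def
  proof (rule the_equality)
    show "GDERIV f z :> ?D z" using G by (simp add: gderiv_def)
    fix D assume "GDERIV f z :> D"
    then have "(\<lambda>h. h \<bullet> D) = (\<lambda>h. h \<bullet> ?D z)"
      using G has_derivative_unique unfolding gderiv_def by blast
    then show "D = ?D z" by (metis vector_eq_ldot)
  qed
  then have g: "grad f = ?D" by blast
  show "(f has_derivative (\<lambda>h. h \<bullet> grad f z)) (at z)" using G g by simp
  show "continuous_on UNIV (grad f)" unfolding g by (intro continuous_intros f)
qed

definition spring_energy :: "'n::finite controller \<Rightarrow> real \<Rightarrow> real" where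
  "spring_energy q s = (LBINT \<sigma>=0..s. fk q \<sigma>)"

definition dissipation :: "'n::finite controller \<Rightarrow> real^'n \<Rightarrow> real" where
  "dissipation q z = - (grad (fV q) z \<bullet> fa q z)"

locale admissible_ctrl =
  fixes q :: "'n::finite controller"
  assumes adm: "admissible_controller q"
begin

lemma C2: "C2_map (fa q)" "C2_map (fb q)" "C2_map (fc q)" "C2_map (fd q)" "C2_map (fk q)" "C2_map (fV q)"
  using adm by (auto simp: admissible_controller_def)

lemma zero: "fd q 0 = 0" "fk q 0 = 0" "fV q 0 = 0" "fa q 0 = 0" "fc q 0 = 0"
  using adm by (auto simp: admissible_controller_def)

lemma spring_energy_nonneg: "0 \<le> spring_energy q s"
proof (cases "s = 0")
  case True
  then show ?thesis by (simp add: spring_energy_def flip: zero_ereal_def)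
next
  case False
  then show ?thesis using adm unfolding admissible_controller_def spring_energy_def by (simp add: less_imp_le)
qed

lemma spring_energy_deriv: "(spring_energy q has_real_derivative fk q s) (at s)"
proof -
  let ?m = "\<bar>s\<bar> + 1"
  have "((\<lambda>u. LBINT y=ereal 0..u. fk q y) has_vector_derivative fk q s) (at s within {-?m..?m})"
    by (rule interval_integral_FTC2) (auto intro: C2_map_continuous C2)
  then have "((\<lambda>u. LBINT y=0..u. fk q y) has_vector_derivative fk q s) (at s)"
    by (subst (asm) at_within_Icc_at) (auto simp: zero_ereal_def)
  then show ?thesis
    unfolding spring_energy_def[abs_def] by (simp add: has_real_derivative_iff_has_vector_derivative)
qed

lemma V_nonneg: "0 \<le> fV q z"
  using adm by (cases "z = 0") (auto simp: admissible_controller_def less_imp_le)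

lemma V_bounded_sublevel: obtains R where "\<And>z. fV q z \<le> B \<Longrightarrow> norm z \<le> R"
proof -
  have "filterlim (fV q) at_top at_infinity" using adm by (simp add: admissible_controller_def)
  then have "\<forall>\<^sub>F z in at_infinity. B < fV q z" by (simp add: filterlim_at_top_dense)
  then obtain R where "\<And>z. R \<le> norm z \<Longrightarrow> B < fV q z" by (auto simp: eventually_at_infinity)
  then show ?thesis using that[of R] by (meson linorder_not_less nle_le)
qed

lemma dissipation_pos: "z \<noteq> 0 \<Longrightarrow> 0 < dissipation q z"
  using adm by (auto simp: admissible_controller_def dissipation_def)

lemma dissipation_nonneg: "0 \<le> dissipation q z"
  using dissipation_pos[of z] by (cases "z = 0") (auto simp: dissipation_def zero)

lemma dissipation_continuous: "continuous_on UNIV (dissipation q)"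
  unfolding dissipation_def[abs_def] by (intro continuous_intros C2_map_grad C2 C2_map_continuous)

lemma damping_mono: assumes "x \<le> y" shows "fd q x \<le> fd q y"
proof (rule DERIV_nonneg_imp_nondecreasing[OF assms])
  fix t show "\<exists>y. (fd q has_real_derivative y) (at t) \<and> 0 \<le> y"
    using C2_map_real_deriv(1)[OF C2(4)] adm by (auto simp: admissible_controller_def)
qed

text \<open>By continuity the derivative stays above half its value at 0 near 0, and the mean value
  theorem does the rest. The estimate is local: away from 0 the damping may be constant on
  intervals.\<close>

lemma damping_strict:
  obtains s \<kappa> where "0 < s" "0 < \<kappa>"
    "\<And>x y. \<bar>x\<bar> \<le> s \<Longrightarrow> \<bar>y\<bar> \<le> s \<Longrightarrow> \<kappa> * (x - y)\<^sup>2 \<le> (fd q x - fd q y) * (x - y)"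
proof -
  note D = C2_map_real_deriv[OF C2(4)]
  have p: "0 < deriv (fd q) 0" using adm by (simp add: admissible_controller_def)
  define \<kappa> where "\<kappa> = deriv (fd q) 0 / 2"
  have "isCont (deriv (fd q)) 0" using D(2) by (simp add: continuous_on_eq_continuous_at)
  then obtain e where e: "e > 0" "\<And>x. \<bar>x\<bar> < e \<Longrightarrow> \<bar>deriv (fd q) x - deriv (fd q) 0\<bar> < \<kappa>"
    using p unfolding continuous_at_eps_delta \<kappa>_def dist_real_def by (metis diff_zero half_gt_zero)
  have main: "\<kappa> * (x - y)\<^sup>2 \<le> (fd q x - fd q y) * (x - y)" if xy: "\<bar>x\<bar> \<le> e / 2" "\<bar>y\<bar> \<le> e / 2" "y < x" for x y
  proof -
    obtain w where w: "y < w" "w < x" "fd q x - fd q y = (x - y) * deriv (fd q) w"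
      using MVT2[OF xy(3), of "fd q" "deriv (fd q)"] D(1) by blast
    have "\<bar>w\<bar> < e" using w xy e by auto
    then have "\<bar>deriv (fd q) w - deriv (fd q) 0\<bar> < \<kappa>" by (rule e(2))
    moreover have "deriv (fd q) 0 = 2 * \<kappa>" by (simp add: \<kappa>_def)
    ultimately have "\<kappa> \<le> deriv (fd q) w" by arith
    then have "\<kappa> * (x - y)\<^sup>2 \<le> deriv (fd q) w * (x - y)\<^sup>2" by (intro mult_right_mono) auto
    then show ?thesis unfolding w(3) by (simp add: power2_eq_square mult_ac)
  qed
  show ?thesis
  proof (rule that[of "e / 2" \<kappa>])
    fix x y assume xy: "\<bar>x\<bar> \<le> e / 2" "\<bar>y\<bar> \<le> e / 2"
    consider "x < y" | "x = y" | "y < x" by linarith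
    then show "\<kappa> * (x - y)\<^sup>2 \<le> (fd q x - fd q y) * (x - y)"
    proof cases
      case 1
      have "(fd q y - fd q x) * (y - x) = (fd q x - fd q y) * (x - y)" by (simp add: algebra_simps)
      then show ?thesis using main[OF xy(2,1) 1] by (simp add: power2_commute)
    qed (use main xy in auto)
  qed (use e p \<kappa>_def in auto)
qed

text \<open>Strictness near 0 fixes the sign at the truncation of x to [-s, s], and monotonicity
  carries it to x.\<close>

lemma damping_pos: assumes "x \<noteq> 0" shows "0 < fd q x * x"
proof -
  obtain s \<kappa> where sk: "0 < s" "0 < \<kappa>" "\<And>x y. \<bar>x\<bar> \<le> s \<Longrightarrow> \<bar>y\<bar> \<le> s \<Longrightarrow> \<kappa> * (x - y)\<^sup>2 \<le> (fd q x - fd q y) * (x - y)"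
    by (rule damping_strict) blast
  have small: "0 < fd q y * y" if "y \<noteq> 0" "\<bar>y\<bar> \<le> s" for y
  proof -
    have "0 < \<kappa> * y\<^sup>2" using that sk by simp
    then show ?thesis using sk(3)[OF that(2), of 0] sk(1) by (simp add: zero)
  qed
  show ?thesis
  proof (cases "x > 0")
    case True
    define m where "m = min x s"
    have n: "0 < m" "\<bar>m\<bar> \<le> s" using True sk(1) by (auto simp: m_def)
    have "0 < fd q m * m" using small[OF _ n(2)] n(1) by simp
    then have "0 < fd q m" using n(1) by (simp add: zero_less_mult_iff)
    then have "0 < fd q x" using damping_mono[of m x] by (simp add: m_def)
    then show ?thesis using True by simp
  next
    case False
    then have x: "x < 0" using assms by simp
    define m where "m = max x (-s)"
    have n: "m < 0" "\<bar>m\<bar> \<le> s" using x sk(1) by (auto simp: m_def)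
    have "0 < fd q m * m" using small[OF _ n(2)] n(1) by simp
    then have "fd q m < 0" using n(1) by (simp add: zero_less_mult_iff)
    then have "fd q x < 0" using damping_mono[of x m] by (simp add: m_def)
    then show ?thesis using x by (simp add: mult_neg_neg)
  qed
qed

lemma damping_nonneg: "0 \<le> fd q x * x"
  using damping_pos[of x] by (cases "x = 0") auto

end

text \<open>A controller with internal state \<open>z\<close> driven by the velocity \<open>w\<close> of the tip coordinate \<open>x\<close>.\<close>

locale ctrl_traj = admissible_ctrl q for q :: "'n::finite controller" +
  fixes z :: "real \<Rightarrow> real^'n" and w x :: "real \<Rightarrow> real"
  assumes cont: "continuous_on {0..} z" "continuous_on {0..} w" "continuous_on {0..} x"
    and ode: "\<And>s t. 0 \<le> s \<Longrightarrow> s \<le> t \<Longrightarrow> z t - z s = integral {s..t} (\<lambda>r. fa q (z r) + w r *\<^sub>R fb q (z r))"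
    and pos_ode: "\<And>s t. 0 \<le> s \<Longrightarrow> s \<le> t \<Longrightarrow> x t - x s = integral {s..t} w"
begin

definition force :: "real \<Rightarrow> real" where
  "force t = - (fc q (z t) + fd q (w t) + fk q (x t))"

definition storage :: "real \<Rightarrow> real" where
  "storage t = fV q (z t) + spring_energy q (x t)"

definition loss :: "real \<Rightarrow> real" where
  "loss t = dissipation q (z t) + fd q (w t) * w t"

lemma comp_cont: "continuous_on UNIV g \<Longrightarrow> continuous_on {0..} f \<Longrightarrow> continuous_on {0..} (\<lambda>t. g (f t))"
  by (rule continuous_on_compose2) auto

lemma cont_comps: "continuous_on {0..} (\<lambda>t. fa q (z t))" "continuous_on {0..} (\<lambda>t. fb q (z t))"
  "continuous_on {0..} (\<lambda>t. fc q (z t))" "continuous_on {0..} (\<lambda>t. fd q (w t))" "continuous_on {0..} (\<lambda>t. fk q (x t))"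
  "continuous_on {0..} (\<lambda>t. dissipation q (z t))" "continuous_on {0..} (\<lambda>t. fV q (z t))"
  using comp_cont[OF C2_map_continuous[OF C2(1)] cont(1)] comp_cont[OF C2_map_continuous[OF C2(2)] cont(1)]
    comp_cont[OF C2_map_continuous[OF C2(3)] cont(1)] comp_cont[OF C2_map_continuous[OF C2(4)] cont(2)]
    comp_cont[OF C2_map_continuous[OF C2(5)] cont(3)] comp_cont[OF dissipation_continuous cont(1)]
    comp_cont[OF C2_map_continuous[OF C2(6)] cont(1)] by simp_all

lemma cont_force: "continuous_on {0..} force" and cont_loss: "continuous_on {0..} loss"
  unfolding force_def[abs_def] loss_def[abs_def] by (intro continuous_intros cont_comps cont)+

lemma loss_nonneg: "0 \<le> loss t"
  by (simp add: loss_def dissipation_nonneg damping_nonneg)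

lemma storage_nonneg: "0 \<le> storage t"
  by (simp add: storage_def V_nonneg spring_energy_nonneg)

text \<open>Passivity: the gradient of V in the direction \<open>fb\<close> is \<open>fc\<close>, so
  the rate of the storage is minus the loss minus the power w times force delivered to the
  beam.\<close>

lemma storage_identity:
  assumes st: "0 \<le> s" "s \<le> T"
  shows "storage T - storage s + integral {s..T} (\<lambda>t. w t * force t) = - integral {s..T} loss"
proof -
  let ?f = "\<lambda>r. fa q (z r) + w r *\<^sub>R fb q (z r)"
  have "((\<lambda>t. - loss t - w t * force t) has_integral storage T - storage s) {s..T}"
  proof (rule fundamental_theorem_of_calculus[OF st(2)])
    fix t assume t: "t \<in> {s..T}"
    have zd: "(z has_vector_derivative ?f t) (at t within {s..T})"
      by (rule integral_eq_has_vector_derivative[OF continuous_on_Icc_sub[OF _ st(1)] _ t])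
        (use st in \<open>auto intro!: continuous_intros cont_comps cont ode\<close>)
    have xd: "(x has_vector_derivative w t) (at t within {s..T})"
      by (rule integral_eq_has_vector_derivative[OF continuous_on_Icc_sub[OF _ st(1)] _ t])
        (use st in \<open>auto intro!: cont pos_ode\<close>)
    have "((\<lambda>t. fV q (z t)) has_vector_derivative ?f t \<bullet> grad (fV q) (z t)) (at t within {s..T})"
      using vector_derivative_diff_chain_within[OF zd, of "fV q"] C2_map_grad(1)[OF C2(6), of "z t"]
      by (auto simp: o_def intro: has_derivative_at_withinI)
    moreover have "((\<lambda>t. spring_energy q (x t)) has_vector_derivative w t * fk q (x t)) (at t within {s..T})"
      using vector_derivative_diff_chain_within[OF xd has_derivative_at_withinI[OF
            spring_energy_deriv[unfolded has_field_derivative_def]]]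
      by (simp add: o_def mult.commute)
    ultimately have "(storage has_vector_derivative ?f t \<bullet> grad (fV q) (z t) + w t * fk q (x t)) (at t within {s..T})"
      unfolding storage_def[abs_def] by (rule has_vector_derivative_add)
    moreover have "grad (fV q) (z t) \<bullet> fb q (z t) = fc q (z t)"
      using adm by (simp add: admissible_controller_def)
    then have "?f t \<bullet> grad (fV q) (z t) + w t * fk q (x t) = - loss t - w t * force t"
      by (simp add: loss_def force_def dissipation_def inner_add_left inner_commute algebra_simps)
    ultimately show "(storage has_vector_derivative - loss t - w t * force t) (at t within {s..T})" by simp
  qed
  moreover have "((\<lambda>t. - loss t - w t * force t) has_integral - integral {s..T} loss - integral {s..T} (\<lambda>t. w t * force t)) {s..T}"
    by (intro has_integral_diff has_integral_neg integrable_integral integrable_Icc_sub[OF _ st(1)] cont_loss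
        continuous_intros cont cont_force)
  ultimately have "storage T - storage s = - integral {s..T} loss - integral {s..T} (\<lambda>t. w t * force t)"
    by (rule has_integral_unique)
  then show ?thesis by simp
qed

end

lemma uniformly_continuous_on_comp_bounded:
  fixes f :: "real \<Rightarrow> 'a::euclidean_space" and g :: "'a \<Rightarrow> real"
  assumes g: "continuous_on UNIV g" and f: "uniformly_continuous_on {0..} f" and R: "\<And>t. 0 \<le> t \<Longrightarrow> norm (f t) \<le> R"
  shows "uniformly_continuous_on {0..} (\<lambda>t. g (f t))"
proof -
  have "uniformly_continuous_on (cball 0 R) g"
    by (intro compact_uniformly_continuous compact_cball continuous_on_subset[OF g]) auto
  then have "uniformly_continuous_on (f ` {0..}) g"
    unfolding uniformly_continuous_on_def using R by (metis (no_types, lifting) atLeast_iff imageE mem_cball_0)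
  from uniformly_continuous_on_compose[OF f this] show ?thesis by (simp add: o_def)
qed

lemma bounded_integrand_Lipschitz:
  fixes F f :: "real \<Rightarrow> 'a::banach"
  assumes "\<And>s t. 0 \<le> s \<Longrightarrow> s \<le> t \<Longrightarrow> F t - F s = integral {s..t} f" "continuous_on {0..} f"
    "\<And>t. 0 \<le> t \<Longrightarrow> norm (f t) \<le> B"
  shows "\<And>s t. 0 \<le> s \<Longrightarrow> s \<le> t \<Longrightarrow> norm (F t - F s) \<le> B * (t - s)"
proof -
  fix s t :: real assume st: "0 \<le> s" "s \<le> t"
  have "norm (integral {s..t} f) \<le> B * (t - s)"
    by (rule integral_bound) (use st assms in \<open>auto intro: continuous_on_Icc_sub\<close>)
  then show "norm (F t - F s) \<le> B * (t - s)" using assms(1)[OF st] by simp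
qed

lemma Lipschitz_uniformly_continuous:
  fixes F :: "real \<Rightarrow> 'a::real_normed_vector"
  assumes "\<And>s t. 0 \<le> s \<Longrightarrow> s \<le> t \<Longrightarrow> norm (F t - F s) \<le> B * (t - s)"
  shows "uniformly_continuous_on {0..} F"
  unfolding uniformly_continuous_on_def
proof (intro allI impI)
  fix e :: real assume e: "0 < e"
  let ?B = "\<bar>B\<bar> + 1"
  have "dist (F t) (F s) < e" if "0 \<le> s" "0 \<le> t" "dist t s < e / ?B" for s t
  proof -
    have "dist (F t) (F s) \<le> ?B * dist t s"
    proof (cases "s \<le> t")
      case True
      then have "norm (F t - F s) \<le> B * (t - s)" using assms that by blast
      also have "\<dots> \<le> ?B * (t - s)" using True by (intro mult_right_mono) auto
      finally show ?thesis using True by (simp add: dist_norm)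
    next
      case False
      then have "norm (F s - F t) \<le> B * (s - t)" using assms that by (meson nle_le)
      also have "\<dots> \<le> ?B * (s - t)" using False by (intro mult_right_mono) auto
      finally show ?thesis using False by (simp add: dist_norm norm_minus_commute abs_minus_commute)
    qed
    also have "\<dots> < e" using that(3) by (simp add: pos_less_divide_eq mult.commute)
    finally show ?thesis .
  qed
  then show "\<exists>d>0. \<forall>x\<in>{0..}. \<forall>x'\<in>{0..}. dist x' x < d \<longrightarrow> dist (F x') (F x) < e"
    using e by (intro exI[of _ "e / ?B"]) auto
qed

lemma uniformly_continuous_approx:
  fixes f :: "real \<Rightarrow> real"
  assumes "\<And>e. 0 < e \<Longrightarrow> \<exists>B. uniformly_continuous_on {0..} B \<and> (\<forall>t\<ge>0. \<bar>f t - B t\<bar> \<le> e)"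
  shows "uniformly_continuous_on {0..} f"
  unfolding uniformly_continuous_on_def
proof (intro allI impI)
  fix e :: real assume e: "0 < e"
  then have "0 < e / 3" by simp
  from assms[OF this] obtain B where B: "uniformly_continuous_on {0..} B" "\<And>t. 0 \<le> t \<Longrightarrow> \<bar>f t - B t\<bar> \<le> e / 3" by blast
  obtain d where d: "d > 0" "\<And>x x'. x \<in> {0..} \<Longrightarrow> x' \<in> {0..} \<Longrightarrow> dist x' x < d \<Longrightarrow> dist (B x') (B x) < e / 3"
    using B(1) \<open>0 < e / 3\<close> unfolding uniformly_continuous_on_def by meson
  have "dist (f x') (f x) < e" if "x \<in> {0..}" "x' \<in> {0..}" "dist x' x < d" for x x'
    using d(2)[OF that] B(2)[of x] B(2)[of x'] that(1,2)
    unfolding dist_real_def abs_less_iff abs_le_iff atLeast_iff by linarith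
  then show "\<exists>d>0. \<forall>x\<in>{0..}. \<forall>x'\<in>{0..}. dist x' x < d \<longrightarrow> dist (f x') (f x) < e"
    using d(1) by blast
qed

text \<open>A substitute for a derivative that tends to 0 which does not mention a derivative: from
  some time on the function is Lipschitz with an arbitrarily small constant.\<close>

definition slow :: "(real \<Rightarrow> real) \<Rightarrow> bool" where
  "slow f \<longleftrightarrow> (\<forall>e>0. \<exists>s\<ge>0. \<forall>t\<ge>s. \<forall>h\<ge>0. \<bar>f (t + h) - f t\<bar> \<le> e * h)"

lemma slow_add: assumes "slow f" "slow g" shows "slow (\<lambda>t. f t + g t)"
  unfolding slow_def
proof (intro allI impI)
  fix e :: real assume "0 < e"
  then have e: "0 < e / 2" by simp
  obtain s1 where s1: "s1 \<ge> 0" "\<And>t h. t \<ge> s1 \<Longrightarrow> h \<ge> 0 \<Longrightarrow> \<bar>f (t + h) - f t\<bar> \<le> e / 2 * h" using assms(1) e unfolding slow_def by meson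
  obtain s2 where s2: "s2 \<ge> 0" "\<And>t h. t \<ge> s2 \<Longrightarrow> h \<ge> 0 \<Longrightarrow> \<bar>g (t + h) - g t\<bar> \<le> e / 2 * h" using assms(2) e unfolding slow_def by meson
  have "\<bar>f (t + h) + g (t + h) - (f t + g t)\<bar> \<le> e * h" if "t \<ge> max s1 s2" "h \<ge> 0" for t h
  proof -
    have "\<bar>f (t + h) - f t\<bar> \<le> e / 2 * h" "\<bar>g (t + h) - g t\<bar> \<le> e / 2 * h" using s1(2) s2(2) that by auto
    moreover have "e / 2 * h + e / 2 * h = e * h" by simp
    ultimately show ?thesis by arith
  qed
  then show "\<exists>s\<ge>0. \<forall>t\<ge>s. \<forall>h\<ge>0. \<bar>f (t + h) + g (t + h) - (f t + g t)\<bar> \<le> e * h"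
    using s1(1) by (intro exI[of _ "max s1 s2"]) auto
qed

lemma slow_Lipschitz:
  assumes "slow f" and L: "\<And>t s. 0 \<le> t \<Longrightarrow> 0 \<le> s \<Longrightarrow> \<bar>g t - g s\<bar> \<le> L * \<bar>f t - f s\<bar>" shows "slow g"
  unfolding slow_def
proof (intro allI impI)
  fix e :: real assume e: "0 < e"
  let ?L = "\<bar>L\<bar> + 1"
  have "0 < e / ?L" using e by simp
  then obtain s where s: "s \<ge> 0" "\<And>t h. t \<ge> s \<Longrightarrow> h \<ge> 0 \<Longrightarrow> \<bar>f (t + h) - f t\<bar> \<le> e / ?L * h" using assms(1) unfolding slow_def by meson
  have "\<bar>g (t + h) - g t\<bar> \<le> e * h" if "t \<ge> s" "h \<ge> 0" for t h
  proof -
    have "\<bar>g (t + h) - g t\<bar> \<le> L * \<bar>f (t + h) - f t\<bar>" using that s(1) by (intro L) auto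
    also have "\<dots> \<le> ?L * \<bar>f (t + h) - f t\<bar>" by (intro mult_right_mono) auto
    also have "\<dots> \<le> ?L * (e / ?L * h)" using s(2)[OF that] by (intro mult_left_mono) auto
    also have "\<dots> = e * h" by simp
    finally show ?thesis .
  qed
  then show "\<exists>s\<ge>0. \<forall>t\<ge>s. \<forall>h\<ge>0. \<bar>g (t + h) - g t\<bar> \<le> e * h" using s(1) by blast
qed

lemma slow_cmult: "slow f \<Longrightarrow> slow (\<lambda>t. c * f t)"
  using slow_Lipschitz[of f "\<lambda>t. c * f t" "\<bar>c\<bar>"] by (simp add: right_diff_distrib flip: abs_mult)

lemma at_top_0_D:
  fixes f :: "real \<Rightarrow> 'a::real_normed_vector"
  assumes "(f \<longlongrightarrow> 0) at_top" "0 < e" obtains s where "0 \<le> s" "\<And>t. s \<le> t \<Longrightarrow> norm (f t) < e"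
proof -
  have "\<forall>\<^sub>F t in at_top. norm (f t) < e" using assms by (auto simp: tendsto_iff)
  then obtain s where "\<And>t. s \<le> t \<Longrightarrow> norm (f t) < e" by (auto simp: eventually_at_top_linorder)
  then show ?thesis using that[of "max s 0"] by simp
qed

lemma slow_integral:
  assumes "\<And>s t. 0 \<le> s \<Longrightarrow> s \<le> t \<Longrightarrow> f t - f s = integral {s..t} w" "continuous_on {0..} w" "(w \<longlongrightarrow> 0) at_top"
  shows "slow f"
  unfolding slow_def
proof (intro allI impI)
  fix e :: real assume e: "0 < e"
  obtain s where s: "0 \<le> s" "\<And>t. s \<le> t \<Longrightarrow> norm (w t) < e" using at_top_0_D[OF assms(3) e] by blast
  have "\<bar>f (t + h) - f t\<bar> \<le> e * h" if "t \<ge> s" "h \<ge> 0" for t h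
  proof -
    have t: "0 \<le> t" "t \<le> t + h" using that s by auto
    have "norm (integral {t..t + h} w) \<le> e * (t + h - t)"
      by (rule integral_bound[OF t(2) continuous_on_Icc_sub[OF assms(2) t(1)]]) (use s(2) that in \<open>auto intro: less_imp_le\<close>)
    then show ?thesis using assms(1)[OF t] that by simp
  qed
  then show "\<exists>s\<ge>0. \<forall>t\<ge>s. \<forall>h\<ge>0. \<bar>f (t + h) - f t\<bar> \<le> e * h" using s(1) by blast
qed

text \<open>\<open>S\<close> is almost constant on late windows of fixed length H and
  \<open>g\<close> is small there, so a value of size e would change the bounded quantity
  \<open>B\<close> by at least e H / 2 over such a window.\<close>

lemma slow_tendsto_0:
  assumes S: "slow S" "continuous_on {0..} S" and g: "(g \<longlongrightarrow> 0) at_top" "continuous_on {0..} g"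
    and B: "\<And>s t. 0 \<le> s \<Longrightarrow> s \<le> t \<Longrightarrow> B t - B s = integral {s..t} (\<lambda>r. g r - S r)" "\<And>t. 0 \<le> t \<Longrightarrow> \<bar>B t\<bar> \<le> C"
  shows "(S \<longlongrightarrow> 0) at_top"
proof (rule tendstoI)
  fix e :: real assume e: "0 < e"
  \<comment> \<open>Chosen so that e H / 2 = 4 (C + 1), more than the 2 C by which \<open>B\<close>
    can change.\<close>
  define H where "H = 8 * (C + 1) / e"
  have C: "0 \<le> C" using B(2)[of 0] by simp
  then have H: "0 < H" using e by (simp add: H_def)
  have "0 < e / 4" "0 < e / (4 * H)" using e H by auto
  from at_top_0_D[OF g(1) this(1)] obtain s1 where s1: "0 \<le> s1" "\<And>t. s1 \<le> t \<Longrightarrow> norm (g t) < e / 4" by blast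
  obtain s2 where s2: "s2 \<ge> 0" "\<And>t h. t \<ge> s2 \<Longrightarrow> h \<ge> 0 \<Longrightarrow> \<bar>S (t + h) - S t\<bar> \<le> e / (4 * H) * h"
    using S(1) \<open>0 < e / (4 * H)\<close> unfolding slow_def by meson
  have "\<bar>S t\<bar> < e" if t: "max s1 s2 \<le> t" for t
  proof (rule ccontr)
    assume "\<not> \<bar>S t\<bar> < e"
    then have St: "e \<le> \<bar>S t\<bar>" by simp
    have t0: "0 \<le> t" "t \<le> t + H" using s1 t H by auto
    have "norm (integral {t..t + H} (\<lambda>r. g r - S r - (- S t))) \<le> e / 2 * (t + H - t)"
    proof (rule integral_bound[OF t0(2)])
      show "continuous_on {t..t + H} (\<lambda>r. g r - S r - (- S t))"
        using t0 by (auto intro!: continuous_on_Icc_sub continuous_intros S g)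
      fix r assume r: "r \<in> {t..t + H}"
      have "\<bar>S (t + (r - t)) - S t\<bar> \<le> e / (4 * H) * (r - t)" using t r by (intro s2) auto
      also have "\<dots> \<le> e / (4 * H) * H" using r e H by (intro mult_left_mono) auto
      finally have "\<bar>S r - S t\<bar> \<le> e / 4" using H by simp
      moreover have "\<bar>g r\<bar> < e / 4" using s1(2)[of r] r t by simp
      ultimately show "norm (g r - S r - (- S t)) \<le> e / 2"
        unfolding real_norm_def abs_le_iff abs_less_iff by linarith
    qed
    moreover have "integral {t..t + H} (\<lambda>r. g r - S r - (- S t)) = (B (t + H) - B t) + S t * H"
    proof -
      have "integral {t..t+H} (\<lambda>r. g r - S r - (- S t)) = integral {t..t+H} (\<lambda>r. g r - S r) - integral {t..t+H} (\<lambda>r. - S t)"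
        using t0 by (intro Henstock_Kurzweil_Integration.integral_diff integrable_Icc_sub continuous_intros S g) auto
      then show ?thesis using B(1)[OF t0] H by (simp add: mult.commute)
    qed
    moreover have "\<bar>B (t + H) - B t\<bar> \<le> 2 * C" using B(2)[of t] B(2)[of "t + H"] t0 by arith
    moreover have "\<bar>S t * H\<bar> = \<bar>S t\<bar> * H" using H by (simp add: abs_mult)
    moreover have "\<bar>S t * H\<bar> \<le> \<bar>B (t + H) - B t + S t * H\<bar> + \<bar>B (t + H) - B t\<bar>" by arith
    ultimately have "\<bar>S t\<bar> * H \<le> e / 2 * H + 2 * C" unfolding real_norm_def by auto
    then have "e * H \<le> e / 2 * H + 2 * C" using mult_right_mono[OF St less_imp_le[OF H]] by linarith
    then have "e / 2 * H \<le> 2 * C" by simp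
    moreover have "e / 2 * H = 4 * (C + 1)" using e by (simp add: H_def)
    ultimately show False using C by simp
  qed
  then show "\<forall>\<^sub>F t in at_top. dist (S t) 0 < e"
    unfolding eventually_at_top_linorder by (intro exI[of _ "max s1 s2"]) auto
qed

lemma comp_limit:
  fixes g :: "'a::real_normed_vector \<Rightarrow> 'b::real_normed_vector" and f :: "real \<Rightarrow> 'a"
  assumes "continuous_on UNIV g" "(f \<longlongrightarrow> 0) at_top" shows "((\<lambda>t. g (f t)) \<longlongrightarrow> g 0) at_top"
proof -
  have "isCont g 0" using assms(1) by (simp add: continuous_on_eq_continuous_at)
  from isCont_tendsto_compose[OF this assms(2)] show ?thesis .
qed

lemma bounded_comp:
  fixes g :: "'a::euclidean_space \<Rightarrow> 'b::real_normed_vector"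
  assumes "continuous_on UNIV g"
  obtains B where "0 \<le> B" "\<And>y. norm y \<le> R \<Longrightarrow> norm (g y) \<le> B"
proof -
  have "bounded (g ` cball 0 R)"
    by (rule compact_imp_bounded[OF compact_continuous_image[OF continuous_on_subset[OF assms subset_UNIV] compact_cball]])
  then obtain B where "B > 0" "\<forall>y\<in>cball 0 R. norm (g y) \<le> B" by (auto simp: bounded_pos)
  then show ?thesis using that[of B] by auto
qed

section \<open>Asymptotics of a single controller\<close>

context ctrl_traj
begin

context
  fixes R C :: real
  assumes bdd: "\<forall>t\<ge>0. norm (z t) \<le> R" "\<forall>t\<ge>0. \<bar>w t\<bar> \<le> R" "\<forall>t\<ge>0. \<bar>x t\<bar> \<le> R"
begin

lemmas bd = bdd[rule_format]

lemma force_bounded: obtains B where "\<And>t. 0 \<le> t \<Longrightarrow> \<bar>force t\<bar> \<le> B"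
proof -
  obtain B1 where B1: "\<And>y. norm y \<le> R \<Longrightarrow> norm (fc q y) \<le> B1" by (rule bounded_comp[OF C2_map_continuous[OF C2(3)]]) blast
  obtain B2 where B2: "\<And>y. norm y \<le> R \<Longrightarrow> norm (fd q y) \<le> B2" by (rule bounded_comp[OF C2_map_continuous[OF C2(4)]]) blast
  obtain B3 where B3: "\<And>y. norm y \<le> R \<Longrightarrow> norm (fk q y) \<le> B3" by (rule bounded_comp[OF C2_map_continuous[OF C2(5)]]) blast
  have "\<bar>force t\<bar> \<le> B1 + B2 + B3" if "0 \<le> t" for t
    using B1[OF bd(1)[OF that]] B2[of "w t"] B3[of "x t"] bd(2,3)[OF that] unfolding force_def by simp
  then show ?thesis by (rule that)
qed

lemma z_Lipschitz: obtains B where "0 \<le> B" "\<And>s t. 0 \<le> s \<Longrightarrow> s \<le> t \<Longrightarrow> norm (z t - z s) \<le> B * (t - s)"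
proof -
  obtain B1 where B1: "0 \<le> B1" "\<And>y. norm y \<le> R \<Longrightarrow> norm (fa q y) \<le> B1" by (rule bounded_comp[OF C2_map_continuous[OF C2(1)]]) blast
  obtain B2 where B2: "0 \<le> B2" "\<And>y. norm y \<le> R \<Longrightarrow> norm (fb q y) \<le> B2" by (rule bounded_comp[OF C2_map_continuous[OF C2(2)]]) blast
  have "norm (fa q (z t) + w t *\<^sub>R fb q (z t)) \<le> B1 + R * B2" if "0 \<le> t" for t
  proof -
    have "norm (fa q (z t) + w t *\<^sub>R fb q (z t)) \<le> norm (fa q (z t)) + \<bar>w t\<bar> * norm (fb q (z t))"
      by (metis norm_scaleR norm_triangle_ineq)
    also have "\<dots> \<le> B1 + R * B2"
      using B1(2)[OF bd(1)[OF that]] B2(2)[OF bd(1)[OF that]] bd(2)[OF that] by (intro add_mono mult_mono) auto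
    finally show ?thesis .
  qed
  note b = this
  have "norm (z t - z s) \<le> (B1 + R * B2) * (t - s)" if "0 \<le> s" "s \<le> t" for s t
    by (rule bounded_integrand_Lipschitz[OF ode _ b that]) (auto intro!: continuous_intros cont_comps cont)
  moreover have "0 \<le> B1 + R * B2" using bd(2)[of 0] B1(1) B2(1) by simp
  ultimately show ?thesis using that by blast
qed

context
  assumes loss_le: "\<forall>T\<ge>0. integral {0..T} loss \<le> C" and uc: "uniformly_continuous_on {0..} w"
begin

text \<open>The loss has a bounded integral and splits into two nonnegative terms, so Barbalat's
  lemma applies to each; definiteness passes from these values to their arguments. Uniform
  continuity of z follows from its equation, that of w enters as \<open>uc\<close> and is supplied
  later by the momentum balance.\<close>

lemma limits: "(z \<longlongrightarrow> 0) at_top" "(w \<longlongrightarrow> 0) at_top"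
proof -
  obtain B where "\<And>s t. 0 \<le> s \<Longrightarrow> s \<le> t \<Longrightarrow> norm (z t - z s) \<le> B * (t - s)" by (rule z_Lipschitz) blast
  then have ucz: "uniformly_continuous_on {0..} z" by (rule Lipschitz_uniformly_continuous)
  have cd: "continuous_on UNIV (\<lambda>s. fd q s * s)" by (intro continuous_intros C2_map_continuous C2)
  have cd': "continuous_on {0..} (\<lambda>t. fd q (w t) * w t)" by (intro continuous_intros cont_comps cont)
  have le: "integral {0..T} (\<lambda>t. dissipation q (z t)) \<le> C" "integral {0..T} (\<lambda>t. fd q (w t) * w t) \<le> C" if "0 \<le> T" for T
  proof -
    have i: "(\<lambda>t. dissipation q (z t)) integrable_on {0..T}" "(\<lambda>t. fd q (w t) * w t) integrable_on {0..T}" "loss integrable_on {0..T}"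
      by (intro integrable_Icc_sub cont_comps cont_loss cd' order_refl)+
    have "integral {0..T} (\<lambda>t. dissipation q (z t)) \<le> integral {0..T} loss" "integral {0..T} (\<lambda>t. fd q (w t) * w t) \<le> integral {0..T} loss"
      by (intro integral_le i; simp add: loss_def damping_nonneg dissipation_nonneg)+
    then show "integral {0..T} (\<lambda>t. dissipation q (z t)) \<le> C" "integral {0..T} (\<lambda>t. fd q (w t) * w t) \<le> C"
      using loss_le that by auto
  qed
  have "((\<lambda>t. dissipation q (z t)) \<longlongrightarrow> 0) at_top"
    by (rule Barbalat[OF uniformly_continuous_on_comp_bounded[OF dissipation_continuous ucz bd(1)] _ le(1)]) (simp_all add: dissipation_nonneg)
  from tendsto_0_of_definite[OF dissipation_continuous _ _ this, of R]
  show "(z \<longlongrightarrow> 0) at_top" using dissipation_pos bd(1) by blast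
  have "((\<lambda>t. fd q (w t) * w t) \<longlongrightarrow> 0) at_top"
    by (rule Barbalat[OF uniformly_continuous_on_comp_bounded[OF cd uc, of R] _ le(2)]) (simp_all add: damping_nonneg bd)
  from tendsto_0_of_definite[OF cd _ _ this, of R]
  show "(w \<longlongrightarrow> 0) at_top" using damping_pos bd(2) by simp
qed

text \<open>Controller output and damping die out, so only the spring survives in the limit.\<close>

lemma force_limit: "((\<lambda>t. force t + fk q (x t)) \<longlongrightarrow> 0) at_top"
proof -
  have "((\<lambda>t. - (fc q (z t) + fd q (w t))) \<longlongrightarrow> - (fc q 0 + fd q 0)) at_top"
    by (intro tendsto_intros comp_limit[OF C2_map_continuous[OF C2(3)]] comp_limit[OF C2_map_continuous[OF C2(4)]] limits)
  then show ?thesis by (simp add: force_def zero)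
qed

lemma V_limit: "((\<lambda>t. fV q (z t)) \<longlongrightarrow> 0) at_top"
  using comp_limit[OF C2_map_continuous[OF C2(6)] limits(1)] by (simp add: zero)

lemma slow_x: "slow x"
  by (rule slow_integral[OF pos_ode cont(2) limits(2)])

lemma slow_k: "slow (\<lambda>t. fk q (x t))"
proof -
  obtain L where L: "0 \<le> L" "\<And>s t. norm s \<le> R \<Longrightarrow> norm t \<le> R \<Longrightarrow> norm (fk q s - fk q t) \<le> L * norm (s - t)"
    using C2_map_Lipschitz[OF C2(5)] by metis
  show ?thesis by (rule slow_Lipschitz[OF slow_x, of _ L]) (use L(2) bd(3) in simp)
qed

text \<open>The right side of the controller equation tends to \<open>fa q 0\<close>, which is 0,
  because z and w tend to 0.\<close>

lemma z_slow:
  assumes "0 < e" obtains s where "0 \<le> s" "\<And>t h. s \<le> t \<Longrightarrow> 0 \<le> h \<Longrightarrow> norm (z (t + h) - z t) \<le> e * h"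
proof -
  let ?f = "\<lambda>r. fa q (z r) + w r *\<^sub>R fb q (z r)"
  have "(?f \<longlongrightarrow> fa q 0 + 0 *\<^sub>R fb q 0) at_top"
    by (intro tendsto_intros comp_limit[OF C2_map_continuous[OF C2(1)]] comp_limit[OF C2_map_continuous[OF C2(2)]] limits)
  then have "(?f \<longlongrightarrow> 0) at_top" by (simp add: zero)
  from at_top_0_D[OF this assms] obtain s where s: "0 \<le> s" "\<And>t. s \<le> t \<Longrightarrow> norm (?f t) < e" by blast
  have "norm (z (t + h) - z t) \<le> e * h" if "s \<le> t" "0 \<le> h" for t h
  proof -
    have t: "0 \<le> t" "t \<le> t + h" using that s by auto
    have "norm (integral {t..t + h} ?f) \<le> e * (t + h - t)"
    proof (rule integral_bound[OF t(2)])
      show "continuous_on {t..t + h} ?f" using t by (auto intro!: continuous_on_Icc_sub continuous_intros cont_comps cont)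
      show "norm (?f r) \<le> e" if "r \<in> {t..t + h}" for r using s(2)[of r] that \<open>s \<le> t\<close> by simp
    qed
    then show ?thesis using ode[OF t] that by simp
  qed
  then show ?thesis using that s(1) by blast
qed

text \<open>Bounds the power in the energy identity for increments. The damping gives a negative
  multiple of the squared velocity increment; the increments of \<open>fc\<close> and
  \<open>fk\<close> are at most a small multiple of h, because z and x vary slowly, and by Young's
  inequality half of the damping absorbs them.\<close>

lemma force_increment:
  obtains \<kappa> where "0 < \<kappa>" "\<And>e. 0 < e \<Longrightarrow> \<exists>s\<ge>0. \<forall>t\<ge>s. \<forall>h\<ge>0.
    (w (t + h) - w t) * (force (t + h) - force t) \<le> - \<kappa> * (w (t + h) - w t)\<^sup>2 + e * h\<^sup>2"
proof -
  obtain s0 \<kappa> where sk: "0 < s0" "0 < \<kappa>"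
    "\<And>x y. \<bar>x\<bar> \<le> s0 \<Longrightarrow> \<bar>y\<bar> \<le> s0 \<Longrightarrow> \<kappa> * (x - y)\<^sup>2 \<le> (fd q x - fd q y) * (x - y)"
    by (rule damping_strict) blast
  obtain L where L: "0 \<le> L" "\<And>s t. norm s \<le> R \<Longrightarrow> norm t \<le> R \<Longrightarrow> norm (fk q s - fk q t) \<le> L * norm (s - t)"
    using C2_map_Lipschitz[OF C2(5)] by metis
  obtain N where N: "0 \<le> N" "\<And>s t. norm s \<le> R \<Longrightarrow> norm t \<le> R \<Longrightarrow> norm (fc q s - fc q t) \<le> N * norm (s - t)"
    using C2_map_Lipschitz[OF C2(3)] by metis
  have "\<exists>s\<ge>0. \<forall>t\<ge>s. \<forall>h\<ge>0. (w (t + h) - w t) * (force (t + h) - force t) \<le> - (\<kappa> / 2) * (w (t + h) - w t)\<^sup>2 + e * h\<^sup>2"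
    if e: "0 < e" for e
  proof -
    \<comment> \<open>Makes the increments of \<open>fc\<close> and \<open>fk\<close> together at
      most sqrt (2 \<kappa> e) h, the value for which Young's inequality leaves e h^2.\<close>
    define \<epsilon> where "\<epsilon> = sqrt (2 * \<kappa> * e) / (L + N + 1)"
    have \<epsilon>: "0 < \<epsilon>" unfolding \<epsilon>_def using e sk L N by (intro divide_pos_pos) auto
    obtain s1 where s1: "0 \<le> s1" "\<And>t h. s1 \<le> t \<Longrightarrow> 0 \<le> h \<Longrightarrow> norm (z (t + h) - z t) \<le> \<epsilon> * h" using z_slow[OF \<epsilon>] by blast
    obtain s2 where s2: "0 \<le> s2" "\<And>t h. s2 \<le> t \<Longrightarrow> 0 \<le> h \<Longrightarrow> \<bar>x (t + h) - x t\<bar> \<le> \<epsilon> * h" using slow_x \<epsilon> unfolding slow_def by meson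
    obtain s3 where s3: "0 \<le> s3" "\<And>t. s3 \<le> t \<Longrightarrow> norm (w t) < s0" using at_top_0_D[OF limits(2) sk(1)] by blast
    have "(w (t + h) - w t) * (force (t + h) - force t) \<le> - (\<kappa> / 2) * (w (t + h) - w t)\<^sup>2 + e * h\<^sup>2"
      if t: "max s1 (max s2 s3) \<le> t" and h: "0 \<le> h" for t h
    proof -
      let ?d = "w (t + h) - w t"
      have t0: "0 \<le> t" using t s1 by simp
      have "\<bar>fc q (z (t + h)) - fc q (z t)\<bar> \<le> N * (\<epsilon> * h)"
        using N(2)[OF bd(1) bd(1), of "t + h" t] s1(2)[of t h] t t0 h N(1) by (auto intro: order_trans[OF _ mult_left_mono])
      moreover have "\<bar>fk q (x (t + h)) - fk q (x t)\<bar> \<le> L * (\<epsilon> * h)"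
        using L(2)[of "x (t + h)" "x t"] bd(3)[of t] bd(3)[of "t + h"] s2(2)[of t h] t t0 h L(1)
        by (auto intro: order_trans[OF _ mult_left_mono])
      ultimately have "\<bar>(fc q (z (t + h)) - fc q (z t)) + (fk q (x (t + h)) - fk q (x t))\<bar> \<le> N * (\<epsilon> * h) + L * (\<epsilon> * h)"
        by arith
      also have "\<dots> \<le> (L + N + 1) * (\<epsilon> * h)" using \<epsilon> h by (simp add: algebra_simps)
      also have "\<dots> = sqrt (2 * \<kappa> * e) * h" using L(1) N(1) by (simp add: \<epsilon>_def)
      finally have p: "\<bar>(fc q (z (t + h)) - fc q (z t)) + (fk q (x (t + h)) - fk q (x t))\<bar> \<le> sqrt (2 * \<kappa> * e) * h" (is "\<bar>?p\<bar> \<le> ?r") .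
      have "\<kappa> * ?d\<^sup>2 \<le> (fd q (w (t + h)) - fd q (w t)) * ?d"
        by (rule sk(3)) (use s3(2)[of t] s3(2)[of "t + h"] t h in auto)
      moreover have "?d * (force (t + h) - force t) = - ((fd q (w (t + h)) - fd q (w t)) * ?d) - ?p * ?d"
        by (simp add: force_def algebra_simps)
      moreover have "- ?p * ?d \<le> ?r * \<bar>?d\<bar>"
      proof -
        have "- ?p * ?d \<le> \<bar>?p\<bar> * \<bar>?d\<bar>" using abs_ge_minus_self[of "?p * ?d"] unfolding abs_mult mult_minus_left .
        also have "\<dots> \<le> ?r * \<bar>?d\<bar>" by (rule mult_right_mono[OF p]) simp
        finally show ?thesis .
      qed
      moreover have "?r * \<bar>?d\<bar> \<le> \<kappa> / 2 * ?d\<^sup>2 + e * h\<^sup>2"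
      proof -
        have "0 \<le> (sqrt \<kappa> * \<bar>?d\<bar> - sqrt (2 * e) * h)\<^sup>2" by simp
        also have "\<dots> = \<kappa> * ?d\<^sup>2 + 2 * e * h\<^sup>2 - 2 * (?r * \<bar>?d\<bar>)"
          using sk(2) e by (simp add: power2_diff power_mult_distrib real_sqrt_mult mult_ac)
        finally show ?thesis by simp
      qed
      ultimately show ?thesis unfolding mult_minus_left by linarith
    qed
    then show ?thesis using s1(1) by (intro exI[of _ "max s1 (max s2 s3)"]) auto
  qed
  then show ?thesis using that[of "\<kappa> / 2"] sk(2) by simp
qed

end

end

end

text \<open>The clamped cubic with slope q and value r at l has second derivative X + Y (l - x),
  where X is \<open>tip_moment\<close> and Y is \<open>tip_shear\<close>. Thus X = u''(l) and Y =
  -u'''(l).\<close>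

definition tip_moment :: "real \<Rightarrow> real \<Rightarrow> real \<Rightarrow> real" where
  "tip_moment l q r = 4 * q / l - 6 * r / l\<^sup>2"
definition tip_shear :: "real \<Rightarrow> real \<Rightarrow> real \<Rightarrow> real" where
  "tip_shear l q r = 12 * r / l ^ 3 - 6 * q / l\<^sup>2"

text \<open>The second derivative of the cubic clamped at \<open>0\<close> with slope \<open>q\<close> and value \<open>r\<close> at \<open>l\<close>.\<close>

definition profile :: "real \<Rightarrow> real \<Rightarrow> real \<Rightarrow> L2" where
  "profile l q r = tip_moment l q r *\<^sub>R one_l l + tip_shear l q r *\<^sub>R lin_l l"

lemma tip_inverse:
  assumes "0 < l"
  shows "l * tip_moment l q r + l\<^sup>2 / 2 * tip_shear l q r = q" "l\<^sup>2 / 2 * tip_moment l q r + l ^ 3 / 3 * tip_shear l q r = r"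
  using assms by (simp_all add: tip_moment_def tip_shear_def field_simps power2_eq_square power3_eq_cube)

lemma profile_inner:
  assumes l: "0 < l"
  shows "profile l q r \<bullet> one_l l = q" "profile l q r \<bullet> lin_l l = r"
    "profile l q r \<bullet> profile l q r = q * tip_moment l q r + r * tip_shear l q r"
proof -
  show 1: "profile l q r \<bullet> one_l l = q" "profile l q r \<bullet> lin_l l = r"
    using tip_inverse[OF l, of q r]
    unfolding profile_def inner_add_left inner_scaleR_left inner_one_lin[OF l] inner_commute[of "lin_l l" "one_l l"]
    by (simp_all add: mult.commute)
  have "profile l q r \<bullet> profile l q r = profile l q r \<bullet> (tip_moment l q r *\<^sub>R one_l l + tip_shear l q r *\<^sub>R lin_l l)"
    by (simp add: profile_def)
  then show "profile l q r \<bullet> profile l q r = q * tip_moment l q r + r * tip_shear l q r"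
    by (simp add: inner_add_right 1 mult.commute)
qed

text \<open>\<open>profile l q r\<close> is the orthogonal projection of \<open>a\<close> onto the
  span of \<open>one_l\<close> and \<open>lin_l\<close>, so this is Pythagoras. The left side
  measures the strain that the tip data do not account for.\<close>

lemma norm_diff_profile:
  fixes a :: L2
  assumes l: "0 < l"
  defines "q \<equiv> a \<bullet> one_l l" and "r \<equiv> a \<bullet> lin_l l"
  shows "(norm (a - profile l q r))\<^sup>2 = a \<bullet> a - (q * tip_moment l q r + r * tip_shear l q r)"
proof -
  have "a \<bullet> profile l q r = q * tip_moment l q r + r * tip_shear l q r"
    by (simp add: profile_def inner_add_right q_def[symmetric] r_def[symmetric] mult.commute)
  then show ?thesis
    using profile_inner(3)[OF l, of q r]
    by (simp add: power2_norm_eq_inner inner_diff_left inner_diff_right inner_commute)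
qed

text \<open>(1 - y) times the geometric sum of n + 1 terms, each at least y^n, is 1 -
  y^(n+1).\<close>

lemma peak_bound:
  fixes y :: real
  assumes "0 \<le> y" "y \<le> 1" shows "y ^ n * (1 - y) \<le> 1 / (real n + 1)"
proof -
  have "real (n + 1) * y ^ n \<le> (\<Sum>i<n+1. y ^ i)"
  proof -
    have "of_nat (card {..<n+1}) * y ^ n \<le> (\<Sum>i\<in>{..<n+1}. y ^ i)"
      by (rule sum_bounded_below) (use assms in \<open>auto intro!: power_decreasing\<close>)
    then show ?thesis by simp
  qed
  then have "(1 - y) * (real (n + 1) * y ^ n) \<le> (1 - y) * (\<Sum>i<n+1. y ^ i)"
    using assms by (intro mult_left_mono) auto
  also have "\<dots> = 1 - y ^ (n + 1)" by (rule one_diff_power_eq[symmetric])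
  also have "\<dots> \<le> 1" using assms by simp
  finally show ?thesis by (simp add: pos_le_divide_eq mult_ac add.commute)
qed

text \<open>The expression is -l times the one in \<open>peak_bound\<close> at y = x / l with
  exponent k + 1.\<close>

lemma scaled_peak_bound:
  fixes x :: real
  assumes "0 < l" "x \<in> {0..l}"
  shows "\<bar>1 / l ^ Suc k * x ^ (Suc k + 1) + (- 1 / l ^ k) * x ^ Suc k\<bar> \<le> l * (1 / (real (Suc k) + 1))"
proof -
  define w where "w = (x / l) ^ Suc k * (1 - x / l)"
  have eq: "1 / l ^ Suc k * x ^ (Suc k + 1) + (- 1 / l ^ k) * x ^ Suc k = - (l * w)"
    using assms(1) by (simp add: w_def field_simps)
  have "w \<le> 1 / (real (Suc k) + 1)" unfolding w_def by (rule peak_bound) (use assms in auto)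
  moreover have "0 \<le> w" using assms by (simp add: w_def)
  ultimately show ?thesis unfolding eq using assms(1) by (simp only: abs_minus_cancel abs_mult) (intro mult_mono; simp)
qed

text \<open>\<open>lip\<close> is where data in the domain enter: a Lipschitz bound at each time s,
  with a constant that may depend on s. The tip coordinates of the two controllers are read off a =
  u'' by the Riesz representers.\<close>

locale closed_loop = beam_motion l \<rho> \<Lambda> J M a v \<xi> \<psi> G1 G2
  + c1: ctrl_traj q1 z1 "\<lambda>t. \<xi> t / J" "\<lambda>t. a t \<bullet> one_l l"
  + c2: ctrl_traj q2 z2 "\<lambda>t. \<psi> t / M" "\<lambda>t. a t \<bullet> lin_l l"
  for l \<rho> \<Lambda> J M a v \<xi> \<psi> G1 G2 and q1 :: "'n1::finite controller" and z1 and q2 :: "'n2::finite controller" and z2 +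
  assumes force: "G1 = c1.force" "G2 = c2.force"
    and lip: "\<And>s. 0 \<le> s \<Longrightarrow> \<exists>K. \<forall>h. 0 < h \<longrightarrow> h \<le> 1 \<longrightarrow> norm (a (s + h) - a s) \<le> K * h \<and> norm (v (s + h) - v s) \<le> K * h
      \<and> \<bar>\<xi> (s + h) - \<xi> s\<bar> \<le> K * h \<and> \<bar>\<psi> (s + h) - \<psi> s\<bar> \<le> K * h"
begin

section \<open>Energy balance of the closed loop\<close>

definition total :: "real \<Rightarrow> real" where
  "total t = energy t + c1.storage t + c2.storage t"

text \<open>The power terms of the beam and of the two controllers cancel, which leaves the
  losses.\<close>

lemma total_identity:
  assumes st: "0 \<le> s" "s \<le> T"
  shows "total T - total s = - (integral {s..T} c1.loss + integral {s..T} c2.loss)"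
proof -
  have "integral {s..T} (\<lambda>t. \<xi> t * G1 t / J + \<psi> t * G2 t / M)
      = integral {s..T} (\<lambda>t. \<xi> t / J * c1.force t) + integral {s..T} (\<lambda>t. \<psi> t / M * c2.force t)"
    unfolding force times_divide_eq_left
    using pos cont(3,4) c1.cont_force c2.cont_force st(1)
    by (intro Henstock_Kurzweil_Integration.integral_add integrable_Icc_sub continuous_intros) auto
  then show ?thesis
    using energy_identity[OF st] c1.storage_identity[OF st] c2.storage_identity[OF st] by (simp add: total_def)
qed

lemma energy_nonneg: "0 \<le> energy t"
  using pos by (simp add: energy_def)

lemma total_nonneg: "0 \<le> total t"
  using energy_nonneg c1.storage_nonneg c2.storage_nonneg by (simp add: total_def)

lemma total_antimono: assumes st: "0 \<le> s" "s \<le> T" shows "total T \<le> total s"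
proof -
  have "0 \<le> integral {s..T} c1.loss" "0 \<le> integral {s..T} c2.loss"
    using st c1.cont_loss c2.cont_loss c1.loss_nonneg c2.loss_nonneg
    by (auto intro!: integral_nonneg integrable_Icc_sub)
  then show ?thesis using total_identity[OF st] by simp
qed

lemma loss_bound: assumes "0 \<le> T" shows "integral {0..T} c1.loss \<le> total 0" "integral {0..T} c2.loss \<le> total 0"
proof -
  have "0 \<le> integral {0..T} c1.loss" "0 \<le> integral {0..T} c2.loss"
    using c1.cont_loss c2.cont_loss c1.loss_nonneg c2.loss_nonneg
    by (auto intro!: integral_nonneg integrable_Icc_sub)
  then show "integral {0..T} c1.loss \<le> total 0" "integral {0..T} c2.loss \<le> total 0"
    using total_identity[OF order_refl assms] total_nonneg[of T] by auto
qed

definition state_bound :: "real \<Rightarrow> bool" where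
  "state_bound R \<longleftrightarrow> 0 \<le> R \<and> (\<forall>t\<ge>0. norm (a t) \<le> R \<and> norm (v t) \<le> R \<and> \<bar>\<xi> t\<bar> \<le> R \<and> \<bar>\<psi> t\<bar> \<le> R \<and> norm (z1 t) \<le> R \<and> norm (z2 t) \<le> R
    \<and> \<bar>\<xi> t / J\<bar> \<le> R \<and> \<bar>\<psi> t / M\<bar> \<le> R \<and> \<bar>a t \<bullet> one_l l\<bar> \<le> R \<and> \<bar>a t \<bullet> lin_l l\<bar> \<le> R)"

text \<open>All terms of \<open>total\<close> are nonnegative, so \<open>total 0\<close> bounds each
  of them for all times; the controller states are bounded because sublevel sets of the Lyapunov
  functions are.\<close>

lemma state_bound_ex: obtains R where "state_bound R"
proof -
  let ?E = "total 0"
  have E: "energy t \<le> ?E" "fV q1 (z1 t) \<le> ?E" "fV q2 (z2 t) \<le> ?E" if "0 \<le> t" for t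
  proof -
    have "total t \<le> ?E" by (rule total_antimono) (use that in auto)
    then show "energy t \<le> ?E" "fV q1 (z1 t) \<le> ?E" "fV q2 (z2 t) \<le> ?E"
      using energy_nonneg[of t] c1.storage_nonneg[of t] c2.storage_nonneg[of t] c1.V_nonneg[of "z1 t"] c2.V_nonneg[of "z2 t"]
        c1.spring_energy_nonneg[of "a t \<bullet> one_l l"] c2.spring_energy_nonneg[of "a t \<bullet> lin_l l"]
      unfolding total_def c1.storage_def c2.storage_def by linarith+
  qed
  obtain R1 where R1: "\<And>z. fV q1 z \<le> ?E \<Longrightarrow> norm z \<le> R1" using c1.V_bounded_sublevel by blast
  obtain R2 where R2: "\<And>z. fV q2 z \<le> ?E \<Longrightarrow> norm z \<le> R2" using c2.V_bounded_sublevel by blast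
  let ?A = "sqrt (2 * ?E / \<Lambda>)" and ?V = "sqrt (2 * ?E / \<rho>)" and ?X = "sqrt (2 * J * ?E)" and ?P = "sqrt (2 * M * ?E)"
  define S where "S = [?A, ?V, ?X, ?P, R1, R2, ?X / J, ?P / M, ?A * norm (one_l l), ?A * norm (lin_l l)]"
  have b: "norm (a t) \<le> ?A" "norm (v t) \<le> ?V" "\<bar>\<xi> t\<bar> \<le> ?X" "\<bar>\<psi> t\<bar> \<le> ?P" if "0 \<le> t" for t
  proof -
    have nn: "0 \<le> \<Lambda> / 2 * (a t \<bullet> a t)" "0 \<le> \<rho> / 2 * (v t \<bullet> v t)" "0 \<le> (\<xi> t)\<^sup>2 / (2 * J)" "0 \<le> (\<psi> t)\<^sup>2 / (2 * M)" using pos by auto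
    have "\<Lambda> / 2 * (a t \<bullet> a t) \<le> ?E" "\<rho> / 2 * (v t \<bullet> v t) \<le> ?E" "(\<xi> t)\<^sup>2 / (2 * J) \<le> ?E" "(\<psi> t)\<^sup>2 / (2 * M) \<le> ?E"
      using E(1)[OF that] nn unfolding energy_def by linarith+
    then have "(norm (a t))\<^sup>2 \<le> 2 * ?E / \<Lambda>" "(norm (v t))\<^sup>2 \<le> 2 * ?E / \<rho>" "\<bar>\<xi> t\<bar>\<^sup>2 \<le> 2 * J * ?E" "\<bar>\<psi> t\<bar>\<^sup>2 \<le> 2 * M * ?E"
      using pos by (simp_all add: power2_norm_eq_inner pos_le_divide_eq pos_divide_le_eq mult_ac)
    then show "norm (a t) \<le> ?A" "norm (v t) \<le> ?V" "\<bar>\<xi> t\<bar> \<le> ?X" "\<bar>\<psi> t\<bar> \<le> ?P"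
      by (intro real_le_rsqrt; simp)+
  qed
  \<comment> \<open>A crude common bound: the sum of absolute values dominates each entry of
    \<open>S\<close>.\<close>
  define R where "R = sum_list (map abs S)"
  have Rge: "y \<le> R" if "y \<in> set S" for y
  proof -
    have "\<bar>y\<bar> \<le> sum_list (map abs S)" by (rule member_le_sum_list) (use that in auto)
    then show ?thesis unfolding R_def by (rule order_trans[OF abs_ge_self])
  qed
  have "0 \<le> sum_list (map abs xs)" for xs :: "real list" by (induction xs) auto
  then have "0 \<le> R" unfolding R_def .
  moreover have "norm (a t) \<le> R \<and> norm (v t) \<le> R \<and> \<bar>\<xi> t\<bar> \<le> R \<and> \<bar>\<psi> t\<bar> \<le> R \<and> norm (z1 t) \<le> R \<and> norm (z2 t) \<le> R
    \<and> \<bar>\<xi> t / J\<bar> \<le> R \<and> \<bar>\<psi> t / M\<bar> \<le> R \<and> \<bar>a t \<bullet> one_l l\<bar> \<le> R \<and> \<bar>a t \<bullet> lin_l l\<bar> \<le> R" if "0 \<le> t" for t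
  proof -
    note bt = b[OF that]
    have "norm (z1 t) \<le> R1" "norm (z2 t) \<le> R2" using R1 R2 E(2,3)[OF that] by auto
    moreover have "\<bar>\<xi> t / J\<bar> \<le> ?X / J" "\<bar>\<psi> t / M\<bar> \<le> ?P / M" using bt(3,4) pos by (auto simp: abs_divide intro: divide_right_mono)
    moreover have "\<bar>a t \<bullet> w\<bar> \<le> ?A * norm w" for w
      by (rule order_trans[OF Cauchy_Schwarz_ineq2 mult_right_mono[OF bt(1)]]) simp
    moreover have "?A \<le> R" "?V \<le> R" "?X \<le> R" "?P \<le> R" "R1 \<le> R" "R2 \<le> R" "?X / J \<le> R" "?P / M \<le> R" "?A * norm (one_l l) \<le> R" "?A * norm (lin_l l) \<le> R"
      by (rule Rge, simp add: S_def)+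
    ultimately show ?thesis using bt by (meson order_trans)
  qed
  ultimately have "state_bound R" by (simp add: state_bound_def)
  then show ?thesis by (rule that)
qed

section \<open>Decay of velocities, controller states and equilibrium residuals\<close>

context
  fixes R assumes R: "state_bound R"
begin

lemma bd:
  assumes "0 \<le> t"
  shows "norm (a t) \<le> R" "norm (v t) \<le> R" "\<bar>\<xi> t\<bar> \<le> R" "\<bar>\<psi> t\<bar> \<le> R" "norm (z1 t) \<le> R" "norm (z2 t) \<le> R"
    "\<bar>\<xi> t / J\<bar> \<le> R" "\<bar>\<psi> t / M\<bar> \<le> R" "\<bar>a t \<bullet> one_l l\<bar> \<le> R" "\<bar>a t \<bullet> lin_l l\<bar> \<le> R"
  using R assms unfolding state_bound_def by blast+

lemma R_nonneg: "0 \<le> R" using R by (simp add: state_bound_def)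

lemma ctrl1_bounds: "\<forall>t\<ge>0. norm (z1 t) \<le> R" "\<forall>t\<ge>0. \<bar>\<xi> t / J\<bar> \<le> R" "\<forall>t\<ge>0. \<bar>a t \<bullet> one_l l\<bar> \<le> R"
  "\<forall>T\<ge>0. integral {0..T} c1.loss \<le> total 0"
  using bd(5,7,9) loss_bound(1) by blast+

lemma ctrl2_bounds: "\<forall>t\<ge>0. norm (z2 t) \<le> R" "\<forall>t\<ge>0. \<bar>\<psi> t / M\<bar> \<le> R" "\<forall>t\<ge>0. \<bar>a t \<bullet> lin_l l\<bar> \<le> R"
  "\<forall>T\<ge>0. integral {0..T} c2.loss \<le> total 0"
  using bd(6,8,10) loss_bound(2) by blast+

text \<open>The integrand of \<open>test_identity\<close> is bounded along the trajectory, so the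
  tested momentum is Lipschitz in time.\<close>

lemma test_uniformly_continuous:
  assumes f: "AC l f f1" "AC l f1 f2" "continuous_on {0..l} f2" "f 0 = 0" "f1 0 = 0"
  shows "uniformly_continuous_on {0..} (\<lambda>t. \<rho> * (v t \<bullet> toL2 l f) + \<psi> t * f l + \<xi> t * f1 l)"
proof -
  obtain B1 where B1: "\<And>t. 0 \<le> t \<Longrightarrow> \<bar>G1 t\<bar> \<le> B1" using c1.force_bounded[OF ctrl1_bounds(1-3)] force(1) by metis
  obtain B2 where B2: "\<And>t. 0 \<le> t \<Longrightarrow> \<bar>G2 t\<bar> \<le> B2" using c2.force_bounded[OF ctrl2_bounds(1-3)] force(2) by metis
  let ?f = "\<lambda>r. G2 r * f l + G1 r * f1 l - \<Lambda> * (a r \<bullet> toL2 l f2)"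
  have "norm (?f t) \<le> B2 * \<bar>f l\<bar> + B1 * \<bar>f1 l\<bar> + \<Lambda> * (R * norm (toL2 l f2))" if t: "0 \<le> t" for t
  proof -
    have "\<bar>?f t\<bar> \<le> \<bar>G2 t * f l\<bar> + \<bar>G1 t * f1 l\<bar> + \<bar>\<Lambda> * (a t \<bullet> toL2 l f2)\<bar>" by arith
    also have "\<bar>G2 t * f l\<bar> \<le> B2 * \<bar>f l\<bar>" using B2[OF t] by (simp add: abs_mult mult_right_mono)
    also have "\<bar>G1 t * f1 l\<bar> \<le> B1 * \<bar>f1 l\<bar>" using B1[OF t] by (simp add: abs_mult mult_right_mono)
    also have "\<bar>\<Lambda> * (a t \<bullet> toL2 l f2)\<bar> \<le> \<Lambda> * (R * norm (toL2 l f2))"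
    proof -
      have "\<bar>a t \<bullet> toL2 l f2\<bar> \<le> R * norm (toL2 l f2)"
        by (rule order_trans[OF Cauchy_Schwarz_ineq2 mult_right_mono[OF bd(1)[OF t]]]) simp
      then show ?thesis using pos(3) by (simp add: abs_mult)
    qed
    finally show ?thesis by simp
  qed
  note b = this
  have c: "continuous_on {0..} ?f" by (intro continuous_intros cont)
  show ?thesis
    by (rule Lipschitz_uniformly_continuous[OF bounded_integrand_Lipschitz[OF test_identity[OF _ _ f] c b]])
qed

lemma inner_v_le: assumes "0 \<le> t" "norm w \<le> B" shows "\<bar>\<rho> * (v t \<bullet> w)\<bar> \<le> \<rho> * (R * B)"
proof -
  have "\<bar>v t \<bullet> w\<bar> \<le> norm (v t) * norm w" by (rule Cauchy_Schwarz_ineq2)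
  also have "\<dots> \<le> R * B" using bd(2)[OF assms(1)] assms(2) R_nonneg by (intro mult_mono) auto
  finally show ?thesis using pos(2) by (simp add: abs_mult)
qed

text \<open>Tested with a function of unit slope (respectively value) at the tip and small \<open>L\<^sup>2\<close> norm, the
  momentum balance shows that \<open>\<xi>\<close> (respectively \<open>\<psi>\<close>) is uniformly continuous up to a small error.\<close>

lemma uniformly_continuous_xi: "uniformly_continuous_on {0..} \<xi>"
proof (rule uniformly_continuous_approx)
  fix e :: real assume e: "0 < e"
  define C where "C = \<rho> * (R * (l * sqrt l))"
  have C: "0 \<le> C" using pos R_nonneg by (simp add: C_def)
  obtain m :: nat where m: "C / e < real m" using reals_Archimedean2 by blast
  let ?n = "Suc (m + 1)"
  \<comment> \<open>With n = m + 2 this is x^(n+1) / l^n - x^n / l^(n-1): value 0 and slope 1 at l,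
    modulus at most l / (n + 1), and exponents large enough for clamping at 0.\<close>
  let ?f = "\<lambda>x. 1 / l ^ ?n * x ^ (?n + 1) + (- 1 / l ^ (m + 1)) * x ^ ?n"
  let ?f1 = "\<lambda>x. 1 / l ^ ?n * (real (?n + 1) * x ^ (?n + 1 - 1)) + (- 1 / l ^ (m + 1)) * (real ?n * x ^ (?n - 1))"
  let ?f2 = "\<lambda>x. 1 / l ^ ?n * real (?n + 1) * (real ?n * x ^ (?n - 1)) + (- 1 / l ^ (m + 1)) * real ?n * (real (?n - 1) * x ^ (?n - 1 - 1))"
  have l: "0 \<le> l" using pos by simp
  have 1: "AC l ?f ?f1" by (intro AC_add AC_pow l)
  have "AC l (\<lambda>x. 1 / l ^ ?n * real (?n + 1) * x ^ ?n + (- 1 / l ^ (m + 1)) * real ?n * x ^ (?n - 1)) ?f2"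
    by (intro AC_add AC_pow l)
  then have 2: "AC l ?f1 ?f2" by (simp add: mult.assoc)
  have fl: "?f l = 0" "?f1 l = 1" using pos(1) by (simp_all add: field_simps)
  have n: "norm (toL2 l ?f) \<le> (l * (1 / (real ?n + 1))) * sqrt l"
  proof (rule norm_agrees_le[OF agrees_toL2 _ _ l])
    show "continuous_on {0..l} ?f" "continuous_on {0..l} ?f" using AC_continuous[OF 1] by auto
    fix x assume x: "x \<in> {0..l}"
    show "\<bar>?f x\<bar> \<le> l * (1 / (real ?n + 1))" by (rule scaled_peak_bound[OF pos(1) x])
  qed
  have "\<bar>\<xi> t - (\<rho> * (v t \<bullet> toL2 l ?f) + \<psi> t * ?f l + \<xi> t * ?f1 l)\<bar> \<le> e" if "0 \<le> t" for t
  proof -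
    have "\<bar>\<rho> * (v t \<bullet> toL2 l ?f)\<bar> \<le> \<rho> * (R * ((l * (1 / (real ?n + 1))) * sqrt l))" by (rule inner_v_le[OF that n])
    also have "\<dots> = C / (real ?n + 1)" by (simp add: C_def)
    also have "\<dots> \<le> e"
    proof -
      have "C < e * real m" using m e by (simp add: pos_divide_less_eq mult.commute)
      also have "\<dots> \<le> e * (real ?n + 1)" using e by (intro mult_left_mono) auto
      finally show ?thesis by (simp add: pos_divide_le_eq)
    qed
    finally show ?thesis unfolding fl by simp
  qed
  moreover have "uniformly_continuous_on {0..} (\<lambda>t. \<rho> * (v t \<bullet> toL2 l ?f) + \<psi> t * ?f l + \<xi> t * ?f1 l)"
    by (rule test_uniformly_continuous[OF 1 2]) (use pos(1) in \<open>auto intro!: continuous_intros\<close>)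
  ultimately show "\<exists>B. uniformly_continuous_on {0..} B \<and> (\<forall>t\<ge>0. \<bar>\<xi> t - B t\<bar> \<le> e)" by blast
qed

lemma norm_power_L2: "norm (toL2 l (\<lambda>x. 1 / l ^ n * x ^ n)) = sqrt (l / (2 * real n + 1))"
proof -
  have l: "0 \<le> l" using pos by simp
  let ?f = "\<lambda>x. 1 / l ^ n * x ^ n"
  have c: "continuous_on {0..l} ?f" by (rule AC_continuous[OF AC_pow[OF l]])
  have "toL2 l ?f \<bullet> toL2 l ?f = (LBINT x:{0..l}. ?f x * ?f x)"
    by (rule inner_agrees2[OF agrees_toL2[OF c] c agrees_toL2[OF c] c])
  also have "\<dots> = (LBINT x:{0..l}. (1 / (l ^ (2 * n) * (2 * real n + 1))) * (real (2 * n + 1) * x ^ (2 * n + 1 - 1)))"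
  proof (rule set_lebesgue_integral_cong; safe?)
    fix x
    have cancel: "1 / p * r = 1 / (p * c) * (c * r)" if "c \<noteq> 0" for p r c :: real using that by simp
    have "?f x * ?f x = 1 / l ^ (2 * n) * x ^ (2 * n)"
      by (simp only: power_even_eq power2_eq_square times_divide_times_eq mult_1_left mult_1_right times_divide_eq_left times_divide_eq_right divide_divide_eq_left)
    also have "\<dots> = 1 / (l ^ (2 * n) * (2 * real n + 1)) * ((2 * real n + 1) * x ^ (2 * n))"
      by (rule cancel) linarith
    also have "\<dots> = (1 / (l ^ (2 * n) * (2 * real n + 1))) * (real (2 * n + 1) * x ^ (2 * n + 1 - 1))"
      by (simp only: add_diff_cancel_right' of_nat_add of_nat_mult of_nat_numeral of_nat_1)
    finally show "?f x * ?f x = (1 / (l ^ (2 * n) * (2 * real n + 1))) * (real (2 * n + 1) * x ^ (2 * n + 1 - 1))" .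
  qed simp
  also have "\<dots> = l / (2 * real n + 1)"
    by (rule trans[OF AC_end[OF AC_pow[OF l] l]]) (use pos(1) in simp)
  finally show ?thesis by (simp add: norm_eq_sqrt_inner)
qed

lemma uniformly_continuous_psi: "uniformly_continuous_on {0..} \<psi>"
proof (rule uniformly_continuous_approx)
  fix e :: real assume e: "0 < e"
  define C where "C = (\<rho> * R)\<^sup>2 * l"
  have C: "0 \<le> C" using pos by (simp add: C_def)
  obtain m :: nat where m: "C / e\<^sup>2 < real m" using reals_Archimedean2 by blast
  let ?n = "m + 2"
  \<comment> \<open>(x/l)^n has value 1 at l but slope n/l, so its momentum also contains
    \<open>?f1 l * \<xi> t\<close>; the uniform continuity of \<xi> proved above allows to subtract
    it.\<close>
  let ?f = "\<lambda>x. 1 / l ^ ?n * x ^ ?n" and ?f1 = "\<lambda>x. 1 / l ^ ?n * (real ?n * x ^ (?n - 1))"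
  let ?f2 = "\<lambda>x. 1 / l ^ ?n * real ?n * (real (?n - 1) * x ^ (?n - 1 - 1))"
  have l: "0 \<le> l" using pos by simp
  have 1: "AC l ?f ?f1" by (intro AC_pow l)
  have "AC l (\<lambda>x. 1 / l ^ ?n * real ?n * x ^ (?n - 1)) ?f2" by (intro AC_pow l)
  then have 2: "AC l ?f1 ?f2" by (simp add: mult.assoc)
  have fl: "?f l = 1" using pos(1) by simp
  have u: "uniformly_continuous_on {0..} (\<lambda>t. \<rho> * (v t \<bullet> toL2 l ?f) + \<psi> t * ?f l + \<xi> t * ?f1 l)"
    by (rule test_uniformly_continuous[OF 1 2]) (use pos(1) in \<open>auto intro!: continuous_intros\<close>)
  have "uniformly_continuous_on {0..} (\<lambda>t. ?f1 l * \<xi> t)"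
    by (rule bounded_linear.uniformly_continuous_on[OF bounded_linear_mult_right uniformly_continuous_xi])
  from uniformly_continuous_on_diff[OF u this]
  have "uniformly_continuous_on {0..} (\<lambda>t. \<rho> * (v t \<bullet> toL2 l ?f) + \<psi> t * ?f l + \<xi> t * ?f1 l - ?f1 l * \<xi> t)" .
  moreover have "\<bar>\<psi> t - (\<rho> * (v t \<bullet> toL2 l ?f) + \<psi> t * ?f l + \<xi> t * ?f1 l - ?f1 l * \<xi> t)\<bar> \<le> e" if "0 \<le> t" for t
  proof -
    have "\<bar>\<rho> * (v t \<bullet> toL2 l ?f)\<bar> \<le> \<rho> * (R * sqrt (l / (2 * real ?n + 1)))"
      by (rule inner_v_le[OF that eq_refl[OF norm_power_L2]])
    also have "\<dots> \<le> e"
    proof (rule power2_le_imp_le)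
      have "C < e\<^sup>2 * real m" using m e by (simp add: pos_divide_less_eq mult.commute)
      also have "\<dots> \<le> e\<^sup>2 * (2 * real ?n + 1)" using e by (intro mult_left_mono) auto
      finally have "C / (2 * real ?n + 1) \<le> e\<^sup>2" by (simp add: pos_divide_le_eq)
      moreover have "(\<rho> * (R * sqrt (l / (2 * real ?n + 1))))\<^sup>2 = C / (2 * real ?n + 1)"
        using l by (simp add: C_def power_mult_distrib)
      ultimately show "(\<rho> * (R * sqrt (l / (2 * real ?n + 1))))\<^sup>2 \<le> e\<^sup>2" by simp
    qed (use e in simp)
    finally show ?thesis unfolding fl by (simp add: mult.commute)
  qed
  ultimately show "\<exists>B. uniformly_continuous_on {0..} B \<and> (\<forall>t\<ge>0. \<bar>\<psi> t - B t\<bar> \<le> e)" by blast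
qed

lemma uniformly_continuous_velocities:
  "uniformly_continuous_on {0..} (\<lambda>t. \<xi> t / J)" "uniformly_continuous_on {0..} (\<lambda>t. \<psi> t / M)"
  using bounded_linear.uniformly_continuous_on[OF bounded_linear_divide uniformly_continuous_xi]
    bounded_linear.uniformly_continuous_on[OF bounded_linear_divide uniformly_continuous_psi] by auto

lemmas ctrl1 = ctrl1_bounds uniformly_continuous_velocities(1)
lemmas ctrl2 = ctrl2_bounds uniformly_continuous_velocities(2)

lemma state_limits: "(z1 \<longlongrightarrow> 0) at_top" "(z2 \<longlongrightarrow> 0) at_top" "(\<xi> \<longlongrightarrow> 0) at_top" "(\<psi> \<longlongrightarrow> 0) at_top"
proof -
  show "(z1 \<longlongrightarrow> 0) at_top" "(z2 \<longlongrightarrow> 0) at_top" using c1.limits(1)[OF ctrl1] c2.limits(1)[OF ctrl2] .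
  show "(\<xi> \<longlongrightarrow> 0) at_top" "(\<psi> \<longlongrightarrow> 0) at_top"
    using tendsto_mult_left[OF c1.limits(2)[OF ctrl1], of J] tendsto_mult_left[OF c2.limits(2)[OF ctrl2], of M] pos by auto
qed

lemma V_limits: "((\<lambda>t. fV q1 (z1 t)) \<longlongrightarrow> 0) at_top" "((\<lambda>t. fV q2 (z2 t)) \<longlongrightarrow> 0) at_top"
  using c1.V_limit[OF ctrl1] c2.V_limit[OF ctrl2] .

text \<open>Residual of the torque balance at the static profile with the current tip data;
  \<open>imbalance2\<close> is that of the force balance.\<close>

definition imbalance1 :: "real \<Rightarrow> real" where
  "imbalance1 t = fk q1 (a t \<bullet> one_l l) + \<Lambda> * tip_moment l (a t \<bullet> one_l l) (a t \<bullet> lin_l l)"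

definition imbalance2 :: "real \<Rightarrow> real" where
  "imbalance2 t = fk q2 (a t \<bullet> lin_l l) + \<Lambda> * tip_shear l (a t \<bullet> one_l l) (a t \<bullet> lin_l l)"

text \<open>For the two cubics the tested momentum is bounded, and its rate is force plus spring
  term, which tends to 0, minus the residual, which varies slowly; \<open>slow_tendsto_0\<close>
  applies.\<close>

lemma imbalance_limits: "(imbalance1 \<longlongrightarrow> 0) at_top" "(imbalance2 \<longlongrightarrow> 0) at_top"
proof -
  let ?q = "\<lambda>t. a t \<bullet> one_l l" and ?r = "\<lambda>t. a t \<bullet> lin_l l"
  have l: "l \<noteq> 0" using pos by simp
  note sq = c1.slow_x[OF ctrl1] and sr = c2.slow_x[OF ctrl2]
  note kc = c1.cont_comps(5) c2.cont_comps(5)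
  have bounded_test: "\<bar>\<rho> * (v t \<bullet> toL2 l f) + \<psi> t * c + \<xi> t * d\<bar> \<le> \<rho> * (R * norm (toL2 l f)) + R * \<bar>c\<bar> + R * \<bar>d\<bar>" if "0 \<le> t" for f c d t
  proof -
    have "\<bar>\<psi> t * c\<bar> \<le> R * \<bar>c\<bar>" "\<bar>\<xi> t * d\<bar> \<le> R * \<bar>d\<bar>" using bd(3,4)[OF that] by (auto simp: abs_mult mult_right_mono)
    then show ?thesis using inner_v_le[OF that order_refl, of "toL2 l f"] by arith
  qed
  have toL2: "toL2 l (\<lambda>x. c + d * (l - x)) = c *\<^sub>R one_l l + d *\<^sub>R lin_l l" for c d
  proof (rule agrees_unique)
    show "agrees l (toL2 l (\<lambda>x. c + d * (l - x))) (\<lambda>x. c * 1 + d * (l - x))"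
      using agrees_toL2[of l "\<lambda>x. c + d * (l - x)"] by (simp add: continuous_intros)
    show "agrees l (c *\<^sub>R one_l l + d *\<^sub>R lin_l l) (\<lambda>x. c * 1 + d * (l - x))"
      by (intro agrees_add agrees_scaleR agrees_one agrees_lin)
  qed
  \<comment> \<open>Hermite cubics: \<open>?f\<close> has value 0 and slope 1 at l,
    \<open>?g\<close> has value 1 and slope 0. Their second derivatives are affine, so testing
    \<open>a\<close> with these gives \<open>tip_moment\<close> and
    \<open>tip_shear\<close>.\<close>
  let ?f = "\<lambda>x. x ^ 3 / l\<^sup>2 - x\<^sup>2 / l" and ?f1 = "\<lambda>x. 3 * x\<^sup>2 / l\<^sup>2 - 2 * x / l" and ?f2 = "\<lambda>x. 4 / l + (- 6 / l\<^sup>2) * (l - x)"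
  let ?g = "\<lambda>x. 3 * x\<^sup>2 / l\<^sup>2 - 2 * x ^ 3 / l ^ 3" and ?g1 = "\<lambda>x. 6 * x / l\<^sup>2 - 6 * x\<^sup>2 / l ^ 3" and ?g2 = "\<lambda>x. - 6 / l\<^sup>2 + 12 / l ^ 3 * (l - x)"
  have f: "AC l ?f ?f1" "AC l ?f1 ?f2" "continuous_on {0..l} ?f2" "?f 0 = 0" "?f1 0 = 0" and
    g: "AC l ?g ?g1" "AC l ?g1 ?g2" "continuous_on {0..l} ?g2" "?g 0 = 0" "?g1 0 = 0"
    using l by (auto intro!: AC_C1 derivative_eq_intros continuous_intros simp: field_simps power2_eq_square power3_eq_cube)
  have fl: "?f l = 0" "?f1 l = 1" "?g l = 1" "?g1 l = 0"
    using l by (simp_all add: field_simps power2_eq_square power3_eq_cube)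
  have inner: "a t \<bullet> toL2 l ?f2 = tip_moment l (?q t) (?r t)" "a t \<bullet> toL2 l ?g2 = tip_shear l (?q t) (?r t)" for t
    unfolding toL2 by (simp_all add: inner_add_right tip_moment_def tip_shear_def algebra_simps)
  show "(imbalance1 \<longlongrightarrow> 0) at_top"
  proof (rule slow_tendsto_0)
    show "slow imbalance1"
      unfolding imbalance1_def[abs_def] tip_moment_def
      using slow_add[OF c1.slow_k[OF ctrl1] slow_add[OF slow_cmult[OF sq, of "\<Lambda> * 4 / l"] slow_cmult[OF sr, of "- \<Lambda> * 6 / l\<^sup>2"]]]
      by (simp add: algebra_simps)
    show "continuous_on {0..} imbalance1"
      unfolding imbalance1_def[abs_def] tip_moment_def by (intro continuous_intros kc cont l) (use l in auto)
    show "((\<lambda>t. G1 t + fk q1 (?q t)) \<longlongrightarrow> 0) at_top" unfolding force by (rule c1.force_limit[OF ctrl1])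
    show "continuous_on {0..} (\<lambda>t. G1 t + fk q1 (?q t))" by (intro continuous_intros kc cont)
    show "(\<rho> * (v t \<bullet> toL2 l ?f) + \<psi> t * ?f l + \<xi> t * ?f1 l) - (\<rho> * (v s \<bullet> toL2 l ?f) + \<psi> s * ?f l + \<xi> s * ?f1 l)
        = integral {s..t} (\<lambda>r. G1 r + fk q1 (?q r) - imbalance1 r)" if "0 \<le> s" "s \<le> t" for s t
      using test_identity[OF that f] by (simp only: fl inner imbalance1_def) (simp add: algebra_simps)
    show "\<bar>\<rho> * (v t \<bullet> toL2 l ?f) + \<psi> t * ?f l + \<xi> t * ?f1 l\<bar> \<le> \<rho> * (R * norm (toL2 l ?f)) + R * \<bar>?f l\<bar> + R * \<bar>?f1 l\<bar>" if "0 \<le> t" for t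
      by (rule bounded_test[OF that])
  qed
  show "(imbalance2 \<longlongrightarrow> 0) at_top"
  proof (rule slow_tendsto_0)
    show "slow imbalance2"
      unfolding imbalance2_def[abs_def] tip_shear_def
      using slow_add[OF c2.slow_k[OF ctrl2] slow_add[OF slow_cmult[OF sr, of "\<Lambda> * 12 / l ^ 3"] slow_cmult[OF sq, of "- \<Lambda> * 6 / l\<^sup>2"]]]
      by (simp add: algebra_simps)
    show "continuous_on {0..} imbalance2"
      unfolding imbalance2_def[abs_def] tip_shear_def by (intro continuous_intros kc cont l) (use l in auto)
    show "((\<lambda>t. G2 t + fk q2 (?r t)) \<longlongrightarrow> 0) at_top" unfolding force by (rule c2.force_limit[OF ctrl2])
    show "continuous_on {0..} (\<lambda>t. G2 t + fk q2 (?r t))" by (intro continuous_intros kc cont)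
    show "(\<rho> * (v t \<bullet> toL2 l ?g) + \<psi> t * ?g l + \<xi> t * ?g1 l) - (\<rho> * (v s \<bullet> toL2 l ?g) + \<psi> s * ?g l + \<xi> s * ?g1 l)
        = integral {s..t} (\<lambda>r. G2 r + fk q2 (?r r) - imbalance2 r)" if "0 \<le> s" "s \<le> t" for s t
      using test_identity[OF that g] by (simp only: fl inner imbalance2_def) (simp add: algebra_simps)
    show "\<bar>\<rho> * (v t \<bullet> toL2 l ?g) + \<psi> t * ?g l + \<xi> t * ?g1 l\<bar> \<le> \<rho> * (R * norm (toL2 l ?g)) + R * \<bar>?g l\<bar> + R * \<bar>?g1 l\<bar>" if "0 \<le> t" for t
      by (rule bounded_test[OF that])
  qed
qed

text \<open>Energy identity for the motion shifted by h minus itself: the initial energy is O(h^2)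
  by \<open>lip\<close>, the final energy is nonnegative, and \<open>force_increment\<close> bounds
  the power. Division by h^2 leaves K independent of h and T, and growth in T - s with a factor as
  small as desired.\<close>

lemma difference_bound:
  assumes e: "0 < e"
  obtains s0 where "0 \<le> s0" "\<And>s. s0 \<le> s \<Longrightarrow> \<exists>K. \<forall>T\<ge>s. \<forall>h. 0 < h \<longrightarrow> h \<le> 1 \<longrightarrow>
    integral {s..T} (\<lambda>t. ((\<xi> (t + h) - \<xi> t) / h)\<^sup>2 + ((\<psi> (t + h) - \<psi> t) / h)\<^sup>2) \<le> K + e * (T - s)"
proof -
  obtain \<kappa>1 where k1: "0 < \<kappa>1" "\<And>e. 0 < e \<Longrightarrow> \<exists>s\<ge>0. \<forall>t\<ge>s. \<forall>h\<ge>0.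
    (\<xi> (t + h) / J - \<xi> t / J) * (c1.force (t + h) - c1.force t) \<le> - \<kappa>1 * (\<xi> (t + h) / J - \<xi> t / J)\<^sup>2 + e * h\<^sup>2"
    by (rule c1.force_increment[OF ctrl1]) blast
  obtain \<kappa>2 where k2: "0 < \<kappa>2" "\<And>e. 0 < e \<Longrightarrow> \<exists>s\<ge>0. \<forall>t\<ge>s. \<forall>h\<ge>0.
    (\<psi> (t + h) / M - \<psi> t / M) * (c2.force (t + h) - c2.force t) \<le> - \<kappa>2 * (\<psi> (t + h) / M - \<psi> t / M)\<^sup>2 + e * h\<^sup>2"
    by (rule c2.force_increment[OF ctrl2]) blast
  define m where "m = min (\<kappa>1 / J\<^sup>2) (\<kappa>2 / M\<^sup>2)"
  have m: "0 < m" using k1 k2 pos by (simp add: m_def)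
  \<comment> \<open>Each controller contributes e' h^2 per unit time; after division by m the two
    add up to e h^2.\<close>
  define e' where "e' = e * m / 2"
  have e': "0 < e'" using e m by (simp add: e'_def)
  obtain s1 where s1: "0 \<le> s1" "\<And>t h. s1 \<le> t \<Longrightarrow> 0 \<le> h \<Longrightarrow>
      (\<xi> (t + h) / J - \<xi> t / J) * (c1.force (t + h) - c1.force t) \<le> - \<kappa>1 * (\<xi> (t + h) / J - \<xi> t / J)\<^sup>2 + e' * h\<^sup>2"
    using k1(2)[OF e'] by blast
  obtain s2 where s2: "0 \<le> s2" "\<And>t h. s2 \<le> t \<Longrightarrow> 0 \<le> h \<Longrightarrow>
      (\<psi> (t + h) / M - \<psi> t / M) * (c2.force (t + h) - c2.force t) \<le> - \<kappa>2 * (\<psi> (t + h) / M - \<psi> t / M)\<^sup>2 + e' * h\<^sup>2"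
    using k2(2)[OF e'] by blast
  show ?thesis
  proof (rule that[of "max s1 s2"])
    show "0 \<le> max s1 s2" using s1 by simp
    fix s assume s: "max s1 s2 \<le> s"
    then have s0: "0 \<le> s" using s1 by simp
    obtain K where K: "\<And>h. 0 < h \<Longrightarrow> h \<le> 1 \<Longrightarrow> norm (a (s + h) - a s) \<le> K * h \<and> norm (v (s + h) - v s) \<le> K * h
      \<and> \<bar>\<xi> (s + h) - \<xi> s\<bar> \<le> K * h \<and> \<bar>\<psi> (s + h) - \<psi> s\<bar> \<le> K * h" using lip[OF s0] by blast
    define C where "C = (\<Lambda> / 2 + \<rho> / 2 + 1 / (2 * J) + 1 / (2 * M)) * K\<^sup>2"
    have "integral {s..T} (\<lambda>t. ((\<xi> (t + h) - \<xi> t) / h)\<^sup>2 + ((\<psi> (t + h) - \<psi> t) / h)\<^sup>2) \<le> C / m + e * (T - s)"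
      if T: "s \<le> T" and h: "0 < h" "h \<le> 1" for T h
    proof -
      let ?x = "\<lambda>t. \<xi> (t + h) - \<xi> t" and ?p = "\<lambda>t. \<psi> (t + h) - \<psi> t"
      interpret D: beam_motion l \<rho> \<Lambda> J M "\<lambda>t. a (t + h) - a t" "\<lambda>t. v (t + h) - v t" ?x ?p "\<lambda>t. G1 (t + h) - G1 t" "\<lambda>t. G2 (t + h) - G2 t"
        by (rule shift_diff_motion) (use h in simp)
      have Es: "D.energy s \<le> C * h\<^sup>2"
      proof -
        have sq: "x\<^sup>2 \<le> K\<^sup>2 * h\<^sup>2" if "\<bar>x\<bar> \<le> K * h" for x
          using power_mono[OF that, of 2] by (simp add: power_mult_distrib)
        have "(norm (a (s + h) - a s))\<^sup>2 \<le> K\<^sup>2 * h\<^sup>2" "(norm (v (s + h) - v s))\<^sup>2 \<le> K\<^sup>2 * h\<^sup>2" "(?x s)\<^sup>2 \<le> K\<^sup>2 * h\<^sup>2" "(?p s)\<^sup>2 \<le> K\<^sup>2 * h\<^sup>2"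
          using K[OF h] by (auto intro!: sq)
        then have "\<Lambda> / 2 * (norm (a (s + h) - a s))\<^sup>2 + \<rho> / 2 * (norm (v (s + h) - v s))\<^sup>2 + (?x s)\<^sup>2 / (2 * J) + (?p s)\<^sup>2 / (2 * M)
            \<le> \<Lambda> / 2 * (K\<^sup>2 * h\<^sup>2) + \<rho> / 2 * (K\<^sup>2 * h\<^sup>2) + (K\<^sup>2 * h\<^sup>2) / (2 * J) + (K\<^sup>2 * h\<^sup>2) / (2 * M)"
          using pos by (intro add_mono mult_left_mono divide_right_mono) auto
        then show ?thesis unfolding D.energy_def C_def power2_norm_eq_inner by (simp add: algebra_simps)
      qed
      have ET: "0 \<le> D.energy T" using pos by (simp add: D.energy_def)
      let ?I = "\<lambda>t. ?x t * (G1 (t + h) - G1 t) / J + ?p t * (G2 (t + h) - G2 t) / M"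
      have iI: "?I integrable_on {s..T}"
        using pos by (intro integrable_Icc_sub[OF _ s0] continuous_intros D.cont) auto
      have iQ: "(\<lambda>t. (?x t)\<^sup>2 + (?p t)\<^sup>2) integrable_on {s..T}"
        by (intro integrable_Icc_sub[OF _ s0] continuous_intros D.cont)
      have "integral {s..T} ?I \<le> integral {s..T} (\<lambda>t. - m * ((?x t)\<^sup>2 + (?p t)\<^sup>2) + 2 * e' * h\<^sup>2)"
      proof (rule integral_le[OF iI])
        show "(\<lambda>t. - m * ((?x t)\<^sup>2 + (?p t)\<^sup>2) + 2 * e' * h\<^sup>2) integrable_on {s..T}"
          by (intro integrable_Icc_sub[OF _ s0] continuous_intros D.cont)
        fix t assume t: "t \<in> {s..T}"
        have 1: "?x t * (G1 (t + h) - G1 t) / J \<le> - \<kappa>1 * (?x t / J)\<^sup>2 + e' * h\<^sup>2"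
          using s1(2)[of t h] t s h unfolding force by (simp add: diff_divide_distrib[symmetric])
        have 2: "?p t * (G2 (t + h) - G2 t) / M \<le> - \<kappa>2 * (?p t / M)\<^sup>2 + e' * h\<^sup>2"
          using s2(2)[of t h] t s h unfolding force by (simp add: diff_divide_distrib[symmetric])
        have "m * (?x t)\<^sup>2 \<le> \<kappa>1 / J\<^sup>2 * (?x t)\<^sup>2" "m * (?p t)\<^sup>2 \<le> \<kappa>2 / M\<^sup>2 * (?p t)\<^sup>2"
          unfolding m_def by (intro mult_right_mono; simp)+
        then show "?I t \<le> - m * ((?x t)\<^sup>2 + (?p t)\<^sup>2) + 2 * e' * h\<^sup>2"
          using 1 2 by (simp add: power_divide distrib_left)
      qed
      also have "\<dots> = - m * integral {s..T} (\<lambda>t. (?x t)\<^sup>2 + (?p t)\<^sup>2) + 2 * e' * h\<^sup>2 * (T - s)"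
      proof (rule integral_unique)
        have "((\<lambda>t. 2 * e' * h\<^sup>2) has_integral 2 * e' * h\<^sup>2 * (T - s)) {s..T}"
          using has_integral_const_real[of "2 * e' * h\<^sup>2" s T] T by (simp add: mult.commute)
        then show "((\<lambda>t. - m * ((?x t)\<^sup>2 + (?p t)\<^sup>2) + 2 * e' * h\<^sup>2) has_integral
            - m * integral {s..T} (\<lambda>t. (?x t)\<^sup>2 + (?p t)\<^sup>2) + 2 * e' * h\<^sup>2 * (T - s)) {s..T}"
          by (intro has_integral_add has_integral_mult_right integrable_integral iQ)
      qed
      finally have "m * integral {s..T} (\<lambda>t. (?x t)\<^sup>2 + (?p t)\<^sup>2) \<le> C * h\<^sup>2 + 2 * e' * h\<^sup>2 * (T - s)"
        using D.energy_identity[OF s0 T] Es ET by simp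
      then have "m * integral {s..T} (\<lambda>t. (?x t)\<^sup>2 + (?p t)\<^sup>2) \<le> m * (h\<^sup>2 * (C / m + e * (T - s)))"
        using m by (simp add: e'_def algebra_simps)
      then have "integral {s..T} (\<lambda>t. (?x t)\<^sup>2 + (?p t)\<^sup>2) \<le> h\<^sup>2 * (C / m + e * (T - s))"
        using m by simp
      moreover have "integral {s..T} (\<lambda>t. (?x t / h)\<^sup>2 + (?p t / h)\<^sup>2) = integral {s..T} (\<lambda>t. (?x t)\<^sup>2 + (?p t)\<^sup>2) / h\<^sup>2"
        by (simp add: power_divide add_divide_distrib[symmetric])
      ultimately show ?thesis using h by (simp add: pos_divide_le_eq mult.commute)
    qed
    then show "\<exists>K. \<forall>T\<ge>s. \<forall>h. 0 < h \<longrightarrow> h \<le> 1 \<longrightarrow>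
      integral {s..T} (\<lambda>t. ((\<xi> (t + h) - \<xi> t) / h)\<^sup>2 + ((\<psi> (t + h) - \<psi> t) / h)\<^sup>2) \<le> K + e * (T - s)" by blast
  qed
qed

end

end

section \<open>Decay of the vibration energy\<close>

text \<open>Where the derivative vanishes its matrix has rank 0 < 1, so \<open>baby_Sard\<close>
  applies after passing to \<open>real^1\<close>.\<close>

lemma Sard_real:
  fixes f :: "real \<Rightarrow> real"
  assumes "\<And>x. x \<in> S \<Longrightarrow> (f has_real_derivative 0) (at x)"
  shows "negligible (f ` S)"
proof -
  let ?e = "axis 1 1 :: real^1"
  let ?F = "\<lambda>x::real^1. f (x $ 1) *\<^sub>R ?e"
  let ?S = "{x::real^1. x $ 1 \<in> S}"
  have "negligible (?F ` ?S)"
  proof (rule baby_Sard[where f'="\<lambda>x h. 0"])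
    fix x assume x: "x \<in> ?S"
    have 1: "((\<lambda>x::real^1. x $ 1) has_derivative (\<lambda>h. h $ 1)) (at x within ?S)"
      by (rule bounded_linear_imp_has_derivative[OF bounded_linear_vec_nth])
    have "(f has_derivative (\<lambda>h. 0)) (at (x $ 1))"
      using assms[of "x $ 1"] x by (simp add: has_field_derivative_def lambda_zero)
    then have "(f has_derivative (\<lambda>h. 0)) (at (x $ 1) within (\<lambda>x. x $ 1) ` ?S)"
      by (rule has_derivative_at_withinI)
    from has_derivative_in_compose[OF 1 this]
    have "((\<lambda>x. f (x $ 1)) has_derivative (\<lambda>h. 0)) (at x within ?S)" .
    from bounded_linear.has_derivative[OF bounded_linear_scaleR_left[of ?e] this]
    show "(?F has_derivative (\<lambda>h. 0)) (at x within ?S)" by simp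
    have "matrix (\<lambda>h::real^1. 0::real^1) = 0" by (simp add: matrix_def vec_eq_iff)
    moreover have "\<not> inj ((*v) (0::real^1^1))"
      unfolding inj_def by (metis matrix_vector_mult_0 axis_eq_0_iff zero_neq_one)
    ultimately show "rank (matrix (\<lambda>h::real^1. 0::real^1)) < CARD(1)"
      using less_rank_noninjective[of "0::real^1^1"] by simp
  qed simp
  then have "negligible ((\<lambda>x::real^1. x $ 1) ` (?F ` ?S))"
    by (rule negligible_differentiable_image_negligible[rotated])
      (auto intro!: differentiable_on_subset[OF linear_imp_differentiable_on] bounded_linear.linear bounded_linear_vec_nth)
  moreover have "f ` S \<subseteq> (\<lambda>x::real^1. x $ 1) ` (?F ` ?S)"
  proof
    fix y assume "y \<in> f ` S"
    then obtain x where x: "x \<in> S" "y = f x" by blast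
    have "y = ?F (x *\<^sub>R ?e) $ 1" "x *\<^sub>R ?e \<in> ?S" using x by (simp_all add: axis_def)
    then show "y \<in> (\<lambda>x::real^1. x $ 1) ` (?F ` ?S)" by blast
  qed
  ultimately show ?thesis by (rule negligible_subset)
qed

lemma abs_le_quadratic: "0 < (m::real) \<Longrightarrow> \<bar>d\<bar> \<le> m + d\<^sup>2 / (4 * m)"
proof -
  assume m: "0 < m"
  have eq: "(\<bar>d\<bar> - 2 * m)\<^sup>2 = d\<^sup>2 + 4 * m * m - 4 * m * \<bar>d\<bar>" by (simp add: power2_eq_square algebra_simps)
  have "4 * m * \<bar>d\<bar> \<le> d\<^sup>2 + 4 * m * m" using zero_le_power2[of "\<bar>d\<bar> - 2 * m"] unfolding eq by simp
  then show ?thesis using m by (simp add: field_simps power2_eq_square)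
qed

text \<open>Pointwise bound of the integrand in \<open>avg_multiplier_identity\<close>, with L for
  \<Lambda> and D1, D2 for the difference quotients. G1 - D1 and D2 - G2 are \<Lambda> u''(l) and
  \<Lambda> u'''(l), split into their static values L X and -L Y and errors e1, e2. The static terms
  use up exactly the strain energy of the profile, so only the excess A - (q X + r Y) remains; the
  errors are paid for by the deviations of the forces from their static values and by squared
  accelerations.\<close>

lemma multiplier_estimate:
  fixes L l X Y q r m :: real
  assumes L: "0 < L" "0 < l" and q: "q = l * X + l\<^sup>2 / 2 * Y" and r: "r = l\<^sup>2 / 2 * X + l ^ 3 / 3 * Y"
    and b: "\<bar>q\<bar> \<le> Cq" "\<bar>X\<bar> \<le> CX" and m: "0 < m"
    and C: "C = l * CX + Cq + l * Cq"
  shows "K - W - 3 * L / 2 * A + (G1 - D1)\<^sup>2 * l / (2 * L) + (G1 - D1) * q - l * (D2 - G2) * q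
    \<le> - (W + 3 * L / 2 * (A - (q * X + r * Y))) + (K + C * (\<bar>G1 - L * X\<bar> + \<bar>G2 - L * Y\<bar>) + (G1 - L * X)\<^sup>2 * l / L)
      + ((C / (4 * m) + l / L) * (D1\<^sup>2 + D2\<^sup>2) + 2 * C * m)"
proof -
  define g1 g2 where "g1 = G1 - L * X" and "g2 = G2 - L * Y"
  define e1 e2 where "e1 = g1 - D1" and "e2 = D2 - g2"
  have G: "G1 - D1 = L * X + e1" "D2 - G2 = e2 - L * Y" by (simp_all add: g1_def g2_def e1_def e2_def)
  have Cq: "0 \<le> Cq" and CX: "0 \<le> CX" using b by auto
  have Cn: "0 \<le> C" "l * CX + Cq \<le> C" "l * Cq \<le> C" using Cq CX L by (auto simp: C)
  have 1: "(L * X + e1)\<^sup>2 * l / (2 * L) = L * X * X * l / 2 + l * X * e1 + e1\<^sup>2 * l / (2 * L)"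
    using L by (simp add: power2_eq_square field_simps)
  \<comment> \<open>The static tip terms add up to 3 L / 2 times the squared norm of the profile,
    with the same factor as A carries.\<close>
  have 2: "L * X * X * l / 2 + L * X * q + l * (L * Y) * q = 3 * L / 2 * (q * X + r * Y)"
    unfolding q r by (simp add: power2_eq_square power3_eq_cube algebra_simps)
  have eq: "K - W - 3 * L / 2 * A + (G1 - D1)\<^sup>2 * l / (2 * L) + (G1 - D1) * q - l * (D2 - G2) * q
      = - (W + 3 * L / 2 * (A - (q * X + r * Y))) + K + (l * X + q) * e1 - l * q * e2 + e1\<^sup>2 * l / (2 * L)"
  proof -
    have T: "(L * X + e1) * q = L * X * q + e1 * q" "l * (e2 - L * Y) * q = l * q * e2 - l * (L * Y) * q"
      "(l * X + q) * e1 = l * X * e1 + e1 * q"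
      by (simp_all add: algebra_simps)
    have T4: "3 * L / 2 * (A - (q * X + r * Y)) = 3 * L / 2 * A - (L * X * X * l / 2 + L * X * q + l * (L * Y) * q)"
      unfolding 2 by (rule right_diff_distrib)
    have "K - W - A' + (a1 + b + c) + (d + e) - (f - g) = - (W + (A' - (a1 + d + g))) + K + (b + e) - f + c"
      for A' a1 b c d e f g :: real by simp
    then show ?thesis unfolding G 1 T T4 .
  qed
  have e: "\<bar>e1\<bar> \<le> \<bar>g1\<bar> + \<bar>D1\<bar>" "\<bar>e2\<bar> \<le> \<bar>g2\<bar> + \<bar>D2\<bar>" by (auto simp: e1_def e2_def)
  have "(l * X + q) * e1 \<le> \<bar>l * X + q\<bar> * \<bar>e1\<bar>" by (metis abs_ge_self abs_mult)
  also have "\<dots> \<le> C * (\<bar>g1\<bar> + \<bar>D1\<bar>)"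
  proof (intro mult_mono)
    have "\<bar>l * X\<bar> \<le> l * CX" using b(2) L by (simp add: abs_mult)
    then show "\<bar>l * X + q\<bar> \<le> C" using b(1) Cn by arith
  qed (use e Cn in auto)
  finally have 3: "(l * X + q) * e1 \<le> C * (\<bar>g1\<bar> + \<bar>D1\<bar>)" .
  have "- (l * q * e2) \<le> \<bar>l * q\<bar> * \<bar>e2\<bar>" by (metis abs_ge_minus_self abs_mult)
  also have "\<dots> \<le> C * (\<bar>g2\<bar> + \<bar>D2\<bar>)"
  proof (intro mult_mono)
    have "\<bar>l * q\<bar> \<le> l * Cq" using b(1) L by (simp add: abs_mult)
    then show "\<bar>l * q\<bar> \<le> C" using Cn by arith
  qed (use e Cn in auto)
  finally have 4: "- (l * q * e2) \<le> C * (\<bar>g2\<bar> + \<bar>D2\<bar>)" .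
  have "e1\<^sup>2 \<le> 2 * g1\<^sup>2 + 2 * D1\<^sup>2"
    using zero_le_power2[of "g1 + D1"] by (simp add: e1_def power2_eq_square algebra_simps)
  then have "e1\<^sup>2 * (l / (2 * L)) \<le> (2 * g1\<^sup>2 + 2 * D1\<^sup>2) * (l / (2 * L))" using L by (intro mult_right_mono) auto
  then have 5: "e1\<^sup>2 * l / (2 * L) \<le> g1\<^sup>2 * l / L + l / L * D1\<^sup>2" using L by (simp add: field_simps)
  have 6: "C * \<bar>D1\<bar> + C * \<bar>D2\<bar> \<le> C / (4 * m) * (D1\<^sup>2 + D2\<^sup>2) + 2 * C * m"
  proof -
    have "C * \<bar>D1\<bar> + C * \<bar>D2\<bar> \<le> C * (m + D1\<^sup>2 / (4 * m)) + C * (m + D2\<^sup>2 / (4 * m))"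
      by (intro add_mono mult_left_mono abs_le_quadratic m Cn)
    also have "\<dots> = C / (4 * m) * (D1\<^sup>2 + D2\<^sup>2) + 2 * C * m"
      by (simp add: distrib_left add_divide_distrib)
    finally show ?thesis .
  qed
  have 7: "0 \<le> l / L * D2\<^sup>2" using L by simp
  have 8: "(C / (4 * m) + l / L) * (D1\<^sup>2 + D2\<^sup>2) = C / (4 * m) * (D1\<^sup>2 + D2\<^sup>2) + (l / L * D1\<^sup>2 + l / L * D2\<^sup>2)"
    by (simp add: distrib_left distrib_right)
  have 9: "C * (\<bar>g1\<bar> + \<bar>D1\<bar>) = C * \<bar>g1\<bar> + C * \<bar>D1\<bar>" "C * (\<bar>g2\<bar> + \<bar>D2\<bar>) = C * \<bar>g2\<bar> + C * \<bar>D2\<bar>"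
    "C * (\<bar>g1\<bar> + \<bar>g2\<bar>) = C * \<bar>g1\<bar> + C * \<bar>g2\<bar>" by (simp_all add: distrib_left)
  have "- V + K + x - y + z \<le> - V + (K + (c1 + c2) + w) + (u + (p1 + p2) + n)"
    if "x \<le> c1 + d1" "- y \<le> c2 + d2" "z \<le> w + p1" "d1 + d2 \<le> u + n" "0 \<le> p2"
    for V x y z c1 c2 d1 d2 w p1 p2 u n :: real
    using that by linarith
  from this[OF 3[unfolded 9] 4[unfolded 9] 5 6 7] show ?thesis
    unfolding eq g1_def[symmetric] g2_def[symmetric] 8 9 .
qed

lemma norm_avg_le:
  assumes "continuous_on {0..} f" "\<And>t. 0 \<le> t \<Longrightarrow> norm (f t) \<le> R" "0 \<le> h" "0 \<le> t"
  shows "norm (avg h f t) \<le> R"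
proof -
  have "norm (integral {0..1} (\<lambda>\<tau>. f (t + h * \<tau>))) \<le> R * (1 - 0)"
  proof (rule integral_bound)
    show "continuous_on {0..1} (\<lambda>\<tau>. f (t + h * \<tau>))"
      by (rule continuous_on_compose2[OF assms(1)]) (use assms in \<open>auto intro!: continuous_intros\<close>)
  qed (use assms in auto)
  then show ?thesis by (simp add: avg_def)
qed

section \<open>Splitting of the energy and decay of its vibration part\<close>

context closed_loop
begin

definition rest :: "real \<Rightarrow> real" where
  "rest t = \<Lambda> / 2 * (norm (a t - profile l (a t \<bullet> one_l l) (a t \<bullet> lin_l l)))\<^sup>2 + \<rho> / 2 * (v t \<bullet> v t)
    + (\<xi> t)\<^sup>2 / (2 * J) + (\<psi> t)\<^sup>2 / (2 * M) + fV q1 (z1 t) + fV q2 (z2 t)"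

definition static_energy :: "real \<Rightarrow> real \<Rightarrow> real" where
  "static_energy q r = \<Lambda> / 2 * (q * tip_moment l q r + r * tip_shear l q r) + spring_energy q1 q + spring_energy q2 r"

lemma total_split: "total t = rest t + static_energy (a t \<bullet> one_l l) (a t \<bullet> lin_l l)"
  unfolding total_def energy_def c1.storage_def c2.storage_def rest_def static_energy_def norm_diff_profile[OF pos(1)]
  by (simp add: algebra_simps)

lemma rest_nonneg: "0 \<le> rest t"
  using pos c1.V_nonneg c2.V_nonneg by (simp add: rest_def)

lemma cont_profile: "continuous_on {0..} (\<lambda>t. profile l (a t \<bullet> one_l l) (a t \<bullet> lin_l l))"
  unfolding profile_def tip_moment_def tip_shear_def using pos(1) by (intro continuous_intros cont) auto

lemma cont_rest: "continuous_on {0..} rest"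
  unfolding rest_def[abs_def] using pos by (intro continuous_intros cont cont_profile c1.cont_comps(7) c2.cont_comps(7)) auto

context
  fixes R assumes R: "state_bound R"
begin

text \<open>If \<open>rest\<close> stayed above \<eta>, the integrated multiplier estimate would
  bound \<eta>/2 (T - s) by a constant plus \<eta>/4 (T - s): the pairing of v with x u' is bounded,
  the deviations of the forces tend to 0, and the accelerations are small in the mean.\<close>

lemma rest_small:
  assumes \<eta>: "0 < \<eta>" and s0: "0 \<le> s0"
  shows "\<exists>t\<ge>s0. rest t < \<eta>"
proof (rule ccontr)
  assume "\<not> ?thesis"
  then have ge: "\<And>t. s0 \<le> t \<Longrightarrow> \<eta> \<le> rest t" by (simp add: not_less)
  note bd = bd[OF R] and R0 = R_nonneg[OF R] and lim = state_limits[OF R] and Vlim = V_limits[OF R]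
  have \<eta>4: "0 < \<eta> / 4" using \<eta> by simp
  have l0: "l \<noteq> 0" using pos by simp
  define Q where "Q h t = avg h a t \<bullet> one_l l" for h t
  define S where "S h t = avg h a t \<bullet> lin_l l" for h t
  define X where "X h t = tip_moment l (Q h t) (S h t)" for h t
  define Y where "Y h t = tip_shear l (Q h t) (S h t)" for h t
  define Cq where "Cq = R * norm (one_l l)"
  define Cr where "Cr = R * norm (lin_l l)"
  define CX where "CX = 4 * Cq / l + 6 * Cr / l\<^sup>2"
  define C where "C = l * CX + Cq + l * Cq"
  define W where "W h t = \<rho> / 2 * (avg h v t \<bullet> avg h v t)" for h t
  define A where "A h t = avg h a t \<bullet> avg h a t" for h t
  \<comment> \<open>At h = 0 this dominates the beam part of \<open>rest\<close>, since 3 \<Lambda>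
    / 2 \<ge> \<Lambda> / 2.\<close>
  define \<Phi> where "\<Phi> h t = W h t + 3 * \<Lambda> / 2 * (A h t - (Q h t * X h t + S h t * Y h t))" for h t
  define \<gamma> where "\<gamma> h t = \<rho> * l / 2 * (avg h \<psi> t / M)\<^sup>2 + C * (\<bar>avg h G1 t - \<Lambda> * X h t\<bar> + \<bar>avg h G2 t - \<Lambda> * Y h t\<bar>)
    + (avg h G1 t - \<Lambda> * X h t)\<^sup>2 * l / \<Lambda>" for h t
  define I where "I h t = \<rho> * (avg h v t \<bullet> moment_op l (avg h a t))" for h t
  obtain KM where KM: "\<And>x. norm (moment_op l x) \<le> norm x * KM" "0 \<le> KM"
    using bounded_linear.nonneg_bounded[OF bounded_linear_moment_op[OF pos(1)]] by blast
  define C4 where "C4 = \<rho> * (R * (R * KM))"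
  have C: "0 \<le> C" using R0 pos unfolding C_def CX_def Cq_def Cr_def by (intro add_nonneg_nonneg mult_nonneg_nonneg divide_nonneg_pos) auto
  \<comment> \<open>Budget for the right side: 2 C \<mu> \<le> \<eta>/8, and below e with C3 e =
    \<eta>/8, together \<eta>/4. On the left, \<eta> loses at most \<eta>/4 to tip energy and
    Lyapunov functions and \<eta>/4 to \<open>\<gamma>\<close>, which leaves \<eta>/2.\<close>
  define \<mu> where "\<mu> = \<eta> / (16 * (C + 1))"
  have \<mu>: "0 < \<mu>" using \<eta> C by (simp add: \<mu>_def)
  have C\<mu>: "2 * C * \<mu> \<le> \<eta> / 8"
  proof -
    have "2 * C * \<mu> = \<eta> / 8 * (C / (C + 1))" using C by (simp add: \<mu>_def field_simps)
    also have "\<dots> \<le> \<eta> / 8 * 1" using C \<eta> by (intro mult_left_mono) auto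
    finally show ?thesis by simp
  qed
  define C3 where "C3 = C / (4 * \<mu>) + l / \<Lambda>"
  have C3: "0 < C3" using C \<mu> pos by (simp add: C3_def add_nonneg_pos)
  define e where "e = \<eta> / (8 * C3)"
  have e: "0 < e" "C3 * e = \<eta> / 8" using \<eta> C3 by (simp_all add: e_def)
  obtain s1 where s1: "0 \<le> s1" "\<And>s. s1 \<le> s \<Longrightarrow> \<exists>K. \<forall>T\<ge>s. \<forall>h. 0 < h \<longrightarrow> h \<le> 1 \<longrightarrow>
    integral {s..T} (\<lambda>t. ((\<xi> (t + h) - \<xi> t) / h)\<^sup>2 + ((\<psi> (t + h) - \<psi> t) / h)\<^sup>2) \<le> K + e * (T - s)"
    by (rule difference_bound[OF R e(1)]) blast
  have "((\<lambda>t. (\<xi> t)\<^sup>2 / (2 * J) + (\<psi> t)\<^sup>2 / (2 * M) + fV q1 (z1 t) + fV q2 (z2 t)) \<longlongrightarrow> 0\<^sup>2 / (2 * J) + 0\<^sup>2 / (2 * M) + 0 + 0) at_top"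
    using pos by (intro tendsto_intros lim Vlim) auto
  then have "((\<lambda>t. (\<xi> t)\<^sup>2 / (2 * J) + (\<psi> t)\<^sup>2 / (2 * M) + fV q1 (z1 t) + fV q2 (z2 t)) \<longlongrightarrow> 0) at_top" by simp
  from at_top_0_D[OF this \<eta>4] obtain s2 where s2: "\<And>t. s2 \<le> t \<Longrightarrow> norm ((\<xi> t)\<^sup>2 / (2 * J) + (\<psi> t)\<^sup>2 / (2 * M) + fV q1 (z1 t) + fV q2 (z2 t)) < \<eta> / 4"
    by blast
  have gt: "((\<lambda>t. G1 t - \<Lambda> * X 0 t) \<longlongrightarrow> 0) at_top" "((\<lambda>t. G2 t - \<Lambda> * Y 0 t) \<longlongrightarrow> 0) at_top"
    using tendsto_diff[OF c1.force_limit[OF ctrl1[OF R]] imbalance_limits(1)[OF R]]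
      tendsto_diff[OF c2.force_limit[OF ctrl2[OF R]] imbalance_limits(2)[OF R]]
    by (simp_all add: force imbalance1_def[OF R] imbalance2_def[OF R] X_def Y_def Q_def S_def)
  have "((\<lambda>t. \<gamma> 0 t) \<longlongrightarrow> \<rho> * l / 2 * (0 / M)\<^sup>2 + C * (\<bar>0\<bar> + \<bar>0\<bar>) + 0\<^sup>2 * l / \<Lambda>) at_top"
    unfolding \<gamma>_def avg_0 using pos by (intro tendsto_intros gt lim) auto
  then have "((\<lambda>t. \<gamma> 0 t) \<longlongrightarrow> 0) at_top" by simp
  from at_top_0_D[OF this \<eta>4] obtain s3 where s3: "\<And>t. s3 \<le> t \<Longrightarrow> norm (\<gamma> 0 t) < \<eta> / 4"
    by blast
  define s where "s = max (max s0 s1) (max s2 s3)"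
  have s: "s0 \<le> s" "s1 \<le> s" "s2 \<le> s" "s3 \<le> s" "0 \<le> s" using s0 by (auto simp: s_def)
  obtain K where K: "\<And>T h. s \<le> T \<Longrightarrow> 0 < h \<Longrightarrow> h \<le> 1 \<Longrightarrow>
    integral {s..T} (\<lambda>t. ((\<xi> (t + h) - \<xi> t) / h)\<^sup>2 + ((\<psi> (t + h) - \<psi> t) / h)\<^sup>2) \<le> K + e * (T - s)"
    using s1(2)[OF s(2)] by blast
  have main: "\<eta> / 2 * (T - s) \<le> 2 * C4 + C3 * K + \<eta> / 4 * (T - s)" if T: "s \<le> T" for T
  proof -
    define B where "B = C3 * (K + e * (T - s)) + \<eta> / 8 * (T - s)"
    \<comment> \<open>\<open>F\<close> contains no difference quotients, so it is continuous up to h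
      = 0, while the bound \<open>B\<close> does not depend on h.\<close>
    define F where "F h = integral {s..T} (\<lambda>t. \<Phi> h t - \<gamma> h t) + (I h T - I h s)" for h
    have jc: "continuous_on ({0..1} \<times> {s..T}) (\<lambda>(h, t). \<Phi> h t - \<gamma> h t)"
      unfolding \<Phi>_def \<gamma>_def W_def A_def X_def Y_def Q_def S_def tip_moment_def tip_shear_def split_beta
      using s(5) pos by (intro continuous_intros cont) auto
    have "F h \<le> B" if h: "0 < h" "h \<le> 1" for h
    proof -
      let ?D1 = "\<lambda>t. (\<xi> (t + h) - \<xi> t) / h" and ?D2 = "\<lambda>t. (\<psi> (t + h) - \<psi> t) / h"
      interpret D: beam_motion l \<rho> \<Lambda> J M "\<lambda>t. a (t + h) - a t" "\<lambda>t. v (t + h) - v t" "\<lambda>t. \<xi> (t + h) - \<xi> t" "\<lambda>t. \<psi> (t + h) - \<psi> t" "\<lambda>t. G1 (t + h) - G1 t" "\<lambda>t. G2 (t + h) - G2 t"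
        by (rule shift_diff_motion) (use h in simp)
      let ?R = "\<lambda>t. \<rho> * l / 2 * (avg h \<psi> t / M)\<^sup>2 - \<rho> / 2 * (avg h v t \<bullet> avg h v t) - 3 * \<Lambda> / 2 * (avg h a t \<bullet> avg h a t)
        + (avg h G1 t - ?D1 t)\<^sup>2 * l / (2 * \<Lambda>) + (avg h G1 t - ?D1 t) * (avg h a t \<bullet> one_l l)
        - l * (?D2 t - avg h G2 t) * (avg h a t \<bullet> one_l l)"
      have cD: "(\<lambda>t. (?D1 t)\<^sup>2 + (?D2 t)\<^sup>2) integrable_on {s..T}"
        using h by (intro integrable_Icc_sub[OF _ s(5)] continuous_intros D.cont) auto
      have cF: "(\<lambda>t. \<Phi> h t - \<gamma> h t) integrable_on {s..T}"
        unfolding \<Phi>_def \<gamma>_def W_def A_def X_def Y_def Q_def S_def tip_moment_def tip_shear_def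
        using s(5) pos h by (intro integrable_continuous_real continuous_intros cont) auto
      have r: "(?R has_integral I h T - I h s) {s..T}"
        unfolding I_def by (rule avg_multiplier_identity[OF h(1) s(5) T])
      have "((\<lambda>t. - (\<Phi> h t - \<gamma> h t) + (C3 * ((?D1 t)\<^sup>2 + (?D2 t)\<^sup>2) + 2 * C * \<mu>)) has_integral
          - integral {s..T} (\<lambda>t. \<Phi> h t - \<gamma> h t) + (C3 * integral {s..T} (\<lambda>t. (?D1 t)\<^sup>2 + (?D2 t)\<^sup>2) + (T - s) *\<^sub>R (2 * C * \<mu>))) {s..T}"
        using has_integral_const_real[of "2 * C * \<mu>" s T] T
        by (intro has_integral_add has_integral_neg has_integral_mult_right integrable_integral cD cF) auto
      then have "I h T - I h s \<le> - integral {s..T} (\<lambda>t. \<Phi> h t - \<gamma> h t) + (C3 * integral {s..T} (\<lambda>t. (?D1 t)\<^sup>2 + (?D2 t)\<^sup>2) + (T - s) *\<^sub>R (2 * C * \<mu>))"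
      proof (rule has_integral_le[OF r])
        fix t assume "t \<in> {s..T}"
        then have t: "0 \<le> t" using s(5) by simp
        have na: "norm (avg h a t) \<le> R" by (rule norm_avg_le[OF cont(1) bd(1)]) (use h t in auto)
        have bq: "\<bar>Q h t\<bar> \<le> Cq" "\<bar>S h t\<bar> \<le> Cr"
          unfolding Q_def S_def Cq_def Cr_def by (rule order_trans[OF Cauchy_Schwarz_ineq2 mult_right_mono[OF na]]; simp)+
        have bX: "\<bar>X h t\<bar> \<le> CX"
        proof -
          have "\<bar>4 * Q h t / l\<bar> \<le> 4 * Cq / l" "\<bar>6 * S h t / l\<^sup>2\<bar> \<le> 6 * Cr / l\<^sup>2"
            using bq pos(1) by (auto simp: abs_divide abs_mult intro!: divide_right_mono)
          then show ?thesis unfolding X_def tip_moment_def CX_def by arith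
        qed
        show "?R t \<le> - (\<Phi> h t - \<gamma> h t) + (C3 * ((?D1 t)\<^sup>2 + (?D2 t)\<^sup>2) + 2 * C * \<mu>)"
          using multiplier_estimate[OF pos(3,1) tip_inverse(1)[OF pos(1), symmetric, of "Q h t" "S h t"]
              tip_inverse(2)[OF pos(1), symmetric, of "S h t" "Q h t"] bq(1) bX[unfolded X_def] \<mu> C_def,
              of "\<rho> * l / 2 * (avg h \<psi> t / M)\<^sup>2" "W h t" "A h t" "avg h G1 t" "?D1 t" "?D2 t" "avg h G2 t"]
          unfolding \<Phi>_def \<gamma>_def C3_def X_def[symmetric] Y_def[symmetric] W_def[symmetric] A_def[symmetric] Q_def[symmetric]
          by linarith
      qed
      moreover have "C3 * integral {s..T} (\<lambda>t. (?D1 t)\<^sup>2 + (?D2 t)\<^sup>2) \<le> C3 * (K + e * (T - s))"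
        using K[OF T h] C3 by (intro mult_left_mono) auto
      moreover have "(T - s) *\<^sub>R (2 * C * \<mu>) \<le> \<eta> / 8 * (T - s)"
        using mult_right_mono[OF C\<mu>, of "T - s"] T by (simp add: mult_ac)
      ultimately show ?thesis unfolding F_def B_def by linarith
    qed
    moreover have "continuous_on {0..1} F"
    proof -
      have "continuous_on {0..1} (\<lambda>h. I h t)" if "0 \<le> t" for t
        unfolding I_def using that
        by (intro continuous_intros cont bounded_linear.continuous_on[OF bounded_linear_moment_op[OF pos(1)]]) auto
      then show ?thesis unfolding F_def[abs_def]
        using s(5) T by (intro continuous_intros continuous_on_integral_param[OF jc]) auto
    qed
    ultimately have "F 0 \<le> B" by (rule continuous_limit_0[rotated])
    have "\<bar>I 0 t\<bar> \<le> C4" if "0 \<le> t" for t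
    proof -
      have "\<bar>v t \<bullet> moment_op l (a t)\<bar> \<le> norm (v t) * norm (moment_op l (a t))" by (rule Cauchy_Schwarz_ineq2)
      also have "\<dots> \<le> R * (R * KM)"
        using bd(1,2)[OF that] KM(1)[of "a t"] KM(2) R0 by (intro mult_mono) (auto intro: order_trans mult_right_mono)
      finally show ?thesis using pos(2) by (simp add: I_def C4_def abs_mult)
    qed
    from this[of T] this[of s] have "I 0 T - I 0 s \<ge> - (2 * C4)" using T s(5) by (auto simp: abs_le_iff)
    moreover have "\<eta> / 2 * (T - s) \<le> integral {s..T} (\<lambda>t. \<Phi> 0 t - \<gamma> 0 t)"
    proof -
      have "integral {s..T} (\<lambda>t. \<eta> / 2) \<le> integral {s..T} (\<lambda>t. \<Phi> 0 t - \<gamma> 0 t)"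
      proof (rule integral_le)
        show "(\<lambda>t. \<Phi> 0 t - \<gamma> 0 t) integrable_on {s..T}"
          unfolding \<Phi>_def \<gamma>_def W_def A_def X_def Y_def Q_def S_def tip_moment_def tip_shear_def
          using s(5) pos by (intro integrable_continuous_real continuous_intros cont) auto
        fix t assume "t \<in> {s..T}"
        then have t: "s0 \<le> t" "s2 \<le> t" "s3 \<le> t" using s by auto
        let ?N = "(norm (a t - profile l (a t \<bullet> one_l l) (a t \<bullet> lin_l l)))\<^sup>2"
        have "\<Phi> 0 t = \<rho> / 2 * (v t \<bullet> v t) + 3 * \<Lambda> / 2 * ?N"
          unfolding \<Phi>_def W_def A_def X_def Y_def Q_def S_def avg_0 norm_diff_profile[OF pos(1)] by simp
        moreover have "0 \<le> \<Lambda> * ?N" using pos by simp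
        ultimately have "\<rho> / 2 * (v t \<bullet> v t) + \<Lambda> / 2 * ?N \<le> \<Phi> 0 t" by simp
        moreover have "\<eta> \<le> rest t" by (rule ge[OF t(1)])
        ultimately show "\<eta> / 2 \<le> \<Phi> 0 t - \<gamma> 0 t"
          using s2[OF t(2)] s3[OF t(3)] unfolding rest_def real_norm_def abs_less_iff by linarith
      qed (rule integrable_const_ivl)
      then show ?thesis using T by (simp add: mult.commute)
    qed
    ultimately have "\<eta> / 2 * (T - s) - 2 * C4 \<le> B" using \<open>F 0 \<le> B\<close> unfolding F_def by linarith
    moreover have "B = C3 * K + \<eta> / 4 * (T - s)"
    proof -
      have "B = C3 * K + C3 * e * (T - s) + \<eta> / 8 * (T - s)" by (simp add: B_def algebra_simps)
      then show ?thesis unfolding e(2) by (simp add: field_simps)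
    qed
    ultimately show ?thesis by linarith
  qed
  \<comment> \<open>Late enough for \<eta>/4 (T - s) to exceed the constant 2 C4 + C3 K.\<close>
  define T where "T = s + (\<bar>2 * C4 + C3 * K\<bar> + 1) / (\<eta> / 4)"
  have "s \<le> T" using \<eta> by (simp add: T_def)
  from main[OF this] have "\<eta> / 4 * (T - s) \<le> 2 * C4 + C3 * K" by simp
  moreover have "\<eta> / 4 * (T - s) = \<bar>2 * C4 + C3 * K\<bar> + 1" using \<eta> by (simp add: T_def)
  ultimately show False by arith
qed

lemma total_tendsto: obtains L where "(total \<longlongrightarrow> L) at_top"
proof
  let ?L = "INF t\<in>{0..}. total t"
  have bb: "bdd_below (total ` {0..})" using total_nonneg by (intro bdd_belowI2[where m=0])
  show "(total \<longlongrightarrow> ?L) at_top"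
  proof (rule order_tendstoI)
    fix y assume "y < ?L"
    then have lt: "y < total t" if "0 \<le> t" for t using cINF_lower[OF bb, of t] that by simp
    show "\<forall>\<^sub>F t in at_top. y < total t" by (rule eventually_mono[OF eventually_ge_at_top[of 0]]) (rule lt)
  next
    fix y assume "?L < y"
    then obtain s where s: "0 \<le> s" "total s < y" using cInf_less_iff[OF _ bb, of y] by auto
    have lt: "total t < y" if "s \<le> t" for t using total_antimono[OF s(1) that] s(2) by simp
    show "\<forall>\<^sub>F t in at_top. total t < y" by (rule eventually_mono[OF eventually_ge_at_top[of s]]) (rule lt)
  qed
qed

text \<open>The torque balance is linear in r and gives r = g(q), so equilibrium pairs lie on a
  curve and the static energy becomes a function of q alone. Its derivative is the torque residual
  plus g' times the force residual, hence 0 at equilibrium pairs, and Sard's theorem in one variable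
  suffices.\<close>

lemma static_energy_critical_values:
  "negligible {static_energy q r | q r. fk q1 q + \<Lambda> * tip_moment l q r = 0 \<and> fk q2 r + \<Lambda> * tip_shear l q r = 0}"
proof -
  define g where "g x = l\<^sup>2 / (6 * \<Lambda>) * (fk q1 x + 4 * \<Lambda> * x / l)" for x
  define g' where "g' x = l\<^sup>2 / (6 * \<Lambda>) * (deriv (fk q1) x + 4 * \<Lambda> / l)" for x
  define H where "H x = static_energy x (g x)" for x
  define Z where "Z = {x. fk q2 (g x) + \<Lambda> * tip_shear l x (g x) = 0}"
  have l0: "l \<noteq> 0" "\<Lambda> \<noteq> 0" using pos by auto
  have gd: "(g has_real_derivative g' x) (at x)" for x
    unfolding g_def[abs_def] g'_def
    by (rule DERIV_cmult, rule DERIV_add[OF C2_map_real_deriv(1)[OF c1.C2(5)]]) (auto intro!: derivative_eq_intros simp: l0)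
  have S1: "fk q1 x + \<Lambda> * tip_moment l x (g x) = 0" for x
    using l0 by (simp add: g_def tip_moment_def field_simps power2_eq_square)
  have "(H has_real_derivative 0) (at x)" if x: "x \<in> Z" for x
  proof -
    have 1: "((\<lambda>x. spring_energy q1 x) has_real_derivative fk q1 x) (at x)" by (rule c1.spring_energy_deriv)
    have 2: "((\<lambda>x. spring_energy q2 (g x)) has_real_derivative fk q2 (g x) * g' x) (at x)"
      by (rule DERIV_chain2[OF c2.spring_energy_deriv gd])
    have e: "\<Lambda> / 2 * (y * tip_moment l y (g y) + g y * tip_shear l y (g y))
        = 2 * \<Lambda> / l * (y * y) + (- (12 * \<Lambda> / (2 * l\<^sup>2))) * (y * g y) + 6 * \<Lambda> / l ^ 3 * (g y * g y)" for y
      using l0 by (simp add: tip_moment_def tip_shear_def field_simps power2_eq_square power3_eq_cube)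
    have "((\<lambda>x. 2 * \<Lambda> / l * (x * x) + (- (12 * \<Lambda> / (2 * l\<^sup>2))) * (x * g x) + 6 * \<Lambda> / l ^ 3 * (g x * g x)) has_real_derivative
        2 * \<Lambda> / l * (1 * x + 1 * x) + (- (12 * \<Lambda> / (2 * l\<^sup>2))) * (1 * g x + g' x * x) + 6 * \<Lambda> / l ^ 3 * (g' x * g x + g' x * g x)) (at x)"
      by (intro DERIV_add DERIV_cmult DERIV_mult DERIV_ident gd)
    moreover have "2 * \<Lambda> / l * (1 * x + 1 * x) + (- (12 * \<Lambda> / (2 * l\<^sup>2))) * (1 * g x + g' x * x) + 6 * \<Lambda> / l ^ 3 * (g' x * g x + g' x * g x)
        = \<Lambda> * (tip_moment l x (g x) + tip_shear l x (g x) * g' x)"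
      using l0 by (simp add: tip_moment_def tip_shear_def field_simps power2_eq_square power3_eq_cube)
    ultimately have 3: "((\<lambda>x. \<Lambda> / 2 * (x * tip_moment l x (g x) + g x * tip_shear l x (g x))) has_real_derivative
        \<Lambda> * (tip_moment l x (g x) + tip_shear l x (g x) * g' x)) (at x)"
      unfolding e by simp
    have "(H has_real_derivative \<Lambda> * (tip_moment l x (g x) + tip_shear l x (g x) * g' x) + fk q1 x + fk q2 (g x) * g' x) (at x)"
      unfolding H_def[abs_def] static_energy_def by (intro DERIV_add 1 2 3)
    moreover have "\<Lambda> * (tip_moment l x (g x) + tip_shear l x (g x) * g' x) + fk q1 x + fk q2 (g x) * g' x
        = (fk q1 x + \<Lambda> * tip_moment l x (g x)) + (fk q2 (g x) + \<Lambda> * tip_shear l x (g x)) * g' x"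
      by (simp add: algebra_simps)
    ultimately show ?thesis using S1[of x] x by (simp add: Z_def)
  qed
  then have "negligible (H ` Z)" by (rule Sard_real)
  moreover have "{static_energy q r | q r. fk q1 q + \<Lambda> * tip_moment l q r = 0 \<and> fk q2 r + \<Lambda> * tip_shear l q r = 0} \<subseteq> H ` Z"
  proof safe
    fix q r assume a: "fk q1 q + \<Lambda> * tip_moment l q r = 0" "fk q2 r + \<Lambda> * tip_shear l q r = 0"
    then have "r = g q" using l0 by (simp add: g_def tip_moment_def field_simps power2_eq_square)
    then show "static_energy q r \<in> H ` Z" using a(2) by (auto simp: H_def Z_def)
  qed
  ultimately show ?thesis by (rule negligible_subset)
qed

theorem rest_limit: "(rest \<longlongrightarrow> 0) at_top"
proof (rule ccontr)
  assume "\<not> (rest \<longlongrightarrow> 0) at_top"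
  then obtain d where d: "d > 0" "\<not> (\<forall>\<^sub>F t in at_top. dist (rest t) 0 < d)" by (auto simp: tendsto_iff)
  then have big: "\<exists>t\<ge>s. d \<le> rest t" for s
    using rest_nonneg by (simp add: eventually_at_top_linorder not_less)
  obtain L where L: "(total \<longlongrightarrow> L) at_top" by (rule total_tendsto)
  let ?s1 = "\<lambda>(q, r). fk q1 q + \<Lambda> * tip_moment l q r" and ?s2 = "\<lambda>(q, r). fk q2 r + \<Lambda> * tip_shear l q r"
  let ?U = "\<lambda>(q, r). static_energy q r"
  let ?qr = "\<lambda>t. (a t \<bullet> one_l l, a t \<bullet> lin_l l)"
  have l0: "l \<noteq> 0" using pos by auto
  have cse: "continuous_on UNIV (spring_energy q1)" "continuous_on UNIV (spring_energy q2)"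
    using c1.spring_energy_deriv c2.spring_energy_deriv by (meson DERIV_isCont continuous_at_imp_continuous_on)+
  have ctp: "continuous_on UNIV (\<lambda>p. tip_moment l (fst p) (snd p))" "continuous_on UNIV (\<lambda>p. tip_shear l (fst p) (snd p))"
    unfolding tip_moment_def tip_shear_def using l0 by (intro continuous_intros; simp)+
  have cc: "continuous_on UNIV ?s1" "continuous_on UNIV ?s2" "continuous_on UNIV ?U"
    unfolding static_energy_def split_beta
    by (intro continuous_on_add continuous_on_mult continuous_on_const ctp continuous_on_fst continuous_on_snd continuous_on_id
        continuous_on_compose2[OF C2_map_continuous[OF c1.C2(5), of UNIV]] continuous_on_compose2[OF C2_map_continuous[OF c2.C2(5), of UNIV]]
        continuous_on_compose2[OF cse(1)] continuous_on_compose2[OF cse(2)] subset_UNIV)+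
  have crit: "L - c \<in> {static_energy q r | q r. fk q1 q + \<Lambda> * tip_moment l q r = 0 \<and> fk q2 r + \<Lambda> * tip_shear l q r = 0}"
    if c: "0 < c" "c < d" for c
  proof -
    \<comment> \<open>Large values recur by assumption and small ones by \<open>rest_small\<close>,
      so the level c is attained after every time n.\<close>
    have "\<exists>t. real n \<le> t \<and> rest t = c" for n
    proof -
      obtain t1 where t1: "real n \<le> t1" "d \<le> rest t1" using big by blast
      have "0 \<le> t1" using t1(1) by (meson of_nat_0_le_iff order_trans)
      from rest_small[OF c(1) this] obtain t2 where t2: "t1 \<le> t2" "rest t2 < c" by blast
      have "\<exists>x\<ge>t1. x \<le> t2 \<and> rest x = c"
        by (rule IVT2'[OF less_imp_le[OF t2(2)] _ t2(1) continuous_on_Icc_sub[OF cont_rest \<open>0 \<le> t1\<close>]]) (use t1 c in simp)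
      then obtain x where "t1 \<le> x" "rest x = c" by blast
      then show ?thesis using t1(1) by (intro exI[of _ x]) simp
    qed
    then obtain \<tau> where \<tau>: "\<And>n. real n \<le> \<tau> n" "\<And>n. rest (\<tau> n) = c" by metis
    have \<tau>0: "0 \<le> \<tau> n" for n using \<tau>(1)[of n] by (meson of_nat_0_le_iff order_trans)
    have \<tau>lim: "filterlim \<tau> at_top sequentially"
      by (rule filterlim_at_top_mono[OF filterlim_real_sequentially]) (use \<tau>(1) in auto)
    have "norm (?qr (\<tau> n)) \<le> R + R" for n
      using bd(9,10)[OF R \<tau>0] norm_Pair_le[of "a (\<tau> n) \<bullet> one_l l" "a (\<tau> n) \<bullet> lin_l l"] by (smt (verit) real_norm_def)
    then have "bounded (range (\<lambda>n. ?qr (\<tau> n)))" unfolding bounded_iff by blast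
    then obtain p k where k: "strict_mono k" "((\<lambda>n. ?qr (\<tau> n)) \<circ> k) \<longlonglongrightarrow> p"
      using bounded_imp_convergent_subsequence by blast
    have klim: "filterlim (\<tau> \<circ> k) at_top sequentially"
      unfolding o_def by (rule filterlim_compose[OF \<tau>lim filterlim_subseq[OF k(1)]])
    have conv: "(\<lambda>n. g (?qr (\<tau> (k n)))) \<longlonglongrightarrow> g p" if "continuous_on UNIV g" for g :: "real \<times> real \<Rightarrow> real"
    proof -
      have "isCont g p" using that continuous_on_eq_continuous_at[OF open_UNIV, of g] by blast
      from isCont_tendsto_compose[OF this k(2)] show ?thesis by (simp add: o_def)
    qed
    have "(\<lambda>n. imbalance1 (\<tau> (k n))) \<longlonglongrightarrow> 0" "(\<lambda>n. imbalance2 (\<tau> (k n))) \<longlonglongrightarrow> 0" "(\<lambda>n. total (\<tau> (k n))) \<longlonglongrightarrow> L"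
      using filterlim_compose[OF imbalance_limits(1)[OF R] klim] filterlim_compose[OF imbalance_limits(2)[OF R] klim]
        filterlim_compose[OF L klim] by (simp_all add: o_def)
    moreover have "(\<lambda>n. imbalance1 (\<tau> (k n))) \<longlonglongrightarrow> ?s1 p" "(\<lambda>n. imbalance2 (\<tau> (k n))) \<longlonglongrightarrow> ?s2 p"
      using conv[OF cc(1)] conv[OF cc(2)] by (simp_all add: imbalance1_def[OF R] imbalance2_def[OF R])
    moreover have "(\<lambda>n. total (\<tau> (k n))) \<longlonglongrightarrow> c + ?U p"
      using tendsto_add[OF tendsto_const[of c] conv[OF cc(3)]] by (simp add: total_split \<tau>(2))
    ultimately have "?s1 p = 0" "?s2 p = 0" "L = c + ?U p" using LIMSEQ_unique by blast+
    then show ?thesis by (cases p) auto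
  qed
  \<comment> \<open>Every y in this interval is L - c with 0 < c < d.\<close>
  have "{L - d<..<L} \<subseteq> {static_energy q r | q r. fk q1 q + \<Lambda> * tip_moment l q r = 0 \<and> fk q2 r + \<Lambda> * tip_shear l q r = 0}"
  proof
    fix y assume "y \<in> {L - d<..<L}"
    then show "y \<in> {static_energy q r | q r. fk q1 q + \<Lambda> * tip_moment l q r = 0 \<and> fk q2 r + \<Lambda> * tip_shear l q r = 0}"
      using crit[of "L - y"] by simp
  qed
  then have "negligible {L - d<..<L}" by (rule negligible_subset[OF static_energy_critical_values])
  moreover have "{L - d<..<L} \<noteq> {}" using d by simp
  ultimately show False using open_not_negligible[OF open_greaterThanLessThan, of "L - d" L] by simp
qed

end

end

section \<open>Semigroups and mild solutions\<close>

text \<open>Integrating factor: exp(-B t) (B G t + A), with G the primitive of g, is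
  nonincreasing.\<close>

lemma Gronwall_const:
  fixes g :: "real \<Rightarrow> real"
  assumes g: "continuous_on {0..s} g" and B: "0 < B"
    and le: "\<And>t. t \<in> {0..s} \<Longrightarrow> g t \<le> A + B * integral {0..t} g" and t: "t \<in> {0..s}"
  shows "g t \<le> A * exp (B * t)"
proof -
  define G where "G t = integral {0..t} g" for t
  define H where "H t = exp (- (B * t)) * (B * G t + A)" for t
  have dG: "(G has_vector_derivative g x) (at x within {0..s})" if "x \<in> {0..s}" for x
    unfolding G_def using integral_has_vector_derivative[OF g that] .
  have "H t \<le> H 0"
  proof (rule DERIV_nonpos_imp_decreasing_open[of 0 t H])
    show "0 \<le> t" using t by simp
    have "continuous_on {0..s} G"
      unfolding G_def[abs_def] by (rule indefinite_integral_continuous_1[OF integrable_continuous_real[OF g]])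
    then have "continuous_on {0..t} G" by (rule continuous_on_subset) (use t in auto)
    then show "continuous_on {0..t} H" unfolding H_def[abs_def] by (intro continuous_intros)
    fix x assume x: "0 < x" "x < t"
    then have xs: "x \<in> {0..s}" "x \<in> interior {0..s}" using t by auto
    have "(G has_real_derivative g x) (at x)"
      using dG[OF xs(1)] at_within_interior[OF xs(2)] by (simp add: has_real_derivative_iff_has_vector_derivative)
    then have "(H has_real_derivative exp (- (B * x)) * (- B) * (B * G x + A) + exp (- (B * x)) * (B * g x)) (at x)"
      unfolding H_def[abs_def] by (auto intro!: derivative_eq_intros)
    moreover have "exp (- (B * x)) * (- B) * (B * G x + A) + exp (- (B * x)) * (B * g x)
        = exp (- (B * x)) * B * (g x - (A + B * G x))" by (simp add: algebra_simps)
    moreover have "exp (- (B * x)) * B * (g x - (A + B * G x)) \<le> 0"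
      using le[OF xs(1)] B by (intro mult_nonneg_nonpos) (auto simp: G_def)
    ultimately show "\<exists>y. (H has_real_derivative y) (at x) \<and> y \<le> 0" by metis
  qed
  then have "exp (- (B * t)) * (B * G t + A) \<le> A" by (simp add: H_def G_def)
  have "B * G t + A = exp (B * t) * (exp (- (B * t)) * (B * G t + A))"
    unfolding mult.assoc[symmetric] exp_add[symmetric] by simp
  also have "\<dots> \<le> exp (B * t) * A" using \<open>exp (- (B * t)) * (B * G t + A) \<le> A\<close> by (intro mult_left_mono) auto
  finally show ?thesis using le[OF t] by (simp add: G_def mult.commute)
qed

section \<open>Mild solutions in a Banach space\<close>

lemma integral_translate:
  fixes g :: "real \<Rightarrow> 'a::banach"
  assumes "g integrable_on {a + s..b + s}"
  shows "integral {a..b} (\<lambda>r. g (r + s)) = integral {a + s..b + s} g"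
proof -
  have "(g has_integral integral {a + s..b + s} g) (cbox (a + s) (b + s))" using assms by auto
  from has_integral_affinity'[OF this, of 1 s]
  have "((\<lambda>r. g (r + s)) has_integral integral {a + s..b + s} g) {a..b}" by simp
  then show ?thesis by (rule integral_unique)
qed

lemma integral_dilate:
  fixes g :: "real \<Rightarrow> 'a::banach"
  assumes "g integrable_on {0..h}" "0 < h"
  shows "integral {0..h} g = h *\<^sub>R integral {0..1} (\<lambda>r. g (h * r))"
proof -
  have "(g has_integral integral {0..h} g) (cbox 0 h)" using assms by auto
  from has_integral_affinity'[OF this assms(2), of 0]
  have "((\<lambda>r. g (h * r)) has_integral (1 / h) *\<^sub>R integral {0..h} g) {0..1}"
    using assms(2) by (simp add: divide_inverse)
  then show ?thesis using assms(2) by (simp add: integral_unique)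
qed

text \<open>\<open>U 0\<close> need not be the identity. In the application U acts on a full product
  space and \<open>U 0\<close> is the projection onto the closed subspace where the two L^2
  components vanish outside (0,l); the constant C in place of contractivity reflects the change to
  an equivalent norm.\<close>

locale bounded_semigroup =
  fixes U :: "real \<Rightarrow> 'a::banach \<Rightarrow> 'a" and C :: real
  assumes lin: "\<And>t. 0 \<le> t \<Longrightarrow> bounded_linear (U t)"
    and bound: "\<And>t x. 0 \<le> t \<Longrightarrow> norm (U t x) \<le> C * norm x" and C: "0 \<le> C"
    and semigroup: "\<And>s t x. 0 \<le> s \<Longrightarrow> 0 \<le> t \<Longrightarrow> U (s + t) x = U s (U t x)"
    and cont0: "\<And>x. ((\<lambda>t. U t x) \<longlongrightarrow> U 0 x) (at_right 0)"
begin

lemma U_diff: "0 \<le> t \<Longrightarrow> U t (x - y) = U t x - U t y"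
  by (rule linear_diff[OF bounded_linear.linear[OF lin]])

lemma increment_le: assumes "0 \<le> s" "0 \<le> t" shows "norm (U s x - U t x) \<le> C * norm (U \<bar>s - t\<bar> x - U 0 x)"
proof -
  have 1: "norm (U b x - U a x) \<le> C * norm (U (b - a) x - U 0 x)" if "0 \<le> a" "a \<le> b" for a b
    using bound[of a "U (b - a) x - U 0 x"] semigroup[of a "b - a" x] semigroup[of a 0 x] that by (simp add: U_diff)
  show ?thesis using 1[of s t] 1[of t s] assms by (cases "s \<le> t") (auto simp: norm_minus_commute)
qed

lemma joint_cont: "continuous_on ({0..} \<times> UNIV) (\<lambda>p. U (fst p) (snd p))"
  unfolding continuous_on_iff
proof safe
  fix t :: real and x and e :: real assume t: "0 \<le> t" and e: "0 < e"
  define e' where "e' = e / 2 / (C + 1)"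
  have e': "0 < e'" using e C by (simp add: e'_def)
  have "\<forall>\<^sub>F r in at_right 0. norm (U r x - U 0 x) < e'"
    using cont0[of x] e' unfolding tendsto_iff dist_norm by blast
  then obtain d where d: "0 < d" "\<And>r. 0 < r \<Longrightarrow> r < d \<Longrightarrow> norm (U r x - U 0 x) < e'"
    unfolding eventually_at_right_field by blast
  have d': "norm (U r x - U 0 x) < e'" if "0 \<le> r" "r < d" for r using d(2)[of r] that e' by (cases "r = 0") auto
  show "\<exists>d>0. \<forall>x'\<in>{0..} \<times> UNIV. dist x' (t, x) < d \<longrightarrow> dist (U (fst x') (snd x')) (U (fst (t, x)) (snd (t, x))) < e"
  proof (intro exI[of _ "min d e'"] conjI ballI impI)
    fix q :: "real \<times> 'a" assume q: "q \<in> {0..} \<times> UNIV" "dist q (t, x) < min d e'"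
    obtain s y where [simp]: "q = (s, y)" by (cases q)
    have s: "0 \<le> s" using q(1) by simp
    have "\<bar>s - t\<bar> < d" "norm (y - x) < e'"
      using q(2) dist_fst_le[of q "(t, x)"] dist_snd_le[of q "(t, x)"] by (auto simp: dist_norm)
    then have "C * norm (y - x) \<le> C * e'" "C * norm (U \<bar>s - t\<bar> x - U 0 x) \<le> C * e'"
      using C d'[of "\<bar>s - t\<bar>"] by (auto intro!: mult_left_mono)
    moreover have "norm (U s y - U t x) \<le> norm (U s (y - x)) + norm (U s x - U t x)"
      using norm_triangle_ineq[of "U s (y - x)" "U s x - U t x"] by (simp add: U_diff[OF s])
    ultimately have "norm (U s y - U t x) \<le> 2 * (C * e')"
      using bound[OF s, of "y - x"] increment_le[OF s t, of x] by linarith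
    also have "\<dots> < 2 * ((C + 1) * e')" using e' by (simp add: distrib_right)
    also have "(C + 1) * e' = e / 2"
    proof -
      have "C + 1 \<noteq> 0" using C by simp
      then show ?thesis unfolding e'_def by (metis nonzero_mult_div_cancel_left times_divide_eq_right)
    qed
    finally show "dist (U (fst q) (snd q)) (U (fst (t, x)) (snd (t, x))) < e" by (simp add: dist_norm)
  qed (use d e' in simp)
qed

lemma continuous_on_U [continuous_intros]:
  assumes "continuous_on S g" "continuous_on S f" "\<And>x. x \<in> S \<Longrightarrow> 0 \<le> g x"
  shows "continuous_on S (\<lambda>x. U (g x) (f x))"
  using continuous_on_compose2[OF joint_cont continuous_on_Pair[OF assms(1,2)]] assms(3) by auto

end

text \<open>\<open>f0\<close> says that the inhomogeneity takes its values in the range of the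
  projection \<open>U 0\<close>.\<close>

locale mild_motion = bounded_semigroup U C for U :: "real \<Rightarrow> 'a::banach \<Rightarrow> 'a" and C +
  fixes f y :: "real \<Rightarrow> 'a"
  assumes contf: "continuous_on {0..} f" and conty: "continuous_on {0..} y"
    and f0: "\<And>t. 0 \<le> t \<Longrightarrow> U 0 (f t) = f t"
    and mild: "\<And>t. 0 \<le> t \<Longrightarrow> y t = U t (y 0) + integral {0..t} (\<lambda>r. U (t - r) (f r))"
begin

lemma contf_comp [continuous_intros]:
  "continuous_on S g \<Longrightarrow> (\<And>x. x \<in> S \<Longrightarrow> 0 \<le> g x) \<Longrightarrow> continuous_on S (\<lambda>x. f (g x))"
  by (rule continuous_on_compose2[OF contf]) auto

lemma conty_comp [continuous_intros]:
  "continuous_on S g \<Longrightarrow> (\<And>x. x \<in> S \<Longrightarrow> 0 \<le> g x) \<Longrightarrow> continuous_on S (\<lambda>x. y (g x))"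
  by (rule continuous_on_compose2[OF conty]) auto

text \<open>Variation of constants restarted at time s.\<close>

lemma mild_shift:
  assumes s: "0 \<le> s" and h: "0 \<le> h"
  shows "U h (y s) = y (s + h) - integral {0..h} (\<lambda>r. U (h - r) (f (s + r)))"
proof -
  let ?g = "\<lambda>r. U (s + h - r) (f r)"
  have c: "?g integrable_on {0..s + h}"
    using s h by (intro integrable_continuous_real continuous_intros) auto
  have "U h (y s) = U h (U s (y 0)) + U h (integral {0..s} (\<lambda>r. U (s - r) (f r)))"
    using mild[OF s] linear_add[OF bounded_linear.linear[OF lin[OF h]]] by metis
  also have "U h (U s (y 0)) = U (s + h) (y 0)" using semigroup[OF h s] by (simp add: add.commute)
  also have "U h (integral {0..s} (\<lambda>r. U (s - r) (f r))) = integral {0..s} (U h \<circ> (\<lambda>r. U (s - r) (f r)))"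
    by (rule integral_linear[symmetric, OF _ lin[OF h]]) (use s in \<open>intro integrable_continuous_real continuous_intros; auto\<close>)
  also have "\<dots> = integral {0..s} ?g"
    by (rule integral_cong) (use h in \<open>simp add: semigroup[symmetric] algebra_simps\<close>)
  also have "\<dots> = integral {0..s + h} ?g - integral {s..s + h} ?g"
    using Henstock_Kurzweil_Integration.integral_combine[of 0 s "s + h" ?g] c s h by (simp add: eq_diff_eq)
  also have "integral {s..s + h} ?g = integral {0..h} (\<lambda>r. U (h - r) (f (s + r)))"
    using integral_translate[of ?g 0 s h] integrable_on_subinterval[OF c, of s "s + h"] s h
    by (simp add: add.commute algebra_simps)
  finally show ?thesis using mild[of "s + h"] s h by simp
qed

text \<open>By \<open>mild_shift\<close> the difference quotient of U at the integral of y is a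
  difference of time averages of y minus an average of U f, and these are continuous up to h = 0.
  This is why time integrals of mild solutions are classical states.\<close>

lemma mild_average:
  assumes st: "0 \<le> s" "s \<le> t"
  shows "((\<lambda>h. (1 / h) *\<^sub>R (U h (integral {s..t} y) - integral {s..t} y)) \<longlongrightarrow>
    y t - y s - integral {s..t} f) (at_right 0)"
proof -
  \<comment> \<open>This is 1/h times the integral of U (h - r) (f (\<sigma> + r)) over [0,h],
    rescaled to the unit interval so that it makes sense at h = 0.\<close>
  let ?k = "\<lambda>h \<sigma>. integral {0..1} (\<lambda>\<tau>. U (h * (1 - \<tau>)) (f (\<sigma> + h * \<tau>)))"
  let ?I = "\<lambda>h. integral {s..t} (?k h)"
  have jc: "continuous_on (({0..1} \<times> {s..t}) \<times> {0..1}) (\<lambda>(p, \<tau>). U (fst p * (1 - \<tau>)) (f (snd p + fst p * \<tau>)))"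
    unfolding split_beta using st by (intro continuous_intros) auto
  have ck: "continuous_on ({0..1} \<times> {s..t}) (\<lambda>p. ?k (fst p) (snd p))"
    using integral_continuous_on_param[where U="{0..1} \<times> {s..t}" and a="0::real" and b=1 and f="\<lambda>p \<tau>. U (fst p * (1 - \<tau>)) (f (snd p + fst p * \<tau>))"] jc
    unfolding cbox_interval .
  then have jc2: "continuous_on ({0..1} \<times> {s..t}) (\<lambda>(h, \<sigma>). ?k h \<sigma>)" by (simp add: split_beta)
  have cI: "continuous_on {0..1} ?I" using integral_continuous_on_param[where U="{0..1}" and a=s and b=t and f="?k"] jc2 unfolding cbox_interval .
  have eq: "(1 / h) *\<^sub>R (U h (integral {s..t} y) - integral {s..t} y) = avg h y t - avg h y s - ?I h"
    if h: "h \<in> {0<..1}" for h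
  proof -
    have iy: "y integrable_on {s..t}" using st by (intro integrable_continuous_real continuous_intros) auto
    have iyh: "(\<lambda>\<sigma>. y (\<sigma> + h)) integrable_on {s..t}" using st h by (intro integrable_continuous_real continuous_intros) auto
    have ik: "?k h integrable_on {s..t}"
      using h by (intro integrable_continuous_real continuous_on_compose2[OF ck, of "{s..t}" "\<lambda>\<sigma>. (h, \<sigma>)", simplified]
          continuous_on_Pair continuous_on_const continuous_on_id) auto
    have "U h (integral {s..t} y) = integral {s..t} (U h \<circ> y)"
      by (rule integral_linear[symmetric, OF iy lin]) (use h in auto)
    also have "\<dots> = integral {s..t} (\<lambda>\<sigma>. y (\<sigma> + h) - h *\<^sub>R ?k h \<sigma>)"
    proof (rule integral_cong)
      fix \<sigma> assume "\<sigma> \<in> {s..t}"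
      then have \<sigma>: "0 \<le> \<sigma>" using st by simp
      have "integral {0..h} (\<lambda>r. U (h - r) (f (\<sigma> + r))) = h *\<^sub>R ?k h \<sigma>"
        using integral_dilate[of "\<lambda>r. U (h - r) (f (\<sigma> + r))" h] h \<sigma>
        by (subst integral_dilate) (auto intro!: integrable_continuous_real continuous_intros simp: algebra_simps)
      then show "(U h \<circ> y) \<sigma> = y (\<sigma> + h) - h *\<^sub>R ?k h \<sigma>" using mild_shift[OF \<sigma>, of h] h by simp
    qed
    also have "\<dots> = integral {s..t} (\<lambda>\<sigma>. y (\<sigma> + h)) - h *\<^sub>R ?I h"
      using ik iyh by (simp add: Henstock_Kurzweil_Integration.integral_diff integrable_cmul)
    finally have "U h (integral {s..t} y) - integral {s..t} y = integral {s..t} (\<lambda>\<sigma>. y (\<sigma> + h) - y \<sigma>) - h *\<^sub>R ?I h"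
      using iyh iy by (simp add: Henstock_Kurzweil_Integration.integral_diff)
    moreover have "integral {s..t} (\<lambda>\<sigma>. y (\<sigma> + h) - y \<sigma>) = h *\<^sub>R (avg h y t - avg h y s)"
    proof -
      have "((\<lambda>\<sigma>. (1 / h) *\<^sub>R (y (\<sigma> + h) - y \<sigma>)) has_integral avg h y t - avg h y s) {s..t}"
        by (rule fundamental_theorem_of_calculus[OF st(2) avg_has_vector_derivative[OF conty]]) (use h st in auto)
      from has_integral_cmul[OF this, of h] show ?thesis using h by (simp add: integral_unique)
    qed
    ultimately show ?thesis using h by (simp add: scaleR_diff_right)
  qed
  have "continuous_on {0..1} (\<lambda>h. avg h y t - avg h y s - ?I h)"
    using st by (intro continuous_intros cI) (auto intro!: continuous_intros conty)
  then have "((\<lambda>h. avg h y t - avg h y s - ?I h) \<longlongrightarrow> avg 0 y t - avg 0 y s - ?I 0) (at 0 within {0..1})"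
    unfolding continuous_on_def by (rule bspec) simp
  then have "((\<lambda>h. avg h y t - avg h y s - ?I h) \<longlongrightarrow> avg 0 y t - avg 0 y s - ?I 0) (at_right 0)"
    unfolding at_within_Icc_at_right[OF zero_less_one] .
  moreover have "?I 0 = integral {s..t} f"
    by (rule integral_cong) (use st f0 in simp)
  ultimately have "((\<lambda>h. avg h y t - avg h y s - ?I h) \<longlongrightarrow> y t - y s - integral {s..t} f) (at_right 0)" by simp
  then show ?thesis
    by (rule Lim_transform_eventually) (use eq in \<open>auto simp: eventually_at_right_field intro!: exI[of _ 1]\<close>)
qed

text \<open>Comparison of y with its shift by h: the start contributes U h (y 0) - y 0 and an
  integral over [0,h], both O(h), and the Lipschitz bound of \<open>N\<close> on bounded sets closes
  the estimate by Gronwall. The constant may grow with s.\<close>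

lemma mild_Lipschitz:
  assumes N: "\<And>t. 0 \<le> t \<Longrightarrow> f t = N (y t)"
    and L: "\<And>R. \<exists>L. \<forall>x z. norm x \<le> R \<longrightarrow> norm z \<le> R \<longrightarrow> norm (N x - N z) \<le> L * norm (x - z)"
    and y0: "\<And>h. 0 < h \<Longrightarrow> h \<le> 1 \<Longrightarrow> norm (U h (y 0) - y 0) \<le> K * h" and y0': "U 0 (y 0) = y 0"
    and s: "0 \<le> s"
  shows "\<exists>K. \<forall>h. 0 < h \<longrightarrow> h \<le> 1 \<longrightarrow> norm (y (s + h) - y s) \<le> K * h"
proof -
  have "compact (y ` {0..s + 1})" "compact (f ` {0..s + 1})"
    using conty contf by (auto intro!: compact_continuous_image intro: continuous_on_subset)
  then have "bounded (y ` {0..s + 1})" "bounded (f ` {0..s + 1})" by (auto dest: compact_imp_bounded)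
  then obtain R F where R: "\<And>t. t \<in> {0..s + 1} \<Longrightarrow> norm (y t) \<le> R" and F: "\<And>t. t \<in> {0..s + 1} \<Longrightarrow> norm (f t) \<le> F"
    unfolding bounded_iff by blast
  obtain L0 where L0: "\<And>x z. norm x \<le> R \<Longrightarrow> norm z \<le> R \<Longrightarrow> norm (N x - N z) \<le> L0 * norm (x - z)" using L by blast
  \<comment> \<open>The added 1 makes \<open>B\<close> positive, as \<open>Gronwall_const\<close>
    asks.\<close>
  define B where "B = C * \<bar>L0\<bar> + 1"
  have B: "0 < B" using C by (simp add: B_def add_nonneg_pos)
  define A where "A = C * K + C * F"
  have "norm (y (s + h) - y s) \<le> (A * exp (B * s)) * h" if h: "0 < h" "h \<le> 1" for h
  proof -
    let ?g = "\<lambda>t. norm (y (t + h) - y t)"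
    have cg: "continuous_on {0..s} ?g" using h by (intro continuous_intros) auto
    have "?g t \<le> A * h + B * integral {0..t} ?g" if t: "t \<in> {0..s}" for t
    proof -
      have t0: "0 \<le> t" "t \<le> s" using t by auto
      let ?w = "\<lambda>r. U (t + h - r) (f r)"
      have i1: "?w integrable_on {0..t + h}" using t0 h by (intro integrable_continuous_real continuous_intros) auto
      have i2: "(\<lambda>r. U (t - r) (f (r + h))) integrable_on {0..t}" "(\<lambda>r. U (t - r) (f r)) integrable_on {0..t}"
        using t0 h by (intro integrable_continuous_real continuous_intros; auto)+
      have "y (t + h) = U t (U h (y 0)) + (integral {0..h} ?w + integral {h..t + h} ?w)"
        using mild[of "t + h"] semigroup[of t h "y 0"] Henstock_Kurzweil_Integration.integral_combine[OF _ _ i1, of h] t0 h by simp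
      moreover have "integral {h..t + h} ?w = integral {0..t} (\<lambda>r. U (t - r) (f (r + h)))"
          using integral_translate[of ?w 0 h t] integrable_on_subinterval[OF i1, of h "t + h"] t0 h
          by (simp add: algebra_simps)
      moreover have "integral {0..t} (\<lambda>r. U (t - r) (f (r + h) - f r))
          = integral {0..t} (\<lambda>r. U (t - r) (f (r + h)) - U (t - r) (f r))"
        by (rule integral_cong) (simp add: U_diff)
      ultimately have "y (t + h) - y t = U t (U h (y 0) - y 0) + integral {0..h} ?w
          + integral {0..t} (\<lambda>r. U (t - r) (f (r + h) - f r))"
        using mild[OF t0(1)] t0 i2 by (simp add: U_diff Henstock_Kurzweil_Integration.integral_diff)
      then have "?g t \<le> norm (U t (U h (y 0) - y 0)) + norm (integral {0..h} ?w) + norm (integral {0..t} (\<lambda>r. U (t - r) (f (r + h) - f r)))"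
        by (simp only: order_trans[OF norm_triangle_ineq add_right_mono[OF norm_triangle_ineq]])
      moreover have "norm (U t (U h (y 0) - y 0)) \<le> C * (K * h)"
        using bound[OF t0(1), of "U h (y 0) - y 0"] mult_left_mono[OF y0[OF h] C] by linarith
      moreover have "norm (integral {0..h} ?w) \<le> C * F * (h - 0)"
      proof (rule integral_bound)
        show "continuous_on {0..h} ?w" using t0 h by (intro continuous_intros) auto
        fix r assume r: "r \<in> {0..h}"
        have "norm (?w r) \<le> C * norm (f r)" using r t0 by (intro bound) auto
        also have "\<dots> \<le> C * F" using r h s by (intro mult_left_mono F C) auto
        finally show "norm (?w r) \<le> C * F" .
      qed (use h in simp)
      moreover have "norm (integral {0..t} (\<lambda>r. U (t - r) (f (r + h) - f r))) \<le> integral {0..t} (\<lambda>r. B * ?g r)"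
      proof (rule integral_norm_bound_integral)
        show "(\<lambda>r. U (t - r) (f (r + h) - f r)) integrable_on {0..t}" "(\<lambda>r. B * ?g r) integrable_on {0..t}"
          using t0 h by (intro integrable_continuous_real continuous_intros; auto)+
        fix r assume r: "r \<in> {0..t}"
        have "norm (U (t - r) (f (r + h) - f r)) \<le> C * norm (f (r + h) - f r)" using r by (intro bound) auto
        also have "norm (f (r + h) - f r) = norm (N (y (r + h)) - N (y r))" using N r h by simp
        also have "C * \<dots> \<le> C * (L0 * ?g r)" using r t0 h by (intro mult_left_mono L0 R C) auto
        also have "\<dots> \<le> C * (\<bar>L0\<bar> * ?g r)" using C by (intro mult_left_mono mult_right_mono) auto
        also have "\<dots> \<le> B * ?g r" by (simp add: B_def distrib_right mult.assoc)
        finally show "norm (U (t - r) (f (r + h) - f r)) \<le> B * ?g r" .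
      qed
      ultimately show ?thesis by (simp add: A_def algebra_simps)
    qed
    from Gronwall_const[OF cg B this, of s] s show ?thesis by (simp add: mult_ac)
  qed
  then show ?thesis by blast
qed

end

section \<open>Coordinates on the state space\<close>

text \<open>The orthogonal projection onto \<open>L2_on l\<close>.\<close>

definition restr :: "real \<Rightarrow> L2 \<Rightarrow> L2" where "restr l a = toL2 l (rep_L2 a)"

lemma agrees_restr: "agrees l (restr l a) (rep_L2 a)"
  unfolding restr_def by (intro agrees_toL2_aux sq_integrable_indicator_mult sq_integrable_rep) simp

lemma restr_L2_on: "restr l a \<in> L2_on l"
  by (rule agrees_L2_on[OF agrees_restr])

lemma restr_id: "a \<in> L2_on l \<Longrightarrow> restr l a = a"
  by (rule agrees_unique[OF agrees_restr agrees_rep])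

lemma agrees_cong_AE: "agrees l a f \<Longrightarrow> AE x in lborel. f x = g x \<Longrightarrow> agrees l a g"
  unfolding agrees_def by (auto elim: eventually_elim2)

lemma bounded_linear_restr: "bounded_linear (restr l)"
proof (rule bounded_linear_intro[where K=1])
  fix a b :: L2 and c :: real
  show "restr l (a + b) = restr l a + restr l b"
    by (rule agrees_unique[OF agrees_cong_AE[OF agrees_restr rep_L2_add] agrees_add[OF agrees_restr agrees_restr]])
  show "restr l (c *\<^sub>R a) = c *\<^sub>R restr l a"
    by (rule agrees_unique[OF agrees_cong_AE[OF agrees_restr rep_L2_scaleR] agrees_scaleR[OF agrees_restr]])
  have "restr l a \<bullet> restr l a = restr l a \<bullet> a"
    unfolding inner_L2_rep
  proof (rule integral_cong_AE)
    show "AE x in lborel. rep_L2 (restr l a) x * rep_L2 (restr l a) x = rep_L2 (restr l a) x * rep_L2 a x"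
      using agrees_restr[of l a] unfolding agrees_def L2_on_def mem_Collect_eq by (auto elim: eventually_elim2)
  qed simp_all
  then have "norm (restr l a) * norm (restr l a) \<le> norm (restr l a) * norm a"
    using Cauchy_Schwarz_ineq2[of "restr l a" a] by (simp add: power2_norm_eq_inner[symmetric] power2_eq_square)
  then show "norm (restr l a) \<le> norm a * 1" by (cases "norm (restr l a) = 0") (auto simp: mult_le_cancel_left_pos)
qed

text \<open>Inverse of the second derivative on functions clamped at 0.\<close>

definition double_primitive :: "real \<Rightarrow> L2 \<Rightarrow> L2" where
  "double_primitive l a = toL2 l (\<lambda>x. 0 + (LBINT s:{0..x}. 0 + (LBINT r:{0..s}. rep_L2 a r)))"

lemma prim2_double_primitive:
  assumes "a \<in> L2_on l"
  obtains F0 F1 where "prim2 l (double_primitive l a) F0 F1 a"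
proof -
  define F1 where "F1 s = 0 + (LBINT r:{0..s}. rep_L2 a r)" for s
  define F0 where "F0 x = 0 + (LBINT s:{0..x}. F1 s)" for x
  have F1: "AC l F1 (rep_L2 a)" unfolding F1_def by (rule AC_rep_primitive)
  have F0: "AC l F0 F1" unfolding F0_def
    by (rule AC_primitive) (auto intro!: borel_integrable_atLeastAtMost' AC_continuous[OF F1])
  have "agrees l (double_primitive l a) F0"
    unfolding double_primitive_def F1_def[symmetric] F0_def[symmetric] by (rule agrees_toL2[OF AC_continuous[OF F0]])
  moreover have "F1 0 = 0" "F0 0 = 0" unfolding F0_def F1_def using LBINT_singleton by simp_all
  ultimately show ?thesis using that F0 F1 assms by (simp add: prim2_def)
qed

lemma prim2_unique:
  assumes p: "prim2 l u F0 F1 a" and q: "prim2 l w G0 G1 a"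
  shows "u = w"
proof -
  have *: "agrees l u F0" "AC l F0 F1" "AC l F1 (rep_L2 a)" "F0 0 = 0" "F1 0 = 0"
    "agrees l w G0" "AC l G0 G1" "AC l G1 (rep_L2 a)" "G0 0 = 0" "G1 0 = 0"
    using p q by (auto simp: prim2_def)
  have 1: "F1 x = G1 x" if "x \<in> {0..l}" for x using *(3,5,8,10) that by (auto simp: AC_def)
  have 2: "F0 x = G0 x" if x: "x \<in> {0..l}" for x
  proof -
    have "(LBINT s:{0..x}. F1 s) = (LBINT s:{0..x}. G1 s)"
      by (rule set_lebesgue_integral_cong) (use 1 x in auto)
    then show ?thesis using *(2,4,7,9) x by (auto simp: AC_def)
  qed
  have "agrees l u G0" using *(1) 2 unfolding agrees_def by (auto elim!: eventually_mono)
  then show ?thesis by (rule agrees_unique[OF _ *(6)])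
qed

lemma prim2_add: "prim2 l u F0 F1 a \<Longrightarrow> prim2 l w G0 G1 b \<Longrightarrow> prim2 l (u + w) (\<lambda>x. F0 x + G0 x) (\<lambda>x. F1 x + G1 x) (a + b)"
  by (auto simp: prim2_def intro!: agrees_add AC_add AC_rep_add L2_on_add)

lemma prim2_scaleR: "prim2 l u F0 F1 a \<Longrightarrow> prim2 l (c *\<^sub>R u) (\<lambda>x. c * F0 x) (\<lambda>x. c * F1 x) (c *\<^sub>R a)"
  by (auto simp: prim2_def intro!: agrees_scaleR AC_cmult AC_rep_scaleR L2_on_scaleR)

lemma double_primitive_add:
  assumes a: "a \<in> L2_on l" and b: "b \<in> L2_on l"
  shows "double_primitive l (a + b) = double_primitive l a + double_primitive l b"
  by (rule prim2_double_primitive[OF a], rule prim2_double_primitive[OF b], rule prim2_double_primitive[OF L2_on_add[OF a b]])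
    (blast intro: prim2_unique prim2_add)

lemma double_primitive_scaleR:
  assumes a: "a \<in> L2_on l"
  shows "double_primitive l (c *\<^sub>R a) = c *\<^sub>R double_primitive l a"
  by (rule prim2_double_primitive[OF a], rule prim2_double_primitive[OF L2_on_scaleR[OF a]])
    (blast intro: prim2_unique prim2_scaleR)

lemma double_primitive_Sobolev0:
  assumes l: "0 < l" and a: "a \<in> L2_on l"
  shows "double_primitive l a \<in> Sobolev0 l 2" "weak_deriv l 2 (double_primitive l a) = a"
    "pt_val l (weak_deriv l 1 (double_primitive l a)) l = a \<bullet> one_l l"
    "pt_val l (weak_deriv l 0 (double_primitive l a)) l = a \<bullet> lin_l l"
proof -
  obtain F0 F1 where p: "prim2 l (double_primitive l a) F0 F1 a" by (rule prim2_double_primitive[OF a])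
  show "double_primitive l a \<in> Sobolev0 l 2" "weak_deriv l 2 (double_primitive l a) = a"
    "pt_val l (weak_deriv l 1 (double_primitive l a)) l = a \<bullet> one_l l"
    "pt_val l (weak_deriv l 0 (double_primitive l a)) l = a \<bullet> lin_l l"
    using prim2_Sobolev0[OF l p] prim2_tips[OF l p] by simp_all
qed

lemma Sobolev0_double_primitive:
  assumes l: "0 < l" and u: "u \<in> Sobolev0 l 2"
  shows "double_primitive l (weak_deriv l 2 u) = u" "weak_deriv l 2 u \<in> L2_on l"
proof -
  obtain F0 F1 where p: "prim2 l u F0 F1 (weak_deriv l 2 u)" by (rule Sobolev0_prim2[OF l u]) auto
  then show a: "weak_deriv l 2 u \<in> L2_on l" by (simp add: prim2_def)
  show "double_primitive l (weak_deriv l 2 u) = u"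
    by (rule prim2_double_primitive[OF a]) (rule prim2_unique[OF _ p])
qed

text \<open>In the coordinates \<open>(u'', v, z1, z2, \<xi>, \<psi>)\<close> the state space becomes a closed subspace of a product of
  Banach spaces, whose norm is equivalent to \<open>norm_H\<close>.\<close>

fun coords :: "real \<Rightarrow> ('n1::finite, 'n2::finite) state \<Rightarrow> ('n1, 'n2) state" where
  "coords l (u, v, z1, z2, \<xi>, \<psi>) = (weak_deriv l 2 u, v, z1, z2, \<xi>, \<psi>)"

text \<open>It projects by \<open>restr\<close> before integrating, so it is linear on the whole
  product space; \<open>coords\<close> inverts it on \<open>coord_space\<close>, and elsewhere gives
  the projection.\<close>

fun state_of :: "real \<Rightarrow> ('n1::finite, 'n2::finite) state \<Rightarrow> ('n1, 'n2) state" where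
  "state_of l (a, v, z1, z2, \<xi>, \<psi>) = (double_primitive l (restr l a), restr l v, z1, z2, \<xi>, \<psi>)"

fun restr_state :: "real \<Rightarrow> ('n1::finite, 'n2::finite) state \<Rightarrow> ('n1, 'n2) state" where
  "restr_state l (a, v, z1, z2, \<xi>, \<psi>) = (restr l a, restr l v, z1, z2, \<xi>, \<psi>)"

definition coord_space :: "real \<Rightarrow> ('n1::finite, 'n2::finite) state set" where
  "coord_space l = L2_on l \<times> L2_on l \<times> UNIV"

lemma restr_state_eq: "restr_state l = (\<lambda>e. (restr l (fst e), restr l (fst (snd e)), snd (snd e)))"
  by (rule ext) (metis restr_state.simps prod.collapse)

lemma bounded_linear_restr_state: "bounded_linear (restr_state l)"
  unfolding restr_state_eq
  by (intro bounded_linear_Pair bounded_linear_compose[OF bounded_linear_restr]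
      bounded_linear_compose[OF bounded_linear_fst bounded_linear_snd]
      bounded_linear_compose[OF bounded_linear_snd bounded_linear_snd] bounded_linear_fst)

lemma restr_state_in: "restr_state l e \<in> coord_space l"
  by (simp add: restr_state_eq coord_space_def restr_L2_on)

lemma restr_state_id: "e \<in> coord_space l \<Longrightarrow> restr_state l e = e"
  by (auto simp: restr_state_eq coord_space_def restr_id)

lemma state_of_restr: "state_of l (restr_state l e) = state_of l e"
  by (cases e) (simp add: restr_id restr_L2_on)

lemma coord_space_add: "x \<in> coord_space l \<Longrightarrow> y \<in> coord_space l \<Longrightarrow> x + y \<in> coord_space l"
  and coord_space_scaleR: "x \<in> coord_space l \<Longrightarrow> c *\<^sub>R x \<in> coord_space l"
  and coord_space_diff: "x \<in> coord_space l \<Longrightarrow> y \<in> coord_space l \<Longrightarrow> x - y \<in> coord_space l"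
  by (auto simp: coord_space_def L2_on_add L2_on_scaleR L2_on_diff)

lemma linear_state_of: "linear (state_of l)"
proof (rule linearI)
  note cl = bounded_linear.linear[OF bounded_linear_restr]
  fix x y :: "('n1::finite, 'n2::finite) state" and c :: real
  show "state_of l (x + y) = state_of l x + state_of l y"
    by (cases x; cases y) (simp add: linear_add[OF cl] double_primitive_add restr_L2_on)
  show "state_of l (c *\<^sub>R x) = c *\<^sub>R state_of l x"
    by (cases x) (simp add: linear_cmul[OF cl] double_primitive_scaleR restr_L2_on)
qed

section \<open>Equivalent norms and the metric of the state space\<close>

lemma pos_def_bounds:
  fixes H :: "real^'n::finite^'n"
  assumes pos: "\<And>z. z \<noteq> 0 \<Longrightarrow> z \<bullet> (H *v z) > 0"
  obtains c C where "0 < c" "0 < C" "\<And>z. c * (norm z)\<^sup>2 \<le> z \<bullet> (H *v z)" "\<And>z. z \<bullet> (H *v z) \<le> C * (norm z)\<^sup>2"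
proof -
  let ?q = "\<lambda>z. z \<bullet> (H *v z)"
  have c: "continuous_on (sphere 0 1) ?q"
    by (intro continuous_intros linear_continuous_on matrix_vector_mul_bounded_linear)
  have ne: "sphere (0::real^'n) 1 \<noteq> {}" by (simp add: sphere_empty)
  obtain x where x: "x \<in> sphere 0 1" "\<And>z. z \<in> sphere 0 1 \<Longrightarrow> ?q x \<le> ?q z"
    using continuous_attains_inf[OF compact_sphere ne c] by blast
  obtain y where y: "y \<in> sphere 0 1" "\<And>z. z \<in> sphere 0 1 \<Longrightarrow> ?q z \<le> ?q y"
    using continuous_attains_sup[OF compact_sphere ne c] by blast
  have sc: "?q z = (norm z)\<^sup>2 * ?q ((1 / norm z) *\<^sub>R z)" if "z \<noteq> 0" for z
    using that by (simp add: linear_cmul[OF matrix_vector_mul_linear] power2_eq_square)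
  have "?q x * (norm z)\<^sup>2 \<le> ?q z \<and> ?q z \<le> ?q y * (norm z)\<^sup>2" for z
  proof (cases "z = 0")
    case False
    then have "(1 / norm z) *\<^sub>R z \<in> sphere 0 1" by simp
    from x(2)[OF this] y(2)[OF this] show ?thesis
      unfolding sc[OF False] mult.commute[of _ "(norm z)\<^sup>2"] by (intro conjI mult_left_mono) (assumption | rule zero_le_power2)+
  qed simp
  moreover have "0 < ?q x" "0 < ?q y" using x(1) y(1) by (auto intro!: pos)
  ultimately show ?thesis using that by blast
qed

text \<open>Triangle inequality for a nonnegative quadratic form seen only along a line:
  \<open>S\<close> stands for the sum of both cross terms of a possibly nonsymmetric form.
  Nonnegativity in t gives the discriminant inequality, which takes the place of
  Cauchy-Schwarz.\<close>

lemma sqrt_quadratic_triangle: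
  fixes A B S :: real
  assumes q: "\<And>t. 0 \<le> A + t * S + t * t * B" and A: "0 \<le> A" and B: "0 \<le> B"
  shows "sqrt (A + S + B) \<le> sqrt A + sqrt B"
proof (rule real_le_lsqrt[THEN order_trans])
  have "S\<^sup>2 \<le> 4 * (A * B)"
  proof (cases "B = 0")
    case True
    have "S = 0"
    proof (rule ccontr)
      assume "S \<noteq> 0"
      then have "A + (- (A + 1) / S) * S = - 1" by simp
      then show False using q[of "- (A + 1) / S"] True by simp
    qed
    then show ?thesis using True by simp
  next
    case False
    \<comment> \<open>t = - S / (2 B) minimises the quadratic.\<close>
    then have "A + (- S / (2 * B)) * S + (- S / (2 * B)) * (- S / (2 * B)) * B = A - S\<^sup>2 / (4 * B)"
      by (simp add: field_simps power2_eq_square)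
    then have "S\<^sup>2 / (4 * B) \<le> A" using q[of "- S / (2 * B)"] by simp
    then show ?thesis using B False by (simp add: field_simps)
  qed
  then have "S \<le> sqrt (4 * (A * B))" by (rule real_le_rsqrt)
  also have "\<dots> = 2 * (sqrt A * sqrt B)" by (simp add: real_sqrt_mult)
  finally show "A + S + B \<le> (sqrt A + sqrt B)\<^sup>2" using A B by (simp add: power2_sum)
qed (use A B in simp_all)

text \<open>\<open>Metric_space\<close> demands nonnegativity and symmetry of the distance for all
  arguments, also outside \<open>space_H\<close>, where weak derivatives and point values may be
  unspecified values of \<open>THE\<close>. Negation changes such a value at most in sign: if no c
  satisfies P, then none satisfies Q, the predicates coincide and so do the two values.\<close>

lemma THE_uminus:
  fixes P Q :: "'a::ab_group_add \<Rightarrow> bool"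
  assumes "\<And>c. P c \<Longrightarrow> Q (- c)" "\<And>c. Q c \<Longrightarrow> P (- c)" "\<And>c d. P c \<Longrightarrow> P d \<Longrightarrow> c = d"
  shows "(THE c. Q c) = - (THE c. P c) \<or> (THE c. Q c) = (THE c. P c)"
proof (cases "\<exists>c. P c")
  case True
  then obtain c where c: "P c" by blast
  have "(THE c. P c) = c" by (rule the_equality[where P=P, OF c]) (rule assms(3)[OF _ c])
  moreover have "(THE c. Q c) = - c"
  proof (rule the_equality[where P=Q, OF assms(1)[OF c]])
    fix d assume "Q d"
    then show "d = - c" using assms(3)[OF assms(2) c, of d] by (metis add.inverse_inverse)
  qed
  ultimately show ?thesis by simp
next
  case False
  then have "P = Q" using assms(2) by (intro ext) blast
  then show ?thesis by simp
qed

lemma rep_L2_uminus: "AE x in lborel. rep_L2 (- f) x = - rep_L2 f x"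
  using rep_L2_scaleR[of "-1" f] by simp

lemma has_weak_deriv_uminus:
  assumes "has_weak_deriv l k u w" shows "has_weak_deriv l k (- u) (- w)"
proof -
  have I: "(\<integral>x. rep_L2 (- u) x * g x \<partial>lborel) = - (\<integral>x. rep_L2 u x * g x \<partial>lborel)" if "g \<in> borel_measurable borel" for u g
  proof -
    have "(\<integral>x. rep_L2 (- u) x * g x \<partial>lborel) = (\<integral>x. - (rep_L2 u x * g x) \<partial>lborel)"
      by (rule integral_cong_AE) (use that rep_L2_uminus[of u] in \<open>auto elim!: eventually_mono\<close>)
    then show ?thesis by simp
  qed
  show ?thesis unfolding has_weak_deriv_def
  proof (intro conjI allI impI)
    show "- u \<in> L2_on l" "- w \<in> L2_on l"
      using assms L2_on_scaleR[of u l "-1"] L2_on_scaleR[of w l "-1"] by (auto simp: has_weak_deriv_def)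
    fix \<phi> assume \<phi>: "test_function l \<phi>"
    show "(\<integral>x. rep_L2 (- u) x * (deriv ^^ k) \<phi> x \<partial>lborel) = (- 1) ^ k * (\<integral>x. rep_L2 (- w) x * \<phi> x \<partial>lborel)"
      using assms \<phi> smooth_iterate_measurable[OF \<phi>, of k] smooth_iterate_measurable[OF \<phi>, of 0]
      by (simp add: has_weak_deriv_def I)
  qed
qed

lemma weak_deriv_uminus: "weak_deriv l k (- u) = - weak_deriv l k u \<or> weak_deriv l k (- u) = weak_deriv l k u"
  unfolding weak_deriv_def
proof (rule THE_uminus)
  show "has_weak_deriv l k u (- c)" if "has_weak_deriv l k (- u) c" for c
    using has_weak_deriv_uminus[OF that] by simp
qed (rule has_weak_deriv_uminus has_weak_deriv_unique; assumption)+

lemma pt_val_uminus: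
  assumes l: "0 < l" and x: "x \<in> {0..l}"
  shows "pt_val l (- w) x = - pt_val l w x \<or> pt_val l (- w) x = pt_val l w x"
proof -
  define P where "P w c \<longleftrightarrow> (\<exists>f. continuous_on {0..l} f \<and> (AE s in lborel. s \<in> {0<..<l} \<longrightarrow> f s = rep_L2 w s) \<and> f x = c)" for w c
  have neg: "P (- w) (- c)" if P: "P w c" for w c
  proof -
    obtain f where f: "continuous_on {0..l} f" "AE s in lborel. s \<in> {0<..<l} \<longrightarrow> f s = rep_L2 w s" "f x = c"
      using P unfolding P_def by blast
    have "AE s in lborel. s \<in> {0<..<l} \<longrightarrow> - f s = rep_L2 (- w) s"
      using f(2) rep_L2_uminus[of w] by eventually_elim simp
    moreover have "continuous_on {0..l} (\<lambda>x. - f x)" by (rule continuous_on_minus[OF f(1)])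
    ultimately show ?thesis unfolding P_def using f(3) by (intro exI[of _ "\<lambda>x. - f x"]) simp
  qed
  have uniq: "c = d" if P: "P w c" "P w d" for c d
  proof -
    obtain f where f: "continuous_on {0..l} f" "AE s in lborel. s \<in> {0<..<l} \<longrightarrow> f s = rep_L2 w s" "f x = c"
      using P(1) unfolding P_def by blast
    obtain g where g: "continuous_on {0..l} g" "AE s in lborel. s \<in> {0<..<l} \<longrightarrow> g s = rep_L2 w s" "g x = d"
      using P(2) unfolding P_def by blast
    have "AE s in lborel. s \<in> {0<..<l} \<longrightarrow> f s = g s" using f(2) g(2) by eventually_elim simp
    from continuous_agrees_unique[OF l f(1) g(1) this x] show ?thesis using f(3) g(3) by simp
  qed
  have "(THE c. P (- w) c) = - (THE c. P w c) \<or> (THE c. P (- w) c) = (THE c. P w c)"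
  proof (rule THE_uminus[where P="P w" and Q="P (- w)"])
    show "P w (- c)" if "P (- w) c" for c using neg[OF that] by simp
  qed (fact neg uniq)+
  then show ?thesis unfolding P_def pt_val_def .
qed

locale beam =
  fixes p :: "('n1::finite, 'n2::finite) beam_system"
  assumes adm: "admissible p"
begin

abbreviation "l \<equiv> len p"

sublocale q1: admissible_ctrl "ctrl1 p" + q2: admissible_ctrl "ctrl2 p"
  by unfold_locales (use adm in \<open>auto simp: admissible_def\<close>)

lemma pos: "0 < l" "0 < dens p" "0 < stiff p" "0 < inert p" "0 < mass p"
  using adm by (auto simp: admissible_def)

lemma gain: "0 < deriv (fk (ctrl1 p)) 0" "0 < deriv (fk (ctrl2 p)) 0"
  using q1.adm q2.adm by (auto simp: admissible_controller_def)

lemma hess: "z \<noteq> 0 \<Longrightarrow> z \<bullet> (hessian (fV (ctrl1 p)) 0 *v z) > 0" "z' \<noteq> 0 \<Longrightarrow> z' \<bullet> (hessian (fV (ctrl2 p)) 0 *v z') > 0"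
  using q1.adm q2.adm by (auto simp: admissible_controller_def)

lemma state_of_space: "state_of l e \<in> space_H p"
  by (cases e) (simp add: space_H_def double_primitive_Sobolev0(1)[OF pos(1) restr_L2_on] restr_L2_on)

lemma coords_in: "y \<in> space_H p \<Longrightarrow> coords l y \<in> coord_space l"
  using Sobolev0_double_primitive(2)[OF pos(1)] by (auto simp: space_H_def coord_space_def)

lemma state_of_coords: "y \<in> space_H p \<Longrightarrow> state_of l (coords l y) = y"
  using Sobolev0_double_primitive[OF pos(1)] by (auto simp: space_H_def restr_id)

lemma coords_state_of: "coords l (state_of l e) = restr_state l e"
  by (cases e) (simp add: double_primitive_Sobolev0(2)[OF pos(1) restr_L2_on])

lemma coords_state_of_id: "e \<in> coord_space l \<Longrightarrow> coords l (state_of l e) = e"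
  by (simp add: coords_state_of restr_state_id)

lemma coords_add: "x \<in> space_H p \<Longrightarrow> y \<in> space_H p \<Longrightarrow> coords l (x + y) = coords l x + coords l y"
  using coords_state_of_id[of "coords l x + coords l y"]
  by (simp add: linear_add[OF linear_state_of] state_of_coords coord_space_add coords_in)

lemma coords_scaleR: "x \<in> space_H p \<Longrightarrow> coords l (c *\<^sub>R x) = c *\<^sub>R coords l x"
  using coords_state_of_id[of "c *\<^sub>R coords l x"]
  by (simp add: linear_cmul[OF linear_state_of] state_of_coords coord_space_scaleR coords_in)

lemma coords_diff: "x \<in> space_H p \<Longrightarrow> y \<in> space_H p \<Longrightarrow> coords l (x - y) = coords l x - coords l y"
  using coords_state_of_id[of "coords l x - coords l y"]
  by (simp add: linear_diff[OF linear_state_of] state_of_coords coord_space_diff coords_in)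

lemma tip_val_double_primitive:
  assumes "a \<in> L2_on l"
  shows "tip_val p 1 (double_primitive l a) = a \<bullet> one_l l" "tip_val p 0 (double_primitive l a) = a \<bullet> lin_l l"
  using double_primitive_Sobolev0(3,4)[OF pos(1) assms] by (simp_all add: tip_val_def)

fun coord_form :: "('n1, 'n2) state \<Rightarrow> ('n1, 'n2) state \<Rightarrow> real" where
  "coord_form (a, v, z1, z2, \<xi>, \<psi>) (a', v', z1', z2', \<xi>', \<psi>') =
     stiff p * (a \<bullet> a') + dens p * (v \<bullet> v') + (1 / inert p) * \<xi> * \<xi>' + (1 / mass p) * \<psi> * \<psi>'
     + deriv (fk (ctrl1 p)) 0 * (a \<bullet> one_l l) * (a' \<bullet> one_l l) + deriv (fk (ctrl2 p)) 0 * (a \<bullet> lin_l l) * (a' \<bullet> lin_l l)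
     + z1 \<bullet> (hessian (fV (ctrl1 p)) 0 *v z1') + z2 \<bullet> (hessian (fV (ctrl2 p)) 0 *v z2')"

lemma inner_H_state_of: "inner_H p (state_of l e) (state_of l e') = coord_form (restr_state l e) (restr_state l e')"
  by (cases e; cases e')
    (simp add: tip_val_double_primitive[OF restr_L2_on] tip_val_double_primitive(1)[OF restr_L2_on, unfolded One_nat_def]
      double_primitive_Sobolev0(2)[OF pos(1) restr_L2_on])

text \<open>The tip terms are nonnegative and dropped in the lower bound; in the upper bound
  Cauchy-Schwarz absorbs them into the norm of a, whence the constant \<open>K\<close>.\<close>

lemma coord_form_bounds:
  obtains c C where "0 < c" "0 < C" "\<And>e. c * (norm e)\<^sup>2 \<le> coord_form e e" "\<And>e. coord_form e e \<le> C * (norm e)\<^sup>2"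
proof -
  obtain c1 C1 where H1: "0 < c1" "0 < C1" "\<And>z. c1 * (norm z)\<^sup>2 \<le> z \<bullet> (hessian (fV (ctrl1 p)) 0 *v z)"
    "\<And>z. z \<bullet> (hessian (fV (ctrl1 p)) 0 *v z) \<le> C1 * (norm z)\<^sup>2" using pos_def_bounds[of "hessian (fV (ctrl1 p)) 0"] hess(1) by metis
  obtain c2 C2 where H2: "0 < c2" "0 < C2" "\<And>z. c2 * (norm z)\<^sup>2 \<le> z \<bullet> (hessian (fV (ctrl2 p)) 0 *v z)"
    "\<And>z. z \<bullet> (hessian (fV (ctrl2 p)) 0 *v z) \<le> C2 * (norm z)\<^sup>2" using pos_def_bounds[of "hessian (fV (ctrl2 p)) 0"] hess(2) by metis
  let ?k1 = "deriv (fk (ctrl1 p)) 0" and ?k2 = "deriv (fk (ctrl2 p)) 0"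
  define c where "c = min (min (min (stiff p) (dens p)) (min (1 / inert p) (1 / mass p))) (min c1 c2)"
  define K where "K = stiff p + ?k1 * (norm (one_l l))\<^sup>2 + ?k2 * (norm (lin_l l))\<^sup>2"
  define C where "C = max (max (max K (dens p)) (max (1 / inert p) (1 / mass p))) (max C1 C2)"
  have c: "0 < c" "c \<le> stiff p" "c \<le> dens p" "c \<le> 1 / inert p" "c \<le> 1 / mass p" "c \<le> c1" "c \<le> c2"
    using pos H1 H2 by (auto simp: c_def)
  have C: "K \<le> C" "dens p \<le> C" "1 / inert p \<le> C" "1 / mass p \<le> C" "C1 \<le> C" "C2 \<le> C" by (auto simp: C_def)
  have n: "(norm (a, v, z1, z2, \<xi>, \<psi>))\<^sup>2 = (norm a)\<^sup>2 + (norm v)\<^sup>2 + (norm z1)\<^sup>2 + (norm z2)\<^sup>2 + \<xi>\<^sup>2 + \<psi>\<^sup>2"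
    for a v and z1 :: "real^'n1" and z2 :: "real^'n2" and \<xi> \<psi> :: real by (simp add: norm_Pair)
  have f: "coord_form (a, v, z1, z2, \<xi>, \<psi>) (a, v, z1, z2, \<xi>, \<psi>) = stiff p * (norm a)\<^sup>2 + dens p * (norm v)\<^sup>2
      + 1 / inert p * \<xi>\<^sup>2 + 1 / mass p * \<psi>\<^sup>2 + ?k1 * (a \<bullet> one_l l)\<^sup>2 + ?k2 * (a \<bullet> lin_l l)\<^sup>2
      + z1 \<bullet> (hessian (fV (ctrl1 p)) 0 *v z1) + z2 \<bullet> (hessian (fV (ctrl2 p)) 0 *v z2)" for a v z1 z2 \<xi> \<psi>
    unfolding coord_form.simps power2_norm_eq_inner unfolding power2_eq_square by (simp add: mult.assoc)
  show ?thesis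
  proof
    show "0 < c" by (rule c)
    show "0 < C" using C(2) pos by linarith
    fix e :: "('n1, 'n2) state"
    obtain a v z1 z2 \<xi> \<psi> where e: "e = (a, v, z1, z2, \<xi>, \<psi>)" by (cases e)
    have "c * (norm a)\<^sup>2 \<le> stiff p * (norm a)\<^sup>2" "c * (norm v)\<^sup>2 \<le> dens p * (norm v)\<^sup>2" "c * \<xi>\<^sup>2 \<le> 1 / inert p * \<xi>\<^sup>2"
      "c * \<psi>\<^sup>2 \<le> 1 / mass p * \<psi>\<^sup>2" "c * (norm z1)\<^sup>2 \<le> c1 * (norm z1)\<^sup>2" "c * (norm z2)\<^sup>2 \<le> c2 * (norm z2)\<^sup>2"
      by (intro mult_right_mono c zero_le_power2)+
    moreover have "0 \<le> ?k1 * (a \<bullet> one_l l)\<^sup>2" "0 \<le> ?k2 * (a \<bullet> lin_l l)\<^sup>2" using gain by simp_all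
    ultimately show "c * (norm e)\<^sup>2 \<le> coord_form e e"
      unfolding e f n using H1(3)[of z1] H2(3)[of z2] unfolding distrib_left by linarith
    have "(a \<bullet> b)\<^sup>2 \<le> (norm b)\<^sup>2 * (norm a)\<^sup>2" for b
      using Cauchy_Schwarz_ineq[of a b] by (simp add: power2_norm_eq_inner mult.commute)
    then have "?k1 * (a \<bullet> one_l l)\<^sup>2 \<le> ?k1 * ((norm (one_l l))\<^sup>2 * (norm a)\<^sup>2)" "?k2 * (a \<bullet> lin_l l)\<^sup>2 \<le> ?k2 * ((norm (lin_l l))\<^sup>2 * (norm a)\<^sup>2)"
      using gain by (intro mult_left_mono; simp)+
    moreover have "K * (norm a)\<^sup>2 = stiff p * (norm a)\<^sup>2 + ?k1 * ((norm (one_l l))\<^sup>2 * (norm a)\<^sup>2) + ?k2 * ((norm (lin_l l))\<^sup>2 * (norm a)\<^sup>2)"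
      by (simp add: K_def distrib_right)
    moreover have "K * (norm a)\<^sup>2 \<le> C * (norm a)\<^sup>2" "dens p * (norm v)\<^sup>2 \<le> C * (norm v)\<^sup>2" "1 / inert p * \<xi>\<^sup>2 \<le> C * \<xi>\<^sup>2"
      "1 / mass p * \<psi>\<^sup>2 \<le> C * \<psi>\<^sup>2" "C1 * (norm z1)\<^sup>2 \<le> C * (norm z1)\<^sup>2" "C2 * (norm z2)\<^sup>2 \<le> C * (norm z2)\<^sup>2"
      by (intro mult_right_mono C zero_le_power2)+
    ultimately show "coord_form e e \<le> C * (norm e)\<^sup>2"
      unfolding e f n using H1(4)[of z1] H2(4)[of z2] unfolding distrib_left by linarith
  qed
qed

lemma norm_H_bounds:
  obtains c C where "0 < c" "0 < C" "\<And>e. e \<in> coord_space l \<Longrightarrow> c * norm e \<le> norm_H p (state_of l e)"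
    "\<And>e. e \<in> coord_space l \<Longrightarrow> norm_H p (state_of l e) \<le> C * norm e"
proof -
  obtain c C where *: "0 < c" "0 < C" "\<And>e. c * (norm e)\<^sup>2 \<le> coord_form e e" "\<And>e. coord_form e e \<le> C * (norm e)\<^sup>2"
    by (rule coord_form_bounds) blast
  show ?thesis
  proof
    fix e :: "('n1, 'n2) state" assume e: "e \<in> coord_space l"
    have eq: "norm_H p (state_of l e) = sqrt (coord_form e e)" using e by (simp add: norm_H_def inner_H_state_of restr_state_id)
    show "sqrt c * norm e \<le> norm_H p (state_of l e)" "norm_H p (state_of l e) \<le> sqrt C * norm e"
      unfolding eq using real_sqrt_le_mono[OF *(3)[of e]] real_sqrt_le_mono[OF *(4)[of e]] by (simp_all add: real_sqrt_mult)
  qed (use * in simp_all)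
qed

lemma coord_form_combine:
  "coord_form (x + t *\<^sub>R y) (x + t *\<^sub>R y) = coord_form x x + t * (coord_form x y + coord_form y x) + t * t * coord_form y y"
proof -
  obtain a v z1 z2 \<xi> \<psi> where x: "x = (a, v, z1, z2, \<xi>, \<psi>)" by (cases x)
  obtain a' v' z1' z2' \<xi>' \<psi>' where y: "y = (a', v', z1', z2', \<xi>', \<psi>')" by (cases y)
  define j m where "j = 1 / inert p" and "m = 1 / mass p"
  show ?thesis
    unfolding x y add_Pair scaleR_Pair coord_form.simps j_def[symmetric] m_def[symmetric]
    by (simp add: inner_add_left inner_add_right matrix_vector_right_distrib linear_cmul[OF matrix_vector_mul_linear] algebra_simps)
qed

lemma Metric_space_H: "Metric_space (space_H p) (\<lambda>x y. norm_H p (x - y))"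
proof
  obtain c C where b: "0 < c" "0 < C" "\<And>e. c * (norm e)\<^sup>2 \<le> coord_form e e" "\<And>e. coord_form e e \<le> C * (norm e)\<^sup>2"
    by (rule coord_form_bounds) blast
  have nn: "0 \<le> coord_form e e" for e by (rule order_trans[OF _ b(3)]) (use b(1) in simp)
  have hn: "0 \<le> z \<bullet> (hessian (fV (ctrl1 p)) 0 *v z)" "0 \<le> z' \<bullet> (hessian (fV (ctrl2 p)) 0 *v z')" for z z'
    using hess by (metis inner_zero_left less_imp_le order_refl)+
  fix x y z :: "('n1, 'n2) state"
  have "0 \<le> inner_H p w w" for w
    by (cases w) (use pos gain hn in \<open>auto simp: mult.assoc intro!: add_nonneg_nonneg mult_nonneg_nonneg\<close>)
  then show "0 \<le> norm_H p (x - y)" by (simp add: norm_H_def)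
  \<comment> \<open>Outside \<open>space_H\<close> these values may be unspecified, but in a square
    the ambiguity of sign disappears.\<close>
  have sq: "tip_val p k (- u) * tip_val p k (- u) = tip_val p k u * tip_val p k u"
    "weak_deriv l k (- u) \<bullet> weak_deriv l k (- u) = weak_deriv l k u \<bullet> weak_deriv l k u" for k u
    unfolding tip_val_def using weak_deriv_uminus[of l k u] pt_val_uminus[of l l "weak_deriv l k u"] pos(1) by auto
  have "inner_H p (- w) (- w) = inner_H p w w" for w
    by (cases w) (simp add: sq mult.assoc linear_neg[OF matrix_vector_mul_linear] del: One_nat_def)
  then show "norm_H p (x - y) = norm_H p (y - x)" by (metis minus_diff_eq norm_H_def)
  assume x: "x \<in> space_H p" and y: "y \<in> space_H p"
  have d: "norm_H p (v - w) = sqrt (coord_form (coords l v - coords l w) (coords l v - coords l w))"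
    if "v \<in> space_H p" "w \<in> space_H p" for v w
    unfolding norm_H_def using inner_H_state_of[of "coords l v - coords l w" "coords l v - coords l w"] that
    by (simp add: linear_diff[OF linear_state_of] state_of_coords restr_state_id coord_space_diff coords_in)
  let ?e = "coords l x - coords l y"
  have 1: "x = y" if "norm_H p (x - y) = 0"
  proof -
    have "coord_form ?e ?e = 0" using that unfolding d[OF x y] by (rule real_sqrt_eq_0_iff[THEN iffD1])
    then have "c * (norm ?e)\<^sup>2 \<le> 0" using b(3)[of ?e] by linarith
    then have "(norm ?e)\<^sup>2 \<le> 0" using b(1) by (simp add: mult_le_0_iff)
    then have "coords l x = coords l y" by simp
    then show "x = y" by (metis state_of_coords[OF x] state_of_coords[OF y])
  qed
  have "coord_form 0 0 = 0" using b(4)[of 0] nn[of 0] by (intro antisym) simp_all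
  then have 2: "norm_H p (y - y) = 0" unfolding d[OF y y] by simp
  show "norm_H p (x - y) = 0 \<longleftrightarrow> x = y" using 1 2 by blast
  assume z: "z \<in> space_H p"
  let ?e = "coords l x - coords l y" and ?f = "coords l y - coords l z"
  have "sqrt (coord_form ?e ?e + (coord_form ?e ?f + coord_form ?f ?e) + coord_form ?f ?f) \<le> sqrt (coord_form ?e ?e) + sqrt (coord_form ?f ?f)"
    by (rule sqrt_quadratic_triangle[OF _ nn nn]) (use nn in \<open>simp add: coord_form_combine[symmetric]\<close>)
  then show "norm_H p (x - z) \<le> norm_H p (x - y) + norm_H p (y - z)"
    using coord_form_combine[of ?e 1 ?f] by (simp add: d[OF x z] d[OF x y] d[OF y z])
qed

end

section \<open>Maps that are Lipschitz on bounded sets\<close>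

definition lip_bounded :: "('a::real_normed_vector \<Rightarrow> 'b::real_normed_vector) \<Rightarrow> bool" where
  "lip_bounded f \<longleftrightarrow> (\<forall>R. \<exists>L\<ge>0. \<forall>x z. norm x \<le> R \<longrightarrow> norm z \<le> R \<longrightarrow> norm (f x - f z) \<le> L * norm (x - z))"

lemma lip_boundedE:
  assumes "lip_bounded f"
  obtains L where "0 \<le> L" "\<And>x z. norm x \<le> R \<Longrightarrow> norm z \<le> R \<Longrightarrow> norm (f x - f z) \<le> L * norm (x - z)"
  using assms unfolding lip_bounded_def by blast

lemma lip_boundedI:
  assumes "\<And>R. 0 \<le> R \<Longrightarrow> \<exists>L\<ge>0. \<forall>x z. norm x \<le> R \<longrightarrow> norm z \<le> R \<longrightarrow> norm (f x - f z) \<le> L * norm (x - z)"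
  shows "lip_bounded f"
  unfolding lip_bounded_def
proof
  fix R :: real
  show "\<exists>L\<ge>0. \<forall>x z. norm x \<le> R \<longrightarrow> norm z \<le> R \<longrightarrow> norm (f x - f z) \<le> L * norm (x - z)"
  proof (cases "0 \<le> R")
    case False
    then have "\<not> norm x \<le> R" for x :: 'a using norm_ge_zero[of x] by linarith
    then show ?thesis by (intro exI[of _ 0]) simp
  qed (rule assms)
qed

lemma lip_bounded_bound:
  fixes f :: "'a::real_normed_vector \<Rightarrow> 'b::real_normed_vector"
  assumes "lip_bounded f" "0 \<le> R"
  obtains B where "0 \<le> B" "\<And>x. norm x \<le> R \<Longrightarrow> norm (f x) \<le> B"
proof -
  obtain L where L: "0 \<le> L" "\<And>x z. norm x \<le> R \<Longrightarrow> norm z \<le> R \<Longrightarrow> norm (f x - f z) \<le> L * norm (x - z)"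
    by (rule lip_boundedE[OF assms(1)]) blast
  show ?thesis
  proof
    show "0 \<le> norm (f 0) + L * R" using L assms(2) by simp
    fix x :: 'a assume x: "norm x \<le> R"
    have "norm (f x - f 0) \<le> L * norm x" using L(2)[OF x, of 0] assms(2) by simp
    also have "\<dots> \<le> L * R" by (rule mult_left_mono[OF x L(1)])
    finally show "norm (f x) \<le> norm (f 0) + L * R" using norm_triangle_ineq[of "f 0" "f x - f 0"] by simp
  qed
qed

lemma lip_bounded_linear: "bounded_linear f \<Longrightarrow> lip_bounded f"
proof (rule lip_boundedI)
  fix R :: real assume f: "bounded_linear f"
  obtain K where "0 \<le> K" "\<And>x. norm (f x) \<le> norm x * K" using bounded_linear.nonneg_bounded[OF f] by blast
  then show "\<exists>L\<ge>0. \<forall>x z. norm x \<le> R \<longrightarrow> norm z \<le> R \<longrightarrow> norm (f x - f z) \<le> L * norm (x - z)"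
    by (intro exI[of _ K]) (simp add: linear_diff[OF bounded_linear.linear[OF f], symmetric] mult.commute)
qed

lemma lip_bounded_C2: "C2_map f \<Longrightarrow> lip_bounded f"
  by (rule lip_boundedI) (metis C2_map_Lipschitz)

lemma lip_bounded_compose:
  assumes g: "lip_bounded g" and f: "lip_bounded f" shows "lip_bounded (\<lambda>x. g (f x))"
proof (rule lip_boundedI)
  fix R :: real assume R: "0 \<le> R"
  obtain B where B: "\<And>x. norm x \<le> R \<Longrightarrow> norm (f x) \<le> B" by (rule lip_bounded_bound[OF f R]) blast
  obtain L where L: "0 \<le> L" "\<And>x z. norm x \<le> R \<Longrightarrow> norm z \<le> R \<Longrightarrow> norm (f x - f z) \<le> L * norm (x - z)"
    by (rule lip_boundedE[OF f]) blast
  obtain M where M: "0 \<le> M" "\<And>x z. norm x \<le> B \<Longrightarrow> norm z \<le> B \<Longrightarrow> norm (g x - g z) \<le> M * norm (x - z)"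
    by (rule lip_boundedE[OF g]) blast
  have "norm (g (f x) - g (f z)) \<le> M * L * norm (x - z)" if "norm x \<le> R" "norm z \<le> R" for x z
    using M(2)[OF B[OF that(1)] B[OF that(2)]] mult_left_mono[OF L(2)[OF that] M(1)] by (simp add: mult.assoc)
  then show "\<exists>L\<ge>0. \<forall>x z. norm x \<le> R \<longrightarrow> norm z \<le> R \<longrightarrow> norm (g (f x) - g (f z)) \<le> L * norm (x - z)"
    using L M by (intro exI[of _ "M * L"]) simp
qed

lemma lip_bounded_Pair:
  assumes f: "lip_bounded f" and g: "lip_bounded g" shows "lip_bounded (\<lambda>x. (f x, g x))"
proof (rule lip_boundedI)
  fix R :: real
  obtain L where L: "0 \<le> L" "\<And>x z. norm x \<le> R \<Longrightarrow> norm z \<le> R \<Longrightarrow> norm (f x - f z) \<le> L * norm (x - z)"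
    by (rule lip_boundedE[OF f]) blast
  obtain M where M: "0 \<le> M" "\<And>x z. norm x \<le> R \<Longrightarrow> norm z \<le> R \<Longrightarrow> norm (g x - g z) \<le> M * norm (x - z)"
    by (rule lip_boundedE[OF g]) blast
  have "norm ((f x, g x) - (f z, g z)) \<le> (L + M) * norm (x - z)" if "norm x \<le> R" "norm z \<le> R" for x z
    using L(2)[OF that] M(2)[OF that] norm_Pair_le[of "f x - f z" "g x - g z"] by (simp add: distrib_right)
  then show "\<exists>L\<ge>0. \<forall>x z. norm x \<le> R \<longrightarrow> norm z \<le> R \<longrightarrow> norm ((f x, g x) - (f z, g z)) \<le> L * norm (x - z)"
    using L M by (intro exI[of _ "L + M"]) simp
qed

lemma lip_bounded_add:
  assumes "lip_bounded f" "lip_bounded g" shows "lip_bounded (\<lambda>x. f x + g x)"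
proof -
  have "bounded_linear (\<lambda>p. fst p + snd p)"
    by (intro bounded_linear_add bounded_linear_fst bounded_linear_snd)
  from lip_bounded_compose[OF lip_bounded_linear[OF this] lip_bounded_Pair[OF assms]] show ?thesis by simp
qed

lemma lip_bounded_diff:
  assumes "lip_bounded f" "lip_bounded g" shows "lip_bounded (\<lambda>x. f x - g x)"
proof -
  have "bounded_linear (\<lambda>p. fst p - snd p)"
    by (intro bounded_linear_sub bounded_linear_fst bounded_linear_snd)
  from lip_bounded_compose[OF lip_bounded_linear[OF this] lip_bounded_Pair[OF assms]] show ?thesis by simp
qed

lemma lip_bounded_const: "lip_bounded (\<lambda>x. c)"
  by (rule lip_boundedI) (auto intro: exI[of _ 0])

lemma lip_bounded_scaleR:
  assumes f: "lip_bounded f" and g: "lip_bounded g" shows "lip_bounded (\<lambda>x. f x *\<^sub>R g x)"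
proof (rule lip_boundedI)
  fix R :: real assume R: "0 \<le> R"
  obtain L where L: "0 \<le> L" "\<And>x z. norm x \<le> R \<Longrightarrow> norm z \<le> R \<Longrightarrow> norm (f x - f z) \<le> L * norm (x - z)"
    by (rule lip_boundedE[OF f]) blast
  obtain M where M: "0 \<le> M" "\<And>x z. norm x \<le> R \<Longrightarrow> norm z \<le> R \<Longrightarrow> norm (g x - g z) \<le> M * norm (x - z)"
    by (rule lip_boundedE[OF g]) blast
  obtain A where A: "0 \<le> A" "\<And>x. norm x \<le> R \<Longrightarrow> norm (f x) \<le> A" by (rule lip_bounded_bound[OF f R]) blast
  obtain B where B: "0 \<le> B" "\<And>x. norm x \<le> R \<Longrightarrow> norm (g x) \<le> B" by (rule lip_bounded_bound[OF g R]) blast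
  have "norm (f x *\<^sub>R g x - f z *\<^sub>R g z) \<le> (A * M + L * B) * norm (x - z)" if x: "norm x \<le> R" and z: "norm z \<le> R" for x z
  proof -
    have "f x *\<^sub>R g x - f z *\<^sub>R g z = f x *\<^sub>R (g x - g z) + (f x - f z) *\<^sub>R g z" by (simp add: algebra_simps)
    then have "norm (f x *\<^sub>R g x - f z *\<^sub>R g z) \<le> norm (f x) * norm (g x - g z) + norm (f x - f z) * norm (g z)"
      by (metis norm_scaleR norm_triangle_ineq real_norm_def)
    moreover have "norm (f x) * norm (g x - g z) \<le> A * (M * norm (x - z))"
      by (intro mult_mono A B M x z norm_ge_zero)
    moreover have "norm (f x - f z) * norm (g z) \<le> (L * norm (x - z)) * B"
      by (intro mult_mono L B x z norm_ge_zero mult_nonneg_nonneg)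
    ultimately show ?thesis by (simp add: algebra_simps)
  qed
  then show "\<exists>L\<ge>0. \<forall>x z. norm x \<le> R \<longrightarrow> norm z \<le> R \<longrightarrow> norm (f x *\<^sub>R g x - f z *\<^sub>R g z) \<le> L * norm (x - z)"
    using A B L M by (intro exI[of _ "A * M + L * B"]) simp
qed

lemma lip_bounded_continuous:
  fixes f :: "'a::real_normed_vector \<Rightarrow> 'b::real_normed_vector"
  assumes f: "lip_bounded f" shows "continuous_on UNIV f"
proof (rule continuous_at_imp_continuous_on, intro ballI)
  fix x :: 'a
  obtain L where L: "0 \<le> L" "\<And>y z. norm y \<le> norm x + 1 \<Longrightarrow> norm z \<le> norm x + 1 \<Longrightarrow> norm (f y - f z) \<le> L * norm (y - z)"
    by (rule lip_boundedE[OF f]) blast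
  have "((\<lambda>y. f y - f x) \<longlongrightarrow> 0) (at x)"
  proof (rule Lim_null_comparison)
    have "\<forall>\<^sub>F y in at x. dist y x < 1" unfolding eventually_at by (intro exI[of _ 1]) simp
    then show "\<forall>\<^sub>F y in at x. norm (f y - f x) \<le> L * norm (y - x)"
    proof eventually_elim
      fix y assume "dist y x < 1"
      then have "norm y \<le> norm x + 1" using norm_triangle_ineq[of x "y - x"] by (simp add: dist_norm)
      then show "norm (f y - f x) \<le> L * norm (y - x)" by (intro L) auto
    qed
    show "((\<lambda>y. L * norm (y - x)) \<longlongrightarrow> 0) (at x)" by (auto intro!: tendsto_eq_intros)
  qed
  then show "isCont f x" by (simp add: isCont_def LIM_zero_iff)
qed

text \<open>Total boundedness: centres of a finite e/3-cover of K give closed balls of radius 2 e/3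
  that cover S, and closedness carries this over to the closure.\<close>

lemma compact_closure_near_compact:
  fixes S :: "'a::banach set"
  assumes near: "\<And>e. 0 < e \<Longrightarrow> \<exists>K. compact K \<and> (\<forall>x\<in>S. \<exists>y\<in>K. dist y x < e)"
  shows "compact (closure S)"
  unfolding compact_eq_totally_bounded
proof (intro conjI allI impI)
  show "complete (closure S)" by (simp add: complete_eq_closed)
  fix e :: real assume e: "0 < e"
  obtain K where K: "compact K" "\<And>x. x \<in> S \<Longrightarrow> \<exists>y\<in>K. dist y x < e / 3" using near[of "e / 3"] e by auto
  obtain k where k: "finite k" "K \<subseteq> (\<Union>x\<in>k. ball x (e / 3))"
    using K(1) e unfolding compact_eq_totally_bounded by (metis zero_less_divide_iff zero_less_numeral)
  have "S \<subseteq> (\<Union>x\<in>k. cball x (2 * e / 3))"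
  proof
    fix x assume "x \<in> S"
    then obtain y where y: "y \<in> K" "dist y x < e / 3" using K(2) by blast
    then obtain z where z: "z \<in> k" "dist z y < e / 3" using k(2) by auto
    have "dist z x \<le> 2 * e / 3" using dist_triangle[of z x y] y(2) z(2) by simp
    then show "x \<in> (\<Union>x\<in>k. cball x (2 * e / 3))" using z(1) by auto
  qed
  then have "closure S \<subseteq> (\<Union>x\<in>k. cball x (2 * e / 3))"
    by (rule closure_minimal) (auto intro!: closed_UN k)
  also have "\<dots> \<subseteq> (\<Union>x\<in>k. ball x e)" using e by auto
  finally show "\<exists>k. finite k \<and> closure S \<subseteq> (\<Union>x\<in>k. ball x e)" using k(1) by blast
qed

context closed_loop
begin

text \<open>After some time T the state is within e of the static profile of its own tip data, and
  these profiles lie in the continuous image of a disc; up to T the orbit is a continuous image of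
  [0,T].\<close>

theorem orbit_precompact: "compact (closure ((\<lambda>t. (a t, v t, z1 t, z2 t, \<xi> t, \<psi> t)) ` {0..}))"
proof (rule compact_closure_near_compact)
  fix e :: real assume e: "0 < e"
  obtain R where R: "state_bound R" by (rule state_bound_ex)
  let ?Y = "\<lambda>t. (a t, v t, z1 t, z2 t, \<xi> t, \<psi> t)"
  let ?E = "\<lambda>p. (profile l (fst p) (snd p), 0::L2, 0, 0, 0::real, 0::real)"
  let ?p = "\<lambda>t. (a t \<bullet> one_l l, a t \<bullet> lin_l l)"
  let ?d = "\<lambda>t. a t - profile l (a t \<bullet> one_l l) (a t \<bullet> lin_l l)"
  have l0: "l \<noteq> 0" using pos by simp
  have sq0: "(f \<longlongrightarrow> 0) at_top" if "((\<lambda>t. (norm (f t))\<^sup>2) \<longlongrightarrow> 0) at_top" for f :: "real \<Rightarrow> L2"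
    using tendsto_real_sqrt[OF that] by (simp add: tendsto_norm_zero_iff)
  have part: "((\<lambda>t. (norm (f t))\<^sup>2) \<longlongrightarrow> 0) at_top" if "0 < c" "\<And>t. c * (norm (f t))\<^sup>2 \<le> rest t" for c and f :: "real \<Rightarrow> L2"
  proof (rule tendsto_sandwich[OF _ _ tendsto_const])
    show "((\<lambda>t. rest t / c) \<longlongrightarrow> 0) at_top" using tendsto_divide[OF rest_limit[OF R] tendsto_const[of c]] that(1) by simp
  qed (use that in \<open>auto simp: field_simps\<close>)
  have nn: "0 \<le> (\<xi> t)\<^sup>2 / (2 * J)" "0 \<le> (\<psi> t)\<^sup>2 / (2 * M)" "0 \<le> fV q1 (z1 t)" "0 \<le> fV q2 (z2 t)"
    "0 \<le> \<Lambda> / 2 * (norm (?d t))\<^sup>2" "0 \<le> \<rho> / 2 * (norm (v t))\<^sup>2" for t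
    using pos c1.V_nonneg c2.V_nonneg by auto
  have dl: "(?d \<longlongrightarrow> 0) at_top"
  proof (rule sq0[OF part[of "\<Lambda> / 2"]])
    show "\<Lambda> / 2 * (norm (?d t))\<^sup>2 \<le> rest t" for t
      using nn(1-4,6)[of t] unfolding rest_def power2_norm_eq_inner by linarith
  qed (use pos in simp)
  have vl: "(v \<longlongrightarrow> 0) at_top"
  proof (rule sq0[OF part[of "\<rho> / 2"]])
    show "\<rho> / 2 * (norm (v t))\<^sup>2 \<le> rest t" for t
      using nn(1-5)[of t] unfolding rest_def power2_norm_eq_inner by linarith
  qed (use pos in simp)
  have "((\<lambda>t. (?d t, v t, z1 t, z2 t, \<xi> t, \<psi> t)) \<longlongrightarrow> (0, 0, 0, 0, 0, 0)) at_top"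
    by (intro tendsto_Pair dl vl state_limits[OF R])
  then have "\<forall>\<^sub>F t in at_top. dist (?d t, v t, z1 t, z2 t, \<xi> t, \<psi> t) (0, 0, 0, 0, 0, 0) < e" using e by (rule tendstoD)
  then obtain T where T: "\<And>t. T \<le> t \<Longrightarrow> dist (?d t, v t, z1 t, z2 t, \<xi> t, \<psi> t) (0, 0, 0, 0, 0, 0) < e"
    by (auto simp: eventually_at_top_linorder)
  let ?K = "?Y ` {0..T} \<union> ?E ` cball 0 (R + R)"
  have "compact (?Y ` {0..T})"
    by (intro compact_continuous_image continuous_on_Pair continuous_on_Icc_sub cont c1.cont c2.cont) auto
  moreover have "compact (?E ` cball 0 (R + R))"
    unfolding profile_def tip_moment_def tip_shear_def using l0 by (intro compact_continuous_image continuous_intros) auto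
  ultimately have "compact ?K" by (rule compact_Un)
  moreover have "\<exists>y\<in>?K. dist y x < e" if x: "x \<in> ?Y ` {0..}" for x
  proof -
    obtain t where t: "0 \<le> t" "x = ?Y t" using x by (elim imageE) simp
    show ?thesis
    proof (cases "t \<le> T")
      case True
      then show ?thesis using t e by (intro bexI[of _ x]) auto
    next
      case False
      have "norm (?p t) \<le> R + R"
        using bd(9,10)[OF R t(1)] norm_Pair_le[of "a t \<bullet> one_l l" "a t \<bullet> lin_l l"] unfolding real_norm_def by linarith
      then have "?E (?p t) \<in> ?K" by (intro UnI2 imageI) simp
      moreover have "dist (?E (?p t)) x = dist (?d t, v t, z1 t, z2 t, \<xi> t, \<psi> t) (0, 0, 0, 0, 0, 0)"
        unfolding t(2) dist_commute[of "?E (?p t)"] by (simp add: dist_norm)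
      ultimately show ?thesis using T[of t] False by (intro bexI[of _ "?E (?p t)"]) auto
    qed
  qed
  ultimately show "\<exists>K. compact K \<and> (\<forall>x\<in>?Y ` {0..}. \<exists>y\<in>K. dist y x < e)" by blast
qed

end

section \<open>Trajectories of the beam system\<close>

locale beam_semigroup = beam p for p :: "('n1::finite, 'n2::finite) beam_system" +
  fixes T :: "real \<Rightarrow> ('n1, 'n2) state \<Rightarrow> ('n1, 'n2) state"
  assumes sg: "semigroup_of_L p T"
begin

lemma contraction:
  "0 \<le> t \<Longrightarrow> x \<in> space_H p \<Longrightarrow> T t x \<in> space_H p"
  "0 \<le> t \<Longrightarrow> x \<in> space_H p \<Longrightarrow> y \<in> space_H p \<Longrightarrow> T t (x + y) = T t x + T t y"
  "0 \<le> t \<Longrightarrow> x \<in> space_H p \<Longrightarrow> T t (c *\<^sub>R x) = c *\<^sub>R T t x"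
  "0 \<le> t \<Longrightarrow> x \<in> space_H p \<Longrightarrow> norm_H p (T t x) \<le> norm_H p x"
  "x \<in> space_H p \<Longrightarrow> T 0 x = x"
  "0 \<le> s \<Longrightarrow> 0 \<le> t \<Longrightarrow> x \<in> space_H p \<Longrightarrow> T (s + t) x = T s (T t x)"
  "x \<in> space_H p \<Longrightarrow> ((\<lambda>t. norm_H p (T t x - x)) \<longlongrightarrow> 0) (at_right 0)"
  using sg unfolding semigroup_of_L_def contraction_C0_semigroup_def by simp_all

lemma space_diff: "x \<in> space_H p \<Longrightarrow> y \<in> space_H p \<Longrightarrow> x - y \<in> space_H p"
  using state_of_space[of "coords l x - coords l y"] by (simp add: linear_diff[OF linear_state_of] state_of_coords)

lemma space_scaleR: "x \<in> space_H p \<Longrightarrow> c *\<^sub>R x \<in> space_H p"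
  using state_of_space[of "c *\<^sub>R coords l x"] by (simp add: linear_cmul[OF linear_state_of] state_of_coords)

lemma norm_coords_le: obtains c where "0 < c" "\<And>x. x \<in> space_H p \<Longrightarrow> norm (coords l x) \<le> c * norm_H p x"
proof -
  obtain c C where c: "0 < c" "\<And>e. e \<in> coord_space l \<Longrightarrow> c * norm e \<le> norm_H p (state_of l e)" by (rule norm_H_bounds) blast
  show ?thesis
  proof
    show "0 < 1 / c" using c by simp
    fix x assume x: "x \<in> space_H p"
    show "norm (coords l x) \<le> 1 / c * norm_H p x"
      using c(2)[OF coords_in[OF x]] c(1) by (simp add: state_of_coords[OF x] field_simps)
  qed
qed

lemma norm_state_of_le: obtains C where "0 < C" "\<And>e. norm_H p (state_of l e) \<le> C * norm e"
proof -
  obtain c C where C: "0 < C" "\<And>e. e \<in> coord_space l \<Longrightarrow> norm_H p (state_of l e) \<le> C * norm e" by (rule norm_H_bounds) blast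
  obtain K where K: "0 < K" "\<And>e :: ('n1, 'n2) state. norm (restr_state l e) \<le> norm e * K"
    using bounded_linear.pos_bounded[OF bounded_linear_restr_state] by blast
  show ?thesis
  proof
    show "0 < C * K" using C K by simp
    fix e
    have "norm_H p (state_of l e) \<le> C * norm (restr_state l e)" using C(2)[OF restr_state_in, of e] by (simp only: state_of_restr)
    also have "\<dots> \<le> C * (norm e * K)" using C K by (intro mult_left_mono) auto
    finally show "norm_H p (state_of l e) \<le> C * K * norm e" by (simp add: mult_ac)
  qed
qed

text \<open>The given semigroup in coordinates. Since \<open>state_of\<close> projects, it is
  defined on the full product space and \<open>U 0\<close> is \<open>restr_state\<close>.\<close>

definition U :: "real \<Rightarrow> ('n1, 'n2) state \<Rightarrow> ('n1, 'n2) state" where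
  "U t e = coords l (T t (state_of l e))"

lemma state_of_U: "0 \<le> t \<Longrightarrow> state_of l (U t e) = T t (state_of l e)"
  by (simp add: U_def state_of_coords contraction(1) state_of_space)

lemma U_0: "U 0 e = restr_state l e"
  by (simp add: U_def contraction(5)[OF state_of_space] coords_state_of)

lemma U_bounded_semigroup: obtains C where "bounded_semigroup U C"
proof -
  obtain c where c: "0 < c" "\<And>x. x \<in> space_H p \<Longrightarrow> norm (coords l x) \<le> c * norm_H p x" by (rule norm_coords_le) blast
  obtain C where C: "0 < C" "\<And>e. norm_H p (state_of l e) \<le> C * norm e" by (rule norm_state_of_le) blast
  have bound: "norm (U t x) \<le> c * C * norm x" if t: "0 \<le> t" for t x
  proof -
    have "norm (U t x) \<le> c * norm_H p (T t (state_of l x))"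
      unfolding U_def by (rule c(2)[OF contraction(1)[OF t state_of_space]])
    also have "\<dots> \<le> c * (C * norm x)"
      using order_trans[OF contraction(4)[OF t state_of_space] C(2)] c(1) by (intro mult_left_mono) auto
    finally show ?thesis by (simp add: mult.assoc)
  qed
  have "bounded_semigroup U (c * C)"
  proof (rule bounded_semigroup.intro)
    fix s t :: real and x :: "('n1, 'n2) state"
    show "bounded_linear (U t)" if t: "0 \<le> t"
    proof (rule bounded_linear_intro[where K="c * C"])
      fix x y and r :: real
      show "U t (x + y) = U t x + U t y"
        unfolding U_def linear_add[OF linear_state_of]
        by (simp only: contraction(2)[OF t state_of_space state_of_space] coords_add contraction(1)[OF t state_of_space])
      show "U t (r *\<^sub>R x) = r *\<^sub>R U t x"
        unfolding U_def linear_cmul[OF linear_state_of]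
        by (simp only: contraction(3)[OF t state_of_space] coords_scaleR contraction(1)[OF t state_of_space])
      show "norm (U t x) \<le> norm x * (c * C)" using bound[OF t, of x] by (simp only: mult.commute)
    qed
    show "norm (U t x) \<le> c * C * norm x" if "0 \<le> t" by (rule bound[OF that])
    show "0 \<le> c * C" using c C by simp
    show "U (s + t) x = U s (U t x)" if "0 \<le> s" "0 \<le> t"
      using state_of_U[OF that(2), of x] contraction(6)[OF that state_of_space, of x] by (simp add: U_def)
    have "((\<lambda>t. U t x - U 0 x) \<longlongrightarrow> 0) (at_right 0)"
    proof (rule Lim_null_comparison)
      show "((\<lambda>t. c * norm_H p (T t (state_of l x) - state_of l x)) \<longlongrightarrow> 0) (at_right 0)"
        by (rule tendsto_mult_right_zero[OF contraction(7)[OF state_of_space]])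
      have "norm (U t x - U 0 x) \<le> c * norm_H p (T t (state_of l x) - state_of l x)" if t: "0 < t" for t
      proof -
        have m: "T t (state_of l x) \<in> space_H p" using t by (intro contraction state_of_space) simp
        show ?thesis
          using c(2)[OF space_diff[OF m state_of_space]] by (simp add: U_def contraction(5)[OF state_of_space] coords_diff[OF m state_of_space])
      qed
      then show "\<forall>\<^sub>F t in at_right 0. norm (U t x - U 0 x) \<le> c * norm_H p (T t (state_of l x) - state_of l x)"
        unfolding eventually_at_right_field by (intro exI[of _ 1]) simp
    qed
    then show "((\<lambda>t. U t x) \<longlongrightarrow> U 0 x) (at_right 0)" by (simp add: LIM_zero_iff)
  qed
  then show ?thesis by (rule that)
qed

lemma generator_graphD: "(x, w) \<in> generator_graph (space_H p) (norm_H p) T \<Longrightarrow> x \<in> dom_A p \<and> w = op_L p x"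
  using sg unfolding semigroup_of_L_def by auto

text \<open>For h below d the difference quotient is within 1 of the generator; for larger h the
  trivial bound is used together with h / d \<ge> 1. The two summands of \<open>K\<close> belong to
  these cases.\<close>

lemma dom_A_difference_quotient:
  assumes x: "x \<in> dom_A p"
  obtains K where "\<And>h. 0 < h \<Longrightarrow> h \<le> 1 \<Longrightarrow> norm (U h (coords l x) - coords l x) \<le> K * h"
proof -
  obtain c where c: "0 < c" "\<And>x. x \<in> space_H p \<Longrightarrow> norm (coords l x) \<le> c * norm_H p x" by (rule norm_coords_le) blast
  obtain C where "bounded_semigroup U C" by (rule U_bounded_semigroup)
  then interpret bounded_semigroup U C .
  let ?w = "op_L p x" and ?X = "coords l x"
  have "(x, ?w) \<in> generator_graph (space_H p) (norm_H p) T" using sg x unfolding semigroup_of_L_def by blast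
  then have xs: "x \<in> space_H p" and ws: "?w \<in> space_H p"
    and lim: "((\<lambda>h. norm_H p ((1 / h) *\<^sub>R (T h x - x) - ?w)) \<longlongrightarrow> 0) (at_right 0)"
    by (auto simp: generator_graph_def)
  obtain d where d: "0 < d" "\<And>h. 0 < h \<Longrightarrow> h < d \<Longrightarrow> norm_H p ((1 / h) *\<^sub>R (T h x - x) - ?w) < 1"
    using order_tendstoD(2)[OF lim, of 1] unfolding eventually_at_right_field by auto
  define K where "K = (c + norm (coords l ?w)) + (C + 1) * norm ?X / d"
  have "norm (U h ?X - ?X) \<le> K * h" if h: "0 < h" "h \<le> 1" for h
  proof (cases "h < d")
    case True
    have m: "T h x - x \<in> space_H p" using h xs by (intro space_diff contraction) auto
    have Uh: "U h ?X - ?X = coords l (T h x - x)"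
      using h xs by (simp add: U_def state_of_coords coords_diff contraction)
    have "norm (coords l ((1 / h) *\<^sub>R (T h x - x) - ?w)) \<le> c * norm_H p ((1 / h) *\<^sub>R (T h x - x) - ?w)"
      by (rule c(2)[OF space_diff[OF space_scaleR[OF m] ws]])
    also have "\<dots> \<le> c * 1" using d(2)[OF h(1) True] c(1) by (intro mult_left_mono) auto
    also have "coords l ((1 / h) *\<^sub>R (T h x - x) - ?w) = (1 / h) *\<^sub>R (U h ?X - ?X) - coords l ?w"
      by (simp only: coords_diff[OF space_scaleR[OF m] ws] coords_scaleR[OF m] Uh)
    finally have "norm ((1 / h) *\<^sub>R (U h ?X - ?X)) \<le> c + norm (coords l ?w)"
      using norm_triangle_ineq2[of "(1 / h) *\<^sub>R (U h ?X - ?X)" "coords l ?w"] by linarith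
    then have "h * norm ((1 / h) *\<^sub>R (U h ?X - ?X)) \<le> h * (c + norm (coords l ?w))"
      using h by (intro mult_left_mono) auto
    then have "norm (U h ?X - ?X) \<le> (c + norm (coords l ?w)) * h"
      unfolding norm_scaleR using h by (simp add: mult.commute)
    moreover have "0 \<le> (C + 1) * norm ?X / d * h" using C d h by simp
    ultimately show ?thesis by (simp add: K_def distrib_right)
  next
    case False
    have "norm (U h ?X - ?X) \<le> (C + 1) * norm ?X"
      using norm_triangle_ineq4[of "U h ?X" ?X] bound[of h ?X] h by (simp add: distrib_right)
    also have "\<dots> \<le> (C + 1) * norm ?X * (h / d)"
    proof -
      have "1 \<le> h / d" using False d(1) by simp
      then show ?thesis using mult_left_mono[of 1 "h / d" "(C + 1) * norm ?X"] C by simp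
    qed
    finally have "norm (U h ?X - ?X) \<le> (C + 1) * norm ?X / d * h" by simp
    moreover have "0 \<le> (c + norm (coords l ?w)) * h" using c h by simp
    ultimately show ?thesis by (simp add: K_def distrib_right)
  qed
  then show ?thesis by (rule that)
qed

lemma op_N_in: "op_N p y \<in> coord_space l" "state_of l (op_N p y) = op_N p y"
proof -
  obtain z1 z2 \<xi> \<psi> where N: "op_N p y = (0, 0, z1, z2, \<xi>, \<psi>)" by (cases y) (simp add: Let_def)
  show "op_N p y \<in> coord_space l" by (simp add: N coord_space_def L2_on_zero)
  have "state_of l (0 :: ('n1, 'n2) state) = 0" by (rule linear_0[OF linear_state_of])
  moreover have c0: "restr l 0 = 0" by (rule linear_0[OF bounded_linear.linear[OF bounded_linear_restr]])
  ultimately have "double_primitive l 0 = 0" by (simp add: zero_prod_def)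
  then show "state_of l (op_N p y) = op_N p y" by (simp add: N c0)
qed

end

lemma lip_bounded_nonlinear_part:
  assumes "admissible_controller q"
  shows "lip_bounded (fa (nonlinear_part q))" "lip_bounded (fb (nonlinear_part q))" "lip_bounded (fc (nonlinear_part q))"
    "lip_bounded (fd (nonlinear_part q))" "lip_bounded (fk (nonlinear_part q))"
proof -
  interpret admissible_ctrl q by unfold_locales (rule assms)
  show "lip_bounded (fa (nonlinear_part q))" "lip_bounded (fb (nonlinear_part q))" "lip_bounded (fc (nonlinear_part q))"
    "lip_bounded (fd (nonlinear_part q))" "lip_bounded (fk (nonlinear_part q))"
    unfolding nonlinear_part_def linear_part_def
    by (simp_all, (intro lip_bounded_diff lip_bounded_C2 C2 lip_bounded_linear lip_bounded_const
      matrix_vector_mul_bounded_linear bounded_linear_inner_right bounded_linear_mult_right)+)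
qed

text \<open>The remainder sees the state only through its finite-dimensional components and the two
  tip functionals, which are bounded linear in u''.\<close>

lemma (in beam) lip_bounded_op_N: "lip_bounded (\<lambda>e. op_N p (state_of l e))"
proof -
  let ?a = "\<lambda>e :: ('n1, 'n2) state. restr l (fst e)" and ?z1 = "\<lambda>e :: ('n1, 'n2) state. fst (snd (snd e))"
    and ?z2 = "\<lambda>e :: ('n1, 'n2) state. fst (snd (snd (snd e)))" and ?\<xi> = "\<lambda>e :: ('n1, 'n2) state. fst (snd (snd (snd (snd e))))"
    and ?\<psi> = "\<lambda>e :: ('n1, 'n2) state. snd (snd (snd (snd (snd e))))"
    and ?r1 = "nonlinear_part (ctrl1 p)" and ?r2 = "nonlinear_part (ctrl2 p)"
  have eq: "(\<lambda>e. op_N p (state_of l e)) = (\<lambda>e. (0, 0, fa ?r1 (?z1 e) + (?\<xi> e / inert p) *\<^sub>R fb ?r1 (?z1 e),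
      fa ?r2 (?z2 e) + (?\<psi> e / mass p) *\<^sub>R fb ?r2 (?z2 e),
      - fc ?r1 (?z1 e) - fd ?r1 (?\<xi> e / inert p) - fk ?r1 (?a e \<bullet> one_l l),
      - fc ?r2 (?z2 e) - fd ?r2 (?\<psi> e / mass p) - fk ?r2 (?a e \<bullet> lin_l l)))"
  proof
    fix e :: "('n1, 'n2) state"
    show "op_N p (state_of l e) = (0, 0, fa ?r1 (?z1 e) + (?\<xi> e / inert p) *\<^sub>R fb ?r1 (?z1 e),
      fa ?r2 (?z2 e) + (?\<psi> e / mass p) *\<^sub>R fb ?r2 (?z2 e),
      - fc ?r1 (?z1 e) - fd ?r1 (?\<xi> e / inert p) - fk ?r1 (?a e \<bullet> one_l l),
      - fc ?r2 (?z2 e) - fd ?r2 (?\<psi> e / mass p) - fk ?r2 (?a e \<bullet> lin_l l))"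
      by (cases e) (simp add: Let_def tip_val_double_primitive[OF restr_L2_on, unfolded One_nat_def])
  qed
  have L: "lip_bounded ?z1" "lip_bounded ?z2" "lip_bounded (\<lambda>e. ?\<xi> e / inert p)" "lip_bounded (\<lambda>e. ?\<psi> e / mass p)"
    "lip_bounded (\<lambda>e. ?a e \<bullet> one_l l)" "lip_bounded (\<lambda>e. ?a e \<bullet> lin_l l)"
    by (intro lip_bounded_linear bounded_linear_intros bounded_linear_fst bounded_linear_snd
        bounded_linear_compose[OF bounded_linear_divide] bounded_linear_compose[OF bounded_linear_restr]
        bounded_linear_compose[OF bounded_linear_inner_left] bounded_linear_compose[OF bounded_linear_fst] bounded_linear_compose[OF bounded_linear_snd])+
  note N1 = lip_bounded_nonlinear_part[OF q1.adm] and N2 = lip_bounded_nonlinear_part[OF q2.adm]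
  have m: "lip_bounded (\<lambda>e. - f e)" if "lip_bounded f" for f :: "('n1, 'n2) state \<Rightarrow> real"
    using lip_bounded_diff[OF lip_bounded_const[of 0] that] by simp
  show ?thesis unfolding eq
    by (rule lip_bounded_Pair lip_bounded_const lip_bounded_add lip_bounded_scaleR lip_bounded_diff m L
        N1[THEN lip_bounded_compose] N2[THEN lip_bounded_compose])+
qed

section \<open>From a mild solution to the closed loop\<close>

lemma integral_component:
  fixes f :: "real \<Rightarrow> 'a::banach" and g :: "'a \<Rightarrow> 'b::banach"
  assumes "bounded_linear g" "continuous_on {0..} f" "0 \<le> s"
  shows "g (integral {s..t} f) = integral {s..t} (\<lambda>r. g (f r))"
  using integral_linear[OF integrable_Icc_sub[OF assms(2,3)] assms(1)] by (simp add: o_def)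

lemma norm_fst_le_norm: "norm (fst e) \<le> norm e" and norm_snd_le_norm: "norm (snd e) \<le> norm e"
  by (cases e; simp add: norm_fst_le norm_snd_le)+

locale beam_orbit = beam_semigroup p T for p :: "('n1::finite, 'n2::finite) beam_system" and T +
  fixes y0 :: "('n1, 'n2) state" and y
  assumes y0: "y0 \<in> dom_A p" and mild_y: "mild_solution p T y0 y"
begin

definition Y where "Y t = coords l (y t)"
definition f where "f t = op_N p (y t)"

lemma y_in: "0 \<le> t \<Longrightarrow> y t \<in> space_H p"
  using mild_y by (simp add: mild_solution_def)

lemma state_of_Y: "0 \<le> t \<Longrightarrow> state_of l (Y t) = y t"
  by (simp add: Y_def state_of_coords y_in)

lemma Y_in: "0 \<le> t \<Longrightarrow> Y t \<in> coord_space l"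
  by (simp add: Y_def coords_in y_in)

lemma f_eq: "0 \<le> t \<Longrightarrow> f t = op_N p (state_of l (Y t))"
  by (simp add: f_def state_of_Y)

lemma y0_in: "y0 \<in> space_H p"
  using y0 by (auto simp: dom_A_def)

lemma continuous_Y: "continuous_on {0..} Y"
  unfolding continuous_on_def
proof
  fix t :: real assume "t \<in> {0..}"
  then have t: "0 \<le> t" by simp
  obtain c where c: "0 < c" "\<And>x. x \<in> space_H p \<Longrightarrow> norm (coords l x) \<le> c * norm_H p x" by (rule norm_coords_le) blast
  have "((\<lambda>s. Y s - Y t) \<longlongrightarrow> 0) (at t within {0..})"
  proof (rule Lim_null_comparison)
    have "((\<lambda>s. norm_H p (y s - y t)) \<longlongrightarrow> 0) (at t within {0..})" using mild_y t by (simp add: mild_solution_def)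
    then show "((\<lambda>s. c * norm_H p (y s - y t)) \<longlongrightarrow> 0) (at t within {0..})" by (rule tendsto_mult_right_zero)
    have "norm (Y s - Y t) \<le> c * norm_H p (y s - y t)" if s: "s \<in> {0..}" for s
      using c(2)[OF space_diff[OF y_in y_in[OF t]], of s] s by (simp add: Y_def coords_diff y_in t)
    then show "\<forall>\<^sub>F s in at t within {0..}. norm (Y s - Y t) \<le> c * norm_H p (y s - y t)"
      unfolding eventually_at_filter by (intro always_eventually) blast
  qed
  then show "(Y \<longlongrightarrow> Y t) (at t within {0..})" by (simp add: LIM_zero_iff)
qed

lemma continuous_f: "continuous_on {0..} f"
  by (rule continuous_on_eq[OF continuous_on_compose2[OF lip_bounded_continuous[OF lip_bounded_op_N] continuous_Y subset_UNIV]])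
    (simp add: f_eq)

text \<open>The integral of \<open>has_integral_H\<close> is a gauge integral with balls of constant
  radius as gauge; Riemann sums commute with the linear map \<open>state_of\<close>, and the norms
  are equivalent.\<close>

lemma mild_has_integral:
  assumes t: "0 \<le> t"
  shows "((\<lambda>s. U (t - s) (f s)) has_integral Y t - U t (coords l y0)) {0..t}"
proof -
  obtain c where c: "0 < c" "\<And>x. x \<in> space_H p \<Longrightarrow> norm (coords l x) \<le> c * norm_H p x" by (rule norm_coords_le) blast
  let ?g = "\<lambda>s. T (t - s) (op_N p (y s))"
  let ?I = "y t - T t y0"
  have gs: "?g s \<in> space_H p" if "s \<in> {0..t}" for s
    using contraction(1)[OF _ state_of_space[of "op_N p (y s)"], of "t - s"] that by (simp add: op_N_in)
  have Ug: "state_of l (U (t - s) (f s)) = ?g s" if "s \<in> {0..t}" for s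
    using that by (simp add: state_of_U f_def op_N_in)
  have I: "?I \<in> space_H p" by (intro space_diff y_in contraction t y0_in)
  have Yt: "state_of l (Y t - U t (coords l y0)) = ?I"
    by (simp add: linear_diff[OF linear_state_of] state_of_Y t state_of_U state_of_coords y0_in)
  have hi: "has_integral_H p ?g ?I 0 t" using mild_y t by (simp add: mild_solution_def)
  have U_in: "U r e \<in> coord_space l" if "0 \<le> r" for r e
    unfolding U_def by (intro coords_in contraction that state_of_space)
  show ?thesis
    unfolding has_integral[of _ _ "0::real" t, unfolded cbox_interval]
  proof (intro allI impI)
    fix e :: real assume e: "0 < e"
    \<comment> \<open>The tolerance e / c compensates the constant of the norm comparison.\<close>
    obtain d where d: "0 < d" "\<And>P. P tagged_division_of {0..t} \<Longrightarrow> (\<lambda>x. ball x d) fine P \<Longrightarrow>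
        norm_H p ((\<Sum>(x, K)\<in>P. measure lborel K *\<^sub>R ?g x) - ?I) < e / c"
      using hi e c(1) unfolding has_integral_H_def by (meson divide_pos_pos)
    show "\<exists>\<gamma>. gauge \<gamma> \<and> (\<forall>\<D>. \<D> tagged_division_of {0..t} \<and> \<gamma> fine \<D> \<longrightarrow>
        norm ((\<Sum>(x, k)\<in>\<D>. measure lborel k *\<^sub>R U (t - x) (f x)) - (Y t - U t (coords l y0))) < e)"
    proof (intro exI[of _ "\<lambda>x. ball x d"] conjI allI impI)
      show "gauge (\<lambda>x. ball x d)" using d(1) by (simp add: gauge_ball)
      fix P assume P: "P tagged_division_of {0..t} \<and> (\<lambda>x. ball x d) fine P"
      have tag: "x \<in> {0..t}" if "(x, K) \<in> P" for x K
        using tagged_division_ofD(2,3)[OF conjunct1[OF P] that] by blast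
      let ?S = "\<Sum>(x, K)\<in>P. measure lborel K *\<^sub>R U (t - x) (f x)"
      let ?e = "?S - (Y t - U t (coords l y0))"
      have "state_of l ?S = (\<Sum>(x, K)\<in>P. measure lborel K *\<^sub>R ?g x)"
        unfolding linear_sum[OF linear_state_of] o_def
        by (rule sum.cong) (use tag Ug in \<open>auto simp: linear_cmul[OF linear_state_of]\<close>)
      moreover have "state_of l ?e = state_of l ?S - state_of l (Y t - U t (coords l y0))" by (rule linear_diff[OF linear_state_of])
      ultimately have eq: "state_of l ?e = (\<Sum>(x, K)\<in>P. measure lborel K *\<^sub>R ?g x) - ?I" unfolding Yt by simp
      have cU: "restr_state l (U (t - x) (f x)) = U (t - x) (f x)" if "(x, K) \<in> P" for x K
        by (rule restr_state_id[OF U_in]) (use tag[OF that] in simp)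
      have restr_S: "restr_state l ?S = ?S"
        unfolding linear_sum[OF bounded_linear.linear[OF bounded_linear_restr_state]] o_def
        by (rule sum.cong) (use cU in \<open>auto simp: linear_cmul[OF bounded_linear.linear[OF bounded_linear_restr_state]]\<close>)
      have "?S \<in> coord_space l" using restr_state_in[of l ?S] unfolding restr_S .
      then have "?e \<in> coord_space l" by (intro coord_space_diff Y_in U_in t)
      then have "norm ?e \<le> c * norm_H p (state_of l ?e)"
        using c(2)[OF state_of_space, of ?e] by (simp only: coords_state_of_id)
      also have "\<dots> < c * (e / c)" unfolding eq using d(2) P c(1) by (intro mult_strict_left_mono) auto
      finally show "norm ?e < e" using c(1) by simp
    qed
  qed
qed

lemma Y_0: "Y 0 = coords l y0"
proof -
  have "((\<lambda>s. U (0 - s) (f s)) has_integral Y 0 - U 0 (coords l y0)) {0}" using mild_has_integral[of 0] by simp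
  from has_integral_unique[OF this has_integral_refl(2)] have "Y 0 = U 0 (coords l y0)" by simp
  then show ?thesis by (simp add: U_0 restr_state_id coords_in y0_in)
qed

lemma Y_mild_motion: obtains C where "mild_motion U C f Y"
proof -
  obtain C where "bounded_semigroup U C" by (rule U_bounded_semigroup)
  then interpret bounded_semigroup U C .
  have "mild_motion U C f Y"
  proof (intro mild_motion.intro mild_motion_axioms.intro bounded_semigroup_axioms continuous_f continuous_Y)
    fix t :: real assume t: "0 \<le> t"
    show "U 0 (f t) = f t" by (simp add: U_0 f_def restr_state_id op_N_in)
    show "Y t = U t (Y 0) + integral {0..t} (\<lambda>r. U (t - r) (f r))"
      using integral_unique[OF mild_has_integral[OF t]] by (simp add: Y_0)
  qed
  then show ?thesis by (rule that)
qed

text \<open>\<open>restr_state\<close> is bounded linear, so it commutes with the integral, and it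
  fixes the integrand.\<close>

lemma integral_in_coord_space:
  fixes g :: "real \<Rightarrow> ('n1, 'n2) state"
  assumes g: "continuous_on {0..} g" "\<And>t. 0 \<le> t \<Longrightarrow> g t \<in> coord_space l" and s: "0 \<le> s"
  shows "integral {s..t} g \<in> coord_space l"
proof -
  have "restr_state l (integral {s..t} g) = integral {s..t} (\<lambda>r. restr_state l (g r))"
    by (rule integral_component[OF bounded_linear_restr_state g(1) s])
  also have "\<dots> = integral {s..t} g" by (rule integral_cong) (use g(2) s in \<open>simp add: restr_state_id\<close>)
  finally show ?thesis using restr_state_in[of l "integral {s..t} g"] by simp
qed

text \<open>\<open>mild_average\<close> transported from coordinates to \<open>norm_H\<close>: the
  limit of the difference quotients puts the pair into the graph of the generator, which is
  \<open>op_L\<close> on \<open>dom_A\<close>. Only the linear operator is applied; the nonlinearity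
  sits in the integral of f.\<close>

lemma average_in_dom_A:
  assumes st: "0 \<le> s" "s \<le> t"
  shows "state_of l (integral {s..t} Y) \<in> dom_A p"
    "op_L p (state_of l (integral {s..t} Y)) = state_of l (Y t - Y s - integral {s..t} f)"
proof -
  obtain C where "mild_motion U C f Y" by (rule Y_mild_motion)
  then interpret mild_motion U C f Y .
  obtain K where K: "0 < K" "\<And>e. norm_H p (state_of l e) \<le> K * norm e" by (rule norm_state_of_le) blast
  let ?I = "integral {s..t} Y" and ?D = "Y t - Y s - integral {s..t} f"
  have "((\<lambda>h. norm_H p ((1 / h) *\<^sub>R (T h (state_of l ?I) - state_of l ?I) - state_of l ?D)) \<longlongrightarrow> 0) (at_right 0)"
  proof (rule Lim_null_comparison)
    have "((\<lambda>h. norm ((1 / h) *\<^sub>R (U h ?I - ?I) - ?D)) \<longlongrightarrow> 0) (at_right 0)"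
      using mild_average[OF st] by (intro tendsto_norm_zero) (simp add: LIM_zero)
    then show "((\<lambda>h. K * norm ((1 / h) *\<^sub>R (U h ?I - ?I) - ?D)) \<longlongrightarrow> 0) (at_right 0)"
      by (rule tendsto_mult_right_zero)
    have "norm (norm_H p ((1 / h) *\<^sub>R (T h (state_of l ?I) - state_of l ?I) - state_of l ?D)) \<le> K * norm ((1 / h) *\<^sub>R (U h ?I - ?I) - ?D)"
      if h: "0 < h" for h
    proof -
      have eq: "(1 / h) *\<^sub>R (T h (state_of l ?I) - state_of l ?I) - state_of l ?D = state_of l ((1 / h) *\<^sub>R (U h ?I - ?I) - ?D)"
        using h by (simp only: linear_diff[OF linear_state_of] linear_cmul[OF linear_state_of] state_of_U less_imp_le)
      interpret Metric_space "space_H p" "\<lambda>x y. norm_H p (x - y)" by (rule Metric_space_H)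
      show ?thesis unfolding eq using K(2)[of "(1 / h) *\<^sub>R (U h ?I - ?I) - ?D"] nonneg[of "state_of l ((1 / h) *\<^sub>R (U h ?I - ?I) - ?D)" 0] by simp
    qed
    then show "\<forall>\<^sub>F h in at_right 0. norm (norm_H p ((1 / h) *\<^sub>R (T h (state_of l ?I) - state_of l ?I) - state_of l ?D)) \<le> K * norm ((1 / h) *\<^sub>R (U h ?I - ?I) - ?D)"
      unfolding eventually_at_right_field by (intro exI[of _ 1]) simp
  qed
  then have "(state_of l ?I, state_of l ?D) \<in> generator_graph (space_H p) (norm_H p) T"
    by (simp add: generator_graph_def state_of_space)
  from generator_graphD[OF this] show "state_of l ?I \<in> dom_A p" "op_L p (state_of l ?I) = state_of l ?D" by auto
qed

abbreviation "a_of \<equiv> (\<lambda>e :: ('n1, 'n2) state. fst e)"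
abbreviation "v_of \<equiv> (\<lambda>e :: ('n1, 'n2) state. fst (snd e))"
abbreviation "z1_of \<equiv> (\<lambda>e :: ('n1, 'n2) state. fst (snd (snd e)))"
abbreviation "z2_of \<equiv> (\<lambda>e :: ('n1, 'n2) state. fst (snd (snd (snd e))))"
abbreviation "\<xi>_of \<equiv> (\<lambda>e :: ('n1, 'n2) state. fst (snd (snd (snd (snd e)))))"
abbreviation "\<psi>_of \<equiv> (\<lambda>e :: ('n1, 'n2) state. snd (snd (snd (snd (snd e)))))"

lemma bounded_linear_projections:
  "bounded_linear a_of" "bounded_linear v_of" "bounded_linear z1_of" "bounded_linear z2_of" "bounded_linear \<xi>_of" "bounded_linear \<psi>_of"
  by (intro bounded_linear_fst bounded_linear_snd bounded_linear_compose[OF bounded_linear_fst] bounded_linear_compose[OF bounded_linear_snd])+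

text \<open>The \<open>lin_\<close> maps are the finite-dimensional components of the linearised
  system. Being bounded linear they commute with time integrals, and added to the components of
  \<open>f\<close> they give back the nonlinear expressions.\<close>

definition lin_z1 where "lin_z1 e = fa (linear_part (ctrl1 p)) (z1_of e) + (\<xi>_of e / inert p) *\<^sub>R fb (ctrl1 p) 0"
definition lin_z2 where "lin_z2 e = fa (linear_part (ctrl2 p)) (z2_of e) + (\<psi>_of e / mass p) *\<^sub>R fb (ctrl2 p) 0"
definition lin_\<xi> where "lin_\<xi> e = - (fc (linear_part (ctrl1 p)) (z1_of e) + fd (linear_part (ctrl1 p)) (\<xi>_of e / inert p)
  + fk (linear_part (ctrl1 p)) (a_of e \<bullet> one_l l))"
definition lin_\<psi> where "lin_\<psi> e = - (fc (linear_part (ctrl2 p)) (z2_of e) + fd (linear_part (ctrl2 p)) (\<psi>_of e / mass p)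
  + fk (linear_part (ctrl2 p)) (a_of e \<bullet> lin_l l))"

lemma bounded_linear_linear_part: "bounded_linear lin_z1" "bounded_linear lin_z2" "bounded_linear lin_\<xi>" "bounded_linear lin_\<psi>"
  unfolding lin_z1_def[abs_def] lin_z2_def[abs_def] lin_\<xi>_def[abs_def] lin_\<psi>_def[abs_def] linear_part_def
  by (simp_all, (intro bounded_linear_add bounded_linear_sub bounded_linear_minus bounded_linear_projections
      bounded_linear_compose[OF matrix_vector_mul_bounded_linear] bounded_linear_compose[OF bounded_linear_inner_right]
      bounded_linear_compose[OF bounded_linear_scaleR_left] bounded_linear_compose[OF bounded_linear_mult_right]
      bounded_linear_compose[OF bounded_linear_divide] bounded_linear_compose[OF bounded_linear_inner_left])+)

lemma f_components:
  assumes t: "0 \<le> t"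
  shows "a_of (f t) = 0" "v_of (f t) = 0"
    "fa (ctrl1 p) (z1_of (Y t)) + (\<xi>_of (Y t) / inert p) *\<^sub>R fb (ctrl1 p) (z1_of (Y t)) = z1_of (f t) + lin_z1 (Y t)"
    "fa (ctrl2 p) (z2_of (Y t)) + (\<psi>_of (Y t) / mass p) *\<^sub>R fb (ctrl2 p) (z2_of (Y t)) = z2_of (f t) + lin_z2 (Y t)"
    "- (fc (ctrl1 p) (z1_of (Y t)) + fd (ctrl1 p) (\<xi>_of (Y t) / inert p) + fk (ctrl1 p) (a_of (Y t) \<bullet> one_l l)) = \<xi>_of (f t) + lin_\<xi> (Y t)"
    "- (fc (ctrl2 p) (z2_of (Y t)) + fd (ctrl2 p) (\<psi>_of (Y t) / mass p) + fk (ctrl2 p) (a_of (Y t) \<bullet> lin_l l)) = \<psi>_of (f t) + lin_\<psi> (Y t)"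
proof -
  obtain a v z1 z2 \<xi> \<psi> where Yt: "Y t = (a, v, z1, z2, \<xi>, \<psi>)" by (cases "Y t")
  have a: "a \<in> L2_on l" using Y_in[OF t] by (simp add: Yt coord_space_def)
  note f = f_eq[OF t, unfolded Yt state_of.simps restr_id[OF a] op_N.simps tip_val_double_primitive[OF a] Let_def]
  show "a_of (f t) = 0" "v_of (f t) = 0"
    "fa (ctrl1 p) (z1_of (Y t)) + (\<xi>_of (Y t) / inert p) *\<^sub>R fb (ctrl1 p) (z1_of (Y t)) = z1_of (f t) + lin_z1 (Y t)"
    "fa (ctrl2 p) (z2_of (Y t)) + (\<psi>_of (Y t) / mass p) *\<^sub>R fb (ctrl2 p) (z2_of (Y t)) = z2_of (f t) + lin_z2 (Y t)"
    "- (fc (ctrl1 p) (z1_of (Y t)) + fd (ctrl1 p) (\<xi>_of (Y t) / inert p) + fk (ctrl1 p) (a_of (Y t) \<bullet> one_l l)) = \<xi>_of (f t) + lin_\<xi> (Y t)"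
    "- (fc (ctrl2 p) (z2_of (Y t)) + fd (ctrl2 p) (\<psi>_of (Y t) / mass p) + fk (ctrl2 p) (a_of (Y t) \<bullet> lin_l l)) = \<psi>_of (f t) + lin_\<psi> (Y t)"
    unfolding f Yt lin_z1_def lin_z2_def lin_\<xi>_def lin_\<psi>_def nonlinear_part_def linear_part_def
    by (simp_all add: scaleR_diff_right)
qed

text \<open>Componentwise reading of \<open>average_in_dom_A\<close>. Membership in
  \<open>Sobolev0\<close> of order 4 supplies the representatives of u'' and u''' with their tip
  values, and the last two components of the equation express these values through
  \<open>lin_\<xi>\<close>, \<open>lin_\<psi>\<close> and \<open>D\<close>.\<close>

lemma averaged_system:
  assumes st: "0 \<le> s" "s \<le> t"
  defines "I \<equiv> integral {s..t} Y" and "D \<equiv> Y t - Y s - integral {s..t} f"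
  shows "beam_reg l (a_of I) (v_of I) (a_of D) (- (dens p / stiff p) *\<^sub>R v_of D) (\<xi>_of I / inert p) (\<psi>_of I / mass p)
      ((lin_\<xi> I - \<xi>_of D) / stiff p) ((\<psi>_of D - lin_\<psi> I) / stiff p)" (is ?reg)
    and "z1_of D = lin_z1 I" "z2_of D = lin_z2 I"
proof -
  obtain A V Z1 Z2 X P where I: "I = (A, V, Z1, Z2, X, P)" by (cases I)
  obtain da dv d1 d2 dx dp where D: "D = (da, dv, d1, d2, dx, dp)" by (cases D)
  have "I \<in> coord_space l" unfolding I_def by (rule integral_in_coord_space[OF continuous_Y Y_in st(1)])
  then have A: "A \<in> L2_on l" and V: "V \<in> L2_on l" by (auto simp: I coord_space_def)
  have "D \<in> coord_space l"
    unfolding D_def using st by (intro coord_space_diff Y_in integral_in_coord_space[OF continuous_f]) (auto simp: f_def op_N_in)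
  then have da: "da \<in> L2_on l" and dv: "dv \<in> L2_on l" by (auto simp: D coord_space_def)
  let ?u = "double_primitive l A"
  note av = average_in_dom_A[OF st, folded I_def D_def, unfolded I D state_of.simps restr_id[OF A] restr_id[OF V] restr_id[OF da] restr_id[OF dv]]
  have dom: "?u \<in> Sobolev0 l 4" "X = inert p * tip_val p 1 V" "P = mass p * tip_val p 0 V"
    using av(1) by (auto simp: dom_A_def)
  \<comment> \<open>\<open>op_L\<close> is \<open>op_A\<close> for the system with linearised
    controllers, and \<open>tip_val\<close> depends on the length only.\<close>
  have tip: "tip_val (p\<lparr>ctrl1 := c1, ctrl2 := c2\<rparr>) k w = tip_val p k w" for c1 :: "'n1 controller" and c2 :: "'n2 controller" and k w
    by (simp add: tip_val_def)
  have op: "V = double_primitive l da" "- (stiff p / dens p) *\<^sub>R weak_deriv l 4 ?u = dv"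
    "d1 = lin_z1 I" "d2 = lin_z2 I" "- stiff p * tip_val p 2 ?u + lin_\<xi> I = dx" "stiff p * tip_val p 3 ?u + lin_\<psi> I = dp"
    using av(2) unfolding op_L_def op_A.simps prod.inject tip tip_val_double_primitive[OF A]
    by (auto simp: I lin_z1_def lin_z2_def lin_\<xi>_def lin_\<psi>_def linear_part_def)
  show "z1_of D = lin_z1 I" "z2_of D = lin_z2 I" by (simp_all add: D op(3,4))
  have u4: "?u \<in> Sobolev l 4" using dom(1) by (simp add: Sobolev0_def)
  have w2: "weak_deriv l 2 ?u = A" by (rule double_primitive_Sobolev0(2)[OF pos(1) A])
  obtain F2 where F2: "agrees l A F2" "AC l F2 (rep_L2 (weak_deriv l 3 ?u))"
    by (rule Sobolev_AC[OF pos(1) u4, of 2]) (simp_all add: w2)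
  obtain F3 where F3: "agrees l (weak_deriv l 3 ?u) F3" "AC l F3 (rep_L2 (weak_deriv l 4 ?u))"
    by (rule Sobolev_AC[OF pos(1) u4, of 3]) simp_all
  have F23: "AC l F2 F3" by (rule AC_agrees[OF F2(2) F3(1) AC_continuous[OF F3(2)]])
  have l: "l \<in> {0..l}" using pos(1) by simp
  have tips: "tip_val p 2 ?u = F2 l" "tip_val p 3 ?u = F3 l"
    unfolding tip_val_def w2 by (rule pt_val_eq[OF pos(1) F2(1) AC_continuous[OF F2(2)] l] pt_val_eq[OF pos(1) F3(1) AC_continuous[OF F3(2)] l])+
  obtain G0 G1 where G: "prim2 l V G0 G1 da" unfolding op(1) by (rule prim2_double_primitive[OF da])
  have "tip_val p 1 V = G1 l" "tip_val p 0 V = G0 l"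
    using prim2_tips[OF pos(1) G] tip_val_double_primitive[OF da] op(1) by simp_all
  then have XP: "G1 l = X / inert p" "G0 l = P / mass p" using dom(2,3) pos by simp_all
  have w4: "weak_deriv l 4 ?u = - (dens p / stiff p) *\<^sub>R dv" unfolding op(2)[symmetric] using pos by simp
  have "weak_deriv l 4 ?u \<in> L2_on l" unfolding w4 by (rule L2_on_scaleR[OF dv])
  moreover have "F2 l = (lin_\<xi> (A, V, Z1, Z2, X, P) - dx) / stiff p" "F3 l = (dp - lin_\<psi> (A, V, Z1, Z2, X, P)) / stiff p"
    using op(5,6) pos by (auto simp: tips[symmetric] I)
  ultimately show ?reg
    unfolding beam_reg_def D I fst_conv snd_conv w4[symmetric] using F2(1) F23 F3(2) G XP
    by blast
qed

lemma continuous_component: "bounded_linear g \<Longrightarrow> continuous_on {0..} (\<lambda>t. g (Y t))"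
  by (rule bounded_linear.continuous_on[OF _ continuous_Y])

lemma continuous_component_f: "bounded_linear g \<Longrightarrow> continuous_on {0..} (\<lambda>t. g (f t))"
  by (rule bounded_linear.continuous_on[OF _ continuous_f])

lemma integral_f_plus:
  fixes g h :: "('n1, 'n2) state \<Rightarrow> 'b::banach"
  assumes g: "bounded_linear g" and h: "bounded_linear h" and s: "0 \<le> s"
    and eq: "\<And>r. 0 \<le> r \<Longrightarrow> k r = g (f r) + h (Y r)"
  shows "integral {s..t} k = g (integral {s..t} f) + h (integral {s..t} Y)"
proof -
  have "integral {s..t} k = integral {s..t} (\<lambda>r. g (f r) + h (Y r))"
    by (rule integral_cong) (use eq s in simp)
  also have "\<dots> = integral {s..t} (\<lambda>r. g (f r)) + integral {s..t} (\<lambda>r. h (Y r))"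
    by (intro Henstock_Kurzweil_Integration.integral_add integrable_Icc_sub continuous_component continuous_component_f g h s)
  finally show ?thesis
    by (simp only: integral_component[OF g continuous_f s] integral_component[OF h continuous_Y s])
qed

definition G1 where "G1 t = - (fc (ctrl1 p) (z1_of (Y t)) + fd (ctrl1 p) (\<xi>_of (Y t) / inert p) + fk (ctrl1 p) (a_of (Y t) \<bullet> one_l l))"
definition G2 where "G2 t = - (fc (ctrl2 p) (z2_of (Y t)) + fd (ctrl2 p) (\<psi>_of (Y t) / mass p) + fk (ctrl2 p) (a_of (Y t) \<bullet> lin_l l))"

lemma Y_diff:
  assumes g: "bounded_linear g" and s: "0 \<le> s"
  shows "g (Y t) - g (Y s) = g (Y t - Y s - integral {s..t} f) + g (integral {s..t} f)"
  by (simp add: linear_diff[OF bounded_linear.linear[OF g]])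

text \<open>Adding the integral of the remainder \<open>f\<close> to the linear averaged system
  restores the nonlinear forces; this provides the conditions of \<open>beam_motion\<close> and
  \<open>ctrl_traj\<close>.\<close>

lemma Y_motion:
  assumes st: "0 \<le> s" "s \<le> t"
  shows "beam_reg l (integral {s..t} (\<lambda>t. a_of (Y t))) (integral {s..t} (\<lambda>t. v_of (Y t))) (a_of (Y t) - a_of (Y s))
      (- (dens p / stiff p) *\<^sub>R (v_of (Y t) - v_of (Y s))) (integral {s..t} (\<lambda>t. \<xi>_of (Y t)) / inert p) (integral {s..t} (\<lambda>t. \<psi>_of (Y t)) / mass p)
      ((integral {s..t} G1 - (\<xi>_of (Y t) - \<xi>_of (Y s))) / stiff p) ((\<psi>_of (Y t) - \<psi>_of (Y s) - integral {s..t} G2) / stiff p)" (is ?reg)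
    and "z1_of (Y t) - z1_of (Y s) = integral {s..t} (\<lambda>r. fa (ctrl1 p) (z1_of (Y r)) + (\<xi>_of (Y r) / inert p) *\<^sub>R fb (ctrl1 p) (z1_of (Y r)))" (is ?z1)
    and "z2_of (Y t) - z2_of (Y s) = integral {s..t} (\<lambda>r. fa (ctrl2 p) (z2_of (Y r)) + (\<psi>_of (Y r) / mass p) *\<^sub>R fb (ctrl2 p) (z2_of (Y r)))" (is ?z2)
proof -
  note bl = bounded_linear_projections and ll = bounded_linear_linear_part
  have f0: "a_of (integral {s..t} f) = 0" "v_of (integral {s..t} f) = 0"
    unfolding integral_component[OF bl(1) continuous_f st(1)] integral_component[OF bl(2) continuous_f st(1)]
    using integral_cong[of "{s..t}" "\<lambda>r. a_of (f r)" "\<lambda>r. 0"] integral_cong[of "{s..t}" "\<lambda>r. v_of (f r)" "\<lambda>r. 0"] f_components(1,2) st(1)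
    by simp_all
  have G: "integral {s..t} G1 = \<xi>_of (integral {s..t} f) + lin_\<xi> (integral {s..t} Y)"
    "integral {s..t} G2 = \<psi>_of (integral {s..t} f) + lin_\<psi> (integral {s..t} Y)"
    by (rule integral_f_plus[OF bl(5) ll(3) st(1)], simp only: G1_def f_components)
      (rule integral_f_plus[OF bl(6) ll(4) st(1)], simp only: G2_def f_components)
  have Z: "integral {s..t} (\<lambda>r. fa (ctrl1 p) (z1_of (Y r)) + (\<xi>_of (Y r) / inert p) *\<^sub>R fb (ctrl1 p) (z1_of (Y r))) = z1_of (integral {s..t} f) + lin_z1 (integral {s..t} Y)"
    "integral {s..t} (\<lambda>r. fa (ctrl2 p) (z2_of (Y r)) + (\<psi>_of (Y r) / mass p) *\<^sub>R fb (ctrl2 p) (z2_of (Y r))) = z2_of (integral {s..t} f) + lin_z2 (integral {s..t} Y)"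
    by (rule integral_f_plus[OF bl(3) ll(1) st(1)], simp only: f_components)
      (rule integral_f_plus[OF bl(4) ll(2) st(1)], simp only: f_components)
  note sys = averaged_system[OF st]
  show ?z1 unfolding Z Y_diff[OF bl(3) st(1)] sys(2) by simp
  show ?z2 unfolding Z Y_diff[OF bl(4) st(1)] sys(3) by simp
  have d: "\<xi> + lin - (dx + \<xi>) = lin - dx" "dx + \<xi> - (\<xi> + lin) = dx - lin" for \<xi> lin dx :: real by simp_all
  show ?reg
    unfolding Y_diff[OF bl(1) st(1)] Y_diff[OF bl(2) st(1)] Y_diff[OF bl(5) st(1)] Y_diff[OF bl(6) st(1)] G f0 add_0_right d
      integral_component[OF bl(1) continuous_Y st(1), symmetric] integral_component[OF bl(2) continuous_Y st(1), symmetric]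
      integral_component[OF bl(5) continuous_Y st(1), symmetric] integral_component[OF bl(6) continuous_Y st(1), symmetric]
    by (rule sys(1))
qed

lemma Y_Lipschitz:
  assumes s: "0 \<le> s" shows "\<exists>K. \<forall>h. 0 < h \<longrightarrow> h \<le> 1 \<longrightarrow> norm (Y (s + h) - Y s) \<le> K * h"
proof -
  obtain C where "mild_motion U C f Y" by (rule Y_mild_motion)
  then interpret mild_motion U C f Y .
  obtain K where K: "\<And>h. 0 < h \<Longrightarrow> h \<le> 1 \<Longrightarrow> norm (U h (coords l y0) - coords l y0) \<le> K * h"
    by (rule dom_A_difference_quotient[OF y0]) blast
  show ?thesis
  proof (rule mild_Lipschitz[OF _ _ _ _ s, where N="\<lambda>e. op_N p (state_of l e)" and K=K])
    show "\<exists>L. \<forall>x z. norm x \<le> R \<longrightarrow> norm z \<le> R \<longrightarrow> norm (op_N p (state_of l x) - op_N p (state_of l z)) \<le> L * norm (x - z)" for R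
      using lip_bounded_op_N unfolding lip_bounded_def by blast
    show "norm (U h (Y 0) - Y 0) \<le> K * h" if "0 < h" "h \<le> 1" for h unfolding Y_0 by (rule K[OF that])
    show "U 0 (Y 0) = Y 0" unfolding U_0 by (intro restr_state_id Y_in) simp
  qed (rule f_eq)
qed

lemma precompact_Y: "compact (closure (Y ` {0..}))"
proof -
  note bl = bounded_linear_projections
  note cY = bl[THEN continuous_component]
  interpret c1: ctrl_traj "ctrl1 p" "\<lambda>t. z1_of (Y t)" "\<lambda>t. \<xi>_of (Y t) / inert p" "\<lambda>t. a_of (Y t) \<bullet> one_l l"
  proof (intro ctrl_traj.intro ctrl_traj_axioms.intro q1.admissible_ctrl_axioms)
    show "continuous_on {0..} (\<lambda>t. z1_of (Y t))" by (rule cY)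
    show "continuous_on {0..} (\<lambda>t. \<xi>_of (Y t) / inert p)" "continuous_on {0..} (\<lambda>t. a_of (Y t) \<bullet> one_l l)"
      using pos by (intro continuous_intros cY; simp)+
    fix s t :: real assume st: "0 \<le> s" "s \<le> t"
    show "z1_of (Y t) - z1_of (Y s) = integral {s..t} (\<lambda>r. fa (ctrl1 p) (z1_of (Y r)) + (\<xi>_of (Y r) / inert p) *\<^sub>R fb (ctrl1 p) (z1_of (Y r)))"
      by (rule Y_motion(2)[OF st])
    show "a_of (Y t) \<bullet> one_l l - a_of (Y s) \<bullet> one_l l = integral {s..t} (\<lambda>t. \<xi>_of (Y t) / inert p)"
      using beam_reg_tips(1)[OF pos(1) Y_motion(1)[OF st]] by (simp add: inner_diff_left)
  qed
  interpret c2: ctrl_traj "ctrl2 p" "\<lambda>t. z2_of (Y t)" "\<lambda>t. \<psi>_of (Y t) / mass p" "\<lambda>t. a_of (Y t) \<bullet> lin_l l"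
  proof (intro ctrl_traj.intro ctrl_traj_axioms.intro q2.admissible_ctrl_axioms)
    show "continuous_on {0..} (\<lambda>t. z2_of (Y t))" by (rule cY)
    show "continuous_on {0..} (\<lambda>t. \<psi>_of (Y t) / mass p)" "continuous_on {0..} (\<lambda>t. a_of (Y t) \<bullet> lin_l l)"
      using pos by (intro continuous_intros cY; simp)+
    fix s t :: real assume st: "0 \<le> s" "s \<le> t"
    show "z2_of (Y t) - z2_of (Y s) = integral {s..t} (\<lambda>r. fa (ctrl2 p) (z2_of (Y r)) + (\<psi>_of (Y r) / mass p) *\<^sub>R fb (ctrl2 p) (z2_of (Y r)))"
      by (rule Y_motion(3)[OF st])
    show "a_of (Y t) \<bullet> lin_l l - a_of (Y s) \<bullet> lin_l l = integral {s..t} (\<lambda>t. \<psi>_of (Y t) / mass p)"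
      using beam_reg_tips(2)[OF pos(1) Y_motion(1)[OF st]] by (simp add: inner_diff_left)
  qed
  have force: "G1 = c1.force" "G2 = c2.force" by (rule ext, simp only: G1_def G2_def c1.force_def c2.force_def)+
  interpret cl: closed_loop l "dens p" "stiff p" "inert p" "mass p" "\<lambda>t. a_of (Y t)" "\<lambda>t. v_of (Y t)" "\<lambda>t. \<xi>_of (Y t)" "\<lambda>t. \<psi>_of (Y t)"
    G1 G2 "ctrl1 p" "\<lambda>t. z1_of (Y t)" "ctrl2 p" "\<lambda>t. z2_of (Y t)"
  proof (intro closed_loop.intro beam_motion.intro closed_loop_axioms.intro c1.ctrl_traj_axioms c2.ctrl_traj_axioms pos cY force)
    show "continuous_on {0..} G1" "continuous_on {0..} G2" unfolding force by (rule c1.cont_force c2.cont_force)+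
    fix s :: real assume s: "0 \<le> s"
    obtain K where K: "\<And>h. 0 < h \<Longrightarrow> h \<le> 1 \<Longrightarrow> norm (Y (s + h) - Y s) \<le> K * h" using Y_Lipschitz[OF s] by blast
    have comp: "norm (a_of e) \<le> norm e" "norm (v_of e) \<le> norm e" "norm (\<xi>_of e) \<le> norm e" "norm (\<psi>_of e) \<le> norm e" for e
      by (rule norm_fst_le_norm order_trans[OF norm_fst_le_norm norm_snd_le_norm]
        order_trans[OF norm_fst_le_norm order_trans[OF norm_snd_le_norm order_trans[OF norm_snd_le_norm order_trans[OF norm_snd_le_norm norm_snd_le_norm]]]]
        order_trans[OF norm_snd_le_norm order_trans[OF norm_snd_le_norm order_trans[OF norm_snd_le_norm order_trans[OF norm_snd_le_norm norm_snd_le_norm]]]])+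
    show "\<exists>K. \<forall>h. 0 < h \<longrightarrow> h \<le> 1 \<longrightarrow> norm (a_of (Y (s + h)) - a_of (Y s)) \<le> K * h \<and> norm (v_of (Y (s + h)) - v_of (Y s)) \<le> K * h
        \<and> \<bar>\<xi>_of (Y (s + h)) - \<xi>_of (Y s)\<bar> \<le> K * h \<and> \<bar>\<psi>_of (Y (s + h)) - \<psi>_of (Y s)\<bar> \<le> K * h"
    proof (intro exI[of _ K] allI impI)
      fix h :: real assume h: "0 < h" "h \<le> 1"
      from order_trans[OF comp(1) K[OF h]] order_trans[OF comp(2) K[OF h]] order_trans[OF comp(3) K[OF h]] order_trans[OF comp(4) K[OF h]]
      show "norm (a_of (Y (s + h)) - a_of (Y s)) \<le> K * h \<and> norm (v_of (Y (s + h)) - v_of (Y s)) \<le> K * h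
        \<and> \<bar>\<xi>_of (Y (s + h)) - \<xi>_of (Y s)\<bar> \<le> K * h \<and> \<bar>\<psi>_of (Y (s + h)) - \<psi>_of (Y s)\<bar> \<le> K * h"
        by simp
    qed
  qed (rule Y_motion)
  show ?thesis using cl.orbit_precompact by simp
qed

text \<open>\<open>state_of\<close> is continuous into the metric of the state space, so it maps the
  compact closure found in coordinates to a compact set. That set is closed and contains the orbit,
  hence also its closure.\<close>

theorem precompact_orbit: "precompact_H p (\<Union>t\<in>{0..}. {y t})"
proof -
  interpret Metric_space "space_H p" "\<lambda>x y. norm_H p (x - y)" by (rule Metric_space_H)
  have top: "top_H p = mtopology" by (simp add: top_H_def)
  let ?K = "closure (Y ` {0..})"
  obtain C where C: "0 < C" "\<And>e. norm_H p (state_of l e) \<le> C * norm e" by (rule norm_state_of_le) blast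
  have "continuous_map euclidean mtopology (state_of l)"
    unfolding continuous_map_to_metric
  proof (intro ballI allI impI)
    fix x :: "('n1, 'n2) state" and e :: real assume e: "0 < e"
    show "\<exists>V. openin euclidean V \<and> x \<in> V \<and> (\<forall>z\<in>V. state_of l z \<in> mball (state_of l x) e)"
    proof (intro exI[of _ "ball x (e / C)"] conjI ballI)
      fix z assume "z \<in> ball x (e / C)"
      then have "C * norm (x - z) < C * (e / C)" using C(1) by (intro mult_strict_left_mono) (auto simp: dist_norm)
      then have "norm_H p (state_of l x - state_of l z) < e"
        using C(2)[of "x - z"] C(1) by (simp add: linear_diff[OF linear_state_of])
      then show "state_of l z \<in> mball (state_of l x) e" by (simp add: state_of_space)
    qed (use e C in auto)
  qed
  moreover have "compactin euclidean ?K" using precompact_Y by simp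
  ultimately have c: "compactin mtopology (state_of l ` ?K)" by (rule image_compactin[rotated])
  have "(\<Union>t\<in>{0..}. {y t}) \<subseteq> state_of l ` ?K"
  proof (rule UN_least)
    fix t :: real assume t: "t \<in> {0..}"
    then have "Y t \<in> ?K" using closure_subset[of "Y ` {0..}"] by blast
    then have "y t \<in> state_of l ` ?K" using state_of_Y[of t] t by (intro image_eqI[where x="Y t"]) simp_all
    then show "{y t} \<subseteq> state_of l ` ?K" by simp
  qed
  then have "mtopology closure_of (\<Union>t\<in>{0..}. {y t}) \<subseteq> state_of l ` ?K"
    by (rule closure_of_minimal[OF _ compactin_imp_closedin[OF Hausdorff_space_mtopology c]])
  then show ?thesis
    unfolding precompact_H_def top by (rule closed_compactin[OF c _ closedin_closure_of])
qed

end

theorem theorem7p4: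
  fixes p :: "('n1::finite, 'n2::finite) beam_system"
    and T S :: "real \<Rightarrow> ('n1, 'n2) state \<Rightarrow> ('n1, 'n2) state"
  assumes "admissible p"
    and "semigroup_of_L p T"
    and "\<forall>y0\<in>space_H p. mild_solution p T y0 (\<lambda>t. S t y0)"
  shows "\<forall>y0\<in>dom_A p. precompact_H p (\<Union>t\<in>{0..}. {S t y0})"
proof
  fix y0 assume y0: "y0 \<in> dom_A p"
  then have "y0 \<in> space_H p" by (auto simp: dom_A_def)
  then interpret beam_orbit p T y0 "\<lambda>t. S t y0"
    by (intro beam_orbit.intro beam_semigroup.intro beam.intro beam_semigroup_axioms.intro beam_orbit_axioms.intro)
      (use assms y0 in auto)
  show "precompact_H p (\<Union>t\<in>{0..}. {S t y0})" by (rule precompact_orbit)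
qed

end
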